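(* For $n\ge4$, there is an isomorphism $$(\mathrm{Der}^+(\mathcal{L}_n^M))^{\mathrm{ab}}\cong(H^*\otimes_{\mathbf{Z}}\Lambda^2H)\oplus\bigoplus_{k\ge2}S^kH$$ of graded abelian Lie algebras over $\mathbf{Z}$ (where $H^*\otimes_{\mathbf{Z}}\Lambda^2H$ is in degree $1$ and $S^kH$ in degree $k$). More precisely, this isomorphism is induced by the identity map on the degree one part $\mathrm{Der}^+(\mathcal{L}_n^M)(1)=H^*\otimes_{\mathbf{Z}}\Lambda^2H$ and by Morita's trace maps $\mathrm{Tr}_{[k]}^M:\mathrm{Der}^+(\mathcal{L}_n^M)(k)\to S^kH$ for $k\ge2$.
   Context: $F_n$ is the free group on $x_1,\ldots,x_n$, $H=F_n^{\mathrm{ab}}$, $H^*=\mathrm{Hom}_{\mathbf{Z}}(H,\mathbf{Z})$. $F_n^M=F_n/[[F_n,F_n],[F_n,F_n]]$ is the free metabelian group, $\Gamma_n^M(k)$ its lower central series, $\mathcal{L}_n^M(k)=\Gamma_n^M(k)/\Gamma_n^M(k+1)$, and $\mathcal{L}_n^M=\bigoplus_{k\ge1}\mathcal{L}_n^M(k)$ is the graded Lie algebra over $\mathbf{Z}$ with bracket induced by commutators (the Chen Lie algebra, i.e. the free metabelian Lie algebra generated by $H$). $\mathcal{L}_n^M(2)=\Lambda^2H$. $\mathrm{Der}^+(\mathcal{L}_n^M)=\bigoplus_{k\ge1}\mathrm{Der}^+(\mathcal{L}_n^M)(k)$ is the graded Lie algebra of positive-degree derivations of $\mathcal{L}_n^M$,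 where the degree $k$ part consists of the derivations sending $H$ to $\mathcal{L}_n^M(k+1)$ and is identified with $H^*\otimes_{\mathbf{Z}}\mathcal{L}_n^M(k+1)$. For a Lie algebra $\mathcal{G}$, $\mathcal{G}^{\mathrm{ab}}=\mathcal{G}/[\mathcal{G},\mathcal{G}]$. Morita's trace map: let $\mathcal{L}_n$ be the free Lie algebra over $\mathbf{Z}$ generated by $H$, and $\iota_{k+1}:\mathcal{L}_n(k+1)\hookrightarrow H^{\otimes(k+1)}$ the embedding determined by $[X,Y]\mapsto X\otimes Y-Y\otimes X$. Let $\varphi^k:H^*\otimes H^{\otimes(k+1)}\to H^{\otimes k}$ be the contraction $x_i^*\otimes x_{j_1}\otimes\cdots\otimes x_{j_{k+1}}\mapsto x_i^*(x_{j_1})\,x_{j_2}\otimes\cdots\otimes x_{j_{k+1}}$, put $\Phi^k=\varphi^k\circ(\mathrm{id}_{H^*}\otimes\iota_{k+1})$, and let $f_{[k]}:H^{\otimes k}\to S^kH$ be the natural projection to the symmetric power. Then $\mathrm{Tr}_{[k]}=f_{[k]}\circ\Phi^k:H^*\otimes_{\mathbf{Z}}\mathcal{L}_n(k+1)\to S^kH$. It factors through the natural surjection $H^*\otimes_{\mathbf{Z}}\mathcal{L}_n(k+1)\to H^*\otimes_{\mathbf{Z}}\mathcal{L}_n^M(k+1)$, and the induced map is $\mathrm{Tr}_{[k]}^M:H^*\otimes_{\mathbf{Z}}\mathcal{L}_n^M(k+1)\to S^kH$. *)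

theory Defs
  imports "HOL-Algebra.Free_Abelian_Groups" "HOL-Algebra.Generated_Groups" "HOL-Library.Multiset"
begin

text \<open>
  Abelian groups are written multiplicatively, following the library's
  \<^const>\<open>free_Abelian_group\<close> and \<^const>\<open>sum_group\<close>. A Lie algebra over the integers is an
  abelian group together with a bracket.
\<close>

section \<open>Lie rings\<close>

record 'a lie = "'a monoid" +
  bracket :: "'a \<Rightarrow> 'a \<Rightarrow> 'a"

definition lie_of :: "'a monoid \<Rightarrow> ('a \<Rightarrow> 'a \<Rightarrow> 'a) \<Rightarrow> 'a lie" where
  "lie_of G br = monoid.extend G (lie.fields br)"

definition lie_derived :: "'a lie \<Rightarrow> 'a set" where
  "lie_derived L = generate L {bracket L x y | x y. x \<in> carrier L \<and> y \<in> carrier L}"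

definition lie_ab :: "'a lie \<Rightarrow> 'a set lie" where
  "lie_ab L = lie_of (L Mod lie_derived L)
     (\<lambda>X Y. the_elem ((\<lambda>(x, y). lie_derived L #>\<^bsub>L\<^esub> bracket L x y) ` (X \<times> Y)))"

definition abelian_lie :: "'a monoid \<Rightarrow> 'a lie" where
  "abelian_lie G = lie_of G (\<lambda>_ _. \<one>\<^bsub>G\<^esub>)"

text \<open>
  A grading of a Lie ring is given by the family \<open>P\<close> of its homogeneous components in degrees
  \<open>k \<ge> 1\<close>.
\<close>

definition graded_lie_iso ::
  "'a lie \<Rightarrow> (nat \<Rightarrow> 'a set) \<Rightarrow> 'b lie \<Rightarrow> (nat \<Rightarrow> 'b set) \<Rightarrow> ('a \<Rightarrow> 'b) set" where
  "graded_lie_iso L P M Q =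
     {h \<in> iso L M.
        (\<forall>x\<in>carrier L. \<forall>y\<in>carrier L. h (bracket L x y) = bracket M (h x) (h y)) \<and>
        (\<forall>k\<ge>1. h ` P k = Q k)}"

text \<open>
  The Lie ring \<open>\<Oplus>\<^sub>k\<^sub>\<ge>\<^sub>1 G k\<close> with the bracket extending biadditively the brackets
  \<open>br i j : G i \<times> G j \<rightarrow> G (i + j)\<close>.
\<close>

definition graded_sum ::
  "(nat \<Rightarrow> 'a monoid) \<Rightarrow> (nat \<Rightarrow> nat \<Rightarrow> 'a \<Rightarrow> 'a \<Rightarrow> 'a) \<Rightarrow> (nat \<Rightarrow> 'a) lie" where
  "graded_sum G br = lie_of (sum_group {1..} G)
     (\<lambda>x y. \<lambda>m\<in>{1..}. finprod (G m) (\<lambda>i. br i (m - i) (x i) (y (m - i))) {1..<m})"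

definition homog :: "nat set \<Rightarrow> (nat \<Rightarrow> 'a monoid) \<Rightarrow> nat \<Rightarrow> 'a \<Rightarrow> (nat \<Rightarrow> 'a)" where
  "homog I G k a = (\<lambda>i\<in>I. if i = k then a else \<one>\<^bsub>G i\<^esub>)"

definition degree_part :: "nat set \<Rightarrow> (nat \<Rightarrow> 'a monoid) \<Rightarrow> nat \<Rightarrow> (nat \<Rightarrow> 'a) set" where
  "degree_part I G k = {x \<in> carrier (sum_group I G). \<forall>i\<in>I. i \<noteq> k \<longrightarrow> x i = \<one>\<^bsub>G i\<^esub>}"


section \<open>Abelian groups given by generators and relations\<close>

definition presented :: "'s set \<Rightarrow> ('s \<Rightarrow>\<^sub>0 int) set \<Rightarrow> ('s \<Rightarrow>\<^sub>0 int) set monoid" where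
  "presented S R = free_Abelian_group S Mod generate (free_Abelian_group S) R"

definition pgen :: "'s set \<Rightarrow> ('s \<Rightarrow>\<^sub>0 int) set \<Rightarrow> 's \<Rightarrow> ('s \<Rightarrow>\<^sub>0 int) set" where
  "pgen S R s = generate (free_Abelian_group S) R #>\<^bsub>free_Abelian_group S\<^esub> frag_of s"

text \<open>
  \<open>lift G g\<close> is the homomorphism from \<open>presented S R\<close> to \<open>G\<close> sending each generator \<open>s\<close> to
  \<open>g s\<close>, for \<open>g\<close> compatible with the relations \<open>R\<close>.
\<close>

definition lift :: "('a, 'm) monoid_scheme \<Rightarrow> ('s \<Rightarrow> 'a) \<Rightarrow> ('s \<Rightarrow>\<^sub>0 int) set \<Rightarrow> 'a" where
  "lift G g X = the_elem
     ((\<lambda>c. finprod G (\<lambda>s. g s [^]\<^bsub>G\<^esub> Poly_Mapping.lookup c s) (Poly_Mapping.keys c)) ` X)"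


section \<open>Multilinear algebra over the integers\<close>

definition dual :: "('a, 'm) monoid_scheme \<Rightarrow> ('a \<Rightarrow> int) monoid" where
  "dual M = \<lparr>carrier = hom M integer_group \<inter> extensional (carrier M),
             monoid.mult = (\<lambda>f g. \<lambda>x\<in>carrier M. f x + g x),
             one = (\<lambda>x\<in>carrier M. 0)\<rparr>"

definition bilin_rels ::
  "('a, 'm) monoid_scheme \<Rightarrow> ('b, 'n) monoid_scheme \<Rightarrow> ('a \<times> 'b \<Rightarrow>\<^sub>0 int) set" where
  "bilin_rels M N =
     {frag_of (a \<otimes>\<^bsub>M\<^esub> b, x) - frag_of (a, x) - frag_of (b, x) | a b x.
        a \<in> carrier M \<and> b \<in> carrier M \<and> x \<in> carrier N} \<union>
     {frag_of (a, x \<otimes>\<^bsub>N\<^esub> y) - frag_of (a, x) - frag_of (a, y) | a x y.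
        a \<in> carrier M \<and> x \<in> carrier N \<and> y \<in> carrier N}"

definition tensor ::
  "('a, 'm) monoid_scheme \<Rightarrow> ('b, 'n) monoid_scheme \<Rightarrow> ('a \<times> 'b \<Rightarrow>\<^sub>0 int) set monoid" where
  "tensor M N = presented (carrier M \<times> carrier N) (bilin_rels M N)"

definition pure ::
  "('a, 'm) monoid_scheme \<Rightarrow> ('b, 'n) monoid_scheme \<Rightarrow> 'a \<Rightarrow> 'b \<Rightarrow> ('a \<times> 'b \<Rightarrow>\<^sub>0 int) set" where
  "pure M N a x = pgen (carrier M \<times> carrier N) (bilin_rels M N) (a, x)"

text \<open>The map \<open>id \<otimes> g : M \<otimes> N \<rightarrow> M \<otimes> N'\<close>, which does not depend on \<open>N\<close> except through \<open>g\<close>.\<close>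

definition id_tensor ::
  "('a, 'm) monoid_scheme \<Rightarrow> ('c, 'n) monoid_scheme \<Rightarrow> ('b \<Rightarrow> 'c) \<Rightarrow>
   ('a \<times> 'b \<Rightarrow>\<^sub>0 int) set \<Rightarrow> ('a \<times> 'c \<Rightarrow>\<^sub>0 int) set" where
  "id_tensor M N' g = lift (tensor M N') (\<lambda>(a, x). pure M N' a (g x))"

definition ext2 :: "('a, 'm) monoid_scheme \<Rightarrow> ('a \<times> 'a \<Rightarrow>\<^sub>0 int) set monoid" where
  "ext2 M = presented (carrier M \<times> carrier M)
     (bilin_rels M M \<union> {frag_of (a, a) | a. a \<in> carrier M})"

definition lists_of_length :: "nat \<Rightarrow> 'a set \<Rightarrow> 'a list set" where
  "lists_of_length k A = {xs. set xs \<subseteq> A \<and> length xs = k}"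

definition multilin_rels :: "('a, 'm) monoid_scheme \<Rightarrow> nat \<Rightarrow> ('a list \<Rightarrow>\<^sub>0 int) set" where
  "multilin_rels M k =
     {frag_of (xs @ [a \<otimes>\<^bsub>M\<^esub> b] @ ys) - frag_of (xs @ [a] @ ys) - frag_of (xs @ [b] @ ys)
        | xs ys a b. set xs \<union> set ys \<subseteq> carrier M \<and> a \<in> carrier M \<and> b \<in> carrier M \<and>
                     length xs + 1 + length ys = k}"

definition sym_rels :: "('a, 'm) monoid_scheme \<Rightarrow> nat \<Rightarrow> ('a list \<Rightarrow>\<^sub>0 int) set" where
  "sym_rels M k =
     {frag_of xs - frag_of ys | xs ys.
        xs \<in> lists_of_length k (carrier M) \<and> ys \<in> lists_of_length k (carrier M) \<and>
        mset xs = mset ys}"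

definition tpow :: "('a, 'm) monoid_scheme \<Rightarrow> nat \<Rightarrow> ('a list \<Rightarrow>\<^sub>0 int) set monoid" where
  "tpow M k = presented (lists_of_length k (carrier M)) (multilin_rels M k)"

definition tprod :: "('a, 'm) monoid_scheme \<Rightarrow> 'a list \<Rightarrow> ('a list \<Rightarrow>\<^sub>0 int) set" where
  "tprod M xs = pgen (lists_of_length (length xs) (carrier M)) (multilin_rels M (length xs)) xs"

definition spow :: "('a, 'm) monoid_scheme \<Rightarrow> nat \<Rightarrow> ('a list \<Rightarrow>\<^sub>0 int) set monoid" where
  "spow M k = presented (lists_of_length k (carrier M)) (multilin_rels M k \<union> sym_rels M k)"

definition sprod :: "('a, 'm) monoid_scheme \<Rightarrow> 'a list \<Rightarrow> ('a list \<Rightarrow>\<^sub>0 int) set" where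
  "sprod M xs = pgen (lists_of_length (length xs) (carrier M))
     (multilin_rels M (length xs) \<union> sym_rels M (length xs)) xs"

definition sym_proj ::
  "('a, 'm) monoid_scheme \<Rightarrow> nat \<Rightarrow> ('a list \<Rightarrow>\<^sub>0 int) set \<Rightarrow> ('a list \<Rightarrow>\<^sub>0 int) set" where
  "sym_proj M k = lift (spow M k) (sprod M)"

definition tmult :: "('a, 'm) monoid_scheme \<Rightarrow> nat \<Rightarrow> nat \<Rightarrow>
    ('a list \<Rightarrow>\<^sub>0 int) set \<Rightarrow> ('a list \<Rightarrow>\<^sub>0 int) set \<Rightarrow> ('a list \<Rightarrow>\<^sub>0 int) set" where
  "tmult M i j X Y =
     lift (tpow M (i + j)) (\<lambda>xs. lift (tpow M (i + j)) (\<lambda>ys. tprod M (xs @ ys)) Y) X"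

definition tbracket :: "('a, 'm) monoid_scheme \<Rightarrow> nat \<Rightarrow> nat \<Rightarrow>
    ('a list \<Rightarrow>\<^sub>0 int) set \<Rightarrow> ('a list \<Rightarrow>\<^sub>0 int) set \<Rightarrow> ('a list \<Rightarrow>\<^sub>0 int) set" where
  "tbracket M i j X Y =
     tmult M i j X Y \<otimes>\<^bsub>tpow M (i + j)\<^esub> inv\<^bsub>tpow M (i + j)\<^esub> (tmult M j i Y X)"

definition contract :: "('a, 'm) monoid_scheme \<Rightarrow> nat \<Rightarrow>
    (('a \<Rightarrow> int) \<times> ('a list \<Rightarrow>\<^sub>0 int) set \<Rightarrow>\<^sub>0 int) set \<Rightarrow> ('a list \<Rightarrow>\<^sub>0 int) set" where
  "contract M k = lift (tpow M k)
     (\<lambda>(f, X). lift (tpow M k) (\<lambda>xs. tprod M (tl xs) [^]\<^bsub>tpow M k\<^esub> f (hd xs)) X)"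


section \<open>Free Lie rings\<close>

text \<open>
  The free Lie ring is the quotient of the free nonassociative ring (the free abelian group on
  the free magma) by the two-sided ideal generated by all \<open>a a\<close> and all Jacobi elements. As this
  ideal is homogeneous, the quotient is formed degree by degree; the relations
  \<open>s s\<close> and \<open>s t + t s\<close> for \<open>s\<close> and \<open>t\<close> in the magma generate the same subgroup as the \<open>a a\<close>.
\<close>

datatype (gens: 'a) magma = Leaf 'a | Node "'a magma" "'a magma"

primrec leaves :: "'a magma \<Rightarrow> nat" where
  "leaves (Leaf i) = 1"
| "leaves (Node s t) = leaves s + leaves t"

definition magma_words :: "nat \<Rightarrow> nat \<Rightarrow> nat magma set" where
  "magma_words n k = {t. gens t \<subseteq> {..<n} \<and> leaves t = k}"

inductive lie_rel :: "nat \<Rightarrow> nat \<Rightarrow> (nat magma \<Rightarrow>\<^sub>0 int) \<Rightarrow> bool" for n where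
  square: "s \<in> magma_words n i \<Longrightarrow> lie_rel n (i + i) (frag_of (Node s s))"
| antisym: "s \<in> magma_words n i \<Longrightarrow> t \<in> magma_words n j \<Longrightarrow>
    lie_rel n (i + j) (frag_of (Node s t) + frag_of (Node t s))"
| jacobi: "s \<in> magma_words n i \<Longrightarrow> t \<in> magma_words n j \<Longrightarrow> u \<in> magma_words n k \<Longrightarrow>
    lie_rel n (i + j + k)
      (frag_of (Node s (Node t u)) + frag_of (Node t (Node u s)) + frag_of (Node u (Node s t)))"
| mult_right: "lie_rel n i r \<Longrightarrow> t \<in> magma_words n j \<Longrightarrow>
    lie_rel n (i + j) (frag_extend (\<lambda>s. frag_of (Node s t)) r)"
| mult_left: "lie_rel n i r \<Longrightarrow> t \<in> magma_words n j \<Longrightarrow>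
    lie_rel n (j + i) (frag_extend (\<lambda>s. frag_of (Node t s)) r)"

definition free_lie :: "nat \<Rightarrow> nat \<Rightarrow> (nat magma \<Rightarrow>\<^sub>0 int) set monoid" where
  "free_lie n k = presented (magma_words n k) (Collect (lie_rel n k))"

text \<open>Evaluation of magma words in a graded Lie ring, with the \<open>i\<close>-th generator sent to \<open>v i\<close>.\<close>

primrec magma_eval ::
  "(nat \<Rightarrow> nat \<Rightarrow> 'b \<Rightarrow> 'b \<Rightarrow> 'b) \<Rightarrow> ('a \<Rightarrow> 'b) \<Rightarrow> 'a magma \<Rightarrow> 'b" where
  "magma_eval br v (Leaf i) = v i"
| "magma_eval br v (Node s t) =
     br (leaves s) (leaves t) (magma_eval br v s) (magma_eval br v t)"


section \<open>The lower central series and its graded Lie ring\<close>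

definition commutator :: "('a, 'm) monoid_scheme \<Rightarrow> 'a \<Rightarrow> 'a \<Rightarrow> 'a" where
  "commutator G a b = a \<otimes>\<^bsub>G\<^esub> b \<otimes>\<^bsub>G\<^esub> inv\<^bsub>G\<^esub> a \<otimes>\<^bsub>G\<^esub> inv\<^bsub>G\<^esub> b"

text \<open>Indexing starts at \<open>1\<close>; the value at \<open>0\<close> is a dummy.\<close>

primrec lcs :: "('a, 'm) monoid_scheme \<Rightarrow> nat \<Rightarrow> 'a set" where
  "lcs G 0 = carrier G"
| "lcs G (Suc k) = (if k = 0 then carrier G
     else generate G {commutator G a b | a b. a \<in> lcs G k \<and> b \<in> carrier G})"

definition gr :: "'a monoid \<Rightarrow> nat \<Rightarrow> 'a set monoid" where
  "gr G k = G\<lparr>carrier := lcs G k\<rparr> Mod lcs G (k + 1)"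

definition gr_bracket :: "'a monoid \<Rightarrow> nat \<Rightarrow> nat \<Rightarrow> 'a set \<Rightarrow> 'a set \<Rightarrow> 'a set" where
  "gr_bracket G k l A B =
     the_elem ((\<lambda>(a, b). lcs G (k + l + 1) #>\<^bsub>G\<^esub> commutator G a b) ` (A \<times> B))"


section \<open>Free groups and free metabelian groups\<close>

text \<open>Reduced words in the letters \<open>(i, True)\<close>, standing for \<open>x\<^sub>i\<close>, and \<open>(i, False)\<close>, for its inverse.\<close>

type_synonym word = "(nat \<times> bool) list"

fun cancel_cons :: "nat \<times> bool \<Rightarrow> word \<Rightarrow> word" where
  "cancel_cons a [] = [a]"
| "cancel_cons a (b # w) = (if fst a = fst b \<and> snd a \<noteq> snd b then w else a # b # w)"

definition free_group :: "nat \<Rightarrow> word monoid" where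
  "free_group n =
     \<lparr>carrier = {w. fst ` set w \<subseteq> {..<n} \<and>
                    successively (\<lambda>a b. \<not> (fst a = fst b \<and> snd a \<noteq> snd b)) w},
      monoid.mult = (\<lambda>u w. foldr cancel_cons u w),
      one = []\<rparr>"

definition second_derived :: "'a monoid \<Rightarrow> 'a set" where
  "second_derived G = derived G (derived G (carrier G))"

definition free_metab :: "nat \<Rightarrow> word set monoid" where
  "free_metab n = free_group n Mod second_derived (free_group n)"

definition Hab :: "nat \<Rightarrow> word set monoid" where
  "Hab n = free_group n Mod derived (free_group n) (carrier (free_group n))"

definition Hab_gen :: "nat \<Rightarrow> nat \<Rightarrow> word set" where
  "Hab_gen n i =
     derived (free_group n) (carrier (free_group n)) #>\<^bsub>free_group n\<^esub> [(i, True)]"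

definition Hab_gen_dual :: "nat \<Rightarrow> nat \<Rightarrow> word set \<Rightarrow> int" where
  "Hab_gen_dual n i =
     (THE f. f \<in> carrier (dual (Hab n)) \<and> (\<forall>j<n. f (Hab_gen n j) = (if j = i then 1 else 0)))"


section \<open>The Chen Lie algebra and its derivations\<close>

abbreviation chen_gr :: "nat \<Rightarrow> nat \<Rightarrow> word set set monoid" where
  "chen_gr n \<equiv> gr (free_metab n)"

abbreviation chen_bracket ::
  "nat \<Rightarrow> nat \<Rightarrow> nat \<Rightarrow> word set set \<Rightarrow> word set set \<Rightarrow> word set set" where
  "chen_bracket n \<equiv> gr_bracket (free_metab n)"

definition chen :: "nat \<Rightarrow> (nat \<Rightarrow> word set set) lie" where
  "chen n = graded_sum (chen_gr n) (chen_bracket n)"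

text \<open>The natural identification of \<open>H\<close> with the degree one part.\<close>

definition Hab_to_chen :: "nat \<Rightarrow> word set \<Rightarrow> word set set" where
  "Hab_to_chen n h = the_elem
     ((\<lambda>w. lcs (free_metab n) 2 #>\<^bsub>free_metab n\<^esub>
             (second_derived (free_group n) #>\<^bsub>free_group n\<^esub> w)) ` h)"

definition lie_derivation :: "'a lie \<Rightarrow> ('a \<Rightarrow> 'a) \<Rightarrow> bool" where
  "lie_derivation L D \<longleftrightarrow> D \<in> hom L L \<and>
     (\<forall>x\<in>carrier L. \<forall>y\<in>carrier L.
        D (bracket L x y) = bracket L (D x) y \<otimes>\<^bsub>L\<^esub> bracket L x (D y))"

definition der :: "nat \<Rightarrow> nat \<Rightarrow> ((nat \<Rightarrow> word set set) \<Rightarrow> (nat \<Rightarrow> word set set)) monoid" where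
  "der n k =
     \<lparr>carrier = {D \<in> extensional (carrier (chen n)). lie_derivation (chen n) D \<and>
        D ` degree_part {1..} (chen_gr n) 1 \<subseteq> degree_part {1..} (chen_gr n) (k + 1)},
      monoid.mult = (\<lambda>D E. \<lambda>x\<in>carrier (chen n). D x \<otimes>\<^bsub>chen n\<^esub> E x),
      one = (\<lambda>x\<in>carrier (chen n). \<one>\<^bsub>chen n\<^esub>)\<rparr>"

definition der_bracket :: "nat \<Rightarrow> nat \<Rightarrow> nat \<Rightarrow>
    ((nat \<Rightarrow> word set set) \<Rightarrow> (nat \<Rightarrow> word set set)) \<Rightarrow>
    ((nat \<Rightarrow> word set set) \<Rightarrow> (nat \<Rightarrow> word set set)) \<Rightarrow>
    ((nat \<Rightarrow> word set set) \<Rightarrow> (nat \<Rightarrow> word set set))" where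
  "der_bracket n k l D E =
     (\<lambda>x\<in>carrier (chen n). D (E x) \<otimes>\<^bsub>chen n\<^esub> inv\<^bsub>chen n\<^esub> (E (D x)))"

definition der_plus ::
  "nat \<Rightarrow> (nat \<Rightarrow> (nat \<Rightarrow> word set set) \<Rightarrow> (nat \<Rightarrow> word set set)) lie" where
  "der_plus n = graded_sum (der n) (der_bracket n)"

text \<open>
  The identification of degree \<open>k\<close> derivations with \<open>H\<^sup>* \<otimes> \<L>(k + 1)\<close>, sending \<open>D\<close> to the
  sum of the \<open>x\<^sub>i\<^sup>* \<otimes> D(x\<^sub>i)\<close>.
\<close>

definition der_tensor :: "nat \<Rightarrow> nat \<Rightarrow> ((nat \<Rightarrow> word set set) \<Rightarrow> (nat \<Rightarrow> word set set)) \<Rightarrow>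
    ((word set \<Rightarrow> int) \<times> word set set \<Rightarrow>\<^sub>0 int) set" where
  "der_tensor n k D =
     finprod (tensor (dual (Hab n)) (chen_gr n (k + 1)))
       (\<lambda>i. pure (dual (Hab n)) (chen_gr n (k + 1)) (Hab_gen_dual n i)
              (D (homog {1..} (chen_gr n) 1 (Hab_to_chen n (Hab_gen n i))) (k + 1)))
       {..<n}"

text \<open>The identification of \<open>\<Lambda>\<^sup>2 H\<close> with the degree two part, \<open>x \<and> y\<close> corresponding to \<open>[x, y]\<close>.\<close>

definition ext2_to_chen :: "nat \<Rightarrow> (word set \<times> word set \<Rightarrow>\<^sub>0 int) set \<Rightarrow> word set set" where
  "ext2_to_chen n =
     lift (chen_gr n 2) (\<lambda>(x, y). chen_bracket n 1 1 (Hab_to_chen n x) (Hab_to_chen n y))"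

definition der1_ident :: "nat \<Rightarrow> ((nat \<Rightarrow> word set set) \<Rightarrow> (nat \<Rightarrow> word set set)) \<Rightarrow>
    ((word set \<Rightarrow> int) \<times> (word set \<times> word set \<Rightarrow>\<^sub>0 int) set \<Rightarrow>\<^sub>0 int) set" where
  "der1_ident n D =
     id_tensor (dual (Hab n)) (ext2 (Hab n)) (inv_into (carrier (ext2 (Hab n))) (ext2_to_chen n))
       (der_tensor n 1 D)"


section \<open>Trace maps\<close>

definition free_lie_embed :: "nat \<Rightarrow> nat \<Rightarrow> (nat magma \<Rightarrow>\<^sub>0 int) set \<Rightarrow> (word set list \<Rightarrow>\<^sub>0 int) set"
  where "free_lie_embed n k =
    lift (tpow (Hab n) k) (magma_eval (tbracket (Hab n)) (\<lambda>i. tprod (Hab n) [Hab_gen n i]))"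

definition free_lie_to_chen :: "nat \<Rightarrow> nat \<Rightarrow> (nat magma \<Rightarrow>\<^sub>0 int) set \<Rightarrow> word set set" where
  "free_lie_to_chen n k =
     lift (chen_gr n k) (magma_eval (chen_bracket n) (\<lambda>i. Hab_to_chen n (Hab_gen n i)))"

definition trace_map :: "nat \<Rightarrow> nat \<Rightarrow>
    ((word set \<Rightarrow> int) \<times> (nat magma \<Rightarrow>\<^sub>0 int) set \<Rightarrow>\<^sub>0 int) set \<Rightarrow> (word set list \<Rightarrow>\<^sub>0 int) set" where
  "trace_map n k u =
     sym_proj (Hab n) k (contract (Hab n) k
       (id_tensor (dual (Hab n)) (tpow (Hab n) (k + 1)) (free_lie_embed n (k + 1)) u))"

text \<open>The map induced by \<^const>\<open>trace_map\<close> along \<open>H\<^sup>* \<otimes> \<L>\<^sub>n(k + 1) \<rightarrow> H\<^sup>* \<otimes> \<L>\<^sub>n\<^sup>M(k + 1)\<close>.\<close>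

definition trace_map_metab :: "nat \<Rightarrow> nat \<Rightarrow>
    ((word set \<Rightarrow> int) \<times> word set set \<Rightarrow>\<^sub>0 int) set \<Rightarrow> (word set list \<Rightarrow>\<^sub>0 int) set" where
  "trace_map_metab n k t = the_elem (trace_map n k `
     {u \<in> carrier (tensor (dual (Hab n)) (free_lie n (k + 1))).
        id_tensor (dual (Hab n)) (chen_gr n (k + 1)) (free_lie_to_chen n (k + 1)) u = t})"


section \<open>The two graded Lie rings to be compared\<close>

definition der_ab :: "nat \<Rightarrow> (nat \<Rightarrow> (nat \<Rightarrow> word set set) \<Rightarrow> (nat \<Rightarrow> word set set)) set lie" where
  "der_ab n = lie_ab (der_plus n)"

text \<open>The class in the abelianization of a derivation of degree \<open>k\<close>.\<close>

definition der_class :: "nat \<Rightarrow> nat \<Rightarrow> ((nat \<Rightarrow> word set set) \<Rightarrow> (nat \<Rightarrow> word set set)) \<Rightarrow>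
    (nat \<Rightarrow> (nat \<Rightarrow> word set set) \<Rightarrow> (nat \<Rightarrow> word set set)) set" where
  "der_class n k D =
     lie_derived (der_plus n) #>\<^bsub>der_plus n\<^esub> homog {1..} (der n) k D"

definition der_ab_part ::
  "nat \<Rightarrow> nat \<Rightarrow> (nat \<Rightarrow> (nat \<Rightarrow> word set set) \<Rightarrow> (nat \<Rightarrow> word set set)) set set" where
  "der_ab_part n k = der_class n k ` carrier (der n k)"

type_synonym target =
  "((word set \<Rightarrow> int) \<times> (word set \<times> word set \<Rightarrow>\<^sub>0 int) set \<Rightarrow>\<^sub>0 int) set \<times>
   (nat \<Rightarrow> (word set list \<Rightarrow>\<^sub>0 int) set)"

definition target :: "nat \<Rightarrow> target lie" where
  "target n =
     abelian_lie (tensor (dual (Hab n)) (ext2 (Hab n)) \<times>\<times> sum_group {2..} (spow (Hab n)))"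

definition target_part :: "nat \<Rightarrow> nat \<Rightarrow> target set" where
  "target_part n k =
     (if k = 1
      then carrier (tensor (dual (Hab n)) (ext2 (Hab n))) \<times> {\<one>\<^bsub>sum_group {2..} (spow (Hab n))\<^esub>}
      else {\<one>\<^bsub>tensor (dual (Hab n)) (ext2 (Hab n))\<^esub>} \<times> degree_part {2..} (spow (Hab n)) k)"

end

theory Submission
  imports Defs "HOL-Computational_Algebra.Formal_Power_Series" "HOL-Library.Function_Algebras"
begin

text \<open>
  By Magnus' method the free metabelian group maps to the \<open>n\<close>-tuples \<open>p\<close> of power series over the
  polynomial ring in \<open>X\<^sub>1, \<dots>, X\<^sub>n\<close> under \<open>p q = p + (1 - \<Theta> p) q\<close>, \<open>\<Theta> p\<close> being the sum of the \<open>X\<^sub>i p\<^sub>i\<close>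
  times the series variable. Leading coefficients embed the degree \<open>k\<close> part of the Chen Lie algebra
  into tuples of homogeneous polynomials of degree \<open>k - 1\<close>, the bracket becoming
  \<open>\<theta>(q) p - \<theta>(p) q\<close> with \<open>\<theta>(p) = \<Sum>\<^sub>i X\<^sub>i p\<^sub>i\<close>; in degree at least 2 the image lies in the kernel of \<open>\<theta>\<close>.
  Hence a derivation of positive degree is a matrix whose rows are killed by \<open>\<theta>\<close>, the bracket of
  derivations is the commutator of matrices, and Morita's trace is the trace of the matrix. So the
  traces vanish on brackets. Conversely, explicit commutators with matrices of degree one reduce
  every matrix of degree at least 2 to a combination of standard ones, which the trace tells apart.
  Brackets have no component in degree one.
\<close>

section \<open>Abelian groups\<close>

text \<open>The group law is Fox calculus: the tuple of a word lists its Fox derivatives, and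
  \<open>1 - Theta n p\<close> is its image under the ring map that sends the i-th generator to
  \<open>1 - fps_X * fps_const (X i)\<close>. Commutators are then given exactly, and not only to
  leading order, by \<open>Brc\<close>. The obstacle is that all groups are integral and given by
  relations, so that linear independence has to be exhibited. It is always exhibited in the same
  way, by a left inverse defined on monomials. For the Chen algebra this is \<open>Linv\<close>, and
  the work lies in the Jacobi identity; for symmetric, tensor and exterior powers it is a choice of
  ordered products. Derivations with prescribed values on the generators exist because the image of
  the leading coefficient map is, from degree 2 on, closed under multiplication by polynomials.
  Morita's trace becomes a matrix trace for the following reason: contracting the first letter of a
  tensor and letting the other letters commute turns the tensor commutator into the bracket of
  tuples. Since that bracket only sees the metabelian quotient, the trace factors through
  it.\<close>

lemma group_homI: "group G \<Longrightarrow> group H \<Longrightarrow> h \<in> hom G H \<Longrightarrow> group_hom G H h"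
  by (simp add: group_hom_def group_hom_axioms_def)

lemma hom_eq_on_generate:
  assumes "group G" "group H" "f \<in> hom G H" "g \<in> hom G H" "K \<subseteq> carrier G"
    and "\<And>x. x \<in> K \<Longrightarrow> f x = g x" and "x \<in> generate G K"
  shows "f x = g x"
proof -
  interpret f: group_hom G H f using assms(1-4) by (intro group_homI)
  interpret g: group_hom G H g using assms(1-4) by (intro group_homI)
  show ?thesis using assms(7)
  proof (induction rule: generate.induct)
    case (eng a b)
    then show ?case
      using group.generate_in_carrier[OF assms(1,5)] by simp
  next
    case (inv h) then show ?case using assms(5,6) by (simp add: subset_eq)
  next
    case one then show ?case by (simp only: f.hom_one g.hom_one)
  next
    case (incl h) then show ?case by (rule assms(6))
  qed
qed

text \<open>Membership form of checking on generators. Once a property is phrased as "the image lies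
  in a subgroup", it passes from generators to everything they generate, and the induction over
  \<open>generate\<close> is not repeated later.\<close>

lemma hom_image_in_subgroup:
  assumes "group G" "group H" "f \<in> hom G H" "K \<subseteq> carrier G" "subgroup L H"
    and "\<And>x. x \<in> K \<Longrightarrow> f x \<in> L" and "x \<in> generate G K"
  shows "f x \<in> L"
proof -
  interpret f: group_hom G H f using assms(1-3) by (intro group_homI)
  show ?thesis using assms(7)
  proof (induction rule: generate.induct)
    case one then show ?case using assms(5) by (simp add: subgroup.one_closed)
  next
    case (incl h) then show ?case using assms by simp
  next
    case (inv h) then show ?case using assms by (simp add: subset_eq subgroup.m_inv_closed)
  next
    case (eng a b) then show ?case using group.generate_in_carrier[OF assms(1,4)] assms(5)
      by (simp add: subgroup.m_closed)
  qed
qed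

text \<open>Polynomials, power series and tuples of them are types with class operations, whereas
  \<open>hom\<close>, \<open>subgroup\<close> and \<open>generate\<close> expect records. The
  targets of all coordinate maps are therefore written as \<open>add_grp\<close>.\<close>

definition add_grp :: "'a::ab_group_add monoid" where
  "add_grp = \<lparr>carrier = UNIV, monoid.mult = (+), one = 0\<rparr>"

lemma add_grp_simps [simp]:
  "carrier add_grp = UNIV" "x \<otimes>\<^bsub>add_grp\<^esub> y = x + y" "\<one>\<^bsub>add_grp\<^esub> = 0"
  by (simp_all add: add_grp_def)

lemma comm_group_add_grp [simp]: "comm_group (add_grp :: 'a::ab_group_add monoid)"
proof (rule comm_groupI)
  fix x :: 'a show "\<exists>y\<in>carrier add_grp. y \<otimes>\<^bsub>add_grp\<^esub> x = \<one>\<^bsub>add_grp\<^esub>"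
    by (auto intro: exI[of _ "-x"])
qed (simp_all add: add.assoc add.commute)

lemma group_add_grp [simp]: "group (add_grp :: 'a::ab_group_add monoid)"
  using comm_group_add_grp comm_group_def by blast

lemma inv_add_grp [simp]: "inv\<^bsub>add_grp\<^esub> x = - x"
  by (rule group.inv_equality[OF group_add_grp]) auto

lemma finprod_add_grp [simp]:
  fixes f :: "'a \<Rightarrow> 'b::ab_group_add" shows "finprod add_grp f A = sum f A"
proof (induction A rule: infinite_finite_induct)
  case (insert x F)
  interpret comm_group "add_grp :: 'b monoid" by simp
  show ?case using insert by (simp add: finprod_insert)
qed (simp_all add: finprod_def)

lemma int_pow_add_grp:
  fixes x :: "'a::ring_1" shows "x [^]\<^bsub>add_grp\<^esub> (m::int) = of_int m * x"
proof -
  interpret comm_group "add_grp :: 'a monoid" by simp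
  have n: "x [^]\<^bsub>add_grp\<^esub> (k::nat) = of_nat k * x" for k
    by (induction k) (auto simp: distrib_right add.commute)
  show ?thesis
  proof (cases m)
    case (nonneg k) then show ?thesis by (simp add: int_pow_int n)
  next
    case (neg k)
    have "x [^]\<^bsub>add_grp\<^esub> (- int (Suc k)) = - (of_nat (Suc k) * x)"
      using n[of "Suc k"] int_pow_neg[of x "int (Suc k)"] by (simp only: int_pow_int add_grp_simps inv_add_grp UNIV_I)
    then show ?thesis using neg by (simp only: of_int_minus of_int_of_nat_eq mult_minus_left)
  qed
qed

lemma hom_add_grp:
  assumes "group G" "h \<in> hom G (add_grp :: 'b::ab_group_add monoid)"
  shows "h \<one>\<^bsub>G\<^esub> = 0"
    and "x \<in> carrier G \<Longrightarrow> y \<in> carrier G \<Longrightarrow> h (x \<otimes>\<^bsub>G\<^esub> y) = h x + h y"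
    and "x \<in> carrier G \<Longrightarrow> h (inv\<^bsub>G\<^esub> x) = - h x"
proof -
  interpret group_hom G "add_grp :: 'b monoid" h
    using assms by (intro group_homI) simp_all
  show "h \<one>\<^bsub>G\<^esub> = 0" using hom_one by simp
  show "x \<in> carrier G \<Longrightarrow> y \<in> carrier G \<Longrightarrow> h (x \<otimes>\<^bsub>G\<^esub> y) = h x + h y" using hom_mult by simp
  show "x \<in> carrier G \<Longrightarrow> h (inv\<^bsub>G\<^esub> x) = - h x" using hom_inv by simp
qed

lemma hom_finprod:
  assumes "comm_group G" "comm_group H" "h \<in> hom G H" "f \<in> A \<rightarrow> carrier G"
  shows "h (finprod G f A) = finprod H (\<lambda>a. h (f a)) A"
proof -
  interpret G: comm_group G by fact
  interpret H: comm_group H by fact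
  interpret h: group_hom G H h
    by (intro group_homI G.is_group H.is_group assms(3))
  show ?thesis using assms(4)
  proof (induction A rule: infinite_finite_induct)
    case (insert x F)
    then show ?case by (subst G.finprod_insert H.finprod_insert; auto simp: Pi_def)+
  qed (simp_all add: finprod_def)
qed

lemma finprod_hom:
  assumes "comm_group H" "group G" "\<And>i. i \<in> A \<Longrightarrow> f i \<in> hom G H"
  shows "(\<lambda>x. finprod H (\<lambda>i. f i x) A) \<in> hom G H"
proof -
  interpret H: comm_group H by fact
  have "(\<lambda>i. f i x) \<in> A \<rightarrow> carrier H" if "x \<in> carrier G" for x
    using assms(3) that by (auto simp: hom_def)
  note c = this
  interpret G: group G by fact
  show ?thesis
  proof (rule homI)
    fix x assume x: "x \<in> carrier G"
    show "finprod H (\<lambda>i. f i x) A \<in> carrier H" using c[OF x] by (rule H.finprod_closed)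
  next
    fix x y assume x: "x \<in> carrier G" and y: "y \<in> carrier G"
    have "finprod H (\<lambda>i. f i (x \<otimes>\<^bsub>G\<^esub> y)) A = finprod H (\<lambda>i. f i x \<otimes>\<^bsub>H\<^esub> f i y) A"
      using c[OF x] c[OF y] x y by (intro H.finprod_cong') (auto simp: hom_mult[OF assms(3)] Pi_iff)
    then show "finprod H (\<lambda>i. f i (x \<otimes>\<^bsub>G\<^esub> y)) A = finprod H (\<lambda>i. f i x) A \<otimes>\<^bsub>H\<^esub> finprod H (\<lambda>i. f i y) A"
      using H.finprod_multf[OF c[OF x] c[OF y]] by simp
  qed
qed

lemma hom_mult_pointwise:
  assumes "comm_group H" "f \<in> hom G H" "g \<in> hom G H"
  shows "(\<lambda>x. f x \<otimes>\<^bsub>H\<^esub> g x) \<in> hom G H"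
proof -
  interpret comm_group H by fact
  show ?thesis using assms(2,3) by (auto simp: hom_def Pi_def m_ac)
qed

lemma hom_inv_pointwise:
  assumes "comm_group H" "f \<in> hom G H"
  shows "(\<lambda>x. inv\<^bsub>H\<^esub> (f x)) \<in> hom G H"
proof -
  interpret comm_group H by fact
  show ?thesis using assms(2) by (auto simp: hom_def Pi_def inv_mult)
qed

text \<open>Maps on quotients are defined in this development by \<open>the_elem\<close> of an
  image. This is the well-definedness criterion under which such a map takes the expected value on a
  coset.\<close>

lemma the_elem_image_coset:
  assumes "group G" "subgroup N G" "g \<in> carrier G"
    and "\<And>m. m \<in> N \<Longrightarrow> f (m \<otimes>\<^bsub>G\<^esub> g) = f g"
  shows "the_elem (f ` (N #>\<^bsub>G\<^esub> g)) = f g"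
proof -
  have "f ` (N #>\<^bsub>G\<^esub> g) = {f g}"
    using assms(4) subgroup.one_closed[OF assms(2)] by (auto simp: r_coset_def image_iff)
  then show ?thesis by simp
qed

text \<open>The body of \<open>lift\<close> before the passage to cosets, that is, the linear
  extension of \<open>g\<close> to formal integer combinations.\<close>

definition frag_hom :: "('a, 'm) monoid_scheme \<Rightarrow> ('s \<Rightarrow> 'a) \<Rightarrow> ('s \<Rightarrow>\<^sub>0 int) \<Rightarrow> 'a" where
  "frag_hom G g c =
     finprod G (\<lambda>s. g s [^]\<^bsub>G\<^esub> Poly_Mapping.lookup c s) (Poly_Mapping.keys c)"

context comm_group
begin

text \<open>Two combinations have different supports, so additivity can only be proved after both
  products are taken over a common finite set.\<close>

lemma frag_hom_superset:
  assumes "g \<in> S \<rightarrow> carrier G" "Poly_Mapping.keys c \<subseteq> T" "T \<subseteq> S" "finite T"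
  shows "frag_hom G g c = finprod G (\<lambda>s. g s [^] Poly_Mapping.lookup c s) T"
  unfolding frag_hom_def
  using assms by (intro finprod_mono_neutral_cong_left) (auto simp: in_keys_iff Pi_def)

lemma frag_hom_hom:
  assumes "g \<in> S \<rightarrow> carrier G"
  shows "frag_hom G g \<in> hom (free_Abelian_group S) G"
proof (rule homI)
  fix x y assume "x \<in> carrier (free_Abelian_group S)" "y \<in> carrier (free_Abelian_group S)"
  then have xy: "Poly_Mapping.keys x \<subseteq> S" "Poly_Mapping.keys y \<subseteq> S" by auto
  let ?T = "Poly_Mapping.keys x \<union> Poly_Mapping.keys y"
  have T: "?T \<subseteq> S" "finite ?T" "Poly_Mapping.keys (x + y) \<subseteq> ?T" using xy keys_add[of x y] by auto
  have c: "s \<in> ?T \<Longrightarrow> g s \<in> carrier G" for s using T assms by auto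
  have "frag_hom G g (x + y) = finprod G (\<lambda>s. g s [^] Poly_Mapping.lookup x s \<otimes> g s [^] Poly_Mapping.lookup y s) ?T"
    unfolding frag_hom_superset[OF assms T(3,1,2)]
    by (rule finprod_cong') (use c in \<open>simp_all add: Poly_Mapping.lookup_add int_pow_mult\<close>)
  also have "\<dots> = frag_hom G g x \<otimes> frag_hom G g y"
    using c by (subst finprod_multf) (simp_all add: frag_hom_superset[OF assms _ T(1,2)] Pi_def)
  finally show "frag_hom G g (x \<otimes>\<^bsub>free_Abelian_group S\<^esub> y) = frag_hom G g x \<otimes> frag_hom G g y"
    by simp
next
  fix x assume "x \<in> carrier (free_Abelian_group S)"
  then have "g \<in> Poly_Mapping.keys x \<rightarrow> carrier G" using assms by auto
  then show "frag_hom G g x \<in> carrier G"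
    unfolding frag_hom_def by (intro finprod_closed) (simp add: Pi_iff)
qed

lemma frag_hom_of:
  assumes "g s \<in> carrier G"
  shows "frag_hom G g (frag_of s) = g s"
  using assms by (simp add: frag_hom_def finprod_singleton int_pow_def2 nat_pow_def)

lemma frag_hom_add:
  assumes "g \<in> S \<rightarrow> carrier G" "Poly_Mapping.keys c \<subseteq> S" "Poly_Mapping.keys d \<subseteq> S"
  shows "frag_hom G g (c + d) = frag_hom G g c \<otimes> frag_hom G g d"
    "frag_hom G g (c - d) = frag_hom G g c \<otimes> inv (frag_hom G g d)"
    "frag_hom G g (- c) = inv (frag_hom G g c)"
    "frag_hom G g c \<in> carrier G"
proof -
  interpret h: group_hom "free_Abelian_group S" G "frag_hom G g"
    by (intro group_homI is_group frag_hom_hom[OF assms(1)]) simp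
  show 1: "frag_hom G g (c + d) = frag_hom G g c \<otimes> frag_hom G g d"
    using h.hom_mult[of c d] assms by simp
  show 2: "frag_hom G g (- c) = inv (frag_hom G g c)"
    using h.hom_inv[of c] assms by simp
  show "frag_hom G g c \<in> carrier G" using h.hom_closed assms by simp
  show "frag_hom G g (c - d) = frag_hom G g c \<otimes> inv (frag_hom G g d)"
    using h.hom_mult[of c "-d"] h.hom_inv[of d] assms by simp
qed

lemma hom_eq_frag_hom:
  assumes "h \<in> hom (free_Abelian_group S) G" "\<And>s. s \<in> S \<Longrightarrow> h (frag_of s) = g s" "Poly_Mapping.keys c \<subseteq> S"
  shows "h c = frag_hom G g c"
proof -
  have g: "g \<in> S \<rightarrow> carrier G" using assms(1,2)
    by (metis Pi_I' frag_of_in_free_Abelian_group hom_in_carrier)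
  interpret h: group_hom "free_Abelian_group S" G h
    by (intro group_homI is_group assms(1)) simp
  show ?thesis using assms(3)
  proof (rule free_Abelian_group_induct[of c S "\<lambda>c. h c = frag_hom G g c"])
    show "h 0 = frag_hom G g 0" using h.hom_one by (simp add: frag_hom_def)
  next
    fix x y :: "'c \<Rightarrow>\<^sub>0 int"
    assume "Poly_Mapping.keys x \<subseteq> S" "Poly_Mapping.keys y \<subseteq> S"
      "h x = frag_hom G g x" "h y = frag_hom G g y"
    then show "h (x - y) = frag_hom G g (x - y)"
      using h.hom_mult[of x "-y"] h.hom_inv[of y] by (simp add: frag_hom_add[OF g])
  next
    fix a assume "a \<in> S"
    then show "h (frag_of a) = frag_hom G g (frag_of a)" using g by (simp add: assms(2) frag_hom_of Pi_iff)
  qed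
qed

end

lemma generate_frag_of:
  "generate (free_Abelian_group S) (frag_of ` S) = carrier (free_Abelian_group S)"
proof (intro equalityI subsetI)
  let ?G = "generate (free_Abelian_group S) (frag_of ` S)"
  have s: "subgroup ?G (free_Abelian_group S)"
    by (rule group.generate_is_subgroup[OF group_free_Abelian_group])
      (simp add: image_subset_iff)
  show "x \<in> carrier (free_Abelian_group S)" if "x \<in> ?G" for x
    using that by (rule subsetD[OF subgroup.subset[OF s]])
  show "x \<in> ?G" if x: "x \<in> carrier (free_Abelian_group S)" for x
  proof (rule free_Abelian_group_induct[of x S "\<lambda>x. x \<in> ?G"])
    show "Poly_Mapping.keys x \<subseteq> S" using x by simp
    show "0 \<in> ?G" using subgroup.one_closed[OF s] by (simp only: one_free_Abelian_group)
  next
    fix x y assume "Poly_Mapping.keys x \<subseteq> S" "Poly_Mapping.keys y \<subseteq> S" "x \<in> ?G" "y \<in> ?G"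
    then show "x - y \<in> ?G"
      using subgroup.m_closed[OF s, of x "-y"] subgroup.m_inv_closed[OF s, of y]
      by (simp only: mult_free_Abelian_group inv_free_Abelian_group diff_conv_add_uminus)
  next
    fix a assume "a \<in> S"
    then show "frag_of a \<in> ?G" by (intro generate.incl imageI)
  qed
qed

lemma hom_generate_image:
  assumes "group G" "group H" "f \<in> hom G H" "K \<subseteq> carrier G"
  shows "f ` generate G K = generate H (f ` K)"
  by (rule group_hom.generate_img[OF group_homI[OF assms(1-3)] assms(4), symmetric])

subsection \<open>Presented groups\<close>

text \<open>Tensor products, exterior squares, tensor and symmetric powers and free Lie rings are
  all instances. Each has to supply only that its relations are supported on its generators.\<close>

locale presentation =
  fixes S :: "'s set" and R :: "('s \<Rightarrow>\<^sub>0 int) set"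
  assumes rels: "\<And>r. r \<in> R \<Longrightarrow> Poly_Mapping.keys r \<subseteq> S"
begin

abbreviation "F \<equiv> free_Abelian_group S"
abbreviation "N \<equiv> generate F R"

lemma N_normal: "N \<lhd> F"
  using rels by (intro comm_group.subgroup_imp_normal[OF abelian_free_Abelian_group]
      group.generate_is_subgroup[OF group_free_Abelian_group]) auto

lemmas N_subgroup = normal_imp_subgroup[OF N_normal]
lemmas N_subset = subgroup.subset[OF N_subgroup]

lemma comm_group: "comm_group (presented S R)"
  unfolding presented_def by (rule comm_group.abelian_FactGroup[OF abelian_free_Abelian_group N_subgroup])

lemma proj_hom: "(\<lambda>c. N #>\<^bsub>F\<^esub> c) \<in> hom F (presented S R)"
  unfolding presented_def by (rule normal.r_coset_hom_Mod[OF N_normal])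

lemma pgen_closed: "s \<in> S \<Longrightarrow> pgen S R s \<in> carrier (presented S R)"
  unfolding pgen_def using hom_in_carrier[OF proj_hom] by simp

lemma pgen_generate: "generate (presented S R) (pgen S R ` S) = carrier (presented S R)"
proof -
  have "carrier (presented S R) = (\<lambda>c. N #>\<^bsub>F\<^esub> c) ` generate F (frag_of ` S)"
    by (simp only: generate_frag_of presented_def carrier_FactGroup)
  also have "\<dots> = generate (presented S R) ((\<lambda>c. N #>\<^bsub>F\<^esub> c) ` frag_of ` S)"
    by (intro hom_generate_image group_free_Abelian_group comm_group.axioms(2)[OF comm_group] proj_hom) auto
  finally show ?thesis by (simp add: image_image pgen_def)
qed

lemma hom_eqI:
  assumes "group H" "f \<in> hom (presented S R) H" "g \<in> hom (presented S R) H"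
    "\<And>s. s \<in> S \<Longrightarrow> f (pgen S R s) = g (pgen S R s)" "x \<in> carrier (presented S R)"
  shows "f x = g x"
proof (rule hom_eq_on_generate[OF _ assms(1-3)])
  show "group (presented S R)" by (rule comm_group.axioms(2)[OF comm_group])
  show "x \<in> generate (presented S R) (pgen S R ` S)" unfolding pgen_generate by (rule assms(5))
next
  show "pgen S R ` S \<subseteq> carrier (presented S R)" by (rule image_subsetI) (rule pgen_closed)
next
  fix y assume "y \<in> pgen S R ` S"
  then obtain s where "s \<in> S" "y = pgen S R s" by blast
  then show "f y = g y" by (simp only: assms(4))
qed

text \<open>The universal property. The linear extension of \<open>g\<close> kills the relations
  \<open>R\<close>, hence the subgroup \<open>N\<close> they generate, hence it is constant on
  cosets; this gives meaning to the \<open>the_elem\<close> in \<open>lift\<close>.\<close>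

lemma lift_hom:
  assumes G: "comm_group G" and g: "g \<in> S \<rightarrow> carrier G"
    and r: "\<And>r. r \<in> R \<Longrightarrow> frag_hom G g r = \<one>\<^bsub>G\<^esub>"
  shows "lift G g \<in> hom (presented S R) G" and "\<And>s. s \<in> S \<Longrightarrow> lift G g (pgen S R s) = g s"
proof -
  interpret G: comm_group G by fact
  interpret h: group_hom F G "frag_hom G g"
    by (intro group_homI group_free_Abelian_group G.is_group G.frag_hom_hom[OF g])
  have k: "frag_hom G g m = \<one>\<^bsub>G\<^esub>" if "m \<in> N" for m
  proof -
    have "R \<subseteq> carrier F" using rels by auto
    then have "frag_hom G g m \<in> {\<one>\<^bsub>G\<^esub>}"
      by (rule hom_image_in_subgroup[OF group_free_Abelian_group G.is_group G.frag_hom_hom[OF g] _ G.triv_subgroup _ that])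
        (simp add: r)
    then show ?thesis by simp
  qed
  have l: "lift G g (N #>\<^bsub>F\<^esub> c) = frag_hom G g c" if c: "c \<in> carrier F" for c
  proof -
    have "the_elem (frag_hom G g ` (N #>\<^bsub>F\<^esub> c)) = frag_hom G g c"
    proof (rule the_elem_image_coset[OF _ N_subgroup c])
      fix m assume m: "m \<in> N"
      have "m \<in> carrier F" using m by (rule subsetD[OF N_subset])
      then show "frag_hom G g (m \<otimes>\<^bsub>F\<^esub> c) = frag_hom G g c"
        by (simp only: h.hom_mult[OF _ c] k[OF m] G.l_one h.hom_closed[OF c])
    qed simp
    then show ?thesis unfolding lift_def frag_hom_def .
  qed
  show "lift G g \<in> hom (presented S R) G"
  proof (rule homI)
    fix X assume "X \<in> carrier (presented S R)"
    then show "lift G g X \<in> carrier G" using l h.hom_closed by (auto simp: presented_def carrier_FactGroup)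
  next
    fix X Y assume "X \<in> carrier (presented S R)" "Y \<in> carrier (presented S R)"
    then obtain c d where cd: "c \<in> carrier F" "d \<in> carrier F" "X = N #>\<^bsub>F\<^esub> c" "Y = N #>\<^bsub>F\<^esub> d"
      by (auto simp: presented_def carrier_FactGroup)
    have "X \<otimes>\<^bsub>presented S R\<^esub> Y = N #>\<^bsub>F\<^esub> (c \<otimes>\<^bsub>F\<^esub> d)"
      unfolding cd(3,4) by (rule hom_mult[OF proj_hom cd(1,2), symmetric])
    then show "lift G g (X \<otimes>\<^bsub>presented S R\<^esub> Y) = lift G g X \<otimes>\<^bsub>G\<^esub> lift G g Y"
      using l[OF group.subgroup_self[OF group_free_Abelian_group, THEN subgroup.m_closed, OF cd(1,2)]] l[OF cd(1)] l[OF cd(2)] h.hom_mult[OF cd(1,2)] cd(3,4) by metis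
  qed
  show "lift G g (pgen S R s) = g s" if "s \<in> S" for s
    using that g l[of "frag_of s"] by (simp add: pgen_def G.frag_hom_of Pi_iff)
qed

text \<open>The other half of the universal property: the tautological generators satisfy the
  relations. The calculation rules for pure tensors, wedges and symmetric products are read off from
  it.\<close>

lemma proj_rel: "r \<in> R \<Longrightarrow> frag_hom (presented S R) (pgen S R) r = \<one>\<^bsub>presented S R\<^esub>"
proof -
  assume r: "r \<in> R"
  interpret P: comm_group "presented S R" by (rule comm_group)
  have "frag_hom (presented S R) (pgen S R) r = N #>\<^bsub>F\<^esub> r"
    by (rule P.hom_eq_frag_hom[OF proj_hom, symmetric]) (use rels[OF r] in \<open>simp_all add: pgen_def\<close>)
  also have "\<dots> = N" using r rels[OF r] by (intro group.coset_join2[OF group_free_Abelian_group] N_subgroup generate.incl) auto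
  finally show ?thesis by (simp add: presented_def)
qed

end

text \<open>Every bilinearity or multilinearity relation has this shape. The equivalence is used
  from right to left to lift maps and from left to right to obtain the laws inside a presented
  group.\<close>

lemma (in comm_group) frag_hom_3:
  assumes "g a \<in> carrier G" "g b \<in> carrier G" "g c \<in> carrier G"
  shows "frag_hom G g (frag_of a - frag_of b - frag_of c) = \<one> \<longleftrightarrow> g a = g b \<otimes> g c"
proof -
  let ?S = "{a,b,c}"
  have g: "g \<in> ?S \<rightarrow> carrier G" using assms by auto
  have "frag_hom G g (frag_of a - frag_of b - frag_of c) = g a \<otimes> inv (g b) \<otimes> inv (g c)"
    using assms keys_diff[of "frag_of a" "frag_of b"]
    by (subst frag_hom_add(2)[OF g]) (auto simp: frag_hom_add(2)[OF g] frag_hom_of)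
  also have "\<dots> = g a \<otimes> inv (g b \<otimes> g c)" using assms by (simp add: inv_mult m_assoc)
  also have "\<dots> = \<one> \<longleftrightarrow> g a = g b \<otimes> g c"
    using assms inv_equality[of "g a" "inv (g b \<otimes> g c)"] by auto
  finally show ?thesis .
qed

lemma (in comm_group) frag_hom_2:
  assumes "g a \<in> carrier G" "g b \<in> carrier G"
  shows "frag_hom G g (frag_of a - frag_of b) = \<one> \<longleftrightarrow> g a = g b"
    and "frag_hom G g (frag_of a + frag_of b) = g a \<otimes> g b"
proof -
  let ?S = "{a,b}"
  have g: "g \<in> ?S \<rightarrow> carrier G" using assms by auto
  show "frag_hom G g (frag_of a - frag_of b) = \<one> \<longleftrightarrow> g a = g b"
    "frag_hom G g (frag_of a + frag_of b) = g a \<otimes> g b"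
    using assms inv_equality[of "g a" "inv (g b)"] by (auto simp: frag_hom_add[OF g] frag_hom_of)
qed

section \<open>Multilinear algebra\<close>

lemma keys_frag_3: "Poly_Mapping.keys (frag_of a - frag_of b - frag_of c) \<subseteq> {a, b, c}"
  using keys_diff[of "frag_of a - frag_of b" "frag_of c"] keys_diff[of "frag_of a" "frag_of b"]
  by fastforce

lemma keys_frag_2: "Poly_Mapping.keys (frag_of a - frag_of b) \<subseteq> {a, b}"
  using keys_diff[of "frag_of a" "frag_of b"] by fastforce

lemma bilin_rels_iff:
  "r \<in> bilin_rels M N \<longleftrightarrow>
    (\<exists>a b x. r = frag_of (a \<otimes>\<^bsub>M\<^esub> b, x) - frag_of (a, x) - frag_of (b, x) \<and>
       a \<in> carrier M \<and> b \<in> carrier M \<and> x \<in> carrier N) \<or>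
    (\<exists>a x y. r = frag_of (a, x \<otimes>\<^bsub>N\<^esub> y) - frag_of (a, x) - frag_of (a, y) \<and>
       a \<in> carrier M \<and> x \<in> carrier N \<and> y \<in> carrier N)"
  unfolding bilin_rels_def by blast

lemma hom_by_mult: "group G \<Longrightarrow> (\<And>x. x \<in> carrier G \<Longrightarrow> f x \<in> carrier H) \<Longrightarrow>
  (\<And>x y. x \<in> carrier G \<Longrightarrow> y \<in> carrier G \<Longrightarrow> f (x \<otimes>\<^bsub>G\<^esub> y) = f x \<otimes>\<^bsub>H\<^esub> f y) \<Longrightarrow> f \<in> hom G H"
  by (rule homI)

section \<open>Bilinear maps and tensor products\<close>

locale two_groups = M: comm_group M + N: comm_group N
  for M :: "('a, 'm) monoid_scheme" and N :: "('b, 'n) monoid_scheme"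
begin

text \<open>The additional relations \<open>R\<close> are empty for tensor products and alternating
  for the exterior square, so that both share one bilinear calculus.\<close>

lemma bilin_presentation:
  assumes "\<And>r. r \<in> R \<Longrightarrow> Poly_Mapping.keys r \<subseteq> carrier M \<times> carrier N"
  shows "presentation (carrier M \<times> carrier N) (bilin_rels M N \<union> R)"
proof
  fix r assume "r \<in> bilin_rels M N \<union> R"
  then consider a b x where "r = frag_of (a \<otimes>\<^bsub>M\<^esub> b, x) - frag_of (a, x) - frag_of (b, x)"
      "a \<in> carrier M" "b \<in> carrier M" "x \<in> carrier N"
    | a x y where "r = frag_of (a, x \<otimes>\<^bsub>N\<^esub> y) - frag_of (a, x) - frag_of (a, y)"
      "a \<in> carrier M" "x \<in> carrier N" "y \<in> carrier N"
    | "r \<in> R" unfolding Un_iff bilin_rels_iff by metis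
  then show "Poly_Mapping.keys r \<subseteq> carrier M \<times> carrier N"
  proof cases
    case 1 show ?thesis unfolding 1(1) by (rule order_trans[OF keys_frag_3]) (use 1 in simp)
  next
    case 2 show ?thesis unfolding 2(1) by (rule order_trans[OF keys_frag_3]) (use 2 in simp)
  next
    case 3 then show ?thesis by (rule assms)
  qed
qed

definition bilinear :: "('c, 'k) monoid_scheme \<Rightarrow> ('a \<times> 'b \<Rightarrow> 'c) \<Rightarrow> bool" where
  "bilinear H g \<longleftrightarrow> (\<forall>a\<in>carrier M. (\<lambda>x. g (a, x)) \<in> hom N H) \<and> (\<forall>x\<in>carrier N. (\<lambda>a. g (a, x)) \<in> hom M H)"

lemma bilinear_rels:
  assumes "comm_group H" "bilinear H g" "r \<in> bilin_rels M N"
  shows "frag_hom H g r = \<one>\<^bsub>H\<^esub>"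
proof -
  interpret H: comm_group H by fact
  have c: "g (a, x) \<in> carrier H" if "a \<in> carrier M" "x \<in> carrier N" for a x
    using assms(2) that unfolding bilinear_def by (metis hom_in_carrier)
  have 1: "g (a, x \<otimes>\<^bsub>N\<^esub> y) = g (a, x) \<otimes>\<^bsub>H\<^esub> g (a, y)" if "a \<in> carrier M" "x \<in> carrier N" "y \<in> carrier N" for a x y
    using hom_mult[of "\<lambda>x. g (a, x)" N H x y] assms(2) that unfolding bilinear_def by blast
  have 2: "g (a \<otimes>\<^bsub>M\<^esub> b, x) = g (a, x) \<otimes>\<^bsub>H\<^esub> g (b, x)" if "a \<in> carrier M" "b \<in> carrier M" "x \<in> carrier N" for a b x
    using hom_mult[of "\<lambda>a. g (a, x)" M H a b] assms(2) that unfolding bilinear_def by blast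
  show ?thesis using assms(3) unfolding bilin_rels_iff
  proof (elim disjE exE conjE)
    fix a b x assume r: "r = frag_of (a \<otimes>\<^bsub>M\<^esub> b, x) - frag_of (a, x) - frag_of (b, x)"
      and m: "a \<in> carrier M" "b \<in> carrier M" "x \<in> carrier N"
    show ?thesis unfolding r
      by (subst H.frag_hom_3) (use m in \<open>simp_all add: c 2\<close>)
  next
    fix a x y assume r: "r = frag_of (a, x \<otimes>\<^bsub>N\<^esub> y) - frag_of (a, x) - frag_of (a, y)"
      and m: "a \<in> carrier M" "x \<in> carrier N" "y \<in> carrier N"
    show ?thesis unfolding r
      by (subst H.frag_hom_3) (use m in \<open>simp_all add: c 1\<close>)
  qed
qed

lemma bilinear_closed:
  "bilinear H g \<Longrightarrow> a \<in> carrier M \<Longrightarrow> x \<in> carrier N \<Longrightarrow> g (a, x) \<in> carrier H"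
  unfolding bilinear_def by (metis hom_in_carrier)

lemma pgen_bilinear:
  assumes "\<And>r. r \<in> R \<Longrightarrow> Poly_Mapping.keys r \<subseteq> carrier M \<times> carrier N"
  shows "bilinear (presented (carrier M \<times> carrier N) (bilin_rels M N \<union> R))
           (pgen (carrier M \<times> carrier N) (bilin_rels M N \<union> R))"
proof -
  interpret P: presentation "carrier M \<times> carrier N" "bilin_rels M N \<union> R"
    by (rule bilin_presentation) (rule assms)
  let ?P = "presented (carrier M \<times> carrier N) (bilin_rels M N \<union> R)"
  let ?p = "pgen (carrier M \<times> carrier N) (bilin_rels M N \<union> R)"
  interpret H: comm_group ?P by (rule P.comm_group)
  have c: "?p (a, x) \<in> carrier ?P" if "a \<in> carrier M" "x \<in> carrier N" for a x
    by (rule P.pgen_closed) (use that in simp)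
  show ?thesis unfolding bilinear_def
  proof (intro conjI ballI hom_by_mult M.is_group N.is_group)
    fix a x y assume m: "a \<in> carrier M" "x \<in> carrier N" "y \<in> carrier N"
    have r: "frag_of (a, x \<otimes>\<^bsub>N\<^esub> y) - frag_of (a, x) - frag_of (a, y) \<in> bilin_rels M N \<union> R"
      using m unfolding Un_iff bilin_rels_iff by blast
    show "?p (a, x \<otimes>\<^bsub>N\<^esub> y) = ?p (a, x) \<otimes>\<^bsub>?P\<^esub> ?p (a, y)"
      using P.proj_rel[OF r] H.frag_hom_3[of ?p "(a, x \<otimes>\<^bsub>N\<^esub> y)" "(a, x)" "(a, y)"] m by (simp add: c)
  next
    fix a b x assume m: "a \<in> carrier M" "b \<in> carrier M" "x \<in> carrier N"
    have r: "frag_of (a \<otimes>\<^bsub>M\<^esub> b, x) - frag_of (a, x) - frag_of (b, x) \<in> bilin_rels M N \<union> R"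
      using m unfolding Un_iff bilin_rels_iff by blast
    show "?p (a \<otimes>\<^bsub>M\<^esub> b, x) = ?p (a, x) \<otimes>\<^bsub>?P\<^esub> ?p (b, x)"
      using P.proj_rel[OF r] H.frag_hom_3[of ?p "(a \<otimes>\<^bsub>M\<^esub> b, x)" "(a, x)" "(b, x)"] m by (simp add: c)
  qed (rule c; assumption)+
qed

lemma tensor_presentation: "presentation (carrier M \<times> carrier N) (bilin_rels M N)"
  using bilin_presentation[of "{}"] by simp

lemma tensor_comm_group: "comm_group (tensor M N)"
  unfolding tensor_def by (rule presentation.comm_group[OF tensor_presentation])

lemma pure_bilinear: "bilinear (tensor M N) (\<lambda>(a, x). pure M N a x)"
  using pgen_bilinear[of "{}"] by (simp add: pure_def tensor_def)

lemma pure_hom: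
  "a \<in> carrier M \<Longrightarrow> (\<lambda>x. pure M N a x) \<in> hom N (tensor M N)"
  "x \<in> carrier N \<Longrightarrow> (\<lambda>a. pure M N a x) \<in> hom M (tensor M N)"
  using pure_bilinear by (simp_all add: bilinear_def)

lemma pure_closed: "a \<in> carrier M \<Longrightarrow> x \<in> carrier N \<Longrightarrow> pure M N a x \<in> carrier (tensor M N)"
  by (rule hom_in_carrier[OF pure_hom(1)])

lemma tensor_lift:
  assumes "comm_group H" "bilinear H g"
  shows "lift H g \<in> hom (tensor M N) H"
    and "a \<in> carrier M \<Longrightarrow> x \<in> carrier N \<Longrightarrow> lift H g (pure M N a x) = g (a, x)"
proof -
  have g: "g \<in> carrier M \<times> carrier N \<rightarrow> carrier H" using bilinear_closed[OF assms(2)] by auto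
  note l = presentation.lift_hom[OF tensor_presentation assms(1) g bilinear_rels[OF assms]]
  show "lift H g \<in> hom (tensor M N) H" unfolding tensor_def by (rule l(1))
  show "a \<in> carrier M \<Longrightarrow> x \<in> carrier N \<Longrightarrow> lift H g (pure M N a x) = g (a, x)"
    unfolding pure_def by (rule l(2)) simp_all
qed

lemma tensor_hom_eqI:
  assumes "group H" "f \<in> hom (tensor M N) H" "g \<in> hom (tensor M N) H"
    and "\<And>a x. a \<in> carrier M \<Longrightarrow> x \<in> carrier N \<Longrightarrow> f (pure M N a x) = g (pure M N a x)"
    and "t \<in> carrier (tensor M N)"
  shows "f t = g t"
  by (rule presentation.hom_eqI[OF tensor_presentation assms(1) assms(2,3)[unfolded tensor_def] _ assms(5)[unfolded tensor_def]])
    (use assms(4) in \<open>auto simp: pure_def\<close>)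

end

lemma id_tensor:
  assumes "comm_group M" "comm_group N" "comm_group N'" "g \<in> hom N N'"
  shows "id_tensor M N' g \<in> hom (tensor M N) (tensor M N')"
    and "a \<in> carrier M \<Longrightarrow> x \<in> carrier N \<Longrightarrow> id_tensor M N' g (pure M N a x) = pure M N' a (g x)"
proof -
  interpret A: two_groups M N by (rule two_groups.intro; fact)
  interpret B: two_groups M N' by (rule two_groups.intro; fact)
  have "A.bilinear (tensor M N') (\<lambda>(a, x). pure M N' a (g x))"
    unfolding A.bilinear_def
  proof (intro conjI ballI)
    fix a assume "a \<in> carrier M"
    then show "(\<lambda>x. case (a, x) of (a, x) \<Rightarrow> pure M N' a (g x)) \<in> hom N (tensor M N')"
      using hom_compose[OF assms(4) B.pure_hom(1)] by (simp add: comp_def)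
  next
    fix x assume "x \<in> carrier N"
    then have "g x \<in> carrier N'" by (rule hom_in_carrier[OF assms(4)])
    then show "(\<lambda>a. case (a, x) of (a, x) \<Rightarrow> pure M N' a (g x)) \<in> hom M (tensor M N')"
      using B.pure_hom(2) by simp
  qed
  note l = A.tensor_lift[OF B.tensor_comm_group this]
  show "id_tensor M N' g \<in> hom (tensor M N) (tensor M N')" unfolding id_tensor_def by (rule l(1))
  show "a \<in> carrier M \<Longrightarrow> x \<in> carrier N \<Longrightarrow> id_tensor M N' g (pure M N a x) = pure M N' a (g x)"
    unfolding id_tensor_def by (simp add: l(2))
qed

subsection \<open>The exterior square\<close>

locale ext_square = M: comm_group M for M :: "('a, 'm) monoid_scheme"
begin

sublocale MM: two_groups M M ..

definition wedge :: "'a \<Rightarrow> 'a \<Rightarrow> ('a \<times> 'a \<Rightarrow>\<^sub>0 int) set" where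
  "wedge a b = pgen (carrier M \<times> carrier M) (bilin_rels M M \<union> {frag_of (a, a) | a. a \<in> carrier M}) (a, b)"

lemma alt_rels: "r \<in> {frag_of (a, a) | a. a \<in> carrier M} \<Longrightarrow> Poly_Mapping.keys r \<subseteq> carrier M \<times> carrier M"
  by (auto simp: keys_frag_of)

lemma ext_presentation:
  "presentation (carrier M \<times> carrier M) (bilin_rels M M \<union> {frag_of (a, a) | a. a \<in> carrier M})"
  by (rule MM.bilin_presentation) (rule alt_rels)

lemma ext2_comm_group: "comm_group (ext2 M)"
  unfolding ext2_def by (rule presentation.comm_group[OF ext_presentation])

lemma wedge_hom:
  "a \<in> carrier M \<Longrightarrow> (\<lambda>x. wedge a x) \<in> hom M (ext2 M)"
  "x \<in> carrier M \<Longrightarrow> (\<lambda>a. wedge a x) \<in> hom M (ext2 M)"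
  using MM.pgen_bilinear[of "{frag_of (a, a) | a. a \<in> carrier M}", OF alt_rels] by (simp_all add: MM.bilinear_def ext2_def wedge_def)

lemma wedge_closed: "a \<in> carrier M \<Longrightarrow> x \<in> carrier M \<Longrightarrow> wedge a x \<in> carrier (ext2 M)"
  by (rule hom_in_carrier[OF wedge_hom(1)])

lemma wedge_self: assumes "a \<in> carrier M" shows "wedge a a = \<one>\<^bsub>ext2 M\<^esub>"
proof -
  interpret E: comm_group "ext2 M" by (rule ext2_comm_group)
  let ?R = "bilin_rels M M \<union> {frag_of (a, a) | a. a \<in> carrier M}"
  have "frag_of (a, a) \<in> ?R" using assms by blast
  from presentation.proj_rel[OF ext_presentation this]
  have "frag_hom (ext2 M) (pgen (carrier M \<times> carrier M) ?R) (frag_of (a, a)) = \<one>\<^bsub>ext2 M\<^esub>"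
    by (simp only: ext2_def)
  then show ?thesis
    by (subst (asm) E.frag_hom_of) (use wedge_closed[OF assms assms] in \<open>simp_all add: wedge_def\<close>)
qed

text \<open>Polarisation: expand the wedge of a product with itself; the two diagonal terms
  vanish.\<close>

lemma wedge_swap: assumes "a \<in> carrier M" "b \<in> carrier M" shows "wedge b a = inv\<^bsub>ext2 M\<^esub> (wedge a b)"
proof -
  interpret E: comm_group "ext2 M" by (rule ext2_comm_group)
  note c = wedge_closed
  have "\<one>\<^bsub>ext2 M\<^esub> = wedge (a \<otimes>\<^bsub>M\<^esub> b) (a \<otimes>\<^bsub>M\<^esub> b)" using assms by (simp add: wedge_self)
  also have "\<dots> = wedge a (a \<otimes>\<^bsub>M\<^esub> b) \<otimes>\<^bsub>ext2 M\<^esub> wedge b (a \<otimes>\<^bsub>M\<^esub> b)"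
    using hom_mult[OF wedge_hom(2)] assms by simp
  also have "wedge a (a \<otimes>\<^bsub>M\<^esub> b) = wedge a b"
    using hom_mult[OF wedge_hom(1)] assms c by (simp add: wedge_self)
  also have "wedge b (a \<otimes>\<^bsub>M\<^esub> b) = wedge b a"
    using hom_mult[OF wedge_hom(1)] assms c by (simp add: wedge_self)
  finally have "wedge b a \<otimes>\<^bsub>ext2 M\<^esub> wedge a b = \<one>\<^bsub>ext2 M\<^esub>"
    using assms c by (simp add: E.m_comm)
  then show ?thesis using assms c E.inv_equality by metis
qed

lemma ext2_lift:
  assumes "comm_group H" "MM.bilinear H g" "\<And>a. a \<in> carrier M \<Longrightarrow> g (a, a) = \<one>\<^bsub>H\<^esub>"
  shows "lift H g \<in> hom (ext2 M) H"
    and "a \<in> carrier M \<Longrightarrow> x \<in> carrier M \<Longrightarrow> lift H g (wedge a x) = g (a, x)"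
proof -
  interpret H: comm_group H by fact
  have g: "g \<in> carrier M \<times> carrier M \<rightarrow> carrier H" using MM.bilinear_closed[OF assms(2)] by auto
  have r: "frag_hom H g r = \<one>\<^bsub>H\<^esub>" if "r \<in> bilin_rels M M \<union> {frag_of (a, a) | a. a \<in> carrier M}" for r
    using that
  proof
    show "r \<in> bilin_rels M M \<Longrightarrow> ?thesis" by (rule MM.bilinear_rels[OF assms(1,2)])
    assume "r \<in> {frag_of (a, a) | a. a \<in> carrier M}"
    then obtain a where "r = frag_of (a, a)" "a \<in> carrier M" by blast
    then show ?thesis by (simp add: H.frag_hom_of assms(3))
  qed
  note l = presentation.lift_hom[OF ext_presentation assms(1) g r]
  show "lift H g \<in> hom (ext2 M) H" unfolding ext2_def by (rule l(1))
  show "a \<in> carrier M \<Longrightarrow> x \<in> carrier M \<Longrightarrow> lift H g (wedge a x) = g (a, x)"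
    unfolding wedge_def by (rule l(2)) simp_all
qed

lemma generate_subset: "group G \<Longrightarrow> K \<subseteq> L \<Longrightarrow> subgroup L G \<Longrightarrow> generate G K \<subseteq> L"
  by (rule group.generate_subgroup_incl)

text \<open>The slots are freed one after the other: for a fixed entry in one slot, the wedge is a
  homomorphism in the other.\<close>

lemma ext2_generate:
  assumes "K \<subseteq> carrier M" "generate M K = carrier M"
  shows "generate (ext2 M) {wedge a b | a b. a \<in> K \<and> b \<in> K} = carrier (ext2 M)"
proof (rule equalityI)
  interpret E: comm_group "ext2 M" by (rule ext2_comm_group)
  let ?L = "generate (ext2 M) {wedge a b | a b. a \<in> K \<and> b \<in> K}"
  have sub: "{wedge a b | a b. a \<in> K \<and> b \<in> K} \<subseteq> carrier (ext2 M)"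
    using assms(1) wedge_closed by blast
  have L: "subgroup ?L (ext2 M)" by (rule E.generate_is_subgroup[OF sub])
  show "?L \<subseteq> carrier (ext2 M)" by (rule E.generate_incl[OF sub])
  have 1: "wedge a b \<in> ?L" if "a \<in> K" "b \<in> carrier M" for a b
  proof (rule hom_image_in_subgroup[OF M.is_group E.is_group wedge_hom(1) assms(1) L])
    show "a \<in> carrier M" using assms(1) that(1) by blast
    show "b \<in> generate M K" using that(2) assms(2) by simp
    show "wedge a x \<in> ?L" if "x \<in> K" for x using \<open>a \<in> K\<close> that by (blast intro: generate.incl)
  qed
  have 2: "wedge a b \<in> ?L" if "a \<in> carrier M" "b \<in> carrier M" for a b
  proof (rule hom_image_in_subgroup[OF M.is_group E.is_group wedge_hom(2) assms(1) L])
    show "b \<in> carrier M" by fact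
    show "a \<in> generate M K" using that(1) assms(2) by simp
    show "wedge x b \<in> ?L" if "x \<in> K" for x by (rule 1) fact+
  qed
  have "carrier (ext2 M) = generate (ext2 M) ((\<lambda>(a, b). wedge a b) ` (carrier M \<times> carrier M))"
    using presentation.pgen_generate[OF ext_presentation] by (simp add: ext2_def wedge_def case_prod_unfold)
  also have "\<dots> \<subseteq> ?L" by (rule E.generate_subgroup_incl[OF _ L]) (use 2 in auto)
  finally show "carrier (ext2 M) \<subseteq> ?L" .
qed

end

subsection \<open>Tensor and symmetric powers\<close>

definition multilinear ::
  "('a, 'm) monoid_scheme \<Rightarrow> nat \<Rightarrow> ('b, 'n) monoid_scheme \<Rightarrow> ('a list \<Rightarrow> 'b) \<Rightarrow> bool" where
  "multilinear M k H g \<longleftrightarrow> (\<forall>xs\<in>lists_of_length k (carrier M). g xs \<in> carrier H) \<and>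
     (\<forall>xs ys a b. set xs \<union> set ys \<subseteq> carrier M \<and> a \<in> carrier M \<and> b \<in> carrier M \<and>
        length xs + 1 + length ys = k \<longrightarrow>
        g (xs @ [a \<otimes>\<^bsub>M\<^esub> b] @ ys) = g (xs @ [a] @ ys) \<otimes>\<^bsub>H\<^esub> g (xs @ [b] @ ys))"

text \<open>With \<open>R\<close> empty this presents the tensor power, with \<open>R\<close> equal
  to \<open>sym_rels\<close> the symmetric power.\<close>

locale power_presentation = M: comm_group M for M :: "('a, 'm) monoid_scheme" +
  fixes k :: nat and R :: "('a list \<Rightarrow>\<^sub>0 int) set"
  assumes extra: "\<And>r. r \<in> R \<Longrightarrow> Poly_Mapping.keys r \<subseteq> lists_of_length k (carrier M)"
begin

abbreviation "S \<equiv> lists_of_length k (carrier M)"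
abbreviation "rl \<equiv> multilin_rels M k \<union> R"
abbreviation "P \<equiv> presented S rl"
abbreviation "pg \<equiv> pgen S rl"

lemma multilin_rels_iff:
  "r \<in> multilin_rels M k \<longleftrightarrow> (\<exists>xs ys a b.
     r = frag_of (xs @ [a \<otimes>\<^bsub>M\<^esub> b] @ ys) - frag_of (xs @ [a] @ ys) - frag_of (xs @ [b] @ ys) \<and>
     set xs \<union> set ys \<subseteq> carrier M \<and> a \<in> carrier M \<and> b \<in> carrier M \<and> length xs + 1 + length ys = k)"
  unfolding multilin_rels_def by blast

lemma in_S: "set xs \<union> set ys \<subseteq> carrier M \<Longrightarrow> a \<in> carrier M \<Longrightarrow> length xs + 1 + length ys = k \<Longrightarrow>
   xs @ [a] @ ys \<in> S"
  by (auto simp: lists_of_length_def)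

lemma pres: "presentation S rl"
proof
  fix r assume "r \<in> rl"
  then show "Poly_Mapping.keys r \<subseteq> S"
  proof
    assume "r \<in> multilin_rels M k"
    then obtain xs ys a b where r: "r = frag_of (xs @ [a \<otimes>\<^bsub>M\<^esub> b] @ ys) - frag_of (xs @ [a] @ ys) - frag_of (xs @ [b] @ ys)"
      and m: "set xs \<union> set ys \<subseteq> carrier M" "a \<in> carrier M" "b \<in> carrier M" "length xs + 1 + length ys = k"
      unfolding multilin_rels_iff by blast
    show ?thesis unfolding r
      by (rule order_trans[OF keys_frag_3])
        (simp only: insert_subset empty_subsetI in_S m M.m_closed simp_thms)
  qed (rule extra)
qed

lemma P_comm_group: "comm_group P" by (rule presentation.comm_group[OF pres])

lemma pg_multilinear: "multilinear M k P pg"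
proof -
  interpret H: comm_group P by (rule P_comm_group)
  show ?thesis unfolding multilinear_def
  proof (intro conjI ballI allI impI)
    show c: "pg xs \<in> carrier P" if "xs \<in> S" for xs by (rule presentation.pgen_closed[OF pres that])
    fix xs ys a b
    assume "set xs \<union> set ys \<subseteq> carrier M \<and> a \<in> carrier M \<and> b \<in> carrier M \<and> length xs + 1 + length ys = k"
    then have m: "set xs \<union> set ys \<subseteq> carrier M" "a \<in> carrier M" "b \<in> carrier M" "length xs + 1 + length ys = k"
      by blast+
    then have r: "frag_of (xs @ [a \<otimes>\<^bsub>M\<^esub> b] @ ys) - frag_of (xs @ [a] @ ys) - frag_of (xs @ [b] @ ys) \<in> rl"
      unfolding Un_iff multilin_rels_iff by blast
    show "pg (xs @ [a \<otimes>\<^bsub>M\<^esub> b] @ ys) = pg (xs @ [a] @ ys) \<otimes>\<^bsub>P\<^esub> pg (xs @ [b] @ ys)"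
      using presentation.proj_rel[OF pres r]
      by (subst (asm) H.frag_hom_3) (simp_all only: c in_S m M.m_closed)
  qed
qed

lemma P_lift:
  assumes "comm_group H" "multilinear M k H g" "\<And>r. r \<in> R \<Longrightarrow> frag_hom H g r = \<one>\<^bsub>H\<^esub>"
  shows "lift H g \<in> hom P H" and "xs \<in> S \<Longrightarrow> lift H g (pg xs) = g xs"
proof -
  interpret H: comm_group H by fact
  have c: "g xs \<in> carrier H" if "xs \<in> S" for xs using assms(2) that unfolding multilinear_def by blast
  then have g: "g \<in> S \<rightarrow> carrier H" by blast
  have r: "frag_hom H g r = \<one>\<^bsub>H\<^esub>" if "r \<in> rl" for r
    using that
  proof
    assume "r \<in> multilin_rels M k"
    then obtain xs ys a b where r: "r = frag_of (xs @ [a \<otimes>\<^bsub>M\<^esub> b] @ ys) - frag_of (xs @ [a] @ ys) - frag_of (xs @ [b] @ ys)"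
      and m: "set xs \<union> set ys \<subseteq> carrier M" "a \<in> carrier M" "b \<in> carrier M" "length xs + 1 + length ys = k"
      unfolding multilin_rels_iff by blast
    have "g (xs @ [a \<otimes>\<^bsub>M\<^esub> b] @ ys) = g (xs @ [a] @ ys) \<otimes>\<^bsub>H\<^esub> g (xs @ [b] @ ys)"
      using assms(2) m unfolding multilinear_def by blast
    then show ?thesis unfolding r
      by (subst H.frag_hom_3) (simp_all only: c in_S m M.m_closed H.m_closed)
  qed (rule assms(3))
  note l = presentation.lift_hom[OF pres assms(1) g r]
  show "lift H g \<in> hom P H" by (rule l(1))
  show "xs \<in> S \<Longrightarrow> lift H g (pg xs) = g xs" by (rule l(2))
qed

lemma P_hom_eqI:
  assumes "group H" "f \<in> hom P H" "g \<in> hom P H" "\<And>xs. xs \<in> S \<Longrightarrow> f (pg xs) = g (pg xs)" "t \<in> carrier P"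
  shows "f t = g t"
  by (rule presentation.hom_eqI[OF pres assms(1-3) _ assms(5)]) (rule assms(4))

text \<open>Replace the entries of a pure product by elements of \<open>K\<close> one after the other.\<close>

lemma P_generate:
  assumes K: "K \<subseteq> carrier M" "generate M K = carrier M"
  shows "generate P (pg ` lists_of_length k K) = carrier P"
proof (rule equalityI)
  interpret H: comm_group P by (rule P_comm_group)
  let ?L = "generate P (pg ` lists_of_length k K)"
  have c: "pg xs \<in> carrier P" if "xs \<in> S" for xs by (rule presentation.pgen_closed[OF pres that])
  have sub: "pg ` lists_of_length k K \<subseteq> carrier P"
    using K(1) by (intro image_subsetI c) (auto simp: lists_of_length_def)
  have L: "subgroup ?L P" by (rule H.generate_is_subgroup[OF sub])
  show "?L \<subseteq> carrier P" by (rule H.generate_incl[OF sub])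
  have *: "pg (xs @ ys) \<in> ?L" if "set xs \<subseteq> K" "set ys \<subseteq> carrier M" "length xs + length ys = k" for xs ys
    using that
  proof (induction ys arbitrary: xs)
    case Nil
    then show ?case by (intro generate.incl imageI) (simp add: lists_of_length_def)
  next
    case (Cons y ys)
    have m: "set xs \<union> set ys \<subseteq> carrier M" "length xs + 1 + length ys = k"
      using Cons.prems K(1) by auto
    have h: "(\<lambda>a. pg (xs @ [a] @ ys)) \<in> hom M P"
    proof (rule homI)
      show "pg (xs @ [a] @ ys) \<in> carrier P" if "a \<in> carrier M" for a
        by (rule c) (rule in_S[OF m(1) that m(2)])
      show "pg (xs @ [a \<otimes>\<^bsub>M\<^esub> b] @ ys) = pg (xs @ [a] @ ys) \<otimes>\<^bsub>P\<^esub> pg (xs @ [b] @ ys)"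
        if "a \<in> carrier M" "b \<in> carrier M" for a b
        using pg_multilinear that m unfolding multilinear_def by blast
    qed
    have "pg (xs @ [y] @ ys) \<in> ?L"
    proof (rule hom_image_in_subgroup[OF M.is_group H.is_group h K(1) L])
      show "y \<in> generate M K" using Cons.prems(2) K(2) by simp
      show "pg (xs @ [a] @ ys) \<in> ?L" if "a \<in> K" for a
        using Cons.IH[of "xs @ [a]"] Cons.prems that by simp
    qed
    then show ?case by simp
  qed
  have "carrier P = generate P (pg ` S)" by (rule presentation.pgen_generate[OF pres, symmetric])
  also have "\<dots> \<subseteq> ?L"
    by (rule H.generate_subgroup_incl[OF _ L]) (use *[of "[]"] in \<open>auto simp: lists_of_length_def\<close>)
  finally show "carrier P \<subseteq> ?L" .
qed

end

text \<open>\<open>tprod\<close> and \<open>sprod\<close> take the degree from the length of their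
  argument, whereas a presented power has a fixed degree. The two descriptions agree on lists of the
  right length, and multilinearity is transferred along this agreement.\<close>

lemma multilinear_cong:
  assumes "comm_group M" "multilinear M k H f"
    and e: "\<And>xs. xs \<in> lists_of_length k (carrier M) \<Longrightarrow> f xs = g xs"
  shows "multilinear M k H g"
proof -
  interpret M: comm_group M by fact
  have 1: "g (xs @ [a] @ ys) = f (xs @ [a] @ ys)"
    if "set xs \<union> set ys \<subseteq> carrier M" "a \<in> carrier M" "length xs + 1 + length ys = k" for xs ys a
    by (rule e[symmetric]) (use that in \<open>auto simp: lists_of_length_def\<close>)
  show ?thesis unfolding multilinear_def
  proof (intro conjI ballI allI impI)
    show "g xs \<in> carrier H" if "xs \<in> lists_of_length k (carrier M)" for xs
      using that assms(2) unfolding multilinear_def by (subst e[OF that, symmetric]) blast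
  next
    fix xs ys a b
    assume m: "set xs \<union> set ys \<subseteq> carrier M \<and> a \<in> carrier M \<and> b \<in> carrier M \<and> length xs + 1 + length ys = k"
    then have "f (xs @ [a \<otimes>\<^bsub>M\<^esub> b] @ ys) = f (xs @ [a] @ ys) \<otimes>\<^bsub>H\<^esub> f (xs @ [b] @ ys)"
      using assms(2) unfolding multilinear_def by blast
    then show "g (xs @ [a \<otimes>\<^bsub>M\<^esub> b] @ ys) = g (xs @ [a] @ ys) \<otimes>\<^bsub>H\<^esub> g (xs @ [b] @ ys)"
      using m by (simp only: 1 M.m_closed)
  qed
qed

context comm_group
begin

lemma tpow_presentation: "power_presentation G k {}"
  by unfold_locales auto

lemma spow_presentation: "power_presentation G k (sym_rels G k)"
proof unfold_locales
  fix r assume "r \<in> sym_rels G k"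
  then obtain xs ys where "r = frag_of xs - frag_of ys" "xs \<in> lists_of_length k (carrier G)" "ys \<in> lists_of_length k (carrier G)"
    unfolding sym_rels_def by blast
  then show "Poly_Mapping.keys r \<subseteq> lists_of_length k (carrier G)" using keys_frag_2[of xs ys] by blast
qed

lemma tpow_comm_group: "comm_group (tpow G k)"
  using power_presentation.P_comm_group[OF tpow_presentation] by (simp add: tpow_def)

lemma spow_comm_group: "comm_group (spow G k)"
  using power_presentation.P_comm_group[OF spow_presentation] by (simp add: spow_def)

lemma tprod_closed: "xs \<in> lists_of_length k (carrier G) \<Longrightarrow> tprod G xs \<in> carrier (tpow G k)"
  using presentation.pgen_closed[OF power_presentation.pres[OF tpow_presentation], of xs k]
  by (simp add: tpow_def tprod_def lists_of_length_def)

lemma sprod_closed: "xs \<in> lists_of_length k (carrier G) \<Longrightarrow> sprod G xs \<in> carrier (spow G k)"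
  using presentation.pgen_closed[OF power_presentation.pres[OF spow_presentation], of xs k]
  by (simp add: spow_def sprod_def lists_of_length_def)

lemma tprod_multilinear: "multilinear G k (tpow G k) (tprod G)"
proof (rule multilinear_cong[OF comm_group_axioms])
  show "multilinear G k (tpow G k) (pgen (lists_of_length k (carrier G)) (multilin_rels G k))"
    using power_presentation.pg_multilinear[OF tpow_presentation, of k] by (simp add: tpow_def)
qed (simp add: tprod_def lists_of_length_def)

lemma sprod_multilinear: "multilinear G k (spow G k) (sprod G)"
proof (rule multilinear_cong[OF comm_group_axioms])
  show "multilinear G k (spow G k) (pgen (lists_of_length k (carrier G)) (multilin_rels G k \<union> sym_rels G k))"
    using power_presentation.pg_multilinear[OF spow_presentation, of k] by (simp add: spow_def)
qed (simp add: sprod_def lists_of_length_def)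

lemma sprod_perm:
  assumes "mset xs = mset ys" "set xs \<subseteq> carrier G" shows "sprod G xs = sprod G ys"
proof -
  let ?k = "length xs"
  interpret H: comm_group "spow G ?k" by (rule spow_comm_group)
  have l: "length ys = ?k" using assms(1) by (metis size_mset)
  have s: "set ys = set xs" using assms(1) by (metis set_mset_mset)
  have xy: "xs \<in> lists_of_length ?k (carrier G)" "ys \<in> lists_of_length ?k (carrier G)"
    using assms(2) s l by (auto simp: lists_of_length_def)
  have r: "frag_of xs - frag_of ys \<in> multilin_rels G ?k \<union> sym_rels G ?k"
    using xy assms(1) unfolding sym_rels_def by blast
  have "frag_hom (spow G ?k) (pgen (lists_of_length ?k (carrier G)) (multilin_rels G ?k \<union> sym_rels G ?k)) (frag_of xs - frag_of ys) = \<one>\<^bsub>spow G ?k\<^esub>"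
    using presentation.proj_rel[OF power_presentation.pres[OF spow_presentation] r] by (simp add: spow_def)
  then have "pgen (lists_of_length ?k (carrier G)) (multilin_rels G ?k \<union> sym_rels G ?k) xs =
     pgen (lists_of_length ?k (carrier G)) (multilin_rels G ?k \<union> sym_rels G ?k) ys"
    using sprod_closed[OF xy(1)] sprod_closed[OF xy(2)]
    by (subst (asm) H.frag_hom_2(1)) (simp_all add: sprod_def l)
  then show ?thesis by (simp add: sprod_def l)
qed

lemma tpow_lift:
  assumes "comm_group H" "multilinear G k H g"
  shows "lift H g \<in> hom (tpow G k) H"
    and "xs \<in> lists_of_length k (carrier G) \<Longrightarrow> lift H g (tprod G xs) = g xs"
  using power_presentation.P_lift[OF tpow_presentation assms] by (auto simp: tpow_def tprod_def lists_of_length_def)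

lemma spow_lift:
  assumes "comm_group H" "multilinear G k H g"
    and "\<And>xs ys. xs \<in> lists_of_length k (carrier G) \<Longrightarrow> ys \<in> lists_of_length k (carrier G) \<Longrightarrow>
       mset xs = mset ys \<Longrightarrow> g xs = g ys"
  shows "lift H g \<in> hom (spow G k) H"
    and "xs \<in> lists_of_length k (carrier G) \<Longrightarrow> lift H g (sprod G xs) = g xs"
proof -
  interpret H: comm_group H by fact
  have r: "frag_hom H g r = \<one>\<^bsub>H\<^esub>" if "r \<in> sym_rels G k" for r
  proof -
    from that obtain xs ys where x: "xs \<in> lists_of_length k (carrier G)" "ys \<in> lists_of_length k (carrier G)"
       "mset xs = mset ys" and r: "r = frag_of xs - frag_of ys" unfolding sym_rels_def by blast
    have "g xs \<in> carrier H" "g ys \<in> carrier H" using assms(2) x unfolding multilinear_def by blast+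
    then show ?thesis unfolding r using assms(3)[OF x] by (simp add: H.frag_hom_2)
  qed
  show "lift H g \<in> hom (spow G k) H"
    "xs \<in> lists_of_length k (carrier G) \<Longrightarrow> lift H g (sprod G xs) = g xs"
    using power_presentation.P_lift[OF spow_presentation assms(1,2) r] by (auto simp: spow_def sprod_def lists_of_length_def)
qed

lemma tpow_hom_eqI:
  assumes "group H" "f \<in> hom (tpow G k) H" "g \<in> hom (tpow G k) H"
    "\<And>xs. xs \<in> lists_of_length k (carrier G) \<Longrightarrow> f (tprod G xs) = g (tprod G xs)" "t \<in> carrier (tpow G k)"
  shows "f t = g t"
  using power_presentation.P_hom_eqI[OF tpow_presentation, of H f k g t] assms
  by (simp add: tpow_def tprod_def lists_of_length_def)

lemma tpow_generate:
  assumes "K \<subseteq> carrier G" "generate G K = carrier G"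
  shows "generate (tpow G k) (tprod G ` lists_of_length k K) = carrier (tpow G k)"
proof -
  have e: "tprod G ` lists_of_length k K = pgen (lists_of_length k (carrier G)) (multilin_rels G k \<union> {}) ` lists_of_length k K"
    by (rule image_cong) (auto simp: tprod_def lists_of_length_def)
  show ?thesis using power_presentation.P_generate[OF tpow_presentation assms, of k] unfolding e tpow_def by simp
qed

lemma spow_generate:
  assumes "K \<subseteq> carrier G" "generate G K = carrier G"
  shows "generate (spow G k) (sprod G ` lists_of_length k K) = carrier (spow G k)"
proof -
  have e: "sprod G ` lists_of_length k K = pgen (lists_of_length k (carrier G)) (multilin_rels G k \<union> sym_rels G k) ` lists_of_length k K"
    by (rule image_cong) (auto simp: sprod_def lists_of_length_def)
  show ?thesis using power_presentation.P_generate[OF spow_presentation assms, of k] unfolding e spow_def .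
qed

end

subsection \<open>Duals of free abelian groups of finite rank\<close>

lemma integer_group_eq: "integer_group = add_grp"
  by (simp add: integer_group_def add_grp_def)

lemma (in comm_group) int_pow_hom_left:
  fixes m :: int shows "(\<lambda>x. x [^] m) \<in> hom G G"
  by (rule homI) (simp_all add: int_pow_mult_distrib m_comm)

lemma (in group) int_pow_hom_right: "x \<in> carrier G \<Longrightarrow> (\<lambda>m::int. x [^] m) \<in> hom add_grp G"
  by (rule homI) (simp_all add: int_pow_mult)

lemma hom_int_pow':
  assumes "group G" "group H" "h \<in> hom G H" "x \<in> carrier G"
  shows "h (x [^]\<^bsub>G\<^esub> (m::int)) = h x [^]\<^bsub>H\<^esub> m"
  using assms by (simp add: hom_int_pow)

context comm_group
begin

lemma carrier_dual: "f \<in> carrier (dual G) \<longleftrightarrow> f \<in> hom G add_grp \<and> f \<in> extensional (carrier G)"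
  by (simp add: dual_def integer_group_eq)

lemma dual_mult: "f \<otimes>\<^bsub>dual G\<^esub> g = (\<lambda>x\<in>carrier G. f x + g x)"
  and dual_one: "\<one>\<^bsub>dual G\<^esub> = (\<lambda>x\<in>carrier G. 0)"
  by (simp_all add: dual_def)

lemma restrict_dual: "f \<in> hom G add_grp \<Longrightarrow> restrict f (carrier G) \<in> carrier (dual G)"
  unfolding carrier_dual by (simp add: hom_def)

lemma dual_comm_group: "comm_group (dual G)"
proof (rule comm_groupI)
  fix f g assume f: "f \<in> carrier (dual G)" and g: "g \<in> carrier (dual G)"
  then have "(\<lambda>x. f x + g x) \<in> hom G add_grp"
    using hom_mult_pointwise[of "add_grp::int monoid" f G g] by (simp add: carrier_dual)
  then show "f \<otimes>\<^bsub>dual G\<^esub> g \<in> carrier (dual G)" unfolding dual_mult by (rule restrict_dual)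
  show "f \<otimes>\<^bsub>dual G\<^esub> g = g \<otimes>\<^bsub>dual G\<^esub> f" by (simp add: dual_mult add.commute)
next
  show "\<one>\<^bsub>dual G\<^esub> \<in> carrier (dual G)"
    unfolding dual_one by (rule restrict_dual) (simp add: hom_def)
next
  fix f g h :: "'a \<Rightarrow> int"
  show "f \<otimes>\<^bsub>dual G\<^esub> g \<otimes>\<^bsub>dual G\<^esub> h = f \<otimes>\<^bsub>dual G\<^esub> (g \<otimes>\<^bsub>dual G\<^esub> h)"
    by (auto simp: dual_mult fun_eq_iff)
next
  fix f assume f: "f \<in> carrier (dual G)"
  show "\<one>\<^bsub>dual G\<^esub> \<otimes>\<^bsub>dual G\<^esub> f = f"
    using f by (auto simp: dual_mult dual_one carrier_dual fun_eq_iff extensional_def)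
  have "(\<lambda>x. - f x) \<in> hom G add_grp"
    using f hom_inv_pointwise[of "add_grp::int monoid" f G] by (simp add: carrier_dual)
  then have "restrict (\<lambda>x. - f x) (carrier G) \<in> carrier (dual G)" by (rule restrict_dual)
  moreover have "restrict (\<lambda>x. - f x) (carrier G) \<otimes>\<^bsub>dual G\<^esub> f = \<one>\<^bsub>dual G\<^esub>"
    by (auto simp: dual_mult dual_one fun_eq_iff)
  ultimately show "\<exists>g\<in>carrier (dual G). g \<otimes>\<^bsub>dual G\<^esub> f = \<one>\<^bsub>dual G\<^esub>" by blast
qed

lemma dual_eval_hom: "x \<in> carrier G \<Longrightarrow> (\<lambda>f. f x) \<in> hom (dual G) add_grp"
  by (rule homI) (simp_all add: dual_mult)

end

text \<open>A free abelian group of finite rank, described by generators together with coordinate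
  homomorphisms dual to them. For the abelianised free group the coordinates will come from the
  leading coefficient map in degree one.\<close>

locale based_group = G: comm_group G for G :: "('a, 'm) monoid_scheme" +
  fixes n :: nat and e :: "nat \<Rightarrow> 'a" and \<xi> :: "nat \<Rightarrow> 'a \<Rightarrow> int"
  assumes e_closed: "i < n \<Longrightarrow> e i \<in> carrier G"
    and e_generate: "generate G (e ` {..<n}) = carrier G"
    and \<xi>_hom: "i < n \<Longrightarrow> \<xi> i \<in> hom G add_grp"
    and \<xi>_e: "i < n \<Longrightarrow> j < n \<Longrightarrow> \<xi> i (e j) = (if j = i then 1 else 0)"
begin

lemma e_subset: "e ` {..<n} \<subseteq> carrier G"
  using e_closed by blast

lemma hom_eqI:
  assumes "group H" "f \<in> hom G H" "g \<in> hom G H" "\<And>i. i < n \<Longrightarrow> f (e i) = g (e i)" "x \<in> carrier G"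
  shows "f x = g x"
  by (rule hom_eq_on_generate[OF G.is_group assms(1-3) e_subset]) (use assms(4,5) e_generate in auto)

definition d :: "nat \<Rightarrow> 'a \<Rightarrow> int" where
  "d i = restrict (\<xi> i) (carrier G)"

lemma d_closed: "i < n \<Longrightarrow> d i \<in> carrier (dual G)"
  unfolding d_def by (rule G.restrict_dual[OF \<xi>_hom])

lemma d_e: "i < n \<Longrightarrow> j < n \<Longrightarrow> d i (e j) = (if j = i then 1 else 0)"
  by (simp add: d_def e_closed \<xi>_e)

lemma dual_eqI:
  assumes "f \<in> carrier (dual G)" "g \<in> carrier (dual G)" "\<And>i. i < n \<Longrightarrow> f (e i) = g (e i)"
  shows "f = g"
proof (rule extensionalityI)
  show "f \<in> extensional (carrier G)" "g \<in> extensional (carrier G)"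
    using assms by (simp_all add: G.carrier_dual)
  show "f x = g x" if "x \<in> carrier G" for x
  proof (rule hom_eqI[OF group_add_grp _ _ _ that])
    show "f \<in> hom G add_grp" "g \<in> hom G add_grp" using assms by (simp_all add: G.carrier_dual)
  qed (rule assms(3))
qed

lemma d_unique:
  assumes "i < n"
  shows "(THE f. f \<in> carrier (dual G) \<and> (\<forall>j<n. f (e j) = (if j = i then 1 else 0))) = d i"
proof (rule the_equality)
  show "d i \<in> carrier (dual G) \<and> (\<forall>j<n. d i (e j) = (if j = i then 1 else 0))"
    using assms by (simp add: d_closed d_e)
  show "f = d i" if "f \<in> carrier (dual G) \<and> (\<forall>j<n. f (e j) = (if j = i then 1 else 0))" for f
    by (rule dual_eqI) (use that assms in \<open>simp_all add: d_closed d_e\<close>)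
qed

lemma dual_expand:
  assumes "f \<in> carrier (dual G)"
  shows "finprod (dual G) (\<lambda>i. d i [^]\<^bsub>dual G\<^esub> f (e i)) {..<n} = f"
proof (rule dual_eqI)
  interpret D: comm_group "dual G" by (rule G.dual_comm_group)
  have c: "(\<lambda>i. d i [^]\<^bsub>dual G\<^esub> f (e i)) \<in> {..<n} \<rightarrow> carrier (dual G)"
    using d_closed by simp
  show "finprod (dual G) (\<lambda>i. d i [^]\<^bsub>dual G\<^esub> f (e i)) {..<n} \<in> carrier (dual G)"
    by (rule D.finprod_closed[OF c])
  fix j assume j: "j < n"
  have "finprod (dual G) (\<lambda>i. d i [^]\<^bsub>dual G\<^esub> f (e i)) {..<n} (e j)
      = (\<Sum>i<n. (d i [^]\<^bsub>dual G\<^esub> f (e i)) (e j))"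
    using hom_finprod[OF G.dual_comm_group comm_group_add_grp G.dual_eval_hom[OF e_closed[OF j]] c] by simp
  also have "\<dots> = (\<Sum>i<n. if i = j then f (e j) else 0)"
  proof (rule sum.cong[OF refl])
    fix i assume i: "i \<in> {..<n}"
    have "(d i [^]\<^bsub>dual G\<^esub> f (e i)) (e j) = f (e i) * d i (e j)"
      using hom_int_pow'[OF D.is_group group_add_grp G.dual_eval_hom[OF e_closed[OF j]] d_closed, of i "f (e i)"] i
      by (simp add: int_pow_add_grp)
    then show "(d i [^]\<^bsub>dual G\<^esub> f (e i)) (e j) = (if i = j then f (e j) else 0)"
      using i j by (auto simp: d_e)
  qed
  also have "\<dots> = f (e j)" using j by simp
  finally show "finprod (dual G) (\<lambda>i. d i [^]\<^bsub>dual G\<^esub> f (e i)) {..<n} (e j) = f (e j)" .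
qed (rule assms)

text \<open>Evaluation of the dual factor at the j-th basis element. Together with
  \<open>tensor_expand\<close>, these maps identify the tensor product with \<open>n\<close>-tuples
  of elements of \<open>N\<close>, for every abelian group \<open>N\<close>; equality and
  surjectivity questions about tensors are settled coordinate by coordinate.\<close>

definition tcoord :: "('b, 'k) monoid_scheme \<Rightarrow> nat \<Rightarrow> (('a \<Rightarrow> int) \<times> 'b \<Rightarrow>\<^sub>0 int) set \<Rightarrow> 'b" where
  "tcoord N j = lift N (\<lambda>(f, x). x [^]\<^bsub>N\<^esub> f (e j))"

context
  fixes N :: "('b, 'k) monoid_scheme"
  assumes N: "comm_group N"
begin

interpretation N: comm_group N by (rule N)
interpretation D: comm_group "dual G" by (rule G.dual_comm_group)
interpretation DN: two_groups "dual G" N ..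
interpretation T: comm_group "tensor (dual G) N" by (rule DN.tensor_comm_group)

lemma tcoord:
  assumes "j < n"
  shows "tcoord N j \<in> hom (tensor (dual G) N) N"
    and "f \<in> carrier (dual G) \<Longrightarrow> x \<in> carrier N \<Longrightarrow> tcoord N j (pure (dual G) N f x) = x [^]\<^bsub>N\<^esub> f (e j)"
proof -
  have "DN.bilinear N (\<lambda>(f, x). x [^]\<^bsub>N\<^esub> f (e j))"
    unfolding DN.bilinear_def
  proof (intro conjI ballI)
    show "(\<lambda>x. case (f, x) of (f, x) \<Rightarrow> x [^]\<^bsub>N\<^esub> f (e j)) \<in> hom N N" for f :: "'a \<Rightarrow> int"
      unfolding prod.case by (rule N.int_pow_hom_left)
    show "(\<lambda>f. case (f, x) of (f, x) \<Rightarrow> x [^]\<^bsub>N\<^esub> f (e j)) \<in> hom (dual G) N" if "x \<in> carrier N" for x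
      using hom_compose[OF G.dual_eval_hom[OF e_closed[OF assms]] N.int_pow_hom_right[OF that]]
      by (simp add: comp_def)
  qed
  from DN.tensor_lift[OF N this]
  show "tcoord N j \<in> hom (tensor (dual G) N) N"
    "f \<in> carrier (dual G) \<Longrightarrow> x \<in> carrier N \<Longrightarrow> tcoord N j (pure (dual G) N f x) = x [^]\<^bsub>N\<^esub> f (e j)"
    by (simp_all add: tcoord_def)
qed

text \<open>On a pure tensor, expand the functional in the dual basis; its integer coefficients then
  move across the tensor sign to the second factor.\<close>

lemma tensor_expand:
  assumes "t \<in> carrier (tensor (dual G) N)"
  shows "finprod (tensor (dual G) N) (\<lambda>i. pure (dual G) N (d i) (tcoord N i t)) {..<n} = t"
proof (rule DN.tensor_hom_eqI[OF T.is_group _ _ _ assms])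
  show "(\<lambda>t. finprod (tensor (dual G) N) (\<lambda>i. pure (dual G) N (d i) (tcoord N i t)) {..<n})
      \<in> hom (tensor (dual G) N) (tensor (dual G) N)"
  proof (rule finprod_hom[OF T.comm_group_axioms T.is_group])
    fix i assume "i \<in> {..<n}"
    then show "(\<lambda>t. pure (dual G) N (d i) (tcoord N i t)) \<in> hom (tensor (dual G) N) (tensor (dual G) N)"
      using hom_compose[OF tcoord(1) DN.pure_hom(1)[OF d_closed]] by (simp add: comp_def)
  qed
  show "(\<lambda>t. t) \<in> hom (tensor (dual G) N) (tensor (dual G) N)" by (simp add: hom_def)
next
  fix f x assume f: "f \<in> carrier (dual G)" and x: "x \<in> carrier N"
  have dc: "(\<lambda>i. d i [^]\<^bsub>dual G\<^esub> f (e i)) \<in> {..<n} \<rightarrow> carrier (dual G)"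
    using d_closed by simp
  have 1: "pure (dual G) N (d i) (tcoord N i (pure (dual G) N f x)) = pure (dual G) N (d i [^]\<^bsub>dual G\<^esub> f (e i)) x"
    if "i < n" for i
    using that f x hom_int_pow'[OF N.is_group T.is_group DN.pure_hom(1)[OF d_closed[OF that]] x, of "f (e i)"]
      hom_int_pow'[OF D.is_group T.is_group DN.pure_hom(2)[OF x] d_closed[OF that], of "f (e i)"]
    by (simp add: tcoord)
  have "finprod (tensor (dual G) N) (\<lambda>i. pure (dual G) N (d i) (tcoord N i (pure (dual G) N f x))) {..<n}
     = finprod (tensor (dual G) N) (\<lambda>i. pure (dual G) N (d i [^]\<^bsub>dual G\<^esub> f (e i)) x) {..<n}"
    by (rule T.finprod_cong') (use x d_closed in \<open>auto simp: 1 intro!: DN.pure_closed\<close>)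
  also have "\<dots> = pure (dual G) N (finprod (dual G) (\<lambda>i. d i [^]\<^bsub>dual G\<^esub> f (e i)) {..<n}) x"
    by (rule hom_finprod[OF D.comm_group_axioms T.comm_group_axioms DN.pure_hom(2)[OF x] dc, symmetric])
  also have "\<dots> = pure (dual G) N f x" by (simp add: dual_expand[OF f])
  finally show "finprod (tensor (dual G) N) (\<lambda>i. pure (dual G) N (d i) (tcoord N i (pure (dual G) N f x))) {..<n}
     = pure (dual G) N f x" .
qed

lemma tcoord_sum:
  assumes "w \<in> {..<n} \<rightarrow> carrier N" "j < n"
  shows "tcoord N j (finprod (tensor (dual G) N) (\<lambda>i. pure (dual G) N (d i) (w i)) {..<n}) = w j"
proof -
  have c: "(\<lambda>i. pure (dual G) N (d i) (w i)) \<in> {..<n} \<rightarrow> carrier (tensor (dual G) N)"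
    using assms(1) d_closed by (auto intro!: DN.pure_closed)
  have "tcoord N j (finprod (tensor (dual G) N) (\<lambda>i. pure (dual G) N (d i) (w i)) {..<n})
     = finprod N (\<lambda>i. tcoord N j (pure (dual G) N (d i) (w i))) {..<n}"
    by (rule hom_finprod[OF T.comm_group_axioms N tcoord(1)[OF assms(2)] c])
  also have "\<dots> = finprod N (\<lambda>i. if j = i then w i else \<one>\<^bsub>N\<^esub>) {..<n}"
    by (rule N.finprod_cong') (use assms in \<open>auto simp: tcoord d_closed d_e Pi_iff\<close>)
  also have "\<dots> = w j" by (rule N.finprod_singleton) (use assms in auto)
  finally show ?thesis .
qed

end

end

section \<open>The lower central series of a metabelian group\<close>

context group
begin

lemma commutator_closed [simp]: "a \<in> carrier G \<Longrightarrow> b \<in> carrier G \<Longrightarrow> commutator G a b \<in> carrier G"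
  by (simp add: commutator_def)

lemma inv_commutator: "a \<in> carrier G \<Longrightarrow> b \<in> carrier G \<Longrightarrow> inv (commutator G a b) = commutator G b a"
  by (simp add: commutator_def inv_mult_group m_assoc)

lemma cancel_assoc:
  "a \<in> carrier G \<Longrightarrow> b \<in> carrier G \<Longrightarrow> a \<otimes> (inv a \<otimes> b) = b"
  "a \<in> carrier G \<Longrightarrow> b \<in> carrier G \<Longrightarrow> inv a \<otimes> (a \<otimes> b) = b"
  by (simp_all flip: m_assoc)

definition conjg :: "'a \<Rightarrow> 'a \<Rightarrow> 'a" where
  "conjg g c = g \<otimes> c \<otimes> inv g"

lemma conjg_closed [simp]: "g \<in> carrier G \<Longrightarrow> c \<in> carrier G \<Longrightarrow> conjg g c \<in> carrier G"
  by (simp add: conjg_def)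

lemma conjg_mult: "g \<in> carrier G \<Longrightarrow> c \<in> carrier G \<Longrightarrow> c' \<in> carrier G \<Longrightarrow>
    conjg g (c \<otimes> c') = conjg g c \<otimes> conjg g c'"
  by (simp add: conjg_def m_assoc cancel_assoc)

lemma conjg_inv: "g \<in> carrier G \<Longrightarrow> c \<in> carrier G \<Longrightarrow> conjg g (inv c) = inv (conjg g c)"
  by (simp add: conjg_def m_assoc inv_mult_group)

lemma conjg_conjg: "g \<in> carrier G \<Longrightarrow> h \<in> carrier G \<Longrightarrow> c \<in> carrier G \<Longrightarrow>
    conjg g (conjg h c) = conjg (g \<otimes> h) c"
  by (simp add: conjg_def m_assoc inv_mult_group)

lemma conjg_eq: "g \<in> carrier G \<Longrightarrow> c \<in> carrier G \<Longrightarrow> conjg g c = commutator G g c \<otimes> c"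
  by (simp add: conjg_def commutator_def m_assoc)

lemma commutator_eq_conjg: "g \<in> carrier G \<Longrightarrow> c \<in> carrier G \<Longrightarrow> commutator G c g = c \<otimes> inv (conjg g c)"
  by (simp add: conjg_def commutator_def m_assoc inv_mult_group)

lemma commutator_mult_left:
  "a \<in> carrier G \<Longrightarrow> b \<in> carrier G \<Longrightarrow> c \<in> carrier G \<Longrightarrow>
    commutator G (a \<otimes> b) c = conjg a (commutator G b c) \<otimes> commutator G a c"
  by (simp add: conjg_def commutator_def m_assoc inv_mult_group cancel_assoc)

lemma commutator_mult_right:
  "a \<in> carrier G \<Longrightarrow> b \<in> carrier G \<Longrightarrow> c \<in> carrier G \<Longrightarrow>
    commutator G a (b \<otimes> c) = commutator G a b \<otimes> conjg b (commutator G a c)"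
  by (simp add: conjg_def commutator_def m_assoc inv_mult_group cancel_assoc)

lemma lcs_1: "lcs G (Suc 0) = carrier G"
  by simp

lemma lcs_Suc: "k \<ge> 1 \<Longrightarrow> lcs G (Suc k) = generate G {commutator G a b | a b. a \<in> lcs G k \<and> b \<in> carrier G}"
  by simp

declare lcs.simps(2) [simp del]

text \<open>Conjugation maps a generating commutator to the commutator of the conjugated entries,
  and this is again a generating one because the preceding term is normal.\<close>

lemma lcs_normal: "lcs G k \<lhd> G"
proof (induction k)
  case 0 then show ?case by (simp add: normal_self)
next
  case (Suc k)
  show ?case
  proof (cases "k = 0")
    case True then show ?thesis by (simp add: normal_self lcs.simps(2))
  next
    case False
    have sub: "lcs G k \<subseteq> carrier G" by (rule subgroup.subset[OF normal_imp_subgroup[OF Suc]])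
    have "generate G {commutator G a b | a b. a \<in> lcs G k \<and> b \<in> carrier G} \<lhd> G"
    proof (rule normal_generateI)
      show "{commutator G a b | a b. a \<in> lcs G k \<and> b \<in> carrier G} \<subseteq> carrier G"
        using sub commutator_closed by blast
      fix h g assume "h \<in> {commutator G a b | a b. a \<in> lcs G k \<and> b \<in> carrier G}" and g: "g \<in> carrier G"
      then obtain a b where ab: "h = commutator G a b" "a \<in> lcs G k" "b \<in> carrier G" by blast
      have a: "a \<in> carrier G" using sub ab(2) by blast
      have "g \<otimes> a \<otimes> inv g \<in> lcs G k" using normal.inv_op_closed2[OF Suc] ab(2) g by simp
      moreover have "g \<otimes> h \<otimes> inv g = commutator G (g \<otimes> a \<otimes> inv g) (g \<otimes> b \<otimes> inv g)"
        unfolding ab(1) commutator_def using a ab(3) g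
        by (simp add: m_assoc inv_mult_group cancel_assoc)
      ultimately show "g \<otimes> h \<otimes> inv g \<in> {commutator G a b | a b. a \<in> lcs G k \<and> b \<in> carrier G}"
        using ab(3) g by blast
    qed
    then show ?thesis using False by (simp add: lcs.simps(2))
  qed
qed

lemmas lcs_subgroup = normal_imp_subgroup[OF lcs_normal]

lemma lcs_carrier: "x \<in> lcs G k \<Longrightarrow> x \<in> carrier G"
  by (rule subsetD[OF subgroup.subset[OF lcs_subgroup]])

lemma commutator_lcs:
  assumes "k \<ge> 1" "a \<in> lcs G k" "b \<in> carrier G"
  shows "commutator G a b \<in> lcs G (Suc k)" "commutator G b a \<in> lcs G (Suc k)"
proof -
  show 1: "commutator G a b \<in> lcs G (Suc k)"
    using assms by (subst lcs_Suc) (blast intro: generate.incl)+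
  show "commutator G b a \<in> lcs G (Suc k)"
    using subgroup.m_inv_closed[OF lcs_subgroup 1] assms by (simp add: inv_commutator lcs_carrier[OF assms(2)])
qed

lemma lcs_Suc_subset: "lcs G (Suc k) \<subseteq> lcs G k"
proof (cases "k = 0")
  case False
  have "commutator G a b \<in> lcs G k" if "a \<in> lcs G k" "b \<in> carrier G" for a b
  proof -
    have "b \<otimes> inv a \<otimes> inv b \<in> lcs G k"
      using normal.inv_op_closed2[OF lcs_normal that(2)] subgroup.m_inv_closed[OF lcs_subgroup that(1)] by simp
    then have "a \<otimes> (b \<otimes> inv a \<otimes> inv b) \<in> lcs G k" by (rule subgroup.m_closed[OF lcs_subgroup that(1)])
    then show ?thesis using that lcs_carrier[OF that(1)] by (simp add: commutator_def m_assoc)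
  qed
  then show ?thesis using False
    by (subst lcs_Suc) (simp, rule generate_subgroup_incl[OF _ lcs_subgroup], blast)
qed (simp add: lcs.simps(2))

lemma lcs_antimono: "k \<le> l \<Longrightarrow> lcs G l \<subseteq> lcs G k"
  by (rule lift_Suc_antimono_le[of "lcs G"]) (rule lcs_Suc_subset)

lemma lcs_ge_2_derived: "k \<ge> 2 \<Longrightarrow> lcs G k \<subseteq> derived G (carrier G)"
proof -
  assume "k \<ge> 2"
  then have "lcs G k \<subseteq> lcs G (Suc (Suc 0))" by (intro lcs_antimono) simp
  also have "\<dots> \<subseteq> derived G (carrier G)"
    unfolding derived_def by (subst lcs_Suc) (auto simp: commutator_def lcs.simps(2) intro!: mono_generate)
  finally show ?thesis .
qed

lemma derived_lcs: "derived G (carrier G) \<subseteq> lcs G (Suc (Suc 0))"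
  unfolding derived_def by (subst lcs_Suc) (auto simp: commutator_def lcs.simps(2) intro!: mono_generate)

end

section \<open>Graded quotients of a metabelian group and their bracket\<close>

locale metabelian_group = group G for G :: "'a monoid" (structure) +
  assumes derived_comm: "c \<in> derived G (carrier G) \<Longrightarrow> c' \<in> derived G (carrier G) \<Longrightarrow> c \<otimes> c' = c' \<otimes> c"
begin

lemma derived_carrier: "c \<in> derived G (carrier G) \<Longrightarrow> c \<in> carrier G"
  using derived_in_carrier[of "carrier G"] by blast

lemma commutator_derived: "a \<in> carrier G \<Longrightarrow> b \<in> carrier G \<Longrightarrow> commutator G a b \<in> derived G (carrier G)"
  unfolding derived_def commutator_def by (rule generate.incl) blast

lemma commutator_derived_one:
  "c \<in> derived G (carrier G) \<Longrightarrow> c' \<in> derived G (carrier G) \<Longrightarrow> commutator G c c' = \<one>"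
  using derived_comm[of c c'] derived_carrier[of c] derived_carrier[of c']
  by (simp add: commutator_def m_assoc cancel_assoc)

text \<open>If both indices are at least 2, the entries lie in the abelian derived subgroup and the
  commutator is trivial. If one index is 1, the claim is the definition of the series, up to
  inversion.\<close>

lemma commutator_lcs_lcs:
  assumes "i \<ge> 1" "j \<ge> 1" "a \<in> lcs G i" "b \<in> lcs G j"
  shows "commutator G a b \<in> lcs G (i + j)"
proof -
  consider "i = 1" | "j = 1" | "i \<ge> 2" "j \<ge> 2" using assms(1,2) by linarith
  then show ?thesis
  proof cases
    case 1 then show ?thesis using commutator_lcs(2)[OF assms(2,4)] assms(3) lcs_carrier[OF assms(4)] lcs_carrier[OF assms(3)] by simp
  next
    case 2 then show ?thesis using commutator_lcs(1)[OF assms(1,3)] assms(4) lcs_carrier[OF assms(4)] lcs_carrier[OF assms(3)] by simp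
  next
    case 3
    then have "commutator G a b = \<one>"
      using assms lcs_ge_2_derived by (intro commutator_derived_one) blast+
    then show ?thesis using subgroup.one_closed[OF lcs_subgroup] by simp
  qed
qed

lemma conjg_mod:
  assumes "c \<in> lcs G k" "g \<in> carrier G" "k \<ge> 1"
  shows "\<exists>m\<in>lcs G (Suc k). conjg g c = m \<otimes> c"
  using commutator_lcs(2)[OF assms(3,1,2)] conjg_eq[OF assms(2) lcs_carrier[OF assms(1)]] by blast

definition cl :: "nat \<Rightarrow> 'a \<Rightarrow> 'a set" where
  "cl k a = lcs G (Suc k) #> a"

lemma lcs_group: "group (G\<lparr>carrier := lcs G k\<rparr>)"
  by (rule subgroup.subgroup_is_group[OF lcs_subgroup is_group])

lemma lcs_normal_lcs: "lcs G (Suc k) \<lhd> (G\<lparr>carrier := lcs G k\<rparr>)"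
  using normal_restrict_supergroup[OF lcs_subgroup lcs_normal lcs_Suc_subset] .

lemma carrier_gr: "carrier (gr G k) = cl k ` lcs G k"
  by (simp add: gr_def carrier_FactGroup cl_def)

lemma cl_closed: "a \<in> lcs G k \<Longrightarrow> cl k a \<in> carrier (gr G k)"
  by (simp add: carrier_gr)

lemma one_gr: "\<one>\<^bsub>gr G k\<^esub> = lcs G (Suc k)"
  by (simp add: gr_def)

lemma gr_group: "group (gr G k)"
  using normal.factorgroup_is_group[OF lcs_normal_lcs] by (simp add: gr_def)

lemma cl_hom: "cl k \<in> hom (G\<lparr>carrier := lcs G k\<rparr>) (gr G k)"
  using normal.r_coset_hom_Mod[OF lcs_normal_lcs, of k] unfolding gr_def cl_def by simp

lemma cl_mult: "a \<in> lcs G k \<Longrightarrow> b \<in> lcs G k \<Longrightarrow> cl k (a \<otimes> b) = cl k a \<otimes>\<^bsub>gr G k\<^esub> cl k b"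
  using hom_mult[OF cl_hom] by simp

lemma cl_one: "cl k \<one> = \<one>\<^bsub>gr G k\<^esub>"
  unfolding one_gr cl_def by (rule coset_join2[OF one_closed lcs_subgroup subgroup.one_closed[OF lcs_subgroup]])

lemma cl_eq_one: "m \<in> lcs G (Suc k) \<Longrightarrow> cl k m = \<one>\<^bsub>gr G k\<^esub>"
  unfolding one_gr cl_def by (rule coset_join2[OF lcs_carrier lcs_subgroup])

lemma cl_absorb: "m \<in> lcs G (Suc k) \<Longrightarrow> a \<in> lcs G k \<Longrightarrow> cl k (m \<otimes> a) = cl k a"
proof -
  assume m: "m \<in> lcs G (Suc k)" and a: "a \<in> lcs G k"
  interpret gr: group "gr G k" by (rule gr_group)
  have "m \<in> lcs G k" using m lcs_Suc_subset by blast
  then show ?thesis using cl_mult[OF _ a] cl_eq_one[OF m] cl_closed[OF a] by simp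
qed

lemma gr_comm_group: assumes "k \<ge> 1" shows "comm_group (gr G k)"
proof (rule group.group_comm_groupI[OF gr_group])
  fix X Y assume "X \<in> carrier (gr G k)" "Y \<in> carrier (gr G k)"
  then obtain a b where ab: "X = cl k a" "Y = cl k b" "a \<in> lcs G k" "b \<in> lcs G k" by (auto simp: carrier_gr)
  have c: "a \<in> carrier G" "b \<in> carrier G" using ab lcs_carrier by blast+
  have "a \<otimes> b = commutator G a b \<otimes> (b \<otimes> a)"
    using c by (simp add: commutator_def m_assoc cancel_assoc)
  then show "X \<otimes>\<^bsub>gr G k\<^esub> Y = Y \<otimes>\<^bsub>gr G k\<^esub> X"
    using cl_absorb[OF commutator_lcs(1)[OF assms ab(3) c(2)] subgroup.m_closed[OF lcs_subgroup ab(4,3)]]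
    unfolding ab(1,2) by (simp add: cl_mult[symmetric] ab)
qed

text \<open>Expanding \<open>commutator G (m \<otimes> a) (m' \<otimes> b)\<close> yields the
  original commutator, conjugated, times commutators that contain \<open>m\<close> or
  \<open>m'\<close>. The latter lie one step deeper, and conjugation does not change a class by
  \<open>conjg_mod\<close>.\<close>

lemma gr_bracket_cl:
  assumes "k \<ge> 1" "l \<ge> 1" "a \<in> lcs G k" "b \<in> lcs G l"
  shows "gr_bracket G k l (cl k a) (cl l b) = cl (k + l) (commutator G a b)"
proof -
  have c: "a \<in> carrier G" "b \<in> carrier G" using assms lcs_carrier by blast+
  have "cl (k + l) (commutator G (m \<otimes> a) (m' \<otimes> b)) = cl (k + l) (commutator G a b)"
    if m: "m \<in> lcs G (Suc k)" and m': "m' \<in> lcs G (Suc l)" for m m'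
  proof -
    have cm: "m \<in> carrier G" "m' \<in> carrier G" using m m' lcs_carrier by blast+
    have mk: "m \<in> lcs G k" using m lcs_Suc_subset by blast
    have b': "m' \<otimes> b \<in> lcs G l"
      using m' assms(4) lcs_Suc_subset by (blast intro: subgroup.m_closed[OF lcs_subgroup])
    have 1: "commutator G m (m' \<otimes> b) \<in> lcs G (Suc (k + l))"
      using commutator_lcs_lcs[OF _ assms(2) m b'] by simp
    have 2: "commutator G a (m' \<otimes> b) \<in> lcs G (k + l)" by (rule commutator_lcs_lcs[OF assms(1,2,3) b'])
    have 3: "commutator G a m' \<in> lcs G (Suc (k + l))"
      using commutator_lcs_lcs[OF assms(1) _ assms(3) m'] by simp
    have 4: "commutator G a b \<in> lcs G (k + l)" by (rule commutator_lcs_lcs[OF assms])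
    obtain p where p: "p \<in> lcs G (Suc (k + l))" "conjg m (commutator G a (m' \<otimes> b)) = p \<otimes> commutator G a (m' \<otimes> b)"
      using conjg_mod[OF 2 cm(1)] assms(1) by auto
    obtain q where q: "q \<in> lcs G (Suc (k + l))" "conjg m' (commutator G a b) = q \<otimes> commutator G a b"
      using conjg_mod[OF 4 cm(2)] assms(1) by auto
    interpret gr: comm_group "gr G (k + l)" by (rule gr_comm_group) (use assms in simp)
    note s = lcs_Suc_subset[THEN subsetD]
    have "cl (k + l) (commutator G (m \<otimes> a) (m' \<otimes> b)) = cl (k + l) (commutator G a (m' \<otimes> b))"
      using c cm p 1 2 s[OF p(1)] s[OF 1] subgroup.m_closed[OF lcs_subgroup s[OF p(1)] 2]
      by (simp add: commutator_mult_left cl_mult cl_eq_one cl_closed)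
    also have "\<dots> = cl (k + l) (commutator G a b)"
      using c cm q 3 4 s[OF q(1)] s[OF 3] subgroup.m_closed[OF lcs_subgroup s[OF q(1)] 4]
      by (simp add: commutator_mult_right cl_mult cl_eq_one cl_closed)
    finally show ?thesis .
  qed
  note 0 = this
  have *: "cl (k + l) (commutator G x y) = cl (k + l) (commutator G a b)"
    if x: "x \<in> cl k a" and y: "y \<in> cl l b" for x y
  proof -
    obtain m m' where "m \<in> lcs G (Suc k)" "x = m \<otimes> a" "m' \<in> lcs G (Suc l)" "y = m' \<otimes> b"
      using x y unfolding cl_def r_coset_def by blast
    then show ?thesis by (simp only: 0)
  qed
  have ab: "a \<in> cl k a" "b \<in> cl l b"
    unfolding cl_def using c by (simp_all add: rcos_self lcs_subgroup)
  have "(\<lambda>(x, y). cl (k + l) (commutator G x y)) ` (cl k a \<times> cl l b) = {cl (k + l) (commutator G a b)}"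
  proof (rule equalityI)
    show "(\<lambda>(x, y). cl (k + l) (commutator G x y)) ` (cl k a \<times> cl l b) \<subseteq> {cl (k + l) (commutator G a b)}"
      by (rule image_subsetI) (use * in \<open>simp add: split_beta mem_Times_iff\<close>)
    show "{cl (k + l) (commutator G a b)} \<subseteq> (\<lambda>(x, y). cl (k + l) (commutator G x y)) ` (cl k a \<times> cl l b)"
      using imageI[of "(a, b)" "cl k a \<times> cl l b" "\<lambda>(x, y). cl (k + l) (commutator G x y)"] ab by simp
  qed
  then have "(\<lambda>(x, y). lcs G (k + l + 1) #> commutator G x y) ` (cl k a \<times> cl l b) = {cl (k + l) (commutator G a b)}"
    by (simp add: cl_def)
  then show ?thesis by (simp add: gr_bracket_def)
qed

lemma cl_bracket_hom:
  assumes "k \<ge> 1" "l \<ge> 1"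
  shows "X \<in> carrier (gr G k) \<Longrightarrow> (\<lambda>Y. gr_bracket G k l X Y) \<in> hom (gr G l) (gr G (k + l))"
    and "Y \<in> carrier (gr G l) \<Longrightarrow> (\<lambda>X. gr_bracket G k l X Y) \<in> hom (gr G k) (gr G (k + l))"
proof -
  have kl: "k + l \<ge> 1" using assms by simp
  interpret gr: comm_group "gr G (k + l)" by (rule gr_comm_group[OF kl])
  note s = lcs_Suc_subset[THEN subsetD]
  have cj: "cl (k + l) (conjg g c) = cl (k + l) c" if g: "g \<in> carrier G" and c: "c \<in> lcs G (k + l)" for g c
  proof -
    obtain m where "m \<in> lcs G (Suc (k + l))" "conjg g c = m \<otimes> c" using conjg_mod[OF c g kl] by blast
    then show ?thesis using cl_absorb[OF _ c] by simp
  qed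
  have cjl: "conjg g c \<in> lcs G (k + l)" if "g \<in> carrier G" and c: "c \<in> lcs G (k + l)" for g c
    unfolding conjg_def by (rule normal.inv_op_closed2[OF lcs_normal that])
  note cc = commutator_lcs_lcs[OF assms]
  show "(\<lambda>Y. gr_bracket G k l X Y) \<in> hom (gr G l) (gr G (k + l))" if X: "X \<in> carrier (gr G k)"
  proof -
    obtain a where a: "a \<in> lcs G k" "X = cl k a" using X by (auto simp: carrier_gr)
    show ?thesis
    proof (rule homI)
      fix Y assume "Y \<in> carrier (gr G l)"
      then obtain b where b: "b \<in> lcs G l" "Y = cl l b" by (auto simp: carrier_gr)
      show "gr_bracket G k l X Y \<in> carrier (gr G (k + l))"
        using a b by (simp add: gr_bracket_cl[OF assms] cl_closed cc)
    next
      fix Y Z assume "Y \<in> carrier (gr G l)" "Z \<in> carrier (gr G l)"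
      then obtain b c where b: "b \<in> lcs G l" "Y = cl l b" and c: "c \<in> lcs G l" "Z = cl l c" by (auto simp: carrier_gr)
      have "gr_bracket G k l X (Y \<otimes>\<^bsub>gr G l\<^esub> Z) = cl (k + l) (commutator G a (b \<otimes> c))"
        using a b c gr_bracket_cl[OF assms a(1) subgroup.m_closed[OF lcs_subgroup b(1) c(1)]] by (simp add: cl_mult)
      also have "\<dots> = cl (k + l) (commutator G a b) \<otimes>\<^bsub>gr G (k + l)\<^esub> cl (k + l) (commutator G a c)"
        using a b c lcs_carrier[OF a(1)] lcs_carrier[OF b(1)] lcs_carrier[OF c(1)]
        by (simp add: commutator_mult_right cl_mult cc cjl cj)
      finally show "gr_bracket G k l X (Y \<otimes>\<^bsub>gr G l\<^esub> Z) = gr_bracket G k l X Y \<otimes>\<^bsub>gr G (k + l)\<^esub> gr_bracket G k l X Z"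
        using a b c by (simp add: gr_bracket_cl[OF assms])
    qed
  qed
  show "(\<lambda>X. gr_bracket G k l X Y) \<in> hom (gr G k) (gr G (k + l))" if Y: "Y \<in> carrier (gr G l)"
  proof -
    obtain a where a: "a \<in> lcs G l" "Y = cl l a" using Y by (auto simp: carrier_gr)
    show ?thesis
    proof (rule homI)
      fix Y' assume "Y' \<in> carrier (gr G k)"
      then obtain b where b: "b \<in> lcs G k" "Y' = cl k b" by (auto simp: carrier_gr)
      show "gr_bracket G k l Y' Y \<in> carrier (gr G (k + l))"
        using a b by (simp add: gr_bracket_cl[OF assms] cl_closed cc)
    next
      fix X Z assume "X \<in> carrier (gr G k)" "Z \<in> carrier (gr G k)"
      then obtain b c where b: "b \<in> lcs G k" "X = cl k b" and c: "c \<in> lcs G k" "Z = cl k c" by (auto simp: carrier_gr)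
      have "gr_bracket G k l (X \<otimes>\<^bsub>gr G k\<^esub> Z) Y = cl (k + l) (commutator G (b \<otimes> c) a)"
        using a b c gr_bracket_cl[OF assms subgroup.m_closed[OF lcs_subgroup b(1) c(1)] a(1)] by (simp add: cl_mult)
      also have "\<dots> = cl (k + l) (commutator G c a) \<otimes>\<^bsub>gr G (k + l)\<^esub> cl (k + l) (commutator G b a)"
        using a b c lcs_carrier[OF a(1)] lcs_carrier[OF b(1)] lcs_carrier[OF c(1)]
        by (simp add: commutator_mult_left cl_mult cc cjl cj)
      also have "\<dots> = cl (k + l) (commutator G b a) \<otimes>\<^bsub>gr G (k + l)\<^esub> cl (k + l) (commutator G c a)"
        by (rule gr.m_comm) (use a b c in \<open>simp_all add: cl_closed cc\<close>)
      finally show "gr_bracket G k l (X \<otimes>\<^bsub>gr G k\<^esub> Z) Y = gr_bracket G k l X Y \<otimes>\<^bsub>gr G (k + l)\<^esub> gr_bracket G k l Z Y"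
        using a b c by (simp add: gr_bracket_cl[OF assms])
    qed
  qed
qed

subsection \<open>Identities in metabelian groups\<close>

lemma conjg_derived: "g \<in> carrier G \<Longrightarrow> c \<in> derived G (carrier G) \<Longrightarrow> conjg g c \<in> derived G (carrier G)"
  unfolding conjg_def by (rule normal.inv_op_closed2[OF derived_is_normal]) (auto simp: normal_self)

lemma derived_subgroup: "subgroup (derived G (carrier G)) G"
  by (rule derived_is_subgroup) simp

text \<open>The derived subgroup as a record of its own, so that identities between commutators
  become calculations in an abelian group on which the whole group acts by conjugation.\<close>

definition DG :: "'a monoid" where "DG = G\<lparr>carrier := derived G (carrier G)\<rparr>"

lemma DG_comm_group: "comm_group DG"
  unfolding DG_def
  by (rule group.group_comm_groupI[OF subgroup.subgroup_is_group[OF derived_subgroup is_group]])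
    (simp add: derived_comm)

lemma DG_simps: "carrier DG = derived G (carrier G)" "x \<otimes>\<^bsub>DG\<^esub> y = x \<otimes> y" "\<one>\<^bsub>DG\<^esub> = \<one>"
  "x \<in> derived G (carrier G) \<Longrightarrow> inv\<^bsub>DG\<^esub> x = inv x"
  by (simp_all add: DG_def m_inv_consistent[OF derived_subgroup])

lemma conjg_derived_id: "c \<in> derived G (carrier G) \<Longrightarrow> c' \<in> derived G (carrier G) \<Longrightarrow> conjg c c' = c'"
  using derived_comm[of c c'] derived_carrier[of c] derived_carrier[of c'] by (simp add: conjg_def m_assoc)

text \<open>The products in the two orders differ by a commutator, which acts trivially on the
  abelian derived subgroup. The conjugation action thus factors through the abelianised
  group.\<close>

lemma conjg_commute:
  assumes "g \<in> carrier G" "h \<in> carrier G" "c \<in> derived G (carrier G)"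
  shows "conjg g (conjg h c) = conjg h (conjg g c)"
proof -
  have "g \<otimes> h = (h \<otimes> g) \<otimes> commutator G (inv g) (inv h)"
    using assms by (simp add: commutator_def m_assoc cancel_assoc)
  then have "conjg (g \<otimes> h) c = conjg (h \<otimes> g) (conjg (commutator G (inv g) (inv h)) c)"
    using assms by (simp add: conjg_conjg derived_carrier)
  then show ?thesis using assms by (simp add: conjg_conjg derived_carrier conjg_derived_id commutator_derived)
qed

text \<open>In additive notation, with \<open>x\<close> and \<open>y\<close> acting by conjugation,
  both sides are \<open>(1 - x) (1 - y) c\<close>. This is what makes the order of the outer entries
  of a left-normed commutator irrelevant.\<close>

lemma commutator_swap:
  assumes "x \<in> carrier G" "y \<in> carrier G" "c \<in> derived G (carrier G)"
  shows "commutator G (commutator G c x) y = commutator G (commutator G c y) x"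
proof -
  interpret D: comm_group DG by (rule DG_comm_group)
  let ?X = "conjg x c" let ?Y = "conjg y c" let ?Z = "conjg x (conjg y c)"
  have cl: "c \<in> carrier DG" "?X \<in> carrier DG" "?Y \<in> carrier DG" "?Z \<in> carrier DG"
    using assms by (simp_all add: DG_simps conjg_derived)
  note cc = cl[unfolded DG_simps]
  have "commutator G (commutator G c x) y = (c \<otimes> inv ?X) \<otimes> inv (?Y \<otimes> inv ?Z)"
    using assms conjg_commute[OF assms] by (simp add: commutator_eq_conjg derived_carrier conjg_mult conjg_inv)
  also have "\<dots> = (c \<otimes>\<^bsub>DG\<^esub> inv\<^bsub>DG\<^esub> ?X) \<otimes>\<^bsub>DG\<^esub> inv\<^bsub>DG\<^esub> (?Y \<otimes>\<^bsub>DG\<^esub> inv\<^bsub>DG\<^esub> ?Z)"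
    using cc by (simp add: DG_simps subgroup.m_closed[OF derived_subgroup] subgroup.m_inv_closed[OF derived_subgroup])
  also have "\<dots> = (c \<otimes>\<^bsub>DG\<^esub> inv\<^bsub>DG\<^esub> ?Y) \<otimes>\<^bsub>DG\<^esub> inv\<^bsub>DG\<^esub> (?X \<otimes>\<^bsub>DG\<^esub> inv\<^bsub>DG\<^esub> ?Z)"
    using cl by (simp add: D.inv_mult D.m_ac)
  also have "\<dots> = (c \<otimes> inv ?Y) \<otimes> inv (?X \<otimes> inv ?Z)"
    using cc by (simp add: DG_simps subgroup.m_closed[OF derived_subgroup] subgroup.m_inv_closed[OF derived_subgroup])
  also have "\<dots> = commutator G (commutator G c y) x"
    using assms by (simp add: commutator_eq_conjg derived_carrier conjg_mult conjg_inv)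
  finally show ?thesis .
qed

text \<open>The Hall--Witt identity; it compares the two expansions of \<open>[a b, c]\<close> and \<open>[[a, b] b a, c]\<close>.\<close>

lemma commutator_jacobi:
  assumes "a \<in> carrier G" "b \<in> carrier G" "c \<in> carrier G"
  shows "commutator G (commutator G a b) c \<otimes> commutator G (commutator G b c) a \<otimes> commutator G (commutator G c a) b = \<one>"
proof -
  interpret D: comm_group DG by (rule DG_comm_group)
  let ?ab = "commutator G a b" and ?bc = "commutator G b c" and ?ac = "commutator G a c"
  note cd = commutator_derived
  have e: "conjg a ?bc \<otimes> ?ac = commutator G ?ab c \<otimes> (conjg b ?ac \<otimes> ?bc)"
  proof -
    have "a \<otimes> b = ?ab \<otimes> (b \<otimes> a)" using assms by (simp add: commutator_def m_assoc cancel_assoc)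
    then have "commutator G (a \<otimes> b) c = conjg ?ab (commutator G (b \<otimes> a) c) \<otimes> commutator G ?ab c"
      using assms by (simp add: commutator_mult_left)
    also have "\<dots> = commutator G (b \<otimes> a) c \<otimes> commutator G ?ab c"
      using assms by (simp add: conjg_derived_id cd)
    also have "\<dots> = commutator G ?ab c \<otimes> commutator G (b \<otimes> a) c"
      using assms by (intro derived_comm cd) simp_all
    finally show ?thesis using assms by (simp add: commutator_mult_left)
  qed
  let ?P = "conjg a ?bc" and ?Q = "conjg b ?ac" and ?J = "commutator G ?ab c"
  have dcl: "?P \<in> carrier DG" "?Q \<in> carrier DG" "?J \<in> carrier DG" "?bc \<in> carrier DG" "?ac \<in> carrier DG"
    using assms by (simp_all add: DG_simps conjg_derived cd)
  note dc = dcl[unfolded DG_simps]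
  note cls = subgroup.m_closed[OF derived_subgroup] subgroup.m_inv_closed[OF derived_subgroup]
  have 1: "commutator G ?bc a = ?bc \<otimes> inv ?P" using assms by (simp add: commutator_eq_conjg)
  have "commutator G c a = inv ?ac" using assms by (simp add: inv_commutator)
  then have 2: "commutator G (commutator G c a) b = inv ?ac \<otimes> ?Q"
    using assms by (simp add: commutator_eq_conjg conjg_inv)
  have e': "?P \<otimes>\<^bsub>DG\<^esub> ?ac = ?J \<otimes>\<^bsub>DG\<^esub> (?Q \<otimes>\<^bsub>DG\<^esub> ?bc)" using e by (simp add: DG_simps)
  have "?J \<otimes> (?bc \<otimes> inv ?P) \<otimes> (inv ?ac \<otimes> ?Q)
     = (?J \<otimes>\<^bsub>DG\<^esub> (?bc \<otimes>\<^bsub>DG\<^esub> inv\<^bsub>DG\<^esub> ?P)) \<otimes>\<^bsub>DG\<^esub> (inv\<^bsub>DG\<^esub> ?ac \<otimes>\<^bsub>DG\<^esub> ?Q)"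
    using dc by (simp add: DG_simps cls)
  also have "\<dots> = (?J \<otimes>\<^bsub>DG\<^esub> (?Q \<otimes>\<^bsub>DG\<^esub> ?bc)) \<otimes>\<^bsub>DG\<^esub> inv\<^bsub>DG\<^esub> (?P \<otimes>\<^bsub>DG\<^esub> ?ac)"
    using dcl by (simp add: D.inv_mult D.m_ac)
  also have "\<dots> = \<one>" unfolding e' DG_simps(3)[symmetric] by (intro D.r_inv D.m_closed dcl)
  finally show ?thesis unfolding 1 2 by simp
qed

end

section \<open>Free groups and free metabelian groups\<close>

definition reduced :: "word \<Rightarrow> bool" where
  "reduced w \<longleftrightarrow> successively (\<lambda>a b. \<not> (fst a = fst b \<and> snd a \<noteq> snd b)) w"

lemma reduced_simps [simp]:
  "reduced []" "reduced [a]"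
  "reduced (a # b # w) \<longleftrightarrow> \<not> (fst a = fst b \<and> snd a \<noteq> snd b) \<and> reduced (b # w)"
  by (simp_all add: reduced_def)

lemma reduced_tl: "reduced (a # w) \<Longrightarrow> reduced w"
  by (cases w) simp_all

lemma reduced_cancel_cons: "reduced w \<Longrightarrow> reduced (cancel_cons a w)"
  by (cases w) (auto intro: reduced_tl)

lemma cancel_cons_reduced: "reduced (a # w) \<Longrightarrow> cancel_cons a w = a # w"
  by (cases w) auto

text \<open>A letter and its inverse act as mutually inverse operations on reduced words. This is
  van der Waerden's argument: the group law comes from letters acting on reduced words by
  permutations.\<close>

lemma cancel_cons_cancel:
  assumes "reduced w" "fst a = fst b" "snd a \<noteq> snd b"
  shows "cancel_cons a (cancel_cons b w) = w"
proof (cases w)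
  case Nil then show ?thesis using assms by simp
next
  case (Cons c w')
  show ?thesis
  proof (cases "fst b = fst c \<and> snd b \<noteq> snd c")
    case True
    then have "c = a" using assms by (auto simp: prod_eq_iff)
    then show ?thesis using assms(1) True Cons by (simp add: cancel_cons_reduced)
  next
    case False then show ?thesis using Cons assms by auto
  qed
qed

lemma reduced_foldr: "reduced w \<Longrightarrow> reduced (foldr cancel_cons u w)"
  by (induction u) (simp_all add: reduced_cancel_cons)

text \<open>The case of interest is a cancellation between \<open>a\<close> and the head of
  \<open>v\<close>; on the right-hand side the same two letters then act one after the other and
  cancel by \<open>cancel_cons_cancel\<close>.\<close>

lemma foldr_cancel_cons_cons:
  assumes "reduced v" "reduced w"
  shows "foldr cancel_cons (cancel_cons a v) w = cancel_cons a (foldr cancel_cons v w)"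
proof (cases v)
  case (Cons b v')
  then show ?thesis using assms by (simp add: cancel_cons_cancel reduced_foldr)
qed simp

lemma foldr_cancel_cons_assoc:
  "reduced v \<Longrightarrow> reduced w \<Longrightarrow>
   foldr cancel_cons (foldr cancel_cons u v) w = foldr cancel_cons u (foldr cancel_cons v w)"
  by (induction u) (simp_all add: foldr_cancel_cons_cons reduced_foldr)

definition flip_word :: "word \<Rightarrow> word" where
  "flip_word w = rev (map (\<lambda>(i, s). (i, \<not> s)) w)"

lemma foldr_flip_word: "foldr cancel_cons (flip_word u) u = []"
  by (induction u) (auto simp: flip_word_def)

lemma reduced_flip_word: "reduced u \<Longrightarrow> reduced (flip_word u)"
  unfolding reduced_def flip_word_def successively_rev successively_map
  by (erule successively_mono) (auto simp: split_beta)

lemma set_flip_word: "fst ` set (flip_word u) = fst ` set u"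
  by (simp add: flip_word_def image_image split_beta)

lemma set_cancel_cons: "fst ` set (cancel_cons a w) \<subseteq> insert (fst a) (fst ` set w)"
  by (cases w) auto

lemma set_foldr_cancel_cons: "fst ` set (foldr cancel_cons u w) \<subseteq> fst ` set u \<union> fst ` set w"
proof (induction u)
  case (Cons a u)
  then show ?case using set_cancel_cons[of a "foldr cancel_cons u w"]
    unfolding foldr.simps comp_def list.set image_insert by blast
qed simp

lemma carrier_free_group: "w \<in> carrier (free_group n) \<longleftrightarrow> fst ` set w \<subseteq> {..<n} \<and> reduced w"
  by (simp add: free_group_def reduced_def)

lemma mult_free_group: "u \<otimes>\<^bsub>free_group n\<^esub> w = foldr cancel_cons u w"
  and one_free_group: "\<one>\<^bsub>free_group n\<^esub> = []"
  by (simp_all add: free_group_def)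

lemma free_group_group: "group (free_group n)"
proof (rule groupI)
  fix u w assume "u \<in> carrier (free_group n)" "w \<in> carrier (free_group n)"
  then show "u \<otimes>\<^bsub>free_group n\<^esub> w \<in> carrier (free_group n)"
    using set_foldr_cancel_cons[of u w] unfolding carrier_free_group mult_free_group
    by (meson Un_least reduced_foldr subset_trans)
next
  fix u v w assume "u \<in> carrier (free_group n)" "v \<in> carrier (free_group n)" "w \<in> carrier (free_group n)"
  then show "u \<otimes>\<^bsub>free_group n\<^esub> v \<otimes>\<^bsub>free_group n\<^esub> w = u \<otimes>\<^bsub>free_group n\<^esub> (v \<otimes>\<^bsub>free_group n\<^esub> w)"
    by (simp add: mult_free_group carrier_free_group foldr_cancel_cons_assoc)
next
  fix u assume "u \<in> carrier (free_group n)"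
  then show "\<exists>w\<in>carrier (free_group n). w \<otimes>\<^bsub>free_group n\<^esub> u = \<one>\<^bsub>free_group n\<^esub>"
    by (intro bexI[of _ "flip_word u"])
      (simp_all add: mult_free_group one_free_group carrier_free_group foldr_flip_word reduced_flip_word set_flip_word)
qed (simp_all add: carrier_free_group mult_free_group one_free_group)

lemma free_group_letter: "i < n \<Longrightarrow> [(i, s)] \<in> carrier (free_group n)"
  by (simp add: carrier_free_group)

lemma inv_letter: "i < n \<Longrightarrow> inv\<^bsub>free_group n\<^esub> [(i, True)] = [(i, False)]"
  by (rule group.inv_equality[OF free_group_group])
    (simp_all add: free_group_letter mult_free_group one_free_group)

lemma free_group_generate:
  "generate (free_group n) ((\<lambda>i. [(i, True)]) ` {..<n}) = carrier (free_group n)" (is "?L = _")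
proof (rule equalityI)
  interpret group "free_group n" by (rule free_group_group)
  have sub: "(\<lambda>i. [(i, True)]) ` {..<n} \<subseteq> carrier (free_group n)"
    using free_group_letter by blast
  show "?L \<subseteq> carrier (free_group n)" by (rule generate_incl[OF sub])
  show "carrier (free_group n) \<subseteq> ?L"
  proof
    fix w assume "w \<in> carrier (free_group n)"
    then show "w \<in> ?L"
    proof (induction w)
      case Nil show ?case using generate.one[of "free_group n"] by (simp add: one_free_group)
    next
      case (Cons a w)
      then have w: "w \<in> carrier (free_group n)" and a: "fst a < n" and r: "reduced (a # w)"
        using reduced_tl[of a w] by (auto simp: carrier_free_group)
      obtain i s where ia: "a = (i, s)" by (cases a)
      have g: "[(i, True)] \<in> (\<lambda>i. [(i, True)]) ` {..<n}" using a ia by simp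
      have "[a] \<in> ?L"
      proof (cases s)
        case True
        then show ?thesis using generate.incl[OF g, of "free_group n"] ia by simp
      next
        case False
        have "inv\<^bsub>free_group n\<^esub> [(i, True)] \<in> ?L" by (rule generate.inv[OF g])
        then show ?thesis using inv_letter[of i n] a ia False by simp
      qed
      from generate.eng[OF this Cons.IH[OF w]] show ?case
        using r by (simp add: mult_free_group cancel_cons_reduced)
    qed
  qed
qed

text \<open>Multiplicativity is proved for a single letter in front of a word, where a cancellation
  in the word is matched by one in \<open>W\<close>, and then extended by induction on the left
  factor.\<close>

lemma free_group_universal:
  assumes "group W" "\<And>i. i < n \<Longrightarrow> f i \<in> carrier W"
  obtains h where "h \<in> hom (free_group n) W" "\<And>i. i < n \<Longrightarrow> h [(i, True)] = f i"
proof
  interpret W: group W by fact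
  define g where "g a = (if snd a then f (fst a) else inv\<^bsub>W\<^esub> f (fst a))" for a :: "nat \<times> bool"
  define h where "h w = foldr (\<lambda>a y. g a \<otimes>\<^bsub>W\<^esub> y) w \<one>\<^bsub>W\<^esub>" for w
  have gc: "g a \<in> carrier W" if "fst a < n" for a using assms(2)[OF that] by (simp add: g_def)
  have hc: "h w \<in> carrier W" if "fst ` set w \<subseteq> {..<n}" for w
    using that
  proof (induction w)
    case (Cons a w)
    then show ?case using W.m_closed[OF gc[of a]] by (simp add: h_def)
  qed (simp add: h_def)
  have cons: "h (cancel_cons a w) = g a \<otimes>\<^bsub>W\<^esub> h w" if "fst a < n" "fst ` set w \<subseteq> {..<n}" for a w
  proof (cases "\<exists>b w'. w = b # w' \<and> fst a = fst b \<and> snd a \<noteq> snd b")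
    case True
    then obtain b w' where w: "w = b # w'" "fst a = fst b" "snd a \<noteq> snd b" by blast
    have c: "h w' \<in> carrier W" "f (fst a) \<in> carrier W" using hc[of w'] w(1) that assms(2) by auto
    have "g a \<otimes>\<^bsub>W\<^esub> (g b \<otimes>\<^bsub>W\<^esub> h w') = h w'"
      using w W.cancel_assoc(1)[OF c(2,1)] W.cancel_assoc(2)[OF c(2,1)]
      by (cases "snd a") (simp_all add: g_def)
    then show ?thesis using w by (simp add: h_def)
  next
    case False
    then have "cancel_cons a w = a # w" by (cases w) auto
    then show ?thesis by (simp add: h_def)
  qed
  have mult: "h (foldr cancel_cons u w) = h u \<otimes>\<^bsub>W\<^esub> h w"
    if "fst ` set u \<subseteq> {..<n}" "fst ` set w \<subseteq> {..<n}" for u w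
    using that(1)
  proof (induction u)
    case Nil show ?case using hc[OF that(2)] by (simp add: h_def)
  next
    case (Cons a u)
    then have a: "fst a < n" and u: "fst ` set u \<subseteq> {..<n}" by auto
    have s: "fst ` set (foldr cancel_cons u w) \<subseteq> {..<n}"
      using set_foldr_cancel_cons[of u w] u that(2) by blast
    have "h (foldr cancel_cons (a # u) w) = g a \<otimes>\<^bsub>W\<^esub> (h u \<otimes>\<^bsub>W\<^esub> h w)"
      using Cons.IH[OF u] by (simp add: cons[OF a s])
    also have "\<dots> = (g a \<otimes>\<^bsub>W\<^esub> h u) \<otimes>\<^bsub>W\<^esub> h w"
      by (rule W.m_assoc[symmetric]) (intro gc[OF a] hc[OF u] hc[OF that(2)])+
    also have "g a \<otimes>\<^bsub>W\<^esub> h u = h (a # u)" by (simp add: h_def)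
    finally show ?case .
  qed
  show "h \<in> hom (free_group n) W"
    by (rule homI) (simp_all add: carrier_free_group mult_free_group hc mult)
  show "h [(i, True)] = f i" if "i < n" for i
    using assms(2)[OF that] by (simp add: h_def g_def)
qed

lemma second_derived_normal: "second_derived (free_group n) \<lhd> free_group n"
proof -
  interpret group "free_group n" by (rule free_group_group)
  show ?thesis unfolding second_derived_def
    by (intro derived_is_normal normal_self)
qed

text \<open>The derived subgroup of the quotient is the image of the derived subgroup of the free
  group, and commutators of the latter lie in \<open>?N\<close> by definition.\<close>

lemma free_metab_metabelian: "metabelian_group (free_metab n)"
proof -
  let ?F = "free_group n" and ?N = "second_derived (free_group n)"
  let ?q = "\<lambda>w. ?N #>\<^bsub>?F\<^esub> w"
  interpret F: group ?F by (rule free_group_group)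
  interpret N: normal ?N ?F by (rule second_derived_normal)
  have G: "group (free_metab n)" unfolding free_metab_def by (rule N.factorgroup_is_group)
  have q: "?q \<in> hom ?F (free_metab n)" unfolding free_metab_def by (rule N.r_coset_hom_Mod)
  interpret q: group_hom ?F "free_metab n" ?q by (intro group_homI F.is_group G q)
  have c: "carrier (free_metab n) = ?q ` carrier ?F" by (simp add: free_metab_def carrier_FactGroup)
  have d: "derived (free_metab n) (carrier (free_metab n)) = ?q ` derived ?F (carrier ?F)"
    unfolding c by (rule q.derived_img) simp
  show ?thesis
  proof (rule metabelian_group.intro[OF G], unfold_locales)
    fix a b assume "a \<in> derived (free_metab n) (carrier (free_metab n))"
      "b \<in> derived (free_metab n) (carrier (free_metab n))"
    then obtain u v where uv: "a = ?q u" "u \<in> derived ?F (carrier ?F)" "b = ?q v" "v \<in> derived ?F (carrier ?F)"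
      unfolding d by blast
    have uc: "u \<in> carrier ?F" "v \<in> carrier ?F" using uv F.derived_in_carrier[of "carrier ?F"] by blast+
    have "u \<otimes>\<^bsub>?F\<^esub> v \<otimes>\<^bsub>?F\<^esub> inv\<^bsub>?F\<^esub> u \<otimes>\<^bsub>?F\<^esub> inv\<^bsub>?F\<^esub> v \<in> ?N"
      unfolding second_derived_def using uv(2,4) by (subst derived_def) (blast intro: generate.incl)
    then have "?q (u \<otimes>\<^bsub>?F\<^esub> v \<otimes>\<^bsub>?F\<^esub> inv\<^bsub>?F\<^esub> u \<otimes>\<^bsub>?F\<^esub> inv\<^bsub>?F\<^esub> v) = ?N"
      by (intro F.coset_join2 N.subgroup_axioms) (use uc in simp)
    then have "a \<otimes>\<^bsub>free_metab n\<^esub> b \<otimes>\<^bsub>free_metab n\<^esub> inv\<^bsub>free_metab n\<^esub> a \<otimes>\<^bsub>free_metab n\<^esub> inv\<^bsub>free_metab n\<^esub> b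
       = \<one>\<^bsub>free_metab n\<^esub>"
      using uc unfolding uv by (simp only: q.hom_mult q.hom_inv F.m_closed F.inv_closed) (simp add: free_metab_def)
    moreover have "a \<in> carrier (free_metab n)" "b \<in> carrier (free_metab n)" using uc unfolding uv c by blast+
    ultimately show "a \<otimes>\<^bsub>free_metab n\<^esub> b = b \<otimes>\<^bsub>free_metab n\<^esub> a"
      by (metis q.H.inv_closed q.H.inv_solve_right' q.H.l_one q.H.m_closed)
  qed
qed

section \<open>The Magnus group\<close>

text \<open>Integer polynomials: a multiset of indices is a monomial, and union with multiplicity is
  the product of monomials. The same type is the free abelian group on monomials, so
  \<open>frag_of\<close> is a monomial and \<open>frag_hom\<close> extends a map from monomials to
  polynomials.\<close>

type_synonym poly = "nat multiset \<Rightarrow>\<^sub>0 int"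

definition X :: "nat \<Rightarrow> poly" where "X i = frag_of {#i#}"

lemma frag_of_mult: "frag_of a * frag_of b = (frag_of (a + b) :: 'a::monoid_add \<Rightarrow>\<^sub>0 int)"
  by (simp add: mult_single)

text \<open>The first Koszul differential of the variables, from tuples to polynomials.\<close>

definition theta :: "nat \<Rightarrow> (nat \<Rightarrow> poly) \<Rightarrow> poly" where
  "theta n p = (\<Sum>i<n. X i * p i)"

definition brc :: "nat \<Rightarrow> (nat \<Rightarrow> poly) \<Rightarrow> (nat \<Rightarrow> poly) \<Rightarrow> nat \<Rightarrow> poly" where
  "brc n p q = (\<lambda>i. theta n q * p i - theta n p * q i)"

text \<open>Each variable \<open>X i\<close> enters accompanied by one factor \<open>fps_X\<close>,
  so that the order in the series variable measures the position in the lower central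
  series.\<close>

definition Theta :: "nat \<Rightarrow> (nat \<Rightarrow> poly fps) \<Rightarrow> poly fps" where
  "Theta n p = fps_X * (\<Sum>i<n. fps_const (X i) * p i)"

definition Brc :: "nat \<Rightarrow> (nat \<Rightarrow> poly fps) \<Rightarrow> (nat \<Rightarrow> poly fps) \<Rightarrow> nat \<Rightarrow> poly fps" where
  "Brc n p q = (\<lambda>i. Theta n q * p i - Theta n p * q i)"

lemma Theta_linear:
  "Theta n (\<lambda>i. p i + q i) = Theta n p + Theta n q"
  "Theta n (\<lambda>i. p i - q i) = Theta n p - Theta n q"
  "Theta n (\<lambda>i. c * p i) = c * Theta n p"
  "Theta n (\<lambda>i. 0) = 0"
  by (simp_all add: Theta_def sum.distrib sum_subtractf sum_distrib_left algebra_simps)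

lemma Theta_Brc: "Theta n (Brc n p q) = 0"
  by (simp only: Brc_def Theta_linear) (simp add: mult.commute)

text \<open>The group of upper triangular matrices with diagonal \<open>1 - Theta n p\<close>,
  \<open>1\<close> and with \<open>p\<close> in the corner, in which the diagonal entry is
  determined by the corner. The condition for indices from \<open>n\<close> on makes a tuple with
  \<open>n\<close> entries a unique function.\<close>

definition magnus_group :: "nat \<Rightarrow> (nat \<Rightarrow> poly fps) monoid" where
  "magnus_group n =
     \<lparr>carrier = {p. \<forall>i\<ge>n. p i = 0},
      monoid.mult = (\<lambda>p q. \<lambda>i. p i + (1 - Theta n p) * q i),
      one = (\<lambda>i. 0)\<rparr>"

lemma magnus_simps:
  "p \<in> carrier (magnus_group n) \<longleftrightarrow> (\<forall>i\<ge>n. p i = 0)"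
  "p \<otimes>\<^bsub>magnus_group n\<^esub> q = (\<lambda>i. p i + (1 - Theta n p) * q i)"
  "\<one>\<^bsub>magnus_group n\<^esub> = (\<lambda>i. 0)"
  by (simp_all add: magnus_group_def)

lemma Theta_mult: "1 - Theta n (\<lambda>i. p i + (1 - Theta n p) * q i) = (1 - Theta n p) * (1 - Theta n q)"
  by (simp only: Theta_linear) (simp add: algebra_simps)

lemma Theta_nth_0: "fps_nth (Theta n p) 0 = 0"
  by (simp add: Theta_def)

text \<open>The series \<open>1 - Theta n p\<close> has constant term 1 and hence an inverse
  \<open>r\<close>. The explicit form of the inverse tuple is kept because it shows at once that
  inversion preserves the order of vanishing and the kernel of \<open>Theta\<close>.\<close>

lemma magnus_inverse_exists:
  "\<exists>r. p \<in> carrier (magnus_group n) \<longrightarrow>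
     (\<lambda>i. - r * p i) \<in> carrier (magnus_group n) \<and>
     (\<lambda>i. - r * p i) \<otimes>\<^bsub>magnus_group n\<^esub> p = \<one>\<^bsub>magnus_group n\<^esub>"
proof -
  define r where "r = fps_right_inverse (1 - Theta n p) 1"
  have "(1 - Theta n p) * r = 1"
    unfolding r_def by (rule fps_right_inverse) (simp add: Theta_nth_0)
  then have r: "1 + r * Theta n p = r" by (simp add: algebra_simps)
  have "1 - Theta n (\<lambda>i. (- r) * p i) = r" unfolding Theta_linear(3) using r by simp
  then show ?thesis by (intro exI[of _ r]) (simp add: magnus_simps)
qed

lemma magnus_group_group: "group (magnus_group n)"
proof (rule groupI)
  fix p q r
  show "p \<otimes>\<^bsub>magnus_group n\<^esub> q \<otimes>\<^bsub>magnus_group n\<^esub> r = p \<otimes>\<^bsub>magnus_group n\<^esub> (q \<otimes>\<^bsub>magnus_group n\<^esub> r)"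
    unfolding magnus_simps Theta_mult by (simp add: algebra_simps)
next
  fix p assume "p \<in> carrier (magnus_group n)"
  then show "\<exists>q\<in>carrier (magnus_group n). q \<otimes>\<^bsub>magnus_group n\<^esub> p = \<one>\<^bsub>magnus_group n\<^esub>"
    using magnus_inverse_exists[of p n] by blast
qed (simp_all add: magnus_simps Theta_linear)

lemma magnus_inv:
  assumes "p \<in> carrier (magnus_group n)"
  shows "\<exists>r. inv\<^bsub>magnus_group n\<^esub> p = (\<lambda>i. - r * p i)"
proof -
  obtain r where "(\<lambda>i. - r * p i) \<in> carrier (magnus_group n)"
     "(\<lambda>i. - r * p i) \<otimes>\<^bsub>magnus_group n\<^esub> p = \<one>\<^bsub>magnus_group n\<^esub>"
    using magnus_inverse_exists[of p n] assms by blast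
  then show ?thesis using group.inv_equality[OF magnus_group_group _ assms] by blast
qed

lemma Brc_closed:
  "p \<in> carrier (magnus_group n) \<Longrightarrow> q \<in> carrier (magnus_group n) \<Longrightarrow> Brc n p q \<in> carrier (magnus_group n)"
  by (simp add: magnus_simps Brc_def)

text \<open>\<open>Brc n p q\<close> is killed by \<open>Theta\<close>, so multiplying by it from
  the left is plain addition; adding it to the product of \<open>q\<close> and \<open>p\<close>
  gives the product of \<open>p\<close> and \<open>q\<close>.\<close>

lemma magnus_commutator:
  assumes "p \<in> carrier (magnus_group n)" "q \<in> carrier (magnus_group n)"
  shows "commutator (magnus_group n) p q = Brc n p q"
proof -
  interpret group "magnus_group n" by (rule magnus_group_group)
  have e: "Brc n p q \<otimes>\<^bsub>magnus_group n\<^esub> (q \<otimes>\<^bsub>magnus_group n\<^esub> p) = p \<otimes>\<^bsub>magnus_group n\<^esub> q"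
    unfolding magnus_simps Theta_Brc by (simp add: Brc_def algebra_simps)
  have "commutator (magnus_group n) p q = (p \<otimes>\<^bsub>magnus_group n\<^esub> q) \<otimes>\<^bsub>magnus_group n\<^esub> inv\<^bsub>magnus_group n\<^esub> (q \<otimes>\<^bsub>magnus_group n\<^esub> p)"
    using assms by (simp add: commutator_def m_assoc inv_mult_group)
  also have "\<dots> = Brc n p q"
    unfolding e[symmetric] using assms Brc_closed[OF assms] by (simp add: m_assoc)
  finally show ?thesis .
qed

section \<open>The filtration of the Magnus group by order of vanishing\<close>

definition low :: "nat \<Rightarrow> 'a::comm_ring_1 fps \<Rightarrow> bool" where
  "low k f \<longleftrightarrow> (\<forall>m<k. fps_nth f m = 0)"

lemma low_add: "low k f \<Longrightarrow> low k g \<Longrightarrow> low k (f + g)"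
  and low_diff: "low k f \<Longrightarrow> low k g \<Longrightarrow> low k (f - g)"
  and low_mono: "low k f \<Longrightarrow> l \<le> k \<Longrightarrow> low l f"
  by (auto simp: low_def)

lemma low_sum: "(\<And>j. j \<in> A \<Longrightarrow> low k (f j)) \<Longrightarrow> low k (sum f A)"
  by (simp add: low_def fps_sum_nth)

lemma low_mult: assumes "low j f" "low k g" shows "low (j + k) (f * g)"
  unfolding low_def
proof (intro allI impI)
  fix m assume m: "m < j + k"
  have "fps_nth f i * fps_nth g (m - i) = 0" if "i \<le> m" for i
    using assms that m unfolding low_def by (cases "i < j") auto
  then show "fps_nth (f * g) m = 0" by (simp add: fps_mult_nth)
qed

lemma low_mult_nth: assumes "low j f" "low k g" shows "fps_nth (f * g) (j + k) = fps_nth f j * fps_nth g k"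
proof -
  have "fps_nth (f * g) (j + k) = (\<Sum>i=0..j + k. if i = j then fps_nth f j * fps_nth g k else 0)"
    unfolding fps_mult_nth
  proof (rule sum.cong[OF refl])
    fix i assume "i \<in> {0..j + k}"
    then show "fps_nth f i * fps_nth g (j + k - i) = (if i = j then fps_nth f j * fps_nth g k else 0)"
      using assms unfolding low_def by (cases i j rule: linorder_cases) auto
  qed
  then show ?thesis by simp
qed

lemma low_0 [simp]: "low 0 f" by (simp add: low_def)

lemma low_Theta: "(\<And>i. i < n \<Longrightarrow> low k (p i)) \<Longrightarrow> low (Suc k) (Theta n p)"
proof -
  assume "\<And>i. i < n \<Longrightarrow> low k (p i)"
  then have "low k (\<Sum>i<n. fps_const (X i) * p i)"
    by (intro low_sum) (use low_mult[of 0 _ k] in auto)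
  from low_mult[OF _ this, of 1 fps_X] show ?thesis by (simp add: low_def Theta_def)
qed

lemma Theta_nth: "fps_nth (Theta n p) (Suc k) = theta n (\<lambda>i. fps_nth (p i) k)"
  by (simp add: Theta_def theta_def fps_sum_nth)

definition U :: "nat \<Rightarrow> nat \<Rightarrow> (nat \<Rightarrow> poly fps) set" where
  "U n k = {p \<in> carrier (magnus_group n). \<forall>i. low k (p i)}"

lemma U_subgroup: "subgroup (U n k) (magnus_group n)"
proof (rule group.subgroupI[OF magnus_group_group])
  show "U n k \<subseteq> carrier (magnus_group n)" by (auto simp: U_def)
  have "(\<lambda>i. 0) \<in> U n k" by (simp add: U_def magnus_simps low_def)
  then show "U n k \<noteq> {}" by blast
next
  fix p assume p: "p \<in> U n k"
  then have pc: "p \<in> carrier (magnus_group n)" by (simp add: U_def)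
  obtain r where r: "inv\<^bsub>magnus_group n\<^esub> p = (\<lambda>i. - r * p i)" using magnus_inv[OF pc] by blast
  have "inv\<^bsub>magnus_group n\<^esub> p \<in> carrier (magnus_group n)"
    using group.inv_closed[OF magnus_group_group pc] .
  moreover have "low k (- r * p i)" for i using low_mult[of 0 "- r" k "p i"] p by (simp add: U_def)
  ultimately show "inv\<^bsub>magnus_group n\<^esub> p \<in> U n k" by (simp add: U_def r)
next
  fix p q assume p: "p \<in> U n k" and q: "q \<in> U n k"
  have "low k ((1 - Theta n p) * q i)" for i using low_mult[of 0 "1 - Theta n p" k "q i"] q by (simp add: U_def)
  then show "p \<otimes>\<^bsub>magnus_group n\<^esub> q \<in> U n k" using p q by (simp add: U_def magnus_simps low_add)
qed

text \<open>Both terms of \<open>Brc\<close> contain a \<open>Theta\<close>, whose explicit factor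
  \<open>fps_X\<close> raises the order by one.\<close>

lemma U_commutator:
  assumes "p \<in> U n k" "q \<in> carrier (magnus_group n)"
  shows "commutator (magnus_group n) p q \<in> U n (Suc k)"
proof -
  have p: "p \<in> carrier (magnus_group n)" "\<And>i. low k (p i)" using assms(1) by (auto simp: U_def)
  have "low (Suc k) (Theta n q * p i)" for i
    using low_mult[OF low_Theta[of n 0 q] p(2)] by simp
  moreover have "low (Suc k) (Theta n p * q i)" for i
    using low_mult[OF low_Theta[of n k p, OF p(2)] low_0[of "q i"]] by simp
  ultimately show ?thesis
    unfolding magnus_commutator[OF p(1) assms(2)] U_def
    using Brc_closed[OF p(1) assms(2)] by (simp add: Brc_def low_diff)
qed

section \<open>The leading coefficient map on the graded quotients\<close>

lemma zero_fun_apply: "(0 :: 'a \<Rightarrow> 'b::zero) = (\<lambda>x. 0)"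
  by (simp add: zero_fun_def)

definition e :: "nat \<Rightarrow> nat \<Rightarrow> poly" where
  "e i = (\<lambda>j. if j = i then 1 else 0)"

lemma theta_e: "i < n \<Longrightarrow> theta n (e i) = X i"
  by (simp add: theta_def e_def if_distrib cong: if_cong)

lemma theta_linear:
  "theta n (\<lambda>i. p i + q i) = theta n p + theta n q"
  "theta n (\<lambda>i. p i - q i) = theta n p - theta n q"
  "theta n (\<lambda>i. c * p i) = c * theta n p"
  "theta n (\<lambda>i. 0) = 0"
  by (simp_all add: theta_def sum.distrib sum_subtractf sum_distrib_left algebra_simps)

lemma theta_brc: "theta n (brc n p q) = 0"
  by (simp only: brc_def theta_linear) (simp add: mult.commute)

text \<open>The data from which all coordinates are derived: generators, and a homomorphism to the
  Magnus group that sends them to the unit vectors. Injectivity is obtained below on the graded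
  quotients, as \<open>J_inj\<close>.\<close>

locale magnus = metabelian_group G for G :: "'a monoid" (structure) +
  fixes n :: nat and x :: "nat \<Rightarrow> 'a" and \<mu> :: "'a \<Rightarrow> nat \<Rightarrow> poly fps"
  assumes x_closed: "i < n \<Longrightarrow> x i \<in> carrier G"
    and x_generate: "generate G (x ` {..<n}) = carrier G"
    and \<mu>_hom: "\<mu> \<in> hom G (magnus_group n)"
    and \<mu>_x: "i < n \<Longrightarrow> \<mu> (x i) = (\<lambda>j. if j = i then 1 else 0)"
begin

lemma \<mu>_closed: "a \<in> carrier G \<Longrightarrow> \<mu> a \<in> carrier (magnus_group n)"
  by (rule hom_in_carrier[OF \<mu>_hom])

lemma \<mu>_group_hom: "group_hom G (magnus_group n) \<mu>"
  by (rule group_homI[OF is_group magnus_group_group \<mu>_hom])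

lemma \<mu>_commutator:
  assumes "a \<in> carrier G" "b \<in> carrier G"
  shows "\<mu> (commutator G a b) = commutator (magnus_group n) (\<mu> a) (\<mu> b)"
proof -
  interpret m: group_hom G "magnus_group n" \<mu> by (rule \<mu>_group_hom)
  show ?thesis unfolding commutator_def using assms by (simp only: m.hom_mult m.hom_inv m_closed inv_closed)
qed

lemma \<mu>_lcs: "a \<in> lcs G (Suc k) \<Longrightarrow> \<mu> a \<in> U n k"
proof (induction k arbitrary: a)
  case 0 then show ?case using \<mu>_closed by (simp add: lcs_1 U_def)
next
  case (Suc k)
  show ?case
  proof (rule hom_image_in_subgroup[OF is_group magnus_group_group \<mu>_hom _ U_subgroup])
    show "{commutator G a b | a b. a \<in> lcs G (Suc k) \<and> b \<in> carrier G} \<subseteq> carrier G"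
      using lcs_carrier commutator_closed by blast
    show "a \<in> generate G {commutator G a b | a b. a \<in> lcs G (Suc k) \<and> b \<in> carrier G}"
      using Suc.prems by (subst (asm) lcs_Suc) simp_all
    fix c assume "c \<in> {commutator G a b | a b. a \<in> lcs G (Suc k) \<and> b \<in> carrier G}"
    then obtain a b where c: "c = commutator G a b" "a \<in> lcs G (Suc k)" "b \<in> carrier G" by blast
    show "\<mu> c \<in> U n (Suc k)"
      unfolding c(1) \<mu>_commutator[OF lcs_carrier[OF c(2)] c(3)]
      by (rule U_commutator[OF Suc.IH[OF c(2)] \<mu>_closed[OF c(3)]])
  qed
qed

text \<open>The k-th term of the series vanishes to order \<open>k - 1\<close>, generators having
  constant leading coefficient; hence the shift in the index of the coefficient.\<close>

definition J :: "nat \<Rightarrow> 'a set \<Rightarrow> nat \<Rightarrow> poly" where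
  "J k A = the_elem ((\<lambda>a i. fps_nth (\<mu> a i) (k - 1)) ` A)"

lemma \<mu>_low: "a \<in> lcs G (Suc k) \<Longrightarrow> low k (\<mu> a i)"
  using \<mu>_lcs[of a k] by (simp add: U_def)

text \<open>The correction \<open>Theta n (\<mu> a) * \<mu> b i\<close> starts above order
  \<open>k\<close>, since \<open>Theta\<close> has no constant term.\<close>

lemma \<mu>_mult_nth:
  assumes "a \<in> carrier G" "b \<in> lcs G (Suc k)"
  shows "fps_nth (\<mu> (a \<otimes> b) i) k = fps_nth (\<mu> a i) k + fps_nth (\<mu> b i) k"
proof -
  have "\<mu> (a \<otimes> b) = (\<lambda>i. \<mu> a i + (1 - Theta n (\<mu> a)) * \<mu> b i)"
    using hom_mult[OF \<mu>_hom assms(1) lcs_carrier[OF assms(2)]] by (simp add: magnus_simps)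
  then show ?thesis
    using low_mult_nth[OF low_0 \<mu>_low[OF assms(2)], of "1 - Theta n (\<mu> a)" i] by (simp add: Theta_nth_0)
qed

lemma J_cl: assumes "a \<in> lcs G (Suc k)" shows "J (Suc k) (cl (Suc k) a) = (\<lambda>i. fps_nth (\<mu> a i) k)"
proof -
  have "the_elem ((\<lambda>a i. fps_nth (\<mu> a i) k) ` (lcs G (Suc (Suc k)) #> a)) = (\<lambda>i. fps_nth (\<mu> a i) k)"
  proof (rule the_elem_image_coset[OF is_group lcs_subgroup lcs_carrier[OF assms]])
    fix m assume m: "m \<in> lcs G (Suc (Suc k))"
    have "fps_nth (\<mu> m i) k = 0" for i using \<mu>_low[OF m, of i] by (simp add: low_def)
    then show "(\<lambda>i. fps_nth (\<mu> (m \<otimes> a) i) k) = (\<lambda>i. fps_nth (\<mu> a i) k)"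
      using \<mu>_mult_nth[OF lcs_carrier[OF m] assms] by simp
  qed
  then show ?thesis by (simp add: J_def cl_def)
qed

lemma J_hom: "J (Suc k) \<in> hom (gr G (Suc k)) add_grp"
proof (rule homI)
  fix A B assume "A \<in> carrier (gr G (Suc k))" "B \<in> carrier (gr G (Suc k))"
  then obtain a b where ab: "A = cl (Suc k) a" "a \<in> lcs G (Suc k)" "B = cl (Suc k) b" "b \<in> lcs G (Suc k)"
    by (auto simp: carrier_gr)
  have m: "a \<otimes> b \<in> lcs G (Suc k)" by (rule subgroup.m_closed[OF lcs_subgroup ab(2,4)])
  show "J (Suc k) (A \<otimes>\<^bsub>gr G (Suc k)\<^esub> B) = J (Suc k) A \<otimes>\<^bsub>add_grp\<^esub> J (Suc k) B"
    unfolding ab(1,3) cl_mult[OF ab(2,4), symmetric] J_cl[OF ab(2)] J_cl[OF ab(4)] J_cl[OF m]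
    using \<mu>_mult_nth[OF lcs_carrier[OF ab(2)] ab(4)] by (simp add: fun_eq_iff)
qed simp

lemma J_hom': "k \<ge> 1 \<Longrightarrow> J k \<in> hom (gr G k) add_grp"
  using J_hom[of "k - 1"] by simp

lemma J_simps:
  assumes "k \<ge> 1"
  shows "J k \<one>\<^bsub>gr G k\<^esub> = 0"
    and "A \<in> carrier (gr G k) \<Longrightarrow> B \<in> carrier (gr G k) \<Longrightarrow> J k (A \<otimes>\<^bsub>gr G k\<^esub> B) = J k A + J k B"
    and "A \<in> carrier (gr G k) \<Longrightarrow> J k (inv\<^bsub>gr G k\<^esub> A) = - J k A"
  using hom_add_grp[OF gr_group J_hom'[OF assms]] by simp_all

text \<open>The commutator is sent exactly to \<open>Brc\<close>, and lowest coefficients multiply.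
  The \<open>fps_X\<close> in \<open>Theta\<close> accounts for the degrees: orders
  \<open>k - 1\<close> and \<open>l - 1\<close> combine to order \<open>k + l - 1\<close>.\<close>

lemma J_bracket:
  assumes "k \<ge> 1" "l \<ge> 1" "A \<in> carrier (gr G k)" "B \<in> carrier (gr G l)"
  shows "J (k + l) (gr_bracket G k l A B) = brc n (J k A) (J l B)"
proof -
  obtain k' l' where kl: "k = Suc k'" "l = Suc l'" using assms(1,2) by (metis Suc_le_D One_nat_def)
  obtain a b where ab: "A = cl k a" "a \<in> lcs G k" "B = cl l b" "b \<in> lcs G l"
    using assms(3,4) by (auto simp: carrier_gr)
  have c: "a \<in> carrier G" "b \<in> carrier G" using ab lcs_carrier by blast+
  have m: "commutator G a b \<in> lcs G (Suc (k' + l))"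
    using commutator_lcs_lcs[OF assms(1,2) ab(2,4)] by (simp add: kl)
  have la: "low k' (\<mu> a i)" for i using \<mu>_low ab(2) kl by blast
  have lb: "low l' (\<mu> b i)" for i using \<mu>_low ab(4) kl by blast
  have "J (k + l) (gr_bracket G k l A B) = (\<lambda>i. fps_nth (\<mu> (commutator G a b) i) (k' + l))"
    using J_cl[OF m] unfolding ab(1,3) gr_bracket_cl[OF assms(1,2) ab(2,4)] by (simp add: kl)
  also have "\<mu> (commutator G a b) = Brc n (\<mu> a) (\<mu> b)"
    unfolding \<mu>_commutator[OF c] by (rule magnus_commutator) (intro \<mu>_closed c)+
  also have "(\<lambda>i. fps_nth (Brc n (\<mu> a) (\<mu> b) i) (k' + l)) =
     (\<lambda>i. theta n (\<lambda>i. fps_nth (\<mu> b i) l') * fps_nth (\<mu> a i) k' - theta n (\<lambda>i. fps_nth (\<mu> a i) k') * fps_nth (\<mu> b i) l')"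
  proof
    fix i
    have "fps_nth (Theta n (\<mu> b) * \<mu> a i) (l + k') = fps_nth (Theta n (\<mu> b)) l * fps_nth (\<mu> a i) k'"
      by (rule low_mult_nth[OF _ la]) (simp add: kl low_Theta[OF lb])
    moreover have "fps_nth (Theta n (\<mu> a) * \<mu> b i) (k + l') = fps_nth (Theta n (\<mu> a)) k * fps_nth (\<mu> b i) l'"
      by (rule low_mult_nth[OF _ lb]) (simp add: kl low_Theta[OF la])
    ultimately show "fps_nth (Brc n (\<mu> a) (\<mu> b) i) (k' + l) =
     theta n (\<lambda>i. fps_nth (\<mu> b i) l') * fps_nth (\<mu> a i) k' - theta n (\<lambda>i. fps_nth (\<mu> a i) k') * fps_nth (\<mu> b i) l'"
      by (simp add: Brc_def kl Theta_nth add.commute)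
  qed
  also have "\<dots> = brc n (J k A) (J l B)"
    using ab(2,4) unfolding ab(1,3) kl by (simp add: J_cl brc_def)
  finally show ?thesis .
qed

subsection \<open>Left-normed generators\<close>

definition g :: "nat \<Rightarrow> 'a set" where "g i = cl 1 (x i)"

lemma g_closed: "i < n \<Longrightarrow> g i \<in> carrier (gr G 1)"
  unfolding g_def by (rule cl_closed) (simp add: lcs_1 x_closed)

lemma J_g: "i < n \<Longrightarrow> J 1 (g i) = e i"
  using J_cl[of "x i" 0] by (auto simp: g_def lcs_1 x_closed \<mu>_x e_def fun_eq_iff)

lemma gr_1_generate: "generate (gr G 1) (g ` {..<n}) = carrier (gr G 1)"
proof -
  have h: "cl 1 \<in> hom G (gr G 1)"
    by (rule homI) (simp_all add: cl_closed cl_mult lcs_1)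
  have "carrier (gr G 1) = cl 1 ` generate G (x ` {..<n})"
    by (simp add: carrier_gr lcs_1 x_generate)
  also have "\<dots> = generate (gr G 1) (cl 1 ` x ` {..<n})"
    by (rule hom_generate_image[OF is_group gr_group h]) (use x_closed in blast)
  finally show ?thesis by (simp add: image_image g_def)
qed

text \<open>By the definition of the series, degree \<open>k + 1\<close> is spanned by brackets of
  degree \<open>k\<close> with degree 1. Biadditivity then reduces the entries to generators, first
  the right one and then the left one being arbitrary again.\<close>

lemma gr_Suc_generate:
  assumes "k \<ge> 1" "K \<subseteq> carrier (gr G k)" "generate (gr G k) K = carrier (gr G k)"
  shows "generate (gr G (k + 1)) {gr_bracket G k 1 A (g i) | A i. A \<in> K \<and> i < n} = carrier (gr G (k + 1))" (is "?L = _")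
proof (rule equalityI)
  interpret H: comm_group "gr G (k + 1)" by (rule gr_comm_group) simp
  note hom1 = cl_bracket_hom(1)[OF assms(1) le_refl] and hom2 = cl_bracket_hom(2)[OF assms(1) le_refl]
  let ?K = "{gr_bracket G k 1 A (g i) | A i. A \<in> K \<and> i < n}"
  have sub: "?K \<subseteq> carrier (gr G (k + 1))"
  proof clarify
    fix A i assume "A \<in> K" "i < n"
    then show "gr_bracket G k 1 A (g i) \<in> carrier (gr G (k + 1))"
      using hom_in_carrier[OF hom2[OF g_closed]] assms(2) by blast
  qed
  have L: "subgroup ?L (gr G (k + 1))" by (rule H.generate_is_subgroup[OF sub])
  show "?L \<subseteq> carrier (gr G (k + 1))" by (rule H.generate_incl[OF sub])
  have 1: "gr_bracket G k 1 A (g i) \<in> ?L" if A: "A \<in> carrier (gr G k)" and i: "i < n" for A i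
  proof (rule hom_image_in_subgroup[OF gr_group H.is_group hom2[OF g_closed[OF i]] assms(2) L])
    show "A \<in> generate (gr G k) K" using A assms(3) by simp
    show "gr_bracket G k 1 B (g i) \<in> ?L" if "B \<in> K" for B using that i by (blast intro: generate.incl)
  qed
  have 2: "gr_bracket G k 1 A B \<in> ?L" if A: "A \<in> carrier (gr G k)" and B: "B \<in> carrier (gr G 1)" for A B
  proof (rule hom_image_in_subgroup[OF gr_group H.is_group hom1[OF A] _ L])
    show "g ` {..<n} \<subseteq> carrier (gr G 1)" using g_closed by blast
    show "B \<in> generate (gr G 1) (g ` {..<n})" using B gr_1_generate by simp
    show "gr_bracket G k 1 A C \<in> ?L" if "C \<in> g ` {..<n}" for C using that 1[OF A] by blast
  qed
  show "carrier (gr G (k + 1)) \<subseteq> ?L"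
  proof
    fix C assume "C \<in> carrier (gr G (k + 1))"
    then obtain c where c: "c \<in> lcs G (k + 1)" "C = cl (k + 1) c" by (auto simp: carrier_gr)
    let ?M = "{commutator G a b | a b. a \<in> lcs G k \<and> b \<in> carrier G}"
    let ?S = "G\<lparr>carrier := lcs G (k + 1)\<rparr>"
    have M: "?M \<subseteq> lcs G (k + 1)" using commutator_lcs(1)[OF assms(1)] by auto
    have "c \<in> generate G ?M" using c(1) assms(1) by (simp add: lcs_Suc)
    then have "c \<in> generate ?S ?M" using generate_consistent[OF M lcs_subgroup] by simp
    then show "C \<in> ?L" unfolding c(2)
    proof (rule hom_image_in_subgroup[OF lcs_group H.is_group cl_hom _ L, rotated 2])
      show "?M \<subseteq> carrier ?S" using M by simp
      fix d assume "d \<in> ?M"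
      then obtain a b where d: "d = commutator G a b" "a \<in> lcs G k" "b \<in> carrier G" by blast
      have "cl (k + 1) d = gr_bracket G k 1 (cl k a) (cl 1 b)"
        unfolding d(1) by (rule gr_bracket_cl[symmetric]) (use assms d in \<open>simp_all add: lcs_1\<close>)
      also have "\<dots> \<in> ?L" by (rule 2) (use d in \<open>simp_all add: cl_closed lcs_1\<close>)
      finally show "cl (k + 1) d \<in> ?L" .
    qed
  qed
qed

text \<open>The list grows outwards: its last entry is bracketed first and its head last. Induction
  on the degree thus removes the head, while the Jacobi identity acts at the end of the
  list.\<close>

primrec lcg :: "nat \<Rightarrow> nat \<Rightarrow> nat list \<Rightarrow> 'a" where
  "lcg a b [] = commutator G (x a) (x b)"
| "lcg a b (f # fs) = commutator G (lcg a b fs) (x f)"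

definition lc :: "nat \<Rightarrow> nat \<Rightarrow> nat list \<Rightarrow> 'a set" where
  "lc a b fs = cl (length fs + 2) (lcg a b fs)"

lemma lcg_lcs: "a < n \<Longrightarrow> b < n \<Longrightarrow> set fs \<subseteq> {..<n} \<Longrightarrow> lcg a b fs \<in> lcs G (length fs + 2)"
proof (induction fs)
  case Nil
  then show ?case using commutator_lcs(1)[of 1 "x a" "x b"] by (simp add: lcs_1 x_closed numeral_2_eq_2)
next
  case (Cons f fs)
  then show ?case using commutator_lcs(1)[OF _ Cons.IH x_closed[of f]] by simp
qed

lemma lc_closed: "a < n \<Longrightarrow> b < n \<Longrightarrow> set fs \<subseteq> {..<n} \<Longrightarrow> lc a b fs \<in> carrier (gr G (length fs + 2))"
  unfolding lc_def by (rule cl_closed[OF lcg_lcs])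

lemma lc_Nil: "a < n \<Longrightarrow> b < n \<Longrightarrow> lc a b [] = gr_bracket G 1 1 (g a) (g b)"
  unfolding lc_def g_def by (subst gr_bracket_cl) (simp_all add: lcs_1 x_closed numeral_2_eq_2)

lemma lc_Cons:
  assumes "a < n" "b < n" "set fs \<subseteq> {..<n}" "f < n"
  shows "lc a b (f # fs) = gr_bracket G (length fs + 2) 1 (lc a b fs) (g f)"
  unfolding lc_def g_def
  by (subst gr_bracket_cl) (use assms lcg_lcs[OF assms(1-3)] in \<open>simp_all add: lcs_1 x_closed\<close>)

lemma gr_generate:
  assumes "k \<ge> 2"
  shows "generate (gr G k) {lc a b fs | a b fs. a < n \<and> b < n \<and> set fs \<subseteq> {..<n} \<and> length fs + 2 = k} = carrier (gr G k)"
  using assms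
proof (induction k rule: dec_induct)
  case base
  have "{gr_bracket G 1 1 A (g i) | A i. A \<in> g ` {..<n} \<and> i < n} =
    {lc a b fs | a b fs. a < n \<and> b < n \<and> set fs \<subseteq> {..<n} \<and> length fs + 2 = 2}"
  proof (intro equalityI subsetI)
    fix C assume "C \<in> {gr_bracket G 1 1 A (g i) | A i. A \<in> g ` {..<n} \<and> i < n}"
    then obtain a b where "C = gr_bracket G 1 1 (g a) (g b)" "a < n" "b < n" by blast
    then have "C = lc a b []" "a < n" "b < n" "set [] \<subseteq> {..<n}" "length ([]::nat list) + 2 = 2" by (simp_all add: lc_Nil)
    then show "C \<in> {lc a b fs | a b fs. a < n \<and> b < n \<and> set fs \<subseteq> {..<n} \<and> length fs + 2 = 2}" by blast
  next
    fix C assume "C \<in> {lc a b fs | a b fs. a < n \<and> b < n \<and> set fs \<subseteq> {..<n} \<and> length fs + 2 = 2}"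
    then obtain a b where "C = lc a b []" "a < n" "b < n" by auto
    then have "C = gr_bracket G 1 1 (g a) (g b)" "a < n" "b < n" by (simp_all add: lc_Nil)
    then show "C \<in> {gr_bracket G 1 1 A (g i) | A i. A \<in> g ` {..<n} \<and> i < n}" by blast
  qed
  then show ?case using gr_Suc_generate[OF _ _ gr_1_generate] g_closed by (force simp: numeral_2_eq_2)
next
  case (step k)
  let ?K = "\<lambda>k. {lc a b fs | a b fs. a < n \<and> b < n \<and> set fs \<subseteq> {..<n} \<and> length fs + 2 = k}"
  have "{gr_bracket G k 1 A (g i) | A i. A \<in> ?K k \<and> i < n} = ?K (Suc k)"
  proof (intro equalityI subsetI)
    fix C assume "C \<in> {gr_bracket G k 1 A (g i) | A i. A \<in> ?K k \<and> i < n}"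
    then obtain a b fs i where "C = gr_bracket G k 1 (lc a b fs) (g i)" "i < n" "a < n" "b < n" "set fs \<subseteq> {..<n}" "length fs + 2 = k"
      by blast
    then have "C = lc a b (i # fs)" "a < n" "b < n" "set (i # fs) \<subseteq> {..<n}" "length (i # fs) + 2 = Suc k"
      by (auto simp: lc_Cons)
    then show "C \<in> ?K (Suc k)" by blast
  next
    fix C assume "C \<in> ?K (Suc k)"
    then obtain a b fs where C: "C = lc a b fs" "a < n" "b < n" "set fs \<subseteq> {..<n}" "length fs + 2 = Suc k" by blast
    then obtain i gs where fs: "fs = i # gs" using step.hyps by (cases fs) auto
    have "C = gr_bracket G k 1 (lc a b gs) (g i)" "i < n" "a < n" "b < n" "set gs \<subseteq> {..<n}" "length gs + 2 = k"
      using C fs lc_Cons[of a b gs i] by auto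
    then show "C \<in> {gr_bracket G k 1 A (g i) | A i. A \<in> ?K k \<and> i < n}" by blast
  qed
  moreover have "?K k \<subseteq> carrier (gr G k)" using lc_closed by blast
  ultimately show ?case using gr_Suc_generate[of k "?K k"] step by simp
qed

definition v :: "nat \<Rightarrow> nat \<Rightarrow> nat \<Rightarrow> poly" where
  "v a b = brc n (e a) (e b)"

lemma v_eq: "a < n \<Longrightarrow> b < n \<Longrightarrow> v a b = (\<lambda>i. X b * e a i - X a * e b i)"
  by (simp add: v_def brc_def theta_e)

text \<open>\<open>theta\<close> vanishes on \<open>v a b\<close> and on its multiples, so
  bracketing with the generator \<open>f\<close> leaves a single term of \<open>brc\<close>,
  multiplication by \<open>X f\<close>.\<close>

lemma J_lc:
  assumes "a < n" "b < n" "set fs \<subseteq> {..<n}"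
  shows "J (length fs + 2) (lc a b fs) = (\<lambda>i. frag_of (mset fs) * v a b i)"
  using assms(3)
proof (induction fs)
  case Nil
  have "J (1 + 1) (lc a b []) = v a b"
    unfolding lc_Nil[OF assms(1,2)] v_def by (subst J_bracket) (simp_all add: g_closed assms J_g del: One_nat_def)
  then show ?case by (simp add: numeral_2_eq_2 single_one)
next
  case (Cons f fs)
  then have f: "f < n" "set fs \<subseteq> {..<n}" by auto
  have "J (length fs + 2 + 1) (lc a b (f # fs)) = brc n (\<lambda>i. frag_of (mset fs) * v a b i) (e f)"
    unfolding lc_Cons[OF assms(1,2) f(2,1)]
    by (subst J_bracket[OF _ _ lc_closed[OF assms(1,2) f(2)] g_closed[OF f(1)]])
      (simp, simp, simp only: J_g[OF f(1)] Cons.IH[OF f(2)])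
  also have "\<dots> = (\<lambda>i. frag_of (mset (f # fs)) * v a b i)"
    unfolding brc_def theta_linear theta_e[OF f(1)]
    by (simp add: v_def theta_brc X_def mult_single mult.assoc[symmetric])
  finally show ?case by simp
qed

lemma lcg_swap:
  assumes "a < n" "b < n" "set fs \<subseteq> {..<n}" "c < n" "d < n"
  shows "lcg a b (c # d # fs) = lcg a b (d # c # fs)"
proof -
  have "lcg a b fs \<in> derived G (carrier G)"
    using lcg_lcs[OF assms(1-3)] lcs_ge_2_derived[of "length fs + 2"] by auto
  then show ?thesis using commutator_swap[OF x_closed[OF assms(5)] x_closed[OF assms(4)]] by simp
qed

lemma lcg_rotate:
  assumes "a < n" "b < n" "set (us @ f # vs) \<subseteq> {..<n}"
  shows "lcg a b (us @ f # vs) = lcg a b (f # us @ vs)"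
  using assms(3)
proof (induction us)
  case (Cons u us)
  have "lcg a b (u # us @ f # vs) = lcg a b (u # f # us @ vs)" using Cons by simp
  also have "\<dots> = lcg a b (f # u # us @ vs)" by (rule lcg_swap) (use assms Cons.prems in auto)
  finally show ?case by simp
qed simp

lemma lcg_perm:
  assumes "a < n" "b < n" "set fs \<subseteq> {..<n}" "mset fs = mset gs"
  shows "lcg a b fs = lcg a b gs"
  using assms(3,4)
proof (induction fs arbitrary: gs)
  case (Cons f fs)
  have "f \<in> set gs" using Cons.prems(2) by (metis list.set_intros(1) mset_eq_setD)
  then obtain us vs where gs: "gs = us @ f # vs" by (meson split_list)
  have s: "set gs \<subseteq> {..<n}" using Cons.prems by (metis mset_eq_setD)
  have "lcg a b fs = lcg a b (us @ vs)" by (rule Cons.IH) (use Cons.prems gs in auto)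
  then have "lcg a b (f # fs) = lcg a b (f # us @ vs)" by simp
  also have "\<dots> = lcg a b gs" unfolding gs by (rule lcg_rotate[symmetric]) (use assms s gs in auto)
  finally show ?case .
qed simp

lemma lc_perm:
  "a < n \<Longrightarrow> b < n \<Longrightarrow> set fs \<subseteq> {..<n} \<Longrightarrow> mset fs = mset gs \<Longrightarrow> lc a b fs = lc a b gs"
  using lcg_perm[of a b fs gs] mset_eq_length[of fs gs] by (simp add: lc_def)

lemma lc_hom_Cons:
  assumes "c < n" "k \<ge> 1"
  shows "(\<lambda>A. gr_bracket G k 1 A (g c)) \<in> hom (gr G k) (gr G (k + 1))"
  by (rule cl_bracket_hom(2)[OF assms(2) le_refl g_closed[OF assms(1)]])

text \<open>With an empty list this is the class of the Hall-Witt identity. Each further bracket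
  with a generator is a homomorphism and carries the identity one degree up.\<close>

lemma lc_jacobi:
  assumes "a < n" "b < n" "c < n" "set fs \<subseteq> {..<n}"
  shows "lc a b (fs @ [c]) \<otimes>\<^bsub>gr G (length fs + 3)\<^esub> lc b c (fs @ [a]) \<otimes>\<^bsub>gr G (length fs + 3)\<^esub> lc c a (fs @ [b])
     = \<one>\<^bsub>gr G (length fs + 3)\<^esub>"
  using assms(4)
proof (induction fs)
  case Nil
  have m: "lcg a b [c] \<in> lcs G 3" "lcg b c [a] \<in> lcs G 3" "lcg c a [b] \<in> lcs G 3"
    using lcg_lcs[of a b "[c]"] lcg_lcs[of b c "[a]"] lcg_lcs[of c a "[b]"] assms by (simp_all add: eval_nat_numeral)
  have "lcg a b [c] \<otimes> lcg b c [a] \<otimes> lcg c a [b] = \<one>"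
    using commutator_jacobi[OF x_closed[OF assms(1)] x_closed[OF assms(2)] x_closed[OF assms(3)]] by simp
  moreover have "cl 3 (lcg a b [c] \<otimes> lcg b c [a] \<otimes> lcg c a [b]) = cl 3 (lcg a b [c]) \<otimes>\<^bsub>gr G 3\<^esub> cl 3 (lcg b c [a]) \<otimes>\<^bsub>gr G 3\<^esub> cl 3 (lcg c a [b])"
    by (simp only: cl_mult m subgroup.m_closed[OF lcs_subgroup])
  ultimately show ?case by (simp add: lc_def cl_one eval_nat_numeral del: lcg.simps)
next
  case (Cons f fs)
  then have f: "f < n" "set fs \<subseteq> {..<n}" by auto
  let ?k = "length fs + 3"
  have k: "?k = Suc (length fs) + 2" by simp
  interpret A: comm_group "gr G ?k" by (rule gr_comm_group) simp
  interpret B: comm_group "gr G (?k + 1)" by (rule gr_comm_group) simp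
  interpret h: group_hom "gr G ?k" "gr G (?k + 1)" "\<lambda>A. gr_bracket G ?k 1 A (g f)"
    by (intro group_homI A.is_group B.is_group lc_hom_Cons f(1)) simp
  have c: "lc a b (fs @ [c]) \<in> carrier (gr G ?k)" "lc b c (fs @ [a]) \<in> carrier (gr G ?k)" "lc c a (fs @ [b]) \<in> carrier (gr G ?k)"
    using lc_closed[of a b "fs @ [c]"] lc_closed[of b c "fs @ [a]"] lc_closed[of c a "fs @ [b]"] assms f
    by (simp_all add: eval_nat_numeral)
  have e: "lc a b ((f # fs) @ [c]) = gr_bracket G ?k 1 (lc a b (fs @ [c])) (g f)"
    "lc b c ((f # fs) @ [a]) = gr_bracket G ?k 1 (lc b c (fs @ [a])) (g f)"
    "lc c a ((f # fs) @ [b]) = gr_bracket G ?k 1 (lc c a (fs @ [b])) (g f)"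
    using lc_Cons[of a b "fs @ [c]" f] lc_Cons[of b c "fs @ [a]" f] lc_Cons[of c a "fs @ [b]" f] assms f
    by (simp_all add: eval_nat_numeral)
  have l: "length (f # fs) + 3 = ?k + 1" by simp
  show ?case unfolding l e
    using h.hom_mult[OF A.m_closed[OF c(1,2)] c(3)] h.hom_mult[OF c(1,2)] h.hom_one Cons.IH[OF f(2)] by metis
qed

lemma lc_swap:
  assumes "a < n" "b < n" "set fs \<subseteq> {..<n}"
  shows "lc b a fs = inv\<^bsub>gr G (length fs + 2)\<^esub> lc a b fs"
  using assms(3)
proof (induction fs)
  case Nil
  interpret A: group "gr G 2" by (rule gr_group)
  have m: "lcg a b [] \<in> lcs G 2" "lcg b a [] \<in> lcs G 2" using lcg_lcs[of a b "[]"] lcg_lcs[of b a "[]"] assms by (simp_all add: numeral_2_eq_2)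
  have "lcg b a [] \<otimes> lcg a b [] = \<one>"
    using assms by (simp add: x_closed flip: inv_commutator[of "x a" "x b"])
  then have "lc b a [] \<otimes>\<^bsub>gr G 2\<^esub> lc a b [] = \<one>\<^bsub>gr G 2\<^esub>"
    using m by (simp add: lc_def cl_one numeral_2_eq_2 del: lcg.simps flip: cl_mult)
  then show ?case using A.inv_equality[of "lc b a []" "lc a b []"] lc_closed[of a b "[]"] lc_closed[of b a "[]"] assms by (simp add: numeral_2_eq_2)
next
  case (Cons f fs)
  then have f: "f < n" "set fs \<subseteq> {..<n}" by auto
  let ?k = "length fs + 2"
  interpret A: comm_group "gr G ?k" by (rule gr_comm_group) simp
  interpret B: comm_group "gr G (?k + 1)" by (rule gr_comm_group) simp
  interpret h: group_hom "gr G ?k" "gr G (?k + 1)" "\<lambda>A. gr_bracket G ?k 1 A (g f)"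
    by (intro group_homI A.is_group B.is_group lc_hom_Cons f(1)) simp
  have l: "length (f # fs) + 2 = ?k + 1" by simp
  show ?case unfolding l lc_Cons[OF assms(1,2) f(2,1)] lc_Cons[OF assms(2,1) f(2,1)] Cons.IH[OF f(2)]
    by (rule h.hom_inv[OF lc_closed[OF assms(1,2) f(2)]])
qed

lemma lc_self:
  assumes "a < n" "set fs \<subseteq> {..<n}"
  shows "lc a a fs = \<one>\<^bsub>gr G (length fs + 2)\<^esub>"
proof -
  have "lcg a a fs = \<one>" using assms(2)
  proof (induction fs)
    case Nil then show ?case using assms(1) by (simp add: commutator_def m_assoc cancel_assoc x_closed)
  next
    case (Cons f fs) then show ?case by (simp add: commutator_def x_closed)
  qed
  then show ?thesis by (simp add: lc_def cl_one)
qed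

end

subsection \<open>Injectivity of the leading coefficient map\<close>

lemma free_Abelian_group_UNIV: "free_Abelian_group UNIV = add_grp"
  by (simp add: free_Abelian_group_def add_grp_def)

lemma sum_fun_apply: "sum f A i = (\<Sum>a\<in>A. f a i)"
proof (induction A rule: infinite_finite_induct)
  case (insert x F) then show ?case by simp
next
  case (infinite A) then show ?case by (simp add: zero_fun_apply)
next
  case empty then show ?case by (simp add: zero_fun_apply)
qed

context magnus
begin

text \<open>\<open>bas k a M\<close> is the standard generator of degree \<open>k\<close> with leading monomial \<open>M\<close> in the \<open>a\<close>-th
  component of its image under \<open>J k\<close>, if there is one.\<close>

definition bas :: "nat \<Rightarrow> nat \<Rightarrow> nat multiset \<Rightarrow> 'a set" where
  "bas k a M =
    (if k = 1 then (if M = {#} \<and> a < n then g a else \<one>\<^bsub>gr G k\<^esub>)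
     else if M \<noteq> {#} \<and> set_mset M \<subseteq> {..<n} \<and> size M + 1 = k \<and> Min_mset M < a \<and> a < n
     then lc a (Min_mset M) (sorted_list_of_multiset (M - {#Min_mset M#}))
     else \<one>\<^bsub>gr G k\<^esub>)"

text \<open>\<open>bas\<close> lists the remaining indices in increasing order; by
  \<open>lc_perm\<close> any other order gives the same element, so only the minimality of
  \<open>m\<close> has to be known.\<close>

lemma bas_lc:
  assumes "m < a" "a < n" "set fs \<subseteq> {..<n}" "\<And>f. f \<in> set fs \<Longrightarrow> m \<le> f" "k = length fs + 2"
    "M = add_mset m (mset fs)"
  shows "bas k a M = lc a m fs"
proof -
  have m: "Min_mset M = m" unfolding assms(6) using assms(4) by (intro Min_eqI) auto
  have "lc a m fs = lc a m (sorted_list_of_multiset (M - {#m#}))"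
    by (rule lc_perm) (use assms in simp_all)
  then show ?thesis using assms m unfolding bas_def by simp
qed

lemma bas_closed: assumes "k \<ge> 1" shows "bas k a M \<in> carrier (gr G k)"
proof -
  interpret H: comm_group "gr G k" by (rule gr_comm_group[OF assms])
  let ?C = "M \<noteq> {#} \<and> set_mset M \<subseteq> {..<n} \<and> size M + 1 = k \<and> Min_mset M < a \<and> a < n"
  consider (1) "k = 1" | (2) "k \<noteq> 1" "\<not> ?C" | (3) "k \<noteq> 1" ?C by blast
  then show ?thesis
  proof cases
    case 1
    then show ?thesis unfolding bas_def using g_closed[of a] H.one_closed
      by (cases "M = {#} \<and> a < n") simp_all
  next
    case 2
    have "bas k a M = \<one>\<^bsub>gr G k\<^esub>" unfolding bas_def if_not_P[OF 2(1)] by (rule if_not_P[OF 2(2)])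
    then show ?thesis by simp
  next
    case 3
    let ?fs = "sorted_list_of_multiset (M - {#Min_mset M#})"
    have m: "Min_mset M \<in># M" using 3(2) by simp
    have "M \<noteq> {#}" using 3(2) by blast
    then have "size M \<noteq> 0" by simp
    moreover have "length ?fs = size M - 1"
      using m by (metis mset_sorted_list_of_multiset size_Diff_singleton size_mset)
    ultimately have l: "length ?fs + 2 = k" using 3(2) by linarith
    have "lc a (Min_mset M) ?fs \<in> carrier (gr G (length ?fs + 2))"
    proof (rule lc_closed)
      show "Min_mset M < n" using m 3(2) by blast
      show "set ?fs \<subseteq> {..<n}" using 3(2) by (auto dest: in_diffD)
    qed (use 3(2) in blast)
    moreover have "bas k a M = lc a (Min_mset M) ?fs" unfolding bas_def if_not_P[OF 3(1)] by (rule if_P[OF 3(2)])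
    ultimately show ?thesis using l by simp
  qed
qed

text \<open>The candidate left inverse of \<open>J k\<close>. It is defined on all tuples by reading
  off monomials, and its values away from the image of \<open>J k\<close> carry no meaning.\<close>

definition Linv :: "nat \<Rightarrow> (nat \<Rightarrow> poly) \<Rightarrow> 'a set" where
  "Linv k p = finprod (gr G k) (\<lambda>a. frag_hom (gr G k) (bas k a) (p a)) {..<n}"

context
  fixes k :: nat assumes k: "k \<ge> 1"
begin

interpretation H: comm_group "gr G k" by (rule gr_comm_group[OF k])

lemma bas_hom: "frag_hom (gr G k) (bas k a) \<in> hom add_grp (gr G k)"
  using H.frag_hom_hom[of "bas k a" UNIV] bas_closed[OF k] by (simp add: free_Abelian_group_UNIV)

lemma Linv_hom: "Linv k \<in> hom add_grp (gr G k)"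
  unfolding Linv_def
proof (rule finprod_hom[OF H.comm_group_axioms group_add_grp])
  fix a
  have "(\<lambda>p. p a) \<in> hom (add_grp :: (nat \<Rightarrow> poly) monoid) add_grp" by (rule homI) simp_all
  from Group.hom_compose[OF this bas_hom[of a]]
  show "(\<lambda>p. frag_hom (gr G k) (bas k a) (p a)) \<in> hom add_grp (gr G k)" by (simp add: comp_def)
qed

lemma Linv_e: "a < n \<Longrightarrow> Linv k (\<lambda>i. q * e a i) = frag_hom (gr G k) (bas k a) q"
proof -
  assume a: "a < n"
  interpret b: group_hom add_grp "gr G k" "frag_hom (gr G k) (bas k i)" for i
    by (intro group_homI group_add_grp H.is_group bas_hom)
  have "Linv k (\<lambda>i. q * e a i) = finprod (gr G k) (\<lambda>i. if a = i then frag_hom (gr G k) (bas k i) q else \<one>\<^bsub>gr G k\<^esub>) {..<n}"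
    unfolding Linv_def
    by (rule H.finprod_cong') (use b.hom_one b.hom_closed in \<open>auto simp: e_def\<close>)
  also have "\<dots> = frag_hom (gr G k) (bas k a) q"
    by (rule H.finprod_singleton) (use a b.hom_closed in auto)
  finally show ?thesis .
qed

lemma frag_hom_bas: "frag_hom (gr G k) (bas k a) (frag_of M) = bas k a M"
  by (rule H.frag_hom_of[where g = "bas k a", OF bas_closed[OF k]])

end

text \<open>The left-hand side is what \<open>Linv\<close> makes of the leading coefficients of the
  left-normed generator on the right. If the pair \<open>(a, b)\<close> contains the least of all
  indices, one factor is trivial and the other is the generator or its inverse. Otherwise the Jacobi
  identity brings the least index into the pair, and its two other terms are precisely the two
  standard generators.\<close>

lemma bas_straighten:
  assumes "a < n" "b < n" "set fs \<subseteq> {..<n}" "k = length fs + 2"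
  shows "bas k a (add_mset b (mset fs)) \<otimes>\<^bsub>gr G k\<^esub> inv\<^bsub>gr G k\<^esub> bas k b (add_mset a (mset fs)) = lc a b fs"
proof -
  have k: "k \<ge> 1" using assms(4) by simp
  interpret H: comm_group "gr G k" by (rule gr_comm_group[OF k])
  note bc = bas_closed[OF k]
  have *: "bas k a (add_mset b (mset fs)) \<otimes>\<^bsub>gr G k\<^esub> inv\<^bsub>gr G k\<^esub> bas k b (add_mset a (mset fs)) = lc a b fs"
    if ab: "b < a" "a < n" "b < n" for a b
  proof (cases "\<exists>f\<in>set fs. f < b")
    case True
    define m where "m = Min (set fs)"
    have "set fs \<noteq> {}" using True by auto
    then have mfs: "m \<in> set fs" "\<And>f. f \<in> set fs \<Longrightarrow> m \<le> f" by (auto simp: m_def)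
    then have m: "m < b" "m < n" using True assms(3) by fastforce+
    obtain us vs where fs: "fs = us @ m # vs" using mfs(1) by (meson split_list)
    define gs where "gs = us @ vs"
    have gs: "mset fs = add_mset m (mset gs)" "set gs \<subseteq> {..<n}" "\<And>f. f \<in> set gs \<Longrightarrow> m \<le> f" "length fs = length gs + 1"
      using assms(3) mfs(2) unfolding fs gs_def by auto
    have kk: "length gs + 3 = k" using assms(4) gs(4) by simp
    have x1: "bas k a (add_mset b (mset fs)) = lc a m (gs @ [b])"
      by (rule bas_lc) (use m ab gs kk in auto)
    have x2: "bas k b (add_mset a (mset fs)) = lc b m (gs @ [a])"
      by (rule bas_lc) (use m ab gs kk in auto)
    have x3: "lc a b fs = lc a b (gs @ [m])"
      by (rule lc_perm) (use ab assms gs in auto)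
    have c: "lc a b (gs @ [m]) \<in> carrier (gr G k)" "lc b m (gs @ [a]) \<in> carrier (gr G k)" "lc m a (gs @ [b]) \<in> carrier (gr G k)"
      using lc_closed[of a b "gs @ [m]"] lc_closed[of b m "gs @ [a]"] lc_closed[of m a "gs @ [b]"] ab m gs kk
      by (simp_all add: eval_nat_numeral)
    have x4: "lc a m (gs @ [b]) = inv\<^bsub>gr G k\<^esub> lc m a (gs @ [b])"
      using lc_swap[of m a "gs @ [b]"] ab m gs kk by (simp add: eval_nat_numeral)
    have "lc a b (gs @ [m]) \<otimes>\<^bsub>gr G k\<^esub> (lc b m (gs @ [a]) \<otimes>\<^bsub>gr G k\<^esub> lc m a (gs @ [b])) = \<one>\<^bsub>gr G k\<^esub>"
      using lc_jacobi[of a b m gs] ab m gs c unfolding kk by (simp add: H.m_assoc)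
    then have "lc a b (gs @ [m]) = inv\<^bsub>gr G k\<^esub> (lc b m (gs @ [a]) \<otimes>\<^bsub>gr G k\<^esub> lc m a (gs @ [b]))"
      using H.inv_equality c H.m_closed by metis
    also have "\<dots> = inv\<^bsub>gr G k\<^esub> lc m a (gs @ [b]) \<otimes>\<^bsub>gr G k\<^esub> inv\<^bsub>gr G k\<^esub> lc b m (gs @ [a])"
      using c by (simp add: H.inv_mult H.m_comm)
    finally show ?thesis unfolding x1 x2 x3 x4 by simp
  next
    case False
    then have f: "\<And>f. f \<in> set fs \<Longrightarrow> b \<le> f" by force
    have x1: "bas k a (add_mset b (mset fs)) = lc a b fs"
      by (rule bas_lc) (use ab f assms in auto)
    \<comment> \<open>No index of this multiset is below \<open>b\<close>, so there is no standard
      generator for it in position \<open>b\<close> and \<open>bas\<close> takes its default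
      value.\<close>
    have "b \<le> Min_mset (add_mset a (mset fs))"
      using f ab by (intro Min.boundedI) auto
    then have x2: "bas k b (add_mset a (mset fs)) = \<one>\<^bsub>gr G k\<^esub>"
    proof -
      have n: "\<not> Min_mset (add_mset a (mset fs)) < b" and k1: "k \<noteq> 1" using \<open>b \<le> _\<close> assms(4) by linarith+
      show ?thesis unfolding bas_def if_not_P[OF k1] by (rule if_not_P) (use n in blast)
    qed
    show ?thesis unfolding x1 x2 using lc_closed[OF ab(2,3) assms(3)] assms(4) H.inv_one H.r_one by metis
  qed
  consider "b < a" | "a < b" | "a = b" by linarith
  then show ?thesis
  proof cases
    case 1 then show ?thesis using assms by (intro *)
  next
    case 2
    have "lc a b fs = inv\<^bsub>gr G k\<^esub> lc b a fs" using lc_swap[OF assms(2,1,3)] assms(4) by simp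
    also have "lc b a fs = bas k b (add_mset a (mset fs)) \<otimes>\<^bsub>gr G k\<^esub> inv\<^bsub>gr G k\<^esub> bas k a (add_mset b (mset fs))"
      using 2 assms by (intro *[symmetric])
    also have "inv\<^bsub>gr G k\<^esub> \<dots> = bas k a (add_mset b (mset fs)) \<otimes>\<^bsub>gr G k\<^esub> inv\<^bsub>gr G k\<^esub> bas k b (add_mset a (mset fs))"
      using bc by (simp add: H.inv_mult H.m_comm)
    finally show ?thesis by simp
  next
    case 3
    have "lc a b fs = \<one>\<^bsub>gr G k\<^esub>" using lc_self[OF assms(1,3)] assms(4) 3 by simp
    then show ?thesis using bc 3 by (simp add: H.r_inv)
  qed
qed

lemma Linv_lc:
  assumes "a < n" "b < n" "set fs \<subseteq> {..<n}" "k = length fs + 2"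
  shows "Linv k (J k (lc a b fs)) = lc a b fs"
proof -
  have k: "k \<ge> 1" using assms(4) by simp
  interpret H: comm_group "gr G k" by (rule gr_comm_group[OF k])
  interpret L: group_hom add_grp "gr G k" "Linv k"
    by (intro group_homI group_add_grp H.is_group Linv_hom[OF k])
  let ?p = "\<lambda>i. frag_of (add_mset b (mset fs)) * e a i" and ?q = "\<lambda>i. frag_of (add_mset a (mset fs)) * e b i"
  have "J k (lc a b fs) = ?p + (- ?q)"
    using J_lc[OF assms(1-3)] unfolding assms(4)
    by (simp add: v_eq assms fun_eq_iff right_diff_distrib mult.assoc[symmetric] X_def mult_single)
  then have "Linv k (J k (lc a b fs)) = Linv k ?p \<otimes>\<^bsub>gr G k\<^esub> inv\<^bsub>gr G k\<^esub> Linv k ?q"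
    using L.hom_mult[of ?p "- ?q"] L.hom_inv[of ?q] by simp
  also have "\<dots> = lc a b fs"
    unfolding Linv_e[OF k assms(1)] Linv_e[OF k assms(2)] frag_hom_bas[OF k] by (rule bas_straighten[OF assms])
  finally show ?thesis .
qed

text \<open>Both sides are homomorphisms in \<open>A\<close>, so it is enough to take the generators
  of degree one, respectively the left-normed ones treated by \<open>Linv_lc\<close>.\<close>

lemma Linv_J: assumes k: "k \<ge> 1" and A: "A \<in> carrier (gr G k)" shows "Linv k (J k A) = A"
proof -
  interpret H: comm_group "gr G k" by (rule gr_comm_group[OF k])
  have h: "(\<lambda>A. Linv k (J k A)) \<in> hom (gr G k) (gr G k)"
    using Group.hom_compose[OF J_hom'[OF k] Linv_hom[OF k]] by (simp add: comp_def)
  have i: "(\<lambda>A. A) \<in> hom (gr G k) (gr G k)" by (simp add: hom_def)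
  show ?thesis
  proof (cases "k = 1")
    case True
    have K: "g ` {..<n} \<subseteq> carrier (gr G k)" unfolding True using g_closed by blast
    have e: "Linv k (J k B) = B" if B: "B \<in> g ` {..<n}" for B
    proof -
      obtain j where j: "j < n" "B = g j" using B by auto
      have "J k B = (\<lambda>i. frag_of {#} * e j i)" unfolding True j(2) J_g[OF j(1)] by (simp add: single_one)
      then have "Linv k (J k B) = bas k j {#}"
        by (simp only: Linv_e[OF k j(1)] frag_hom_bas[OF k])
      also have "\<dots> = B" by (simp only: bas_def True j if_True simp_thms)
      finally show ?thesis .
    qed
    have "A \<in> generate (gr G k) (g ` {..<n})" using A unfolding True gr_1_generate .
    then show ?thesis
      using hom_eq_on_generate[where f = "\<lambda>A. Linv k (J k A)" and g = "\<lambda>A. A", OF H.is_group H.is_group h i K e]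
      by blast
  next
    case False
    let ?K = "{lc a b fs | a b fs. a < n \<and> b < n \<and> set fs \<subseteq> {..<n} \<and> length fs + 2 = k}"
    have K: "?K \<subseteq> carrier (gr G k)" using lc_closed by blast
    have e: "Linv k (J k B) = B" if B: "B \<in> ?K" for B
    proof -
      obtain a b fs where f: "B = lc a b fs" "a < n" "b < n" "set fs \<subseteq> {..<n}" "k = length fs + 2" using B by blast
      show ?thesis unfolding f(1) by (rule Linv_lc[OF f(2-5)])
    qed
    have "k \<ge> 2" using k False by linarith
    then have "A \<in> generate (gr G k) ?K" using gr_generate[of k] A by blast
    then show ?thesis
      using hom_eq_on_generate[where f = "\<lambda>A. Linv k (J k A)" and g = "\<lambda>A. A", OF H.is_group H.is_group h i K e]
      by blast
  qed
qed

lemma J_inj: "k \<ge> 1 \<Longrightarrow> inj_on (J k) (carrier (gr G k))"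
  by (rule inj_on_inverseI) (rule Linv_J)

lemma J_eq_0: "k \<ge> 1 \<Longrightarrow> A \<in> carrier (gr G k) \<Longrightarrow> J k A = 0 \<longleftrightarrow> A = \<one>\<^bsub>gr G k\<^esub>"
proof
  assume k: "k \<ge> 1" and A: "A \<in> carrier (gr G k)"
  interpret H: comm_group "gr G k" by (rule gr_comm_group[OF k])
  assume "J k A = 0"
  then show "A = \<one>\<^bsub>gr G k\<^esub>" using inj_onD[OF J_inj[OF k], of A "\<one>\<^bsub>gr G k\<^esub>"] A J_simps(1)[OF k] H.one_closed by simp
qed (simp add: J_simps)

subsection \<open>The image of the leading coefficient map\<close>

definition Mon :: "nat \<Rightarrow> nat multiset set" where
  "Mon d = {M. set_mset M \<subseteq> {..<n} \<and> size M = d}"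

text \<open>Working with the image itself gives access to the generators from
  \<open>gr_generate\<close>; membership in the kernel of \<open>theta\<close> is derived from it in
  \<open>theta_J\<close>.\<close>

definition B :: "nat \<Rightarrow> (nat \<Rightarrow> poly) set" where
  "B k = J k ` carrier (gr G k)"

lemma B_subgroup: "k \<ge> 1 \<Longrightarrow> subgroup (B k) add_grp"
proof -
  assume k: "k \<ge> 1"
  interpret h: group_hom "gr G k" add_grp "J k" by (intro group_homI gr_group group_add_grp J_hom'[OF k])
  show ?thesis unfolding B_def by (rule h.img_is_subgroup)
qed

lemma B_closed:
  assumes "k \<ge> 1"
  shows "0 \<in> B k" "p \<in> B k \<Longrightarrow> q \<in> B k \<Longrightarrow> p + q \<in> B k" "p \<in> B k \<Longrightarrow> - p \<in> B k"
    "p \<in> B k \<Longrightarrow> q \<in> B k \<Longrightarrow> p - q \<in> B k"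
proof -
  note s = B_subgroup[OF assms]
  show "0 \<in> B k" using subgroup.one_closed[OF s] by simp
  show 1: "p + q \<in> B k" if "p \<in> B k" "q \<in> B k" for p q using subgroup.m_closed[OF s that] by simp
  show 2: "- p \<in> B k" if "p \<in> B k" for p using subgroup.m_inv_closed[OF s that] by simp
  show "p - q \<in> B k" if "p \<in> B k" "q \<in> B k" using 1[OF that(1) 2[OF that(2)]] by simp
qed

lemma B_sum: "k \<ge> 1 \<Longrightarrow> (\<And>j. j \<in> A \<Longrightarrow> f j \<in> B k) \<Longrightarrow> sum f A \<in> B k"
  by (induction A rule: infinite_finite_induct) (simp_all add: B_closed)

text \<open>An induction principle for the image of \<open>J k\<close>. It is applied to the kernel
  of \<open>theta\<close>, to tuples of homogeneous polynomials, and to the tuples that may occur as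
  a row of a matrix in a given subgroup.\<close>

lemma J_hom_in:
  assumes "k \<ge> 1" "subgroup S add_grp" "A \<in> carrier (gr G k)"
    and "k = 1 \<Longrightarrow> \<forall>i<n. e i \<in> S"
    and "k \<ge> 2 \<Longrightarrow> \<forall>M\<in>Mon (k - 2). \<forall>a<n. \<forall>b<n. (\<lambda>i. frag_of M * v a b i) \<in> S"
  shows "J k A \<in> S"
proof (cases "k = 1")
  case True
  show ?thesis
  proof (rule hom_image_in_subgroup[OF gr_group group_add_grp J_hom'[OF assms(1)] _ assms(2)])
    show "A \<in> generate (gr G k) (g ` {..<n})" using gr_1_generate assms(3) True by simp
    show "g ` {..<n} \<subseteq> carrier (gr G k)" using g_closed True by auto
    show "J k y \<in> S" if y: "y \<in> g ` {..<n}" for y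
    proof -
      obtain j where "j < n" "y = g j" using y by auto
      then show ?thesis using J_g[of j] assms(4) True by simp
    qed
  qed
next
  case False
  let ?K = "{lc a b fs | a b fs. a < n \<and> b < n \<and> set fs \<subseteq> {..<n} \<and> length fs + 2 = k}"
  have k: "k \<ge> 2" using False assms(1) by simp
  show ?thesis
  proof (rule hom_image_in_subgroup[OF gr_group group_add_grp J_hom'[OF assms(1)] _ assms(2)])
    show "A \<in> generate (gr G k) ?K" using gr_generate[OF k] assms(3) by simp
    show "?K \<subseteq> carrier (gr G k)" using lc_closed by blast
    show "J k y \<in> S" if y: "y \<in> ?K" for y
    proof -
      obtain a b fs where f: "y = lc a b fs" "a < n" "b < n" "set fs \<subseteq> {..<n}" "length fs + 2 = k" using y by blast
      have "mset fs \<in> Mon (k - 2)" using f by (auto simp: Mon_def)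
      then show ?thesis using assms(5)[OF k] f J_lc[OF f(2-4)] by auto
    qed
  qed
qed

lemma theta_J:
  assumes "k \<ge> 2" "A \<in> carrier (gr G k)"
  shows "theta n (J k A) = 0"
proof -
  have h: "theta n \<in> hom (add_grp :: (nat \<Rightarrow> poly) monoid) add_grp"
    by (rule homI) (simp_all add: plus_fun_def theta_linear)
  interpret t: group_hom add_grp add_grp "theta n" by (intro group_homI group_add_grp h)
  have "J k A \<in> kernel add_grp add_grp (theta n)"
  proof (rule J_hom_in[OF _ t.subgroup_kernel assms(2)])
    show "\<forall>M\<in>Mon (k - 2). \<forall>a<n. \<forall>b<n. (\<lambda>i. frag_of M * v a b i) \<in> kernel add_grp add_grp (theta n)"
      by (simp add: kernel_def theta_linear v_def theta_brc)
  qed (use assms in auto)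
  then show ?thesis by (simp add: kernel_def)
qed

lemma keys_mult_single:
  "Poly_Mapping.keys (frag_of M * (q :: poly)) \<subseteq> (\<lambda>N. M + N) ` Poly_Mapping.keys q"
proof
  fix N assume "N \<in> Poly_Mapping.keys (frag_of M * q)"
  then obtain a b where "N = a + b" "a \<in> Poly_Mapping.keys (frag_of M)" "b \<in> Poly_Mapping.keys q"
    using keys_mult[of "frag_of M" q] by blast
  then show "N \<in> (\<lambda>N. M + N) ` Poly_Mapping.keys q" by simp
qed

text \<open>The type \<open>poly\<close> carries no grading; this recovers the degree on which
  \<open>B_matrix\<close> relies.\<close>

lemma J_homogeneous:
  assumes "k \<ge> 1" "A \<in> carrier (gr G k)"
  shows "Poly_Mapping.keys (J k A i) \<subseteq> Mon (k - 1)"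
proof -
  let ?S = "{p :: nat \<Rightarrow> poly. Poly_Mapping.keys (p i) \<subseteq> Mon (k - 1)}"
  have "subgroup ?S add_grp"
  proof (rule group.subgroupI[OF group_add_grp])
    have "0 \<in> ?S" by (simp add: zero_fun_def)
    then show "?S \<noteq> {}" by blast
    show "p \<otimes>\<^bsub>add_grp\<^esub> q \<in> ?S" if "p \<in> ?S" "q \<in> ?S" for p q
      using that order_trans[OF keys_add[of "p i" "q i"]] by simp
    show "inv\<^bsub>add_grp\<^esub> p \<in> ?S" if "p \<in> ?S" for p using that by simp
  qed simp
  then have "J k A \<in> ?S"
  proof (rule J_hom_in[OF assms(1) _ assms(2)])
    assume "k = 1"
    then show "\<forall>j<n. e j \<in> ?S" by (auto simp: e_def Mon_def keys_one)
  next
    assume k: "k \<ge> 2"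
    show "\<forall>M\<in>Mon (k - 2). \<forall>a<n. \<forall>b<n. (\<lambda>i. frag_of M * v a b i) \<in> ?S"
    proof (intro ballI allI impI CollectI)
      fix M a b assume M: "M \<in> Mon (k - 2)" and ab: "a < n" "b < n"
      have "Poly_Mapping.keys (v a b i) \<subseteq> {{#b#}, {#a#}}"
        unfolding v_eq[OF ab] by (rule order_trans[OF keys_diff]) (auto simp: e_def X_def)
      then have "Poly_Mapping.keys (frag_of M * v a b i) \<subseteq> (\<lambda>N. M + N) ` {{#b#}, {#a#}}"
        using keys_mult_single[of M "v a b i"] by blast
      also have "\<dots> \<subseteq> Mon (k - 1)" using M ab k by (auto simp: Mon_def)
      finally show "Poly_Mapping.keys (frag_of M * v a b i) \<subseteq> Mon (k - 1)" .
    qed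
  qed
  then show ?thesis by simp
qed

text \<open>From degree 2 on \<open>theta\<close> vanishes on the image, so the bracket with the
  generator \<open>j\<close> is multiplication by \<open>X j\<close>; hence the image is stable
  under all variables.\<close>

lemma B_mono_mult:
  assumes "k \<ge> 2" "p \<in> B k" "set_mset M \<subseteq> {..<n}"
  shows "(\<lambda>i. frag_of M * p i) \<in> B (k + size M)"
  using assms(3)
proof (induction M)
  case empty then show ?case using assms(2) by (simp add: single_one)
next
  case (add j M)
  let ?l = "k + size M"
  have j: "j < n" using add.prems by simp
  obtain A where A: "A \<in> carrier (gr G ?l)" "(\<lambda>i. frag_of M * p i) = J ?l A"
    using add by (auto simp: B_def)
  have "J (?l + 1) (gr_bracket G ?l 1 A (g j)) = brc n (J ?l A) (e j)"
    by (subst J_bracket[OF _ _ A(1) g_closed[OF j]]) (use assms(1) in \<open>simp, simp, simp only: J_g[OF j]\<close>)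
  also have "\<dots> = (\<lambda>i. frag_of (add_mset j M) * p i)"
    using theta_J[OF _ A(1)] assms(1)
    by (simp add: brc_def theta_e[OF j] A(2)[symmetric] X_def mult.assoc[symmetric] mult_single)
  finally have "(\<lambda>i. frag_of (add_mset j M) * p i) = J (?l + 1) (gr_bracket G ?l 1 A (g j))" by simp
  moreover have "gr_bracket G ?l 1 A (g j) \<in> carrier (gr G (?l + 1))"
    by (rule hom_in_carrier[OF lc_hom_Cons[OF j] A(1)]) (use assms(1) in simp)
  ultimately show ?case by (auto simp: B_def)
qed

lemma B_poly_mult:
  assumes "k \<ge> 2" "p \<in> B k" "Poly_Mapping.keys q \<subseteq> Mon d"
  shows "(\<lambda>i. q * p i) \<in> B (k + d)"
proof (rule free_Abelian_group_induct[OF assms(3), of "\<lambda>q. (\<lambda>i. q * p i) \<in> B (k + d)"])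
  have k: "k + d \<ge> 1" using assms(1) by simp
  show "(\<lambda>i. 0 * p i) \<in> B (k + d)" using B_closed(1)[OF k] by (simp add: zero_fun_apply)
  show "(\<lambda>i. (x - y) * p i) \<in> B (k + d)" if "(\<lambda>i. x * p i) \<in> B (k + d)" "(\<lambda>i. y * p i) \<in> B (k + d)" for x y
    using B_closed(4)[OF k that] by (simp add: fun_diff_def left_diff_distrib)
  show "(\<lambda>i. frag_of M * p i) \<in> B (k + d)" if "M \<in> Mon d" for M
    using B_mono_mult[OF assms(1,2), of M] that by (simp add: Mon_def)
qed

text \<open>Component \<open>j\<close> of an element of degree \<open>m\<close> is homogeneous of
  degree \<open>m - 1\<close>; multiplied into the row \<open>P j\<close>, which has degree
  \<open>k + 1\<close>, it gives degree \<open>m + k\<close>. So extending prescribed values on the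
  generators linearly over polynomials does not leave the Chen algebra.\<close>

lemma B_matrix:
  assumes "k \<ge> 1" "m \<ge> 1" "\<And>j. j < n \<Longrightarrow> P j \<in> B (k + 1)" "A \<in> carrier (gr G m)"
  shows "(\<lambda>i. \<Sum>j<n. P j i * J m A j) \<in> B (m + k)"
proof -
  have "(\<lambda>i. J m A j * P j i) \<in> B (m + k)" if "j < n" for j
    using B_poly_mult[OF _ assms(3)[OF that] J_homogeneous[OF assms(2,4), of j]] assms(1,2)
    by (simp add: add.commute)
  then have "(\<Sum>j<n. (\<lambda>i. J m A j * P j i)) \<in> B (m + k)"
    using assms(1) by (intro B_sum) simp_all
  moreover have "(\<Sum>j<n. (\<lambda>i. J m A j * P j i)) = (\<lambda>i. \<Sum>j<n. P j i * J m A j)"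
    by (rule ext) (simp only: sum_fun_apply mult.commute)
  ultimately show ?thesis by simp
qed

end

section \<open>Graded sums\<close>

lemma lie_of_simps [simp]:
  "carrier (lie_of G br) = carrier G" "x \<otimes>\<^bsub>lie_of G br\<^esub> y = x \<otimes>\<^bsub>G\<^esub> y"
  "\<one>\<^bsub>lie_of G br\<^esub> = \<one>\<^bsub>G\<^esub>" "bracket (lie_of G br) = br"
  by (simp_all add: lie_of_def monoid.defs lie.defs)

lemma comm_group_lie_of: assumes "comm_group G" shows "comm_group (lie_of G br)"
proof -
  interpret G: comm_group G by fact
  show ?thesis
  proof (rule comm_groupI; unfold lie_of_simps)
    show "\<exists>y\<in>carrier G. y \<otimes>\<^bsub>G\<^esub> x = \<one>\<^bsub>G\<^esub>" if "x \<in> carrier G" for x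
      using G.l_inv[OF that] G.inv_closed[OF that] by blast
  qed (simp_all add: G.m_ac)
qed

lemma sum_group_comm:
  assumes "\<And>i. i \<in> I \<Longrightarrow> comm_group (G i)"
  shows "comm_group (sum_group I G)"
proof (rule group.group_comm_groupI)
  have g: "\<And>i. i \<in> I \<Longrightarrow> group (G i)" using assms comm_group.axioms(2) by blast
  show "group (sum_group I G)" by (rule sum_group[OF g])
  fix x y assume "x \<in> carrier (sum_group I G)" "y \<in> carrier (sum_group I G)"
  then have "x i \<in> carrier (G i)" "y i \<in> carrier (G i)" if "i \<in> I" for i
    using that by (auto simp: carrier_sum_group[OF g])
  then show "x \<otimes>\<^bsub>sum_group I G\<^esub> y = y \<otimes>\<^bsub>sum_group I G\<^esub> x"
    unfolding mult_sum_group using comm_monoid.m_comm[OF comm_group.axioms(1)[OF assms]]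
    by (intro restrict_ext) blast
qed

locale group_family =
  fixes I :: "nat set" and G :: "nat \<Rightarrow> 'a monoid"
  assumes grp: "\<And>i. i \<in> I \<Longrightarrow> comm_group (G i)"
begin

lemma grp': "i \<in> I \<Longrightarrow> group (G i)"
  using grp comm_group.axioms(2) by blast

lemma carrier_iff: "x \<in> carrier (sum_group I G) \<longleftrightarrow>
   (\<forall>i\<in>I. x i \<in> carrier (G i)) \<and> x \<in> extensional I \<and> finite {i \<in> I. x i \<noteq> \<one>\<^bsub>G i\<^esub>}"
  by (auto simp: carrier_sum_group[OF grp'] PiE_iff)

lemma homog_closed: "k \<in> I \<Longrightarrow> a \<in> carrier (G k) \<Longrightarrow> homog I G k a \<in> carrier (sum_group I G)"
proof -
  assume k: "k \<in> I" and a: "a \<in> carrier (G k)"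
  have "{i \<in> I. homog I G k a i \<noteq> \<one>\<^bsub>G i\<^esub>} \<subseteq> {k}" by (auto simp: homog_def)
  then have "finite {i \<in> I. homog I G k a i \<noteq> \<one>\<^bsub>G i\<^esub>}" by (rule finite_subset) simp
  moreover have "homog I G k a i \<in> carrier (G i)" if "i \<in> I" for i
    using that a monoid.one_closed[OF group.is_monoid[OF grp'[OF that]]] by (simp add: homog_def)
  ultimately show ?thesis unfolding carrier_iff by (simp add: homog_def)
qed

lemma homog_hom: "k \<in> I \<Longrightarrow> homog I G k \<in> hom (G k) (sum_group I G)"
proof (rule homI)
  assume k: "k \<in> I"
  show "homog I G k a \<in> carrier (sum_group I G)" if "a \<in> carrier (G k)" for a
    by (rule homog_closed[OF k that])
  show "homog I G k (a \<otimes>\<^bsub>G k\<^esub> b) = homog I G k a \<otimes>\<^bsub>sum_group I G\<^esub> homog I G k b" for a b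
    unfolding mult_sum_group homog_def
    by (rule restrict_ext)
      (simp add: monoid.l_one[OF group.is_monoid[OF grp']] monoid.one_closed[OF group.is_monoid[OF grp']])
qed

text \<open>Induction on the support, splitting off one component at a time. Premise
  \<open>h\<close> concerns only nontrivial components, so a predicate can rule out a degree by
  demanding triviality there; \<open>phi_kernel\<close> does so in degree one.\<close>

lemma sum_group_subset:
  assumes S: "subgroup S (sum_group I G)"
    and h: "\<And>k a. k \<in> I \<Longrightarrow> a \<in> carrier (G k) \<Longrightarrow> a \<noteq> \<one>\<^bsub>G k\<^esub> \<Longrightarrow> P k a \<Longrightarrow> homog I G k a \<in> S"
    and x: "x \<in> carrier (sum_group I G)" and P: "\<And>k. k \<in> I \<Longrightarrow> P k (x k)"
  shows "x \<in> S"
proof -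
  let ?supp = "\<lambda>x. {i \<in> I. x i \<noteq> \<one>\<^bsub>G i\<^esub>}"
  have "x \<in> S" if "finite A" "x \<in> carrier (sum_group I G)" "?supp x = A" "\<And>k. k \<in> A \<Longrightarrow> P k (x k)" for A x
    using that
  proof (induction A arbitrary: x rule: finite_induct)
    case empty
    have "x = \<one>\<^bsub>sum_group I G\<^esub>"
    proof (rule extensionalityI)
      show "x \<in> extensional I" using empty.prems(1) unfolding carrier_iff by blast
      show "\<one>\<^bsub>sum_group I G\<^esub> \<in> extensional I" by simp
      show "x i = \<one>\<^bsub>sum_group I G\<^esub> i" if "i \<in> I" for i using empty.prems(2) that by auto
    qed
    then show ?case using subgroup.one_closed[OF S] by metis
  next
    case (insert k A)
    note xc = insert.prems(1)[unfolded carrier_iff]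
    have k: "k \<in> I" "x k \<noteq> \<one>\<^bsub>G k\<^esub>" using insert.prems(2) by blast+
    define y where "y = (\<lambda>i\<in>I. if i = k then \<one>\<^bsub>G i\<^esub> else x i)"
    have sy: "?supp y = A" using insert.prems(2) insert.hyps(2) unfolding y_def by auto
    have "y i \<in> carrier (G i)" if "i \<in> I" for i
      using that xc monoid.one_closed[OF group.is_monoid[OF grp'[OF that]]] by (cases "i = k") (auto simp: y_def)
    then have yc: "y \<in> carrier (sum_group I G)"
      unfolding carrier_iff using sy insert.hyps(1) by (simp add: y_def)
    have yS: "y \<in> S"
    proof (rule insert.IH[OF yc sy])
      fix i assume "i \<in> A"
      then have "y i = x i" "i \<in> insert k A" using insert.hyps(2) sy unfolding y_def by auto
      then show "P i (y i)" using insert.prems(3)[of i] by simp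
    qed
    have "x = homog I G k (x k) \<otimes>\<^bsub>sum_group I G\<^esub> y"
    proof (rule extensionalityI)
      show "x \<in> extensional I" using xc by blast
      show "homog I G k (x k) \<otimes>\<^bsub>sum_group I G\<^esub> y \<in> extensional I" by simp
      fix i assume i: "i \<in> I"
      interpret Gi: group "G i" by (rule grp'[OF i])
      have xi: "x i \<in> carrier (G i)" using i xc by blast
      show "x i = (homog I G k (x k) \<otimes>\<^bsub>sum_group I G\<^esub> y) i"
        using i Gi.r_one[OF xi] Gi.l_one[OF xi] by (cases "i = k") (auto simp: homog_def y_def)
    qed
    moreover have "homog I G k (x k) \<in> S"
      by (rule h[OF k(1) _ k(2) insert.prems(3)]) (use xc k in auto)
    ultimately show ?case using subgroup.m_closed[OF S _ yS] by metis
  qed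
  then show ?thesis using x P unfolding carrier_iff by blast
qed

end

lemma graded_sum_simps:
  "carrier (graded_sum G br) = carrier (sum_group {1..} G)"
  "x \<otimes>\<^bsub>graded_sum G br\<^esub> y = x \<otimes>\<^bsub>sum_group {1..} G\<^esub> y"
  "\<one>\<^bsub>graded_sum G br\<^esub> = \<one>\<^bsub>sum_group {1..} G\<^esub>"
  "bracket (graded_sum G br) x y =
     (\<lambda>m\<in>{1..}. finprod (G m) (\<lambda>i. br i (m - i) (x i) (y (m - i))) {1..<m})"
  by (simp_all add: graded_sum_def)

text \<open>Finite support: if \<open>x\<close> is trivial above degree \<open>a\<close> and
  \<open>y\<close> above degree \<open>b\<close>, then in degrees above \<open>a + b\<close> every
  term of the bracket has a trivial argument.\<close>

lemma graded_sum_bracket_closed: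
  assumes G: "\<And>i. i \<ge> 1 \<Longrightarrow> comm_group (G i)"
    and br: "\<And>i j x y. i \<ge> 1 \<Longrightarrow> j \<ge> 1 \<Longrightarrow> x \<in> carrier (G i) \<Longrightarrow> y \<in> carrier (G j) \<Longrightarrow> br i j x y \<in> carrier (G (i + j))"
    and one: "\<And>i j x. i \<ge> 1 \<Longrightarrow> j \<ge> 1 \<Longrightarrow> x \<in> carrier (G i) \<Longrightarrow> br i j x \<one>\<^bsub>G j\<^esub> = \<one>\<^bsub>G (i + j)\<^esub>"
      "\<And>i j y. i \<ge> 1 \<Longrightarrow> j \<ge> 1 \<Longrightarrow> y \<in> carrier (G j) \<Longrightarrow> br i j \<one>\<^bsub>G i\<^esub> y = \<one>\<^bsub>G (i + j)\<^esub>"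
    and x: "x \<in> carrier (graded_sum G br)" and y: "y \<in> carrier (graded_sum G br)"
  shows "bracket (graded_sum G br) x y \<in> carrier (graded_sum G br)"
proof -
  interpret F: group_family "{1..}" G by (rule group_family.intro) (use G in simp)
  note xc = x[unfolded graded_sum_simps F.carrier_iff] and yc = y[unfolded graded_sum_simps F.carrier_iff]
  have mi: "m - i \<ge> 1" "m - i \<ge> Suc 0" "i \<ge> 1" "i + (m - i) = m" if "i \<in> {1..<m}" for i m :: nat using that by auto
  have xi: "x i \<in> carrier (G i)" and yi: "y i \<in> carrier (G i)" if "i \<ge> 1" for i using xc yc that by auto
  have t: "br i (m - i) (x i) (y (m - i)) \<in> carrier (G m)" if "i \<in> {1..<m}" for i m
    using br[OF mi(3,1) xi[OF mi(3)] yi[OF mi(1)], OF that that that that] mi(4)[OF that] by simp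
  let ?b = "bracket (graded_sum G br) x y"
  have "finite {i \<in> {1..}. x i \<noteq> \<one>\<^bsub>G i\<^esub>}" using xc by blast
  then obtain a where "\<forall>i\<in>{i \<in> {1..}. x i \<noteq> \<one>\<^bsub>G i\<^esub>}. i \<le> a"
    unfolding finite_nat_set_iff_bounded_le by blast
  then have a: "\<And>i. i \<ge> 1 \<Longrightarrow> x i \<noteq> \<one>\<^bsub>G i\<^esub> \<Longrightarrow> i \<le> a" by simp
  have "finite {i \<in> {1..}. y i \<noteq> \<one>\<^bsub>G i\<^esub>}" using yc by blast
  then obtain b where "\<forall>i\<in>{i \<in> {1..}. y i \<noteq> \<one>\<^bsub>G i\<^esub>}. i \<le> b"
    unfolding finite_nat_set_iff_bounded_le by blast
  then have b: "\<And>i. i \<ge> 1 \<Longrightarrow> y i \<noteq> \<one>\<^bsub>G i\<^esub> \<Longrightarrow> i \<le> b" by simp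
  have "?b m = \<one>\<^bsub>G m\<^esub>" if m: "m > a + b" for m
  proof -
    interpret Gm: comm_group "G m" by (rule G) (use m in simp)
    have "br i (m - i) (x i) (y (m - i)) = \<one>\<^bsub>G m\<^esub>" if i: "i \<in> {1..<m}" for i
    proof (cases "x i = \<one>\<^bsub>G i\<^esub>")
      case True then show ?thesis using one(2)[OF mi(3,1)[OF i] yi[OF mi(1)[OF i]]] mi(4)[OF i] by simp
    next
      case False
      then have "i \<le> a" using a[of i] i by simp
      then have "m - i > b" using m by simp
      then have "y (m - i) = \<one>\<^bsub>G (m - i)\<^esub>" using b[of "m - i"] i by force
      then show ?thesis using one(1)[OF mi(3,1)[OF i] xi[OF mi(3)[OF i]]] mi(4)[OF i] by simp
    qed
    then have "finprod (G m) (\<lambda>i. br i (m - i) (x i) (y (m - i))) {1..<m} = \<one>\<^bsub>G m\<^esub>"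
      by (intro Gm.finprod_one_eqI) simp
    then show ?thesis using m by (simp add: graded_sum_simps)
  qed
  note b1 = this
  have "{i \<in> {1..}. ?b i \<noteq> \<one>\<^bsub>G i\<^esub>} \<subseteq> {..a + b}"
  proof
    fix i assume "i \<in> {i \<in> {1..}. ?b i \<noteq> \<one>\<^bsub>G i\<^esub>}"
    then show "i \<in> {..a + b}" using b1[of i] by (cases "i \<le> a + b") auto
  qed
  then have "finite {i \<in> {1..}. ?b i \<noteq> \<one>\<^bsub>G i\<^esub>}" by (rule finite_subset) simp
  moreover have "?b m \<in> carrier (G m)" if m: "m \<ge> 1" for m
  proof -
    interpret Gm: comm_group "G m" by (rule G[OF m])
    have "?b m = finprod (G m) (\<lambda>i. br i (m - i) (x i) (y (m - i))) {1..<m}"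
      using m by (simp add: graded_sum_simps(4))
    also have "\<dots> \<in> carrier (G m)" by (rule Gm.finprod_closed) (use t in blast)
    finally show ?thesis .
  qed
  moreover have "?b \<in> extensional {1..}" by (simp add: graded_sum_simps(4))
  ultimately show ?thesis unfolding graded_sum_simps(1) F.carrier_iff by blast
qed

section \<open>The Chen Lie algebra and its derivations\<close>

lemma Theta_mult_nth:
  "fps_nth (Theta n p * q) (Suc m) = (\<Sum>s=0..m. theta n (\<lambda>i. fps_nth (p i) s) * fps_nth q (m - s))"
proof -
  define S where "S = (\<Sum>i<n. fps_const (X i) * p i)"
  have S: "fps_nth S s = theta n (\<lambda>i. fps_nth (p i) s)" for s
    by (simp add: S_def theta_def fps_sum_nth)
  have "fps_nth (Theta n p * q) (Suc m) = fps_nth (S * q) m"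
    by (simp add: Theta_def S_def mult.assoc)
  then show ?thesis by (simp only: fps_mult_nth S)
qed

lemma Brc_mono:
  "Brc n (\<lambda>i. fps_const (p i) * fps_X ^ a) (\<lambda>i. fps_const (q i) * fps_X ^ b) =
    (\<lambda>i. fps_const (brc n p q i) * fps_X ^ (a + b + 1))"
proof -
  have T: "Theta n (\<lambda>i. fps_const (p i) * fps_X ^ c) = fps_const (theta n p) * fps_X ^ (c + 1)" for p c
  proof -
    have "(\<Sum>i<n. fps_const (X i) * (fps_const (p i) * fps_X ^ c)) = (\<Sum>i<n. fps_const (X i * p i)) * fps_X ^ c"
      by (simp add: sum_distrib_right mult.assoc[symmetric])
    also have "(\<Sum>i<n. fps_const (X i * p i)) = fps_const (theta n p)"
      unfolding theta_def by (induction n) (simp_all flip: fps_const_add)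
    finally show ?thesis by (simp add: Theta_def algebra_simps)
  qed
  show ?thesis unfolding Brc_def T brc_def
    by (rule ext) (simp add: power_add algebra_simps flip: fps_const_sub fps_const_mult)
qed

text \<open>The operator that is linear over power series and sends the j-th unit vector to
  \<open>fps_X ^ k\<close> times row \<open>j\<close>. A derivation of degree \<open>k\<close> will
  turn out to act on leading coefficients in exactly this way.\<close>

definition act :: "nat \<Rightarrow> nat \<Rightarrow> (nat \<Rightarrow> nat \<Rightarrow> poly) \<Rightarrow> (nat \<Rightarrow> poly fps) \<Rightarrow> nat \<Rightarrow> poly fps" where
  "act n k P p = (\<lambda>i. fps_X ^ k * (\<Sum>j<n. fps_const (P j i) * p j))"

lemma act_linear:
  "act n k P (p + q) = act n k P p + act n k P q"
  "act n k P (\<lambda>i. c * p i - d * q i) = (\<lambda>i. c * act n k P p i - d * act n k P q i)"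
  "act n k P 0 = 0"
  by (simp_all add: act_def fun_eq_iff algebra_simps sum.distrib sum_subtractf sum_distrib_left)

lemma act_matrix:
  "act n k (P + Q) p = act n k P p + act n k Q p"
  "act n k (- P) p = - act n k P p"
  "act n k 0 p = 0"
  by (simp_all add: act_def fun_eq_iff algebra_simps sum.distrib sum_negf flip: fps_const_add fps_const_neg)

text \<open>The commutator of matrices in the convention that row \<open>j\<close> is the value at
  generator \<open>j\<close>; applying \<open>Q\<close> first and then \<open>P\<close> multiplies
  entries as \<open>P m i * Q j m\<close>.\<close>

definition mcomm :: "nat \<Rightarrow> (nat \<Rightarrow> nat \<Rightarrow> poly) \<Rightarrow> (nat \<Rightarrow> nat \<Rightarrow> poly) \<Rightarrow> nat \<Rightarrow> nat \<Rightarrow> poly" where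
  "mcomm n P Q j i = (\<Sum>m<n. P m i * Q j m) - (\<Sum>m<n. Q m i * P j m)"

lemma fps_const_sum: "fps_const (sum f A) = (\<Sum>a\<in>A. fps_const (f a))"
  by (rule fps_ext) (simp add: fps_sum_nth sum.neutral)

lemma act_act:
  "act n k P (act n l Q p) = (\<lambda>i. fps_X ^ (k + l) * (\<Sum>j<n. fps_const (\<Sum>m<n. P m i * Q j m) * p j))"
proof
  fix i
  have "act n k P (act n l Q p) i = fps_X ^ (k + l) * (\<Sum>m<n. \<Sum>j<n. fps_const (P m i) * (fps_const (Q j m) * p j))"
    by (simp add: act_def sum_distrib_left power_add algebra_simps)
  also have "(\<Sum>m<n. \<Sum>j<n. fps_const (P m i) * (fps_const (Q j m) * p j)) = (\<Sum>j<n. fps_const (\<Sum>m<n. P m i * Q j m) * p j)"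
    by (subst sum.swap) (simp add: fps_const_sum sum_distrib_right mult.assoc flip: fps_const_mult)
  finally show "act n k P (act n l Q p) i = fps_X ^ (k + l) * (\<Sum>j<n. fps_const (\<Sum>m<n. P m i * Q j m) * p j)" .
qed

lemma act_mcomm: "act n k P (act n l Q p) - act n l Q (act n k P p) = act n (k + l) (mcomm n P Q) p"
  unfolding act_act
  by (simp add: act_def mcomm_def fun_eq_iff add.commute left_diff_distrib sum_subtractf right_diff_distrib flip: fps_const_sub)

lemma act_nth: "fps_nth (act n k P p i) m = (if m < k then 0 else \<Sum>j<n. P j i * fps_nth (p j) (m - k))"
  by (simp add: act_def fps_X_power_mult_nth fps_sum_nth)

lemma Theta_act:
  assumes "\<And>j. j < n \<Longrightarrow> theta n (P j) = 0"
  shows "Theta n (act n k P p) = 0"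
proof -
  have "(\<Sum>i<n. fps_const (X i) * act n k P p i) = (\<Sum>i<n. \<Sum>j<n. fps_X ^ k * (fps_const (X i * P j i) * p j))"
    by (simp add: act_def sum_distrib_left algebra_simps flip: fps_const_mult)
  also have "\<dots> = (\<Sum>j<n. fps_X ^ k * (fps_const (theta n (P j)) * p j))"
    by (subst sum.swap) (simp add: theta_def fps_const_sum sum_distrib_left sum_distrib_right)
  also have "\<dots> = 0" using assms by simp
  finally show ?thesis by (simp add: Theta_def)
qed

text \<open>\<open>theta\<close> kills the rows, so \<open>Theta\<close> kills all values of
  \<open>act\<close>. Two of the four terms on the right vanish, and linearity over power series
  identifies the other two with the left-hand side.\<close>

lemma act_Brc:
  assumes "\<And>j. j < n \<Longrightarrow> theta n (P j) = 0"
  shows "act n k P (Brc n p q) = Brc n (act n k P p) q + Brc n p (act n k P q)"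
proof -
  have T: "Theta n (act n k P r) = 0" for r by (rule Theta_act[OF assms])
  show ?thesis unfolding Brc_def act_linear T by (simp add: fun_eq_iff)
qed

section \<open>The Chen Lie algebra in power series coordinates\<close>

locale chen_magnus =
  magnus "free_metab n" n "\<lambda>i. second_derived (free_group n) #>\<^bsub>free_group n\<^esub> [(i, True)]" \<mu> for n \<mu>
begin

sublocale L: group_family "{1..}" "chen_gr n"
  by (rule group_family.intro) (simp add: gr_comm_group)

lemma chen_comm_group: "comm_group (chen n)"
  unfolding chen_def graded_sum_def by (intro comm_group_lie_of sum_group_comm gr_comm_group) simp

lemma chen_simps:
  "carrier (chen n) = carrier (sum_group {1..} (chen_gr n))"
  "x \<otimes>\<^bsub>chen n\<^esub> y = x \<otimes>\<^bsub>sum_group {1..} (chen_gr n)\<^esub> y"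
  "\<one>\<^bsub>chen n\<^esub> = \<one>\<^bsub>sum_group {1..} (chen_gr n)\<^esub>"
  "bracket (chen n) x y =
     (\<lambda>m\<in>{1..}. finprod (chen_gr n m) (\<lambda>i. chen_bracket n i (m - i) (x i) (y (m - i))) {1..<m})"
  unfolding chen_def by (rule graded_sum_simps)+

lemma chen_component: "x \<in> carrier (chen n) \<Longrightarrow> i \<ge> 1 \<Longrightarrow> x i \<in> carrier (chen_gr n i)"
  unfolding chen_simps L.carrier_iff by simp

lemma chen_bracket_component:
  "i \<ge> 1 \<Longrightarrow> j \<ge> 1 \<Longrightarrow> a \<in> carrier (chen_gr n i) \<Longrightarrow> b \<in> carrier (chen_gr n j) \<Longrightarrow>
    chen_bracket n i j a b \<in> carrier (chen_gr n (i + j))"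
  by (rule hom_in_carrier[OF cl_bracket_hom(1)])

lemma chen_bracket_closed:
  assumes "x \<in> carrier (chen n)" "y \<in> carrier (chen n)"
  shows "bracket (chen n) x y \<in> carrier (chen n)"
  unfolding chen_def
proof (rule graded_sum_bracket_closed[where G = "chen_gr n" and br = "chen_bracket n"])
  show "comm_group (chen_gr n i)" if "i \<ge> 1" for i by (rule gr_comm_group[OF that])
  show "chen_bracket n i j a b \<in> carrier (chen_gr n (i + j))"
    if "i \<ge> 1" "j \<ge> 1" "a \<in> carrier (chen_gr n i)" "b \<in> carrier (chen_gr n j)" for i j a b
    by (rule chen_bracket_component[OF that])
next
  fix i j :: nat and a assume ij: "i \<ge> 1" "j \<ge> 1"
  then have ij': "i + j \<ge> 1" by simp
  show "chen_bracket n i j a \<one>\<^bsub>chen_gr n j\<^esub> = \<one>\<^bsub>chen_gr n (i + j)\<^esub>" if "a \<in> carrier (chen_gr n i)"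
    by (rule hom_one[OF cl_bracket_hom(1)[OF ij that] gr_group gr_group])
  show "chen_bracket n i j \<one>\<^bsub>chen_gr n i\<^esub> a = \<one>\<^bsub>chen_gr n (i + j)\<^esub>" if "a \<in> carrier (chen_gr n j)"
    by (rule hom_one[OF cl_bracket_hom(2)[OF ij that] gr_group gr_group])
qed (use assms in \<open>simp_all add: chen_def\<close>)

text \<open>All leading coefficients of an element of the graded sum in a single tuple of series,
  degree \<open>m + 1\<close> going to the coefficient of index \<open>m\<close>. In this form the
  bracket of the Chen algebra is again \<open>Brc\<close>, and convolution sums over degrees are
  hidden in the product of series.\<close>

definition Jh :: "(nat \<Rightarrow> word set set) \<Rightarrow> nat \<Rightarrow> poly fps" where
  "Jh x i = Abs_fps (\<lambda>m. J (Suc m) (x (Suc m)) i)"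

lemma Jh_nth: "fps_nth (Jh x i) m = J (Suc m) (x (Suc m)) i"
  by (simp add: Jh_def)

lemma Jh_hom: "Jh \<in> hom (chen n) add_grp"
proof (rule homI)
  fix x y assume x: "x \<in> carrier (chen n)" and y: "y \<in> carrier (chen n)"
  show "Jh (x \<otimes>\<^bsub>chen n\<^esub> y) = Jh x \<otimes>\<^bsub>add_grp\<^esub> Jh y"
  proof (rule ext, rule fps_ext)
    fix i m
    have "J (Suc m) (x (Suc m) \<otimes>\<^bsub>chen_gr n (Suc m)\<^esub> y (Suc m)) = J (Suc m) (x (Suc m)) + J (Suc m) (y (Suc m))"
      by (rule J_simps(2)) (use x y chen_component in simp_all)
    then show "fps_nth (Jh (x \<otimes>\<^bsub>chen n\<^esub> y) i) m = fps_nth ((Jh x \<otimes>\<^bsub>add_grp\<^esub> Jh y) i) m"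
      by (simp add: Jh_nth chen_simps)
  qed
qed simp

lemma Jh_mult: "x \<in> carrier (chen n) \<Longrightarrow> y \<in> carrier (chen n) \<Longrightarrow> Jh (x \<otimes>\<^bsub>chen n\<^esub> y) = Jh x + Jh y"
  and Jh_inv: "x \<in> carrier (chen n) \<Longrightarrow> Jh (inv\<^bsub>chen n\<^esub> x) = - Jh x"
  and Jh_one: "Jh \<one>\<^bsub>chen n\<^esub> = 0"
  using hom_add_grp[OF comm_group.axioms(2)[OF chen_comm_group] Jh_hom] by simp_all

lemma Jh_eqI:
  assumes "x \<in> carrier (chen n)" "y \<in> carrier (chen n)" "Jh x = Jh y"
  shows "x = y"
proof (rule extensionalityI)
  show "x \<in> extensional {1..}" "y \<in> extensional {1..}"
    using assms(1,2) unfolding chen_simps L.carrier_iff by blast+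
  fix m :: nat assume m: "m \<in> {1..}"
  then obtain m' where m': "m = Suc m'" by (cases m) auto
  have "J m (x m) = J m (y m)"
    using assms(3) unfolding m' by (metis (no_types) Jh_nth ext)
  then show "x m = y m"
    using inj_onD[OF J_inj[of m]] chen_component[OF assms(1), of m] chen_component[OF assms(2), of m] m by simp
qed

lemma Jh_bracket:
  assumes "x \<in> carrier (chen n)" "y \<in> carrier (chen n)"
  shows "Jh (bracket (chen n) x y) = Brc n (Jh x) (Jh y)"
proof (rule ext, rule fps_ext)
  fix l k
  show "fps_nth (Jh (bracket (chen n) x y) l) k = fps_nth (Brc n (Jh x) (Jh y) l) k"
  proof (cases k)
    case 0
    have "J (Suc 0) \<one>\<^bsub>chen_gr n (Suc 0)\<^esub> = 0" using J_simps(1)[of 1] by simp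
    moreover have "bracket (chen n) x y (Suc 0) = \<one>\<^bsub>chen_gr n (Suc 0)\<^esub>"
      using comm_monoid.finprod_empty[OF comm_group.axioms(1)[OF gr_comm_group[of "Suc 0"]]]
      by (simp add: chen_simps)
    ultimately show ?thesis using 0 by (simp add: Jh_nth Brc_def Theta_nth_0)
  next
    case (Suc m)
    let ?M = "Suc (Suc m)"
    have mi: "i \<ge> 1" "?M - i \<ge> 1" "i + (?M - i) = ?M" if "i \<in> {1..<?M}" for i using that by auto
    have c: "(\<lambda>i. chen_bracket n i (?M - i) (x i) (y (?M - i))) \<in> {1..<?M} \<rightarrow> carrier (chen_gr n ?M)"
    proof
      fix i assume i: "i \<in> {1..<?M}"
      show "chen_bracket n i (?M - i) (x i) (y (?M - i)) \<in> carrier (chen_gr n ?M)"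
        using chen_bracket_component[OF mi(1,2)[OF i] chen_component[OF assms(1) mi(1)[OF i]] chen_component[OF assms(2) mi(2)[OF i]]]
        unfolding mi(3)[OF i] .
    qed
    have "J ?M (bracket (chen n) x y ?M) = (\<Sum>i\<in>{1..<?M}. J ?M (chen_bracket n i (?M - i) (x i) (y (?M - i))))"
      using hom_finprod[OF gr_comm_group comm_group_add_grp J_hom' c] by (simp add: chen_simps)
    also have "\<dots> = (\<Sum>i\<in>{1..<?M}. brc n (J i (x i)) (J (?M - i) (y (?M - i))))"
    proof (rule sum.cong[OF refl])
      fix i assume i: "i \<in> {1..<?M}"
      show "J ?M (chen_bracket n i (?M - i) (x i) (y (?M - i))) = brc n (J i (x i)) (J (?M - i) (y (?M - i)))"
        using J_bracket[OF mi(1,2)[OF i] chen_component[OF assms(1) mi(1)[OF i]] chen_component[OF assms(2) mi(2)[OF i]]]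
        unfolding mi(3)[OF i] .
    qed
    finally have "fps_nth (Jh (bracket (chen n) x y) l) (Suc m) =
      (\<Sum>i\<in>{1..<?M}. theta n (J (?M - i) (y (?M - i))) * J i (x i) l) - (\<Sum>i\<in>{1..<?M}. theta n (J i (x i)) * J (?M - i) (y (?M - i)) l)"
      by (simp only: Jh_nth sum_fun_apply brc_def sum_subtractf)
    \<comment> \<open>Both sums are reindexed by the degree of the argument of \<open>theta\<close>,
      lowered by one, to match the convolution in \<open>Theta_mult_nth\<close>.\<close>
    also have "(\<Sum>i\<in>{1..<?M}. theta n (J (?M - i) (y (?M - i))) * J i (x i) l) = (\<Sum>s=0..m. theta n (J (Suc s) (y (Suc s))) * J (Suc (m - s)) (x (Suc (m - s))) l)"
      by (rule sum.reindex_bij_witness[of _ "\<lambda>s. Suc (m - s)" "\<lambda>i. Suc m - i"]) (auto simp: Suc_diff_le)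
    also have "(\<Sum>i\<in>{1..<?M}. theta n (J i (x i)) * J (?M - i) (y (?M - i)) l) = (\<Sum>s=0..m. theta n (J (Suc s) (x (Suc s))) * J (Suc (m - s)) (y (Suc (m - s))) l)"
      by (rule sum.reindex_bij_witness[of _ Suc "\<lambda>i. i - 1"]) (auto simp: Suc_diff_le)
    finally show ?thesis
      unfolding Suc by (simp add: Brc_def Theta_mult_nth Jh_nth)
  qed
qed

abbreviation "hom_el \<equiv> homog {1..} (chen_gr n)"

lemma hom_el_closed: "k \<ge> 1 \<Longrightarrow> a \<in> carrier (chen_gr n k) \<Longrightarrow> hom_el k a \<in> carrier (chen n)"
  unfolding chen_simps by (rule L.homog_closed) simp_all

lemma Jh_hom_el:
  assumes "a \<in> carrier (chen_gr n (Suc k))"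
  shows "Jh (hom_el (Suc k) a) = (\<lambda>i. fps_const (J (Suc k) a i) * fps_X ^ k)"
  by (rule ext, rule fps_ext) (auto simp: Jh_nth homog_def J_simps)

lemma Jh_gen: "j < n \<Longrightarrow> Jh (hom_el 1 (g j)) = (\<lambda>i. if i = j then 1 else 0)"
  using Jh_hom_el[of "g j" 0] g_closed J_g by (auto simp: e_def fun_eq_iff)

lemma bracket_hom_el:
  assumes "k \<ge> 1" "a \<in> carrier (chen_gr n k)" "b \<in> carrier (chen_gr n 1)"
  shows "bracket (chen n) (hom_el k a) (hom_el 1 b) = hom_el (k + 1) (chen_bracket n k 1 a b)"
proof -
  obtain k' where k: "k = Suc k'" using assms(1) by (cases k) auto
  have c: "chen_bracket n k 1 a b \<in> carrier (chen_gr n (k + 1))" by (rule chen_bracket_component) (use assms in simp_all)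
  have 1: "Jh (hom_el 1 b) = (\<lambda>i. fps_const (J 1 b i) * fps_X ^ 0)" using Jh_hom_el[of b 0] assms(3) by simp
  have 2: "Jh (hom_el k a) = (\<lambda>i. fps_const (J k a i) * fps_X ^ k')" using Jh_hom_el[of a k'] assms(2) k by simp
  have 3: "Jh (hom_el (k + 1) (chen_bracket n k 1 a b)) = (\<lambda>i. fps_const (J (k + 1) (chen_bracket n k 1 a b) i) * fps_X ^ k)"
    using Jh_hom_el[of _ k] c by simp
  have h: "hom_el k a \<in> carrier (chen n)" "hom_el 1 b \<in> carrier (chen n)"
    using assms by (intro hom_el_closed; simp)+
  show ?thesis
  proof (rule Jh_eqI)
    show "bracket (chen n) (hom_el k a) (hom_el 1 b) \<in> carrier (chen n)" by (rule chen_bracket_closed[OF h])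
    show "hom_el (k + 1) (chen_bracket n k 1 a b) \<in> carrier (chen n)" by (rule hom_el_closed[OF _ c]) simp
    have "Jh (bracket (chen n) (hom_el k a) (hom_el 1 b)) = (\<lambda>i. fps_const (brc n (J k a) (J 1 b) i) * fps_X ^ (k' + 0 + 1))"
      unfolding Jh_bracket[OF h] 1 2 by (rule Brc_mono)
    also have "\<dots> = Jh (hom_el (k + 1) (chen_bracket n k 1 a b))"
      unfolding 3 J_bracket[OF assms(1) le_refl assms(2,3)] by (simp add: k)
    finally show "Jh (bracket (chen n) (hom_el k a) (hom_el 1 b)) = Jh (hom_el (k + 1) (chen_bracket n k 1 a b))" .
  qed
qed

text \<open>Brackets of degree \<open>k\<close> with the degree one generators span degree
  \<open>k + 1\<close>, so closure under these special brackets is enough to reach every homogeneous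
  element, and sums of those are everything.\<close>

lemma chen_generated:
  assumes S: "subgroup S (chen n)" and g: "\<And>i. i < n \<Longrightarrow> hom_el 1 (g i) \<in> S"
    and b: "\<And>x i. x \<in> S \<Longrightarrow> i < n \<Longrightarrow> bracket (chen n) x (hom_el 1 (g i)) \<in> S"
    and x: "x \<in> carrier (chen n)"
  shows "x \<in> S"
proof -
  have C: "group (chen n)" by (rule comm_group.axioms(2)[OF chen_comm_group])
  have hom: "hom_el k \<in> hom (chen_gr n k) (chen n)" if "k \<ge> 1" for k
    using L.homog_hom[of k] that by (simp add: hom_def chen_simps)
  have h: "hom_el k a \<in> S" if "k \<ge> 1" "a \<in> carrier (chen_gr n k)" for k a
    using that
  proof (induction k arbitrary: a rule: dec_induct)
    case base
    show ?case
    proof (rule hom_image_in_subgroup[OF gr_group C hom _ S])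
      show "a \<in> generate (chen_gr n 1) (g ` {..<n})" using base gr_1_generate by simp
      show "g ` {..<n} \<subseteq> carrier (chen_gr n 1)" using g_closed by blast
      show "hom_el 1 y \<in> S" if "y \<in> g ` {..<n}" for y using that g by blast
    qed simp
  next
    case (step k)
    let ?K = "{chen_bracket n k 1 A (g i) | A i. A \<in> carrier (chen_gr n k) \<and> i < n}"
    have gen: "generate (chen_gr n (k + 1)) ?K = carrier (chen_gr n (k + 1))"
    proof (rule gr_Suc_generate)
      show "generate (chen_gr n k) (carrier (chen_gr n k)) = carrier (chen_gr n k)"
        using group.generate_incl[OF gr_group, of "carrier (chen_gr n k)" k] by (auto intro: generate.incl)
    qed (use step in simp_all)
    show ?case
    proof (rule hom_image_in_subgroup[OF gr_group C hom _ S])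
      show "a \<in> generate (chen_gr n (Suc k)) ?K" using step.prems gen by simp
      show "?K \<subseteq> carrier (chen_gr n (Suc k))"
        using chen_bracket_component[of k 1] g_closed step.hyps by auto
      fix y assume "y \<in> ?K"
      then obtain A i where y: "y = chen_bracket n k 1 A (g i)" "A \<in> carrier (chen_gr n k)" "i < n" by blast
      have "hom_el (Suc k) y = bracket (chen n) (hom_el k A) (hom_el 1 (g i))"
        unfolding y(1) Suc_eq_plus1 by (rule bracket_hom_el[OF step.hyps(1) y(2) g_closed[OF y(3)], symmetric])
      then show "hom_el (Suc k) y \<in> S" using b[OF step.IH[OF y(2)] y(3)] by simp
    qed simp
  qed
  have S': "subgroup S (sum_group {1..} (chen_gr n))"
  proof (rule group.subgroupI)
    show "group (sum_group {1..} (chen_gr n))" by (rule sum_group) (rule gr_group)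
    show "S \<subseteq> carrier (sum_group {1..} (chen_gr n))" using subgroup.subset[OF S] by (simp add: chen_simps)
    show "S \<noteq> {}" using subgroup.one_closed[OF S] by blast
    show "x \<otimes>\<^bsub>sum_group {1..} (chen_gr n)\<^esub> y \<in> S" if "x \<in> S" "y \<in> S" for x y
      using subgroup.m_closed[OF S that] by (simp only: chen_simps)
    show "inv\<^bsub>sum_group {1..} (chen_gr n)\<^esub> x \<in> S" if "x \<in> S" for x
      using subgroup.m_inv_closed[OF S that] by (simp only: m_inv_def chen_simps)
  qed
  show ?thesis
    by (rule L.sum_group_subset[OF S', of "\<lambda>_ _. True"]) (use x h in \<open>simp_all add: chen_simps\<close>)
qed

end

section \<open>Matrices annihilated by the row of variables\<close>

lemma frag_hom_add_grp:
  fixes h :: "'s \<Rightarrow> 'a::ab_group_add"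
  shows "frag_hom add_grp h \<in> hom add_grp add_grp"
    and "frag_hom add_grp h (frag_of s) = h s"
proof -
  interpret A: comm_group "add_grp :: 'a monoid" by simp
  show "frag_hom add_grp h \<in> hom add_grp add_grp"
    using A.frag_hom_hom[of h UNIV] by (simp add: free_Abelian_group_UNIV)
  show "frag_hom add_grp h (frag_of s) = h s" by (rule A.frag_hom_of) simp
qed

lemma add_subgroupI:
  assumes "0 \<in> S" "\<And>p q. p \<in> S \<Longrightarrow> q \<in> S \<Longrightarrow> p - q \<in> S"
  shows "subgroup S (add_grp :: 'a::ab_group_add monoid)"
proof (rule group.subgroupI[OF group_add_grp])
  have neg: "- p \<in> S" if "p \<in> S" for p using assms(2)[OF assms(1) that] by simp
  show "S \<noteq> {}" using assms(1) by blast
  show "inv\<^bsub>add_grp\<^esub> p \<in> S" if "p \<in> S" for p using neg[OF that] by simp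
  show "p \<otimes>\<^bsub>add_grp\<^esub> q \<in> S" if "p \<in> S" "q \<in> S" for p q using assms(2)[OF that(1) neg[OF that(2)]] by simp
qed simp

lemma add_subgroupD:
  assumes "subgroup S (add_grp :: 'a::ab_group_add monoid)"
  shows "0 \<in> S" "p \<in> S \<Longrightarrow> q \<in> S \<Longrightarrow> p + q \<in> S" "p \<in> S \<Longrightarrow> - p \<in> S" "p \<in> S \<Longrightarrow> q \<in> S \<Longrightarrow> p - q \<in> S"
proof -
  show "0 \<in> S" using subgroup.one_closed[OF assms] by simp
  show 1: "p + q \<in> S" if "p \<in> S" "q \<in> S" for p q using subgroup.m_closed[OF assms that] by simp
  show 2: "- p \<in> S" if "p \<in> S" for p using subgroup.m_inv_closed[OF assms that] by simp
  show "p - q \<in> S" if "p \<in> S" "q \<in> S" for p q using 1[OF that(1) 2[OF that(2)]] by simp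
qed

lemma add_subgroup_sum:
  "subgroup S (add_grp :: 'a::ab_group_add monoid) \<Longrightarrow> (\<And>j. j \<in> A \<Longrightarrow> f j \<in> S) \<Longrightarrow> sum f A \<in> S"
  by (induction A rule: infinite_finite_induct) (simp_all add: add_subgroupD)

section \<open>Traces and commutators of matrices\<close>

definition tr :: "nat \<Rightarrow> (nat \<Rightarrow> nat \<Rightarrow> poly) \<Rightarrow> poly" where
  "tr n P = (\<Sum>i<n. P i i)"

lemma tr_diff: "tr n (P - Q) = tr n P - tr n Q"
  and tr_add: "tr n (P + Q) = tr n P + tr n Q"
  and tr_0: "tr n 0 = 0"
  by (simp_all add: tr_def sum_subtractf sum.distrib)

lemma tr_mcomm: "tr n (mcomm n P Q) = 0"
proof -
  have "(\<Sum>j<n. \<Sum>m<n. P m j * Q j m) = (\<Sum>j<n. \<Sum>m<n. Q m j * P j m)"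
    by (subst sum.swap) (simp add: mult.commute)
  then show ?thesis by (simp add: tr_def mcomm_def sum_subtractf)
qed

context magnus
begin

text \<open>The matrices of derivations of degree \<open>k\<close>, row \<open>j\<close> being the
  leading tuple of the value at generator \<open>j\<close>. The rows from \<open>n\<close> on are
  fixed as zero so that a derivation has only one matrix.\<close>

definition Mt :: "nat \<Rightarrow> (nat \<Rightarrow> nat \<Rightarrow> poly) set" where
  "Mt k = {P. (\<forall>j<n. P j \<in> B (k + 1)) \<and> (\<forall>j\<ge>n. P j = 0)}"

text \<open>A matrix with one nonzero row, corresponding to the tensor of a dual basis vector with a
  left-normed commutator.\<close>

definition em :: "nat multiset \<Rightarrow> nat \<Rightarrow> nat \<Rightarrow> nat \<Rightarrow> nat \<Rightarrow> nat \<Rightarrow> poly" where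
  "em F a b l = (\<lambda>j. if j = l then (\<lambda>i. frag_of F * v a b i) else 0)"

lemma Mt_subgroup: "subgroup (Mt k) add_grp"
  by (rule add_subgroupI) (simp_all add: Mt_def B_closed)

lemma em_Mt:
  assumes "F \<in> Mon k" "a < n" "b < n" "l < n"
  shows "em F a b l \<in> Mt (k + 1)"
proof -
  let ?fs = "sorted_list_of_multiset F"
  have f: "set ?fs \<subseteq> {..<n}" "length ?fs = k" "mset ?fs = F"
    using assms(1) by (simp_all add: Mon_def) (metis mset_sorted_list_of_multiset size_mset)
  have "(\<lambda>i. frag_of F * v a b i) = J (k + 2) (lc a b ?fs)"
    using J_lc[OF assms(2,3) f(1)] f by simp
  moreover have "lc a b ?fs \<in> carrier (gr G (k + 2))"
    using lc_closed[OF assms(2,3) f(1)] f by simp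
  ultimately have "(\<lambda>i. frag_of F * v a b i) \<in> B (k + 2)" by (simp add: B_def)
  moreover have "0 \<in> B (k + 2)" by (rule B_closed) simp
  ultimately show ?thesis using assms(4) by (simp add: Mt_def em_def)
qed

text \<open>A matrix is the sum of its rows. For one row, \<open>J_hom_in\<close> is applied to the
  subgroup of those tuples whose one-row matrix belongs to \<open>S\<close>.\<close>

lemma Mt_generated:
  assumes S: "subgroup S add_grp" and e: "\<And>F a b l. F \<in> Mon k \<Longrightarrow> a < n \<Longrightarrow> b < n \<Longrightarrow> l < n \<Longrightarrow> em F a b l \<in> S"
    and P: "P \<in> Mt (k + 1)"
  shows "P \<in> S"
proof -
  have col: "(\<lambda>j. if j = l then p else 0) \<in> S" if l: "l < n" and p: "p \<in> B (k + 2)" for l p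
  proof -
    let ?S = "{p. (\<lambda>j. if j = l then p else 0) \<in> S}"
    obtain A where A: "A \<in> carrier (gr G (k + 2))" "p = J (k + 2) A" using p by (auto simp: B_def)
    have z: "(\<lambda>j. if j = l then (p - q) else 0) = (\<lambda>j. if j = l then p else 0) - (\<lambda>j. if j = l then q else 0)"
      for p q :: "nat \<Rightarrow> poly" by (auto simp: fun_eq_iff)
    have S': "subgroup ?S add_grp"
    proof (rule add_subgroupI)
      have "(\<lambda>j. if j = l then 0 else 0 :: nat \<Rightarrow> poly) = 0" by (simp add: zero_fun_apply)
      then show "0 \<in> ?S" using add_subgroupD(1)[OF S] by simp
      show "p - q \<in> ?S" if "p \<in> ?S" "q \<in> ?S" for p q
        using add_subgroupD(4)[OF S] that unfolding mem_Collect_eq z by blast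
    qed
    have "J (k + 2) A \<in> ?S"
      by (rule J_hom_in[OF _ S' A(1)]) (use e[OF _ _ _ l] in \<open>simp_all add: em_def\<close>)
    then show ?thesis unfolding A(2) mem_Collect_eq .
  qed
  have "P = (\<Sum>l<n. (\<lambda>j. if j = l then P l else 0))"
  proof
    fix j
    have "(\<Sum>l<n. (\<lambda>j. if j = l then P l else 0)) j = (\<Sum>l<n. if j = l then P l else 0)"
      by (rule sum_fun_apply)
    also have "\<dots> = P j" using P by (simp add: Mt_def)
    finally show "P j = (\<Sum>l<n. (\<lambda>j. if j = l then P l else 0)) j" by simp
  qed
  also have "\<dots> \<in> S" by (rule add_subgroup_sum[OF S]) (use col P in \<open>simp add: Mt_def\<close>)
  finally show ?thesis .
qed

text \<open>The product of two one-row matrices meets a single entry of one of them: entry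
  \<open>j\<close> of \<open>v c d\<close> in one order and entry \<open>l\<close> of
  \<open>v a b\<close> in the other.\<close>

lemma mcomm_em:
  assumes "j < n" "l < n"
  shows "mcomm n (em f a b j) (em h c d l) =
    (\<lambda>k i. (if k = l then frag_of (f + h) * v c d j * v a b i else 0)
         - (if k = j then frag_of (f + h) * v a b l * v c d i else 0))"
proof (intro ext)
  fix k i
  have "(\<Sum>m<n. em f a b j m i * em h c d l k m) = (\<Sum>m<n. if m = j then (if k = l then frag_of (f + h) * v c d j * v a b i else 0) else 0)"
    by (rule sum.cong[OF refl]) (simp add: em_def mult_ac frag_of_mult[symmetric] del: mult_single)
  moreover have "(\<Sum>m<n. em h c d l m i * em f a b j k m) = (\<Sum>m<n. if m = l then (if k = j then frag_of (f + h) * v a b l * v c d i else 0) else 0)"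
    by (rule sum.cong[OF refl]) (simp add: em_def mult_ac frag_of_mult[symmetric] del: mult_single)
  ultimately show "mcomm n (em f a b j) (em h c d l) k i =
     (if k = l then frag_of (f + h) * v c d j * v a b i else 0)
         - (if k = j then frag_of (f + h) * v a b l * v c d i else 0)"
    using assms by (simp add: mcomm_def)
qed

lemma v_self: "v a a = (\<lambda>i. 0)"
  by (simp add: v_def brc_def)

lemma v_swap: "v b a = (\<lambda>i. - v a b i)"
  by (simp add: v_def brc_def)

lemma em_swap: "em F b a l = - em F a b l"
  by (simp add: em_def v_swap[of b a] fun_eq_iff)

lemma em_self: "em F a a l = 0"
  by (simp add: em_def v_self fun_eq_iff zero_fun_apply)

lemma v_first: "a < n \<Longrightarrow> b < n \<Longrightarrow> a \<noteq> b \<Longrightarrow> v a b a = X b"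
  by (simp add: v_eq e_def)

lemma v_other: "a < n \<Longrightarrow> b < n \<Longrightarrow> l \<noteq> a \<Longrightarrow> l \<noteq> b \<Longrightarrow> v a b l = 0"
  by (simp add: v_eq e_def)

lemma tr_em: "l < n \<Longrightarrow> tr n (em F a b l) = frag_of F * v a b l"
proof -
  assume l: "l < n"
  have "tr n (em F a b l) = (\<Sum>i<n. if i = l then frag_of F * v a b l else 0)"
    unfolding tr_def by (rule sum.cong[OF refl]) (simp add: em_def)
  then show ?thesis using l by simp
qed

text \<open>Modulo commutators every matrix is determined by its trace: the two commutator formulas
  \<open>off_diagonal\<close> and \<open>diagonal\<close> below reduce each generator to a standard one with the same trace.\<close>

lemma trace_zero_in_commutators:
  assumes n: "n \<ge> 2" and k: "k \<ge> 2" and Z: "subgroup Z add_grp"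
    and comm: "\<And>P Q. P \<in> Mt 1 \<Longrightarrow> Q \<in> Mt (k - 1) \<Longrightarrow> mcomm n P Q \<in> Z"
    and P: "P \<in> Mt k" "tr n P = 0"
  shows "P \<in> Z"
proof -
  have e0: "em {#} a b j \<in> Mt 1" if "a < n" "b < n" "j < n" for a b j
    using em_Mt[of "{#}" 0] that by (simp add: Mon_def)
  have e1: "em H a b j \<in> Mt (k - 1)" if "H \<in> Mon (k - 2)" "a < n" "b < n" "j < n" for H a b j
  proof -
    have "k - 2 + 1 = k - 1" using k by simp
    then show ?thesis using em_Mt[OF that] by simp
  qed
  have off_diagonal: "em (add_mset d H) a b l \<in> Z"
    if "H \<in> Mon (k - 2)" "d < n" "a < n" "b < n" "l < n" "l \<noteq> a" "l \<noteq> b" for H d a b l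
  proof -
    \<comment> \<open>Any index other than \<open>d\<close> serves: \<open>v j d\<close> then has
      the entry \<open>X d\<close> at \<open>j\<close>, while \<open>v a b\<close> has entry zero at
      \<open>l\<close>, so only the first term of the commutator survives.\<close>
    define j where "j = (if d = 0 then 1 else 0 :: nat)"
    have j: "j < n" "j \<noteq> d" using n by (auto simp: j_def)
    have "mcomm n (em {#} a b j) (em H j d l) = em (add_mset d H) a b l"
      unfolding mcomm_em[OF j(1) that(5)] v_first[OF j(1) that(2) j(2)] v_other[OF that(3,4,6,7)]
      by (simp add: em_def fun_eq_iff X_def mult_single)
    then show ?thesis using comm[OF e0[OF that(3,4) j(1)] e1[OF that(1) j(1) that(2,5)]] by simp
  qed
  have diagonal: "em (add_mset d H) a b a - em (add_mset b H) j d j \<in> Z"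
    if "H \<in> Mon (k - 2)" "a < n" "b < n" "j < n" "d < n" "a \<noteq> b" "j \<noteq> d" for H a b j d
  proof -
    \<comment> \<open>Here both entries met are variables, \<open>X d\<close> and
      \<open>X b\<close>, and the two resulting one-row matrices have the same trace.\<close>
    have "mcomm n (em {#} a b j) (em H j d a) = em (add_mset d H) a b a - em (add_mset b H) j d j"
      unfolding mcomm_em[OF that(4,2)] v_first[OF that(4,5,7)] v_first[OF that(2,3,6)]
      by (simp add: em_def fun_eq_iff X_def mult_single)
    then show ?thesis using comm[OF e0[OF that(2,3,4)] e1[OF that(1,4,5,2)]] by simp
  qed
  define a0 where "a0 m = (if m = 0 then 1 else 0 :: nat)" for m :: nat
  have a0: "a0 m < n" "a0 m \<noteq> m" for m using n by (auto simp: a0_def)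
  \<comment> \<open>A representative of trace \<open>M\<close> for each nonempty monomial in the
    available variables: the least variable of \<open>M\<close> is split off and returned by the
    diagonal entry of \<open>v\<close>. The role of \<open>a0\<close> is only to name an index
    different from its argument.\<close>
  define t where "t M = em (M - {#Min_mset M#}) (a0 (Min_mset M)) (Min_mset M) (a0 (Min_mset M))" for M
  define T where "T = frag_hom add_grp t"
  have T: "T \<in> hom add_grp add_grp" "T (frag_of M) = t M" for M
    unfolding T_def by (rule frag_hom_add_grp)+
  interpret T: group_hom add_grp add_grp T by (intro group_homI group_add_grp T(1))
  have T_diff: "T (p - q) = T p - T q" and T_0: "T 0 = 0" for p q
    using T.hom_mult[of p "- q"] T.hom_inv[of q] T.hom_one by simp_all
  have main: "em F a b a - t (add_mset b F) \<in> Z" if F: "F \<in> Mon (k - 1)" and ab: "a < n" "b < n" "a \<noteq> b" for F a b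
  proof -
    define m where "m = Min_mset (add_mset b F)"
    have mM: "m \<in># add_mset b F" unfolding m_def by (rule Min_in) simp_all
    have mn: "m < n" using mM F ab by (auto simp: Mon_def)
    have tm: "t (add_mset b F) = em (add_mset b F - {#m#}) (a0 m) m (a0 m)"
      unfolding t_def m_def ..
    show ?thesis
    proof (cases "b = m")
      case True
      \<comment> \<open>Now \<open>b\<close> is itself the least variable and cannot be exchanged
        for a smaller one. Both matrices are compared with a third, built on another variable
        \<open>d\<close> of the monomial; such a \<open>d\<close> exists because \<open>k\<close> is
        at least 2.\<close>
      have "size F \<noteq> 0" using F k by (simp add: Mon_def)
      then obtain d H where H: "F = add_mset d H" by (metis multiset_cases size_empty)
      have Hd: "H \<in> Mon (k - 2)" "d < n" using F H by (auto simp: Mon_def)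
      have 1: "em F a m a - em (add_mset m H) (a0 d) d (a0 d) \<in> Z"
        unfolding H by (rule diagonal) (use Hd ab True a0 in auto)
      have 2: "em F (a0 m) m (a0 m) - em (add_mset m H) (a0 d) d (a0 d) \<in> Z"
        unfolding H by (rule diagonal) (use Hd mn a0 in auto)
      have "em F a m a - em F (a0 m) m (a0 m) \<in> Z"
        using add_subgroupD(4)[OF Z 1 2] by (simp only: diff_diff_eq2 diff_add_cancel)
      then show ?thesis unfolding True tm[unfolded True] by (simp only: add_mset_remove_trivial)
    next
      case False
      then have "m \<in># F" using mM by simp
      then obtain H where H: "F = add_mset m H" by (metis insert_DiffM)
      have Hd: "H \<in> Mon (k - 2)" using F H by (auto simp: Mon_def)
      \<comment> \<open>One exchange of \<open>b\<close> against the least variable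
        \<open>m\<close>; the second matrix is already the representative of the common
        trace.\<close>
      have "em (add_mset m H) a b a - em (add_mset b H) (a0 m) m (a0 m) \<in> Z"
        by (rule diagonal) (use Hd ab mn a0 in auto)
      moreover have "add_mset b F - {#m#} = add_mset b H" by (simp add: H add_mset_commute[of b m])
      ultimately show ?thesis unfolding tm by (simp only: H)
    qed
  qed
  \<comment> \<open>Being congruent to the representative of one's own trace is preserved by
    differences, so it can be checked on the generating matrices.\<close>
  let ?S = "{P. P - T (tr n P) \<in> Z}"
  have S: "subgroup ?S add_grp"
  proof (rule add_subgroupI)
    show "0 \<in> ?S" using add_subgroupD(1)[OF Z] by (simp add: tr_0 T_0)
    show "p - q \<in> ?S" if "p \<in> ?S" "q \<in> ?S" for p q
    proof -
      have eq: "p - q - T (tr n (p - q)) = (p - T (tr n p)) - (q - T (tr n q))" by (simp add: tr_diff T_diff)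
      have pq: "p - T (tr n p) \<in> Z" "q - T (tr n q) \<in> Z" using that by blast+
      show ?thesis unfolding mem_Collect_eq eq by (rule add_subgroupD(4)[OF Z pq])
    qed
  qed
  have first: "em F a b a \<in> ?S" if F: "F \<in> Mon (k - 1)" and ab: "a < n" "b < n" "a \<noteq> b" for F a b
  proof -
    have "tr n (em F a b a) = frag_of (add_mset b F)"
      using ab by (simp add: tr_em v_first X_def mult_single)
    then show ?thesis using main[OF that] by (simp add: T(2))
  qed
  have "P \<in> ?S"
  proof (rule Mt_generated[OF S, of "k - 1"])
    show "P \<in> Mt (k - 1 + 1)" using P(1) k by simp
    fix F a b l assume F: "F \<in> Mon (k - 1)" and ab: "a < n" "b < n" "l < n"
    consider "a = b" | "l \<noteq> a" "l \<noteq> b" | "a \<noteq> b" "l = a" | "a \<noteq> b" "l = b" by blast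
    then show "em F a b l \<in> ?S"
    proof cases
      case 1 then show ?thesis using add_subgroupD(1)[OF S] by (simp add: em_self)
    next
      case 2
      have "size F \<noteq> 0" using F k by (simp add: Mon_def)
      then obtain d H where H: "F = add_mset d H" by (metis multiset_cases size_empty)
      have "H \<in> Mon (k - 2)" "d < n" using F H by (auto simp: Mon_def)
      then have "em F a b l \<in> Z" unfolding H by (intro off_diagonal) (use ab 2 in auto)
      moreover have "tr n (em F a b l) = 0" using ab 2 by (simp add: tr_em v_other)
      ultimately show ?thesis by (simp add: T_0)
    next
      case 3 then show ?thesis using first[OF F ab(1,2)] by simp
    next
      case 4
      have "em F b a b \<in> ?S" by (rule first[OF F ab(2,1)]) (use 4 in simp)
      then have "- em F b a b \<in> ?S" by (rule add_subgroupD(3)[OF S])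
      then show ?thesis unfolding 4(2) em_swap[of F a b b] .
    qed
  qed
  then show ?thesis using P(2) by (simp add: T_0)
qed

lemma trace_monomial:
  assumes n: "n \<ge> 2" and M: "M \<in> Mon (k + 1)"
  shows "\<exists>P\<in>Mt (k + 1). tr n P = frag_of M"
proof -
  have "size M \<noteq> 0" using M by (simp add: Mon_def)
  then obtain b F where F: "M = add_mset b F" by (metis multiset_cases size_empty)
  have b: "b < n" "F \<in> Mon k" using M F by (auto simp: Mon_def)
  define a where "a = (if b = 0 then 1 else 0 :: nat)"
  have a: "a < n" "a \<noteq> b" using n by (auto simp: a_def)
  have "em F a b a \<in> Mt (k + 1)" by (rule em_Mt[OF b(2) a(1) b(1) a(1)])
  moreover have "tr n (em F a b a) = frag_of M"
    using a b by (simp add: tr_em v_first X_def mult_single F)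
  ultimately show ?thesis by blast
qed

lemma theta_Mt: "k \<ge> 1 \<Longrightarrow> P \<in> Mt k \<Longrightarrow> j < n \<Longrightarrow> theta n (P j) = 0"
  using theta_J[of "k + 1"] by (auto simp: Mt_def B_def)

lemma mcomm_Mt:
  assumes "k \<ge> 1" "l \<ge> 1" "P \<in> Mt k" "Q \<in> Mt l"
  shows "mcomm n P Q \<in> Mt (k + l)"
proof -
  have prod: "(\<lambda>i. \<Sum>m<n. P m i * Q j m) \<in> B (k + l + 1)"
    if k: "k \<ge> 1" "l \<ge> 1" and PQ: "P \<in> Mt k" "Q \<in> Mt l" and j: "j < n" for k l P Q j
  proof -
    obtain A where A: "A \<in> carrier (gr G (l + 1))" "Q j = J (l + 1) A" using PQ j by (auto simp: Mt_def B_def)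
    have "(\<lambda>i. \<Sum>m<n. P m i * J (l + 1) A m) \<in> B (l + 1 + k)"
      by (rule B_matrix[OF k(1) _ _ A(1)]) (use PQ in \<open>simp_all add: Mt_def\<close>)
    then show ?thesis unfolding A(2) by (simp add: add_ac)
  qed
  have "mcomm n P Q j \<in> B (k + l + 1)" if j: "j < n" for j
  proof -
    have "mcomm n P Q j = (\<lambda>i. \<Sum>m<n. P m i * Q j m) - (\<lambda>i. \<Sum>m<n. Q m i * P j m)"
      by (simp add: mcomm_def fun_eq_iff)
    moreover have "(\<lambda>i. \<Sum>m<n. Q m i * P j m) \<in> B (k + l + 1)"
      using prod[OF assms(2,1,4,3) j] by (simp add: add.commute)
    ultimately show ?thesis using B_closed(4)[OF _ prod[OF assms j]] by simp
  qed
  moreover have "mcomm n P Q j = 0" if j: "j \<ge> n" for j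
  proof -
    have "P j = 0" "Q j = 0" using assms(3,4) j by (simp_all add: Mt_def)
    then show ?thesis by (simp add: mcomm_def fun_eq_iff)
  qed
  ultimately show ?thesis by (simp add: Mt_def)
qed

end

section \<open>Derivations as matrices\<close>

context chen_magnus
begin

interpretation C: comm_group "chen n" by (rule chen_comm_group)

text \<open>\<open>D\<close> is the operator of the matrix \<open>P\<close> as seen through the
  injective map \<open>Jh\<close>. Questions about derivations are thereby moved to matrices, with
  no choice involved on either side.\<close>

definition rep :: "nat \<Rightarrow> ((nat \<Rightarrow> word set set) \<Rightarrow> nat \<Rightarrow> word set set) \<Rightarrow> (nat \<Rightarrow> nat \<Rightarrow> poly) \<Rightarrow> bool" where
  "rep k D P \<longleftrightarrow> P \<in> Mt k \<and> D \<in> extensional (carrier (chen n)) \<and>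
     (\<forall>x\<in>carrier (chen n). D x \<in> carrier (chen n) \<and> Jh (D x) = act n k P (Jh x))"

lemma repD:
  assumes "rep k D P"
  shows "P \<in> Mt k" "D \<in> extensional (carrier (chen n))"
    "x \<in> carrier (chen n) \<Longrightarrow> D x \<in> carrier (chen n)"
    "x \<in> carrier (chen n) \<Longrightarrow> Jh (D x) = act n k P (Jh x)"
  using assms unfolding rep_def by blast+

abbreviation "x_el j \<equiv> hom_el 1 (g j)"

lemma x_el_closed: "j < n \<Longrightarrow> x_el j \<in> carrier (chen n)"
  by (rule hom_el_closed) (simp_all only: le_refl g_closed)

lemma act_x_el: "j < n \<Longrightarrow> act n k P (Jh (x_el j)) = (\<lambda>i. fps_X ^ k * fps_const (P j i))"
proof -
  assume j: "j < n"
  have "(\<Sum>m<n. fps_const (P m i) * (if m = j then 1 else 0)) = (\<Sum>m<n. if m = j then fps_const (P j i) else 0)" for i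
    by (rule sum.cong) simp_all
  then show ?thesis using j unfolding act_def Jh_gen[OF j] by simp
qed

definition Psi :: "nat \<Rightarrow> ((nat \<Rightarrow> word set set) \<Rightarrow> nat \<Rightarrow> word set set) \<Rightarrow> nat \<Rightarrow> nat \<Rightarrow> poly" where
  "Psi k D = (\<lambda>j. if j < n then J (k + 1) (D (x_el j) (k + 1)) else 0)"

lemma rep_Psi: assumes "rep k D P" shows "Psi k D = P"
proof
  fix j
  show "Psi k D j = P j"
  proof (cases "j < n")
    case True
    have "J (Suc k) (D (x_el j) (Suc k)) i = P j i" for i
    proof -
      have "J (Suc k) (D (x_el j) (Suc k)) i = fps_nth (Jh (D (x_el j)) i) k" by (simp only: Jh_nth)
      also have "\<dots> = fps_nth (fps_X ^ k * fps_const (P j i)) k"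
        by (simp only: repD(4)[OF assms x_el_closed[OF True]] act_x_el[OF True])
      also have "\<dots> = P j i" by (simp add: fps_X_power_mult_nth)
      finally show ?thesis .
    qed
    then show ?thesis using True by (simp add: Psi_def fun_eq_iff)
  next
    case False then show ?thesis using repD(1)[OF assms] by (simp add: Psi_def Mt_def)
  qed
qed

lemma rep_unique: assumes "rep k D P" "rep k E P" shows "D = E"
proof (rule extensionalityI)
  show "D \<in> extensional (carrier (chen n))" "E \<in> extensional (carrier (chen n))" using assms repD(2) by blast+
  show "D x = E x" if x: "x \<in> carrier (chen n)" for x
    by (rule Jh_eqI) (use repD(3,4)[OF assms(1) x] repD(3,4)[OF assms(2) x] in simp_all)
qed

text \<open>In each degree above \<open>k\<close> the tuple prescribed by the matrix lies in the
  image \<open>B\<close>, by \<open>B_matrix\<close>, and \<open>Linv\<close> returns the element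
  with that tuple. Degrees up to \<open>k\<close> get the neutral element, as degrees are raised by
  \<open>k\<close>.\<close>

lemma rep_exists:
  assumes k: "k \<ge> 1" and P: "P \<in> Mt k"
  shows "\<exists>D. rep k D P"
proof -
  define z where "z x m = (if m > k then Linv m (\<lambda>i. \<Sum>j<n. P j i * J (m - k) (x (m - k)) j) else \<one>\<^bsub>chen_gr n m\<^esub>)"
    for x :: "nat \<Rightarrow> word set set" and m
  define D where "D = (\<lambda>x\<in>carrier (chen n). \<lambda>m\<in>{1..}. z x m)"
  have zc: "z x m \<in> carrier (chen_gr n m)"
    and Jz: "J m (z x m) = (if m > k then (\<lambda>i. \<Sum>j<n. P j i * J (m - k) (x (m - k)) j) else 0)"
    if x: "x \<in> carrier (chen n)" and m: "m \<ge> 1" for x m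
  proof -
    interpret H: comm_group "chen_gr n m" by (rule gr_comm_group[OF m])
    have "z x m \<in> carrier (chen_gr n m) \<and> J m (z x m) = (if m > k then (\<lambda>i. \<Sum>j<n. P j i * J (m - k) (x (m - k)) j) else 0)"
    proof (cases "m > k")
      case True
      have mk: "m - k \<ge> 1" "m - k + k = m" using True by auto
      have "(\<lambda>i. \<Sum>j<n. P j i * J (m - k) (x (m - k)) j) \<in> B m"
        using B_matrix[OF k mk(1) _ chen_component[OF x mk(1)], of P] P mk(2) by (simp add: Mt_def)
      then obtain A where A: "A \<in> carrier (chen_gr n m)" "(\<lambda>i. \<Sum>j<n. P j i * J (m - k) (x (m - k)) j) = J m A"
        unfolding B_def by blast
      have "z x m = A" unfolding z_def if_P[OF True] A(2) by (rule Linv_J[OF m A(1)])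
      then show ?thesis using A(1) unfolding if_P[OF True] A(2) by blast
    next
      case False
      then have "z x m = \<one>\<^bsub>chen_gr n m\<^esub>" unfolding z_def by (rule if_not_P)
      then show ?thesis unfolding if_not_P[OF False] using J_simps(1)[OF m] by simp
    qed
    then show "z x m \<in> carrier (chen_gr n m)"
      "J m (z x m) = (if m > k then (\<lambda>i. \<Sum>j<n. P j i * J (m - k) (x (m - k)) j) else 0)" by blast+
  qed
  have "D x \<in> carrier (chen n) \<and> Jh (D x) = act n k P (Jh x)" if x: "x \<in> carrier (chen n)" for x
  proof
    have Dx: "D x = (\<lambda>m\<in>{1..}. z x m)" using x by (simp add: D_def)
    have "finite {i \<in> {1..}. x i \<noteq> \<one>\<^bsub>chen_gr n i\<^esub>}" using x unfolding chen_simps L.carrier_iff by blast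
    then have f: "finite ((\<lambda>i. i + k) ` {i \<in> {1..}. x i \<noteq> \<one>\<^bsub>chen_gr n i\<^esub>})" by (rule finite_imageI)
    have "{i \<in> {1..}. D x i \<noteq> \<one>\<^bsub>chen_gr n i\<^esub>} \<subseteq> (\<lambda>i. i + k) ` {i \<in> {1..}. x i \<noteq> \<one>\<^bsub>chen_gr n i\<^esub>}"
    proof
      fix m assume "m \<in> {i \<in> {1..}. D x i \<noteq> \<one>\<^bsub>chen_gr n i\<^esub>}"
      then have m': "m \<in> {1..}" "D x m \<noteq> \<one>\<^bsub>chen_gr n m\<^esub>" by blast+
      have "D x m = z x m" unfolding Dx by (rule restrict_apply'[OF m'(1)])
      then have mb: "z x m \<noteq> \<one>\<^bsub>chen_gr n m\<^esub>" using m'(2) by (rule subst)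
      have ma: "m \<ge> 1" using m'(1) by simp
      note m = ma mb
      have mk: "m > k"
      proof (rule ccontr)
        assume "\<not> m > k"
        then have "z x m = \<one>\<^bsub>chen_gr n m\<^esub>" unfolding z_def by (rule if_not_P)
        then show False using m(2) by contradiction
      qed
      \<comment> \<open>The support of the value is the support of \<open>x\<close> shifted by
        \<open>k\<close>, or less: a trivial component of \<open>x\<close> prescribes the zero
        tuple, whose only preimage under \<open>J m\<close> is trivial.\<close>
      have "x (m - k) \<noteq> \<one>\<^bsub>chen_gr n (m - k)\<^esub>"
      proof
        assume "x (m - k) = \<one>\<^bsub>chen_gr n (m - k)\<^esub>"
        moreover have "J (m - k) \<one>\<^bsub>chen_gr n (m - k)\<^esub> = 0" by (rule J_simps(1)) (use mk in simp)
        ultimately have "J (m - k) (x (m - k)) j = 0" for j by simp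
        then have "J m (z x m) = 0"
          unfolding Jz[OF x m(1)] if_P[OF mk] by (simp add: zero_fun_apply)
        then have "z x m = \<one>\<^bsub>chen_gr n m\<^esub>" unfolding J_eq_0[OF m(1) zc[OF x m(1)]] .
        then show False using m(2) by contradiction
      qed
      then show "m \<in> (\<lambda>i. i + k) ` {i \<in> {1..}. x i \<noteq> \<one>\<^bsub>chen_gr n i\<^esub>}"
        using mk by (intro image_eqI[of _ _ "m - k"]) auto
    qed
    then have "finite {i \<in> {1..}. D x i \<noteq> \<one>\<^bsub>chen_gr n i\<^esub>}" using f by (rule finite_subset)
    moreover have "D x i \<in> carrier (chen_gr n i)" if "i \<in> {1..}" for i using zc[OF x, of i] that by (simp add: Dx)
    moreover have "D x \<in> extensional {1..}" by (simp add: Dx)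
    ultimately show "D x \<in> carrier (chen n)" unfolding chen_simps L.carrier_iff by blast
    show "Jh (D x) = act n k P (Jh x)"
    proof (rule ext, rule fps_ext)
      fix i m
      have "fps_nth (Jh (D x) i) m = J (Suc m) (z x (Suc m)) i" by (simp add: Jh_nth Dx)
      also have "\<dots> = fps_nth (act n k P (Jh x) i) m"
      proof (cases "m < k")
        case True
        then have "J (Suc m) (z x (Suc m)) = 0" using Jz[OF x, of "Suc m"] by simp
        then show ?thesis using True by (simp add: act_nth)
      next
        case False
        then have "J (Suc m) (z x (Suc m)) = (\<lambda>i. \<Sum>j<n. P j i * J (Suc m - k) (x (Suc m - k)) j)"
          using Jz[OF x, of "Suc m"] by simp
        moreover have "Suc m - k = Suc (m - k)" using False by simp
        ultimately show ?thesis using False by (simp only: act_nth Jh_nth if_False)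
      qed
      finally show "fps_nth (Jh (D x) i) m = fps_nth (act n k P (Jh x) i) m" .
    qed
  qed
  moreover have "D \<in> extensional (carrier (chen n))" by (simp add: D_def)
  ultimately have "rep k D P" using P unfolding rep_def by blast
  then show ?thesis by blast
qed

lemma carrier_der: "D \<in> carrier (der n k) \<longleftrightarrow> D \<in> extensional (carrier (chen n)) \<and> lie_derivation (chen n) D \<and>
    D ` degree_part {1..} (chen_gr n) 1 \<subseteq> degree_part {1..} (chen_gr n) (k + 1)"
  by (simp add: der_def)

text \<open>The Leibniz rule is \<open>act_Brc\<close> pulled back along the injective
  \<open>Jh\<close>; it uses that the rows of matrices in \<open>Mt k\<close> are killed by
  \<open>theta\<close>.\<close>

lemma rep_der:
  assumes k: "k \<ge> 1" and r: "rep k D P"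
  shows "D \<in> carrier (der n k)"
  unfolding carrier_der
proof (intro conjI)
  note D = repD(3,4)[OF r]
  have th: "\<And>j. j < n \<Longrightarrow> theta n (P j) = 0" using theta_Mt[OF k repD(1)[OF r]] by blast
  show "D \<in> extensional (carrier (chen n))" by (rule repD(2)[OF r])
  show "lie_derivation (chen n) D" unfolding lie_derivation_def
  proof (intro conjI ballI homI)
    fix x y assume x: "x \<in> carrier (chen n)" and y: "y \<in> carrier (chen n)"
    show "D x \<in> carrier (chen n)" by (rule D(1)[OF x])
    show "D (x \<otimes>\<^bsub>chen n\<^esub> y) = D x \<otimes>\<^bsub>chen n\<^esub> D y"
      by (rule Jh_eqI) (simp_all only: Jh_mult D C.m_closed x y act_linear)
    have b: "bracket (chen n) x y \<in> carrier (chen n)" "bracket (chen n) (D x) y \<in> carrier (chen n)" "bracket (chen n) x (D y) \<in> carrier (chen n)"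
      using x y D(1) by (simp_all add: chen_bracket_closed)
    show "D (bracket (chen n) x y) = bracket (chen n) (D x) y \<otimes>\<^bsub>chen n\<^esub> bracket (chen n) x (D y)"
    proof (rule Jh_eqI)
      show "Jh (D (bracket (chen n) x y)) = Jh (bracket (chen n) (D x) y \<otimes>\<^bsub>chen n\<^esub> bracket (chen n) x (D y))"
        unfolding D(2)[OF b(1)] Jh_mult[OF b(2,3)] Jh_bracket[OF x y] Jh_bracket[OF D(1)[OF x] y]
          Jh_bracket[OF x D(1)[OF y]] D(2)[OF x] D(2)[OF y] by (rule act_Brc[OF th])
    qed (simp_all only: D b C.m_closed)
  qed
  show "D ` degree_part {1..} (chen_gr n) 1 \<subseteq> degree_part {1..} (chen_gr n) (k + 1)"
  proof (rule image_subsetI)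
    fix x assume "x \<in> degree_part {1..} (chen_gr n) 1"
    then have x: "x \<in> carrier (chen n)" and x1: "\<And>i. i \<ge> 1 \<Longrightarrow> i \<noteq> 1 \<Longrightarrow> x i = \<one>\<^bsub>chen_gr n i\<^esub>"
      by (auto simp: degree_part_def chen_simps)
    have xz: "fps_nth (Jh x j) m = 0" if "m \<noteq> 0" for j m
      using x1[of "Suc m"] J_simps(1)[of "Suc m"] that by (simp add: Jh_nth zero_fun_apply)
    have "D x i = \<one>\<^bsub>chen_gr n i\<^esub>" if i: "i \<ge> 1" "i \<noteq> k + 1" for i
    proof -
      obtain m where m: "i = Suc m" using i(1) by (cases i) auto
      have "fps_nth (act n k P (Jh x) l) m = 0" for l
        unfolding act_nth using xz[of "m - k"] i(2) m by simp
      then have "J i (D x i) = 0"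
        using D(2)[OF x] unfolding m by (metis (no_types) Jh_nth ext zero_fun_apply)
      then show ?thesis using J_eq_0[OF i(1) chen_component[OF D(1)[OF x] i(1)]] by simp
    qed
    then show "D x \<in> degree_part {1..} (chen_gr n) (k + 1)"
      using D(1)[OF x] by (auto simp: degree_part_def chen_simps)
  qed
qed

text \<open>The elements on which \<open>D\<close> agrees with the operator of its own matrix form a
  subgroup. It contains the generators, since \<open>D\<close> sends them to pure degree
  \<open>k + 1\<close>, and by the Leibniz rule it is stable under brackets with them, so
  \<open>chen_generated\<close> applies.\<close>

lemma der_rep:
  assumes k: "k \<ge> 1" and D: "D \<in> carrier (der n k)"
  shows "rep k D (Psi k D)"
proof -
  note D' = D[unfolded carrier_der]
  have Dh: "D \<in> hom (chen n) (chen n)"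
    and Db: "\<And>x y. x \<in> carrier (chen n) \<Longrightarrow> y \<in> carrier (chen n) \<Longrightarrow>
       D (bracket (chen n) x y) = bracket (chen n) (D x) y \<otimes>\<^bsub>chen n\<^esub> bracket (chen n) x (D y)"
    using D' unfolding lie_derivation_def by blast+
  have Dc: "D x \<in> carrier (chen n)" if "x \<in> carrier (chen n)" for x by (rule hom_in_carrier[OF Dh that])
  interpret D: group_hom "chen n" "chen n" D by (intro group_homI C.is_group Dh)
  let ?P = "Psi k D"
  have x1: "x_el j \<in> degree_part {1..} (chen_gr n) 1" if "j < n" for j
    using x_el_closed[OF that] by (simp add: degree_part_def chen_simps homog_def)
  have Dx: "D (x_el j) \<in> degree_part {1..} (chen_gr n) (k + 1)" if "j < n" for j
    using D' x1[OF that] by blast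
  have P: "?P \<in> Mt k"
    using chen_component[OF Dc[OF x_el_closed], of _ "k + 1"] unfolding Mt_def B_def Psi_def by simp
  have th: "\<And>j. j < n \<Longrightarrow> theta n (?P j) = 0" using theta_Mt[OF k P] by blast
  have gen: "Jh (D (x_el j)) = act n k ?P (Jh (x_el j))" if j: "j < n" for j
    unfolding act_x_el[OF j]
  proof (rule ext, rule fps_ext)
    fix i m
    show "fps_nth (Jh (D (x_el j)) i) m = fps_nth (fps_X ^ k * fps_const (?P j i)) m"
    proof (cases "m = k")
      case True then show ?thesis using j by (simp add: Jh_nth Psi_def fps_X_power_mult_nth)
    next
      case False
      have "D (x_el j) (Suc m) = \<one>\<^bsub>chen_gr n (Suc m)\<^esub>"
        using Dx[OF j] False by (simp add: degree_part_def)
      then show ?thesis using False J_simps(1)[of "Suc m"] by (simp add: Jh_nth fps_X_power_mult_nth zero_fun_apply)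
    qed
  qed
  let ?S = "{x \<in> carrier (chen n). Jh (D x) = act n k ?P (Jh x)}"
  have S: "subgroup ?S (chen n)"
  proof (rule C.subgroupI)
    have "\<one>\<^bsub>chen n\<^esub> \<in> ?S" by (simp add: Jh_one act_linear)
    then show "?S \<noteq> {}" by blast
    show "inv\<^bsub>chen n\<^esub> x \<in> ?S" if "x \<in> ?S" for x
    proof -
      have "act n k ?P (- Jh x) = - act n k ?P (Jh x)"
        using act_linear(1)[of n k ?P "Jh x" "- Jh x"] by (simp add: act_linear(3) eq_neg_iff_add_eq_0 add.commute)
      then show ?thesis using that Dc by (simp add: Jh_inv)
    qed
    show "x \<otimes>\<^bsub>chen n\<^esub> y \<in> ?S" if "x \<in> ?S" "y \<in> ?S" for x y
      using that Dc by (simp add: Jh_mult act_linear)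
  qed simp
  have "x \<in> ?S" if x: "x \<in> carrier (chen n)" for x
  proof (rule chen_generated[OF S _ _ x])
    show "x_el i \<in> ?S" if "i < n" for i using gen[OF that] x_el_closed[OF that] by blast
    show "bracket (chen n) y (x_el i) \<in> ?S" if y: "y \<in> ?S" and i: "i < n" for y i
    proof -
      have yJ: "Jh (D y) = act n k ?P (Jh y)" using y by blast
      have yc: "y \<in> carrier (chen n)" and xc: "x_el i \<in> carrier (chen n)" using y x_el_closed[OF i] by blast+
      note b = chen_bracket_closed[OF Dc[OF yc] xc] chen_bracket_closed[OF yc Dc[OF xc]]
      have "Jh (D (bracket (chen n) y (x_el i))) = act n k ?P (Jh (bracket (chen n) y (x_el i)))"
        unfolding Db[OF yc xc] Jh_mult[OF b] Jh_bracket[OF Dc[OF yc] xc] Jh_bracket[OF yc Dc[OF xc]]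
          Jh_bracket[OF yc xc] gen[OF i] yJ by (rule act_Brc[OF th, symmetric])
      then show ?thesis using chen_bracket_closed[OF yc xc] by blast
    qed
  qed
  note S_all = this
  show ?thesis unfolding rep_def
  proof (intro conjI ballI)
    show "D \<in> extensional (carrier (chen n))" using D' by blast
    show "Jh (D x) = act n k ?P (Jh x)" if "x \<in> carrier (chen n)" for x using S_all[OF that] by blast
    show "?P \<in> Mt k" by (rule P)
    show "D x \<in> carrier (chen n)" if "x \<in> carrier (chen n)" for x by (rule Dc[OF that])
  qed
qed

lemma der_simps:
  "D \<otimes>\<^bsub>der n k\<^esub> E = (\<lambda>x\<in>carrier (chen n). D x \<otimes>\<^bsub>chen n\<^esub> E x)"
  "\<one>\<^bsub>der n k\<^esub> = (\<lambda>x\<in>carrier (chen n). \<one>\<^bsub>chen n\<^esub>)"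
  by (simp_all add: der_def)

lemma rep_mult:
  assumes "rep k D P" "rep k E Q" shows "rep k (D \<otimes>\<^bsub>der n k\<^esub> E) (P + Q)"
  unfolding rep_def der_simps
proof (intro conjI ballI)
  show "P + Q \<in> Mt k" using add_subgroupD(2)[OF Mt_subgroup] assms repD(1) by blast
  fix x assume x: "x \<in> carrier (chen n)"
  note D = repD(3,4)[OF assms(1) x] and E = repD(3,4)[OF assms(2) x]
  show "(\<lambda>x\<in>carrier (chen n). D x \<otimes>\<^bsub>chen n\<^esub> E x) x \<in> carrier (chen n)" using x D E by simp
  show "Jh ((\<lambda>x\<in>carrier (chen n). D x \<otimes>\<^bsub>chen n\<^esub> E x) x) = act n k (P + Q) (Jh x)"
    using x D E by (simp add: Jh_mult act_matrix)
qed simp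

lemma rep_one: "rep k \<one>\<^bsub>der n k\<^esub> 0"
  unfolding rep_def der_simps using add_subgroupD(1)[OF Mt_subgroup[of k]]
  by (simp add: Jh_one act_matrix)

text \<open>The group laws are those of matrices, transported by \<open>rep_unique\<close>.\<close>

lemma der_comm_group: assumes k: "k \<ge> 1" shows "comm_group (der n k)"
proof (rule comm_groupI)
  note r = der_rep[OF k] and d = rep_der[OF k]
  fix D assume D: "D \<in> carrier (der n k)"
  show "\<one>\<^bsub>der n k\<^esub> \<otimes>\<^bsub>der n k\<^esub> D = D"
    by (rule rep_unique[OF rep_mult[OF rep_one r[OF D]]]) (use r[OF D] in simp)
  obtain E where E: "rep k E (- Psi k D)"
    using rep_exists[OF k] add_subgroupD(3)[OF Mt_subgroup repD(1)[OF r[OF D]]] by blast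
  have "E \<otimes>\<^bsub>der n k\<^esub> D = \<one>\<^bsub>der n k\<^esub>"
    by (rule rep_unique[OF rep_mult[OF E r[OF D]]]) (use rep_one in simp)
  then show "\<exists>E\<in>carrier (der n k). E \<otimes>\<^bsub>der n k\<^esub> D = \<one>\<^bsub>der n k\<^esub>" using d[OF E] by blast
  fix E assume E: "E \<in> carrier (der n k)"
  show "D \<otimes>\<^bsub>der n k\<^esub> E \<in> carrier (der n k)" by (rule d[OF rep_mult[OF r[OF D] r[OF E]]])
  show "D \<otimes>\<^bsub>der n k\<^esub> E = E \<otimes>\<^bsub>der n k\<^esub> D"
    by (rule rep_unique[OF rep_mult[OF r[OF D] r[OF E]]]) (use rep_mult[OF r[OF E] r[OF D]] in \<open>simp add: add.commute\<close>)
  fix F assume F: "F \<in> carrier (der n k)"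
  show "D \<otimes>\<^bsub>der n k\<^esub> E \<otimes>\<^bsub>der n k\<^esub> F = D \<otimes>\<^bsub>der n k\<^esub> (E \<otimes>\<^bsub>der n k\<^esub> F)"
    by (rule rep_unique[OF rep_mult[OF rep_mult[OF r[OF D] r[OF E]] r[OF F]]])
      (use rep_mult[OF r[OF D] rep_mult[OF r[OF E] r[OF F]]] in \<open>simp add: add.assoc\<close>)
next
  show "\<one>\<^bsub>der n k\<^esub> \<in> carrier (der n k)" by (rule rep_der[OF k rep_one])
qed

lemma Psi_hom: "k \<ge> 1 \<Longrightarrow> Psi k \<in> hom (der n k) add_grp"
  by (rule homI) (simp_all add: rep_Psi[OF rep_mult[OF der_rep der_rep]])

lemma Psi_Mt: "k \<ge> 1 \<Longrightarrow> D \<in> carrier (der n k) \<Longrightarrow> Psi k D \<in> Mt k"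
  using repD(1)[OF der_rep] .

lemma Psi_inj: "k \<ge> 1 \<Longrightarrow> D \<in> carrier (der n k) \<Longrightarrow> E \<in> carrier (der n k) \<Longrightarrow> Psi k D = Psi k E \<Longrightarrow> D = E"
  using rep_unique[of k D "Psi k D" E] der_rep[of k D] der_rep[of k E] by simp

lemma Psi_surj: "k \<ge> 1 \<Longrightarrow> P \<in> Mt k \<Longrightarrow> \<exists>D\<in>carrier (der n k). Psi k D = P"
  using rep_exists[of k P] rep_der rep_Psi by blast

lemma rep_bracket:
  assumes "k \<ge> 1" "l \<ge> 1" "rep k D P" "rep l E Q"
  shows "rep (k + l) (der_bracket n k l D E) (mcomm n P Q)"
  unfolding rep_def der_bracket_def
proof (intro conjI ballI)
  show "mcomm n P Q \<in> Mt (k + l)" by (rule mcomm_Mt[OF assms(1,2) repD(1)[OF assms(3)] repD(1)[OF assms(4)]])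
  fix x assume x: "x \<in> carrier (chen n)"
  note D = repD(3,4)[OF assms(3)] and E = repD(3,4)[OF assms(4)]
  have c: "D (E x) \<in> carrier (chen n)" "E (D x) \<in> carrier (chen n)" using D E x by blast+
  show "(\<lambda>x\<in>carrier (chen n). D (E x) \<otimes>\<^bsub>chen n\<^esub> inv\<^bsub>chen n\<^esub> E (D x)) x \<in> carrier (chen n)"
    using x c by simp
  have "Jh (D (E x) \<otimes>\<^bsub>chen n\<^esub> inv\<^bsub>chen n\<^esub> E (D x)) = act n k P (act n l Q (Jh x)) - act n l Q (act n k P (Jh x))"
    unfolding Jh_mult[OF c(1) C.inv_closed[OF c(2)]] Jh_inv[OF c(2)] D(2)[OF E(1)[OF x]] E(2)[OF D(1)[OF x]] D(2)[OF x] E(2)[OF x]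
    by simp
  then show "Jh ((\<lambda>x\<in>carrier (chen n). D (E x) \<otimes>\<^bsub>chen n\<^esub> inv\<^bsub>chen n\<^esub> E (D x)) x) = act n (k + l) (mcomm n P Q) (Jh x)"
    using x unfolding act_mcomm by simp
qed simp

lemma der_bracket_closed:
  assumes "k \<ge> 1" "l \<ge> 1" "D \<in> carrier (der n k)" "E \<in> carrier (der n l)"
  shows "der_bracket n k l D E \<in> carrier (der n (k + l))"
    and "Psi (k + l) (der_bracket n k l D E) = mcomm n (Psi k D) (Psi l E)"
proof -
  note r = rep_bracket[OF assms(1,2) der_rep[OF assms(1,3)] der_rep[OF assms(2,4)]]
  show "der_bracket n k l D E \<in> carrier (der n (k + l))" by (rule rep_der[OF _ r]) (use assms(1) in simp)
  show "Psi (k + l) (der_bracket n k l D E) = mcomm n (Psi k D) (Psi l E)" by (rule rep_Psi[OF r])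
qed

lemma mcomm_0: "mcomm n 0 Q = 0" "mcomm n P 0 = 0"
  by (simp_all add: mcomm_def fun_eq_iff)

lemma Psi_one: "Psi k \<one>\<^bsub>der n k\<^esub> = 0"
  by (rule rep_Psi[OF rep_one])

lemma der_bracket_one:
  assumes "k \<ge> 1" "l \<ge> 1"
  shows "D \<in> carrier (der n k) \<Longrightarrow> der_bracket n k l D \<one>\<^bsub>der n l\<^esub> = \<one>\<^bsub>der n (k + l)\<^esub>"
    and "E \<in> carrier (der n l) \<Longrightarrow> der_bracket n k l \<one>\<^bsub>der n k\<^esub> E = \<one>\<^bsub>der n (k + l)\<^esub>"
proof -
  have "rep (k + l) (der_bracket n k l D \<one>\<^bsub>der n l\<^esub>) 0" if "D \<in> carrier (der n k)"
    using rep_bracket[OF assms der_rep[OF assms(1) that] rep_one] by (simp add: mcomm_0)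
  then show "D \<in> carrier (der n k) \<Longrightarrow> der_bracket n k l D \<one>\<^bsub>der n l\<^esub> = \<one>\<^bsub>der n (k + l)\<^esub>"
    using rep_unique rep_one by blast
  have "rep (k + l) (der_bracket n k l \<one>\<^bsub>der n k\<^esub> E) 0" if "E \<in> carrier (der n l)"
    using rep_bracket[OF assms rep_one der_rep[OF assms(2) that]] by (simp add: mcomm_0)
  then show "E \<in> carrier (der n l) \<Longrightarrow> der_bracket n k l \<one>\<^bsub>der n k\<^esub> E = \<one>\<^bsub>der n (k + l)\<^esub>"
    using rep_unique rep_one by blast
qed

subsection \<open>The Lie algebra of positive derivations and its derived algebra\<close>

sublocale DG: group_family "{1..}" "der n"
  by (rule group_family.intro) (simp add: der_comm_group)

lemma der_plus_comm_group: "comm_group (der_plus n)"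
  unfolding der_plus_def graded_sum_def by (intro comm_group_lie_of sum_group_comm der_comm_group) simp

lemma der_plus_simps:
  "carrier (der_plus n) = carrier (sum_group {1..} (der n))"
  "x \<otimes>\<^bsub>der_plus n\<^esub> y = x \<otimes>\<^bsub>sum_group {1..} (der n)\<^esub> y"
  "\<one>\<^bsub>der_plus n\<^esub> = \<one>\<^bsub>sum_group {1..} (der n)\<^esub>"
  "bracket (der_plus n) x y =
     (\<lambda>m\<in>{1..}. finprod (der n m) (\<lambda>i. der_bracket n i (m - i) (x i) (y (m - i))) {1..<m})"
  unfolding der_plus_def by (rule graded_sum_simps)+

lemma der_plus_component: "x \<in> carrier (der_plus n) \<Longrightarrow> i \<ge> 1 \<Longrightarrow> x i \<in> carrier (der n i)"
  unfolding der_plus_simps DG.carrier_iff by simp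

lemma der_plus_bracket_closed:
  assumes "x \<in> carrier (der_plus n)" "y \<in> carrier (der_plus n)"
  shows "bracket (der_plus n) x y \<in> carrier (der_plus n)"
  unfolding der_plus_def
proof (rule graded_sum_bracket_closed[where G = "der n" and br = "der_bracket n"])
  show "comm_group (der n i)" if "i \<ge> 1" for i by (rule der_comm_group[OF that])
  show "der_bracket n i j a b \<in> carrier (der n (i + j))"
    if "i \<ge> 1" "j \<ge> 1" "a \<in> carrier (der n i)" "b \<in> carrier (der n j)" for i j a b
    by (rule der_bracket_closed(1)[OF that])
  show "der_bracket n i j a \<one>\<^bsub>der n j\<^esub> = \<one>\<^bsub>der n (i + j)\<^esub>"
    if "i \<ge> 1" "j \<ge> 1" "a \<in> carrier (der n i)" for i j a by (rule der_bracket_one(1)[OF that])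
  show "der_bracket n i j \<one>\<^bsub>der n i\<^esub> b = \<one>\<^bsub>der n (i + j)\<^esub>"
    if "i \<ge> 1" "j \<ge> 1" "b \<in> carrier (der n j)" for i j b by (rule der_bracket_one(2)[OF that])
qed (use assms in \<open>simp_all add: der_plus_def\<close>)

lemma der_bracket_term:
  assumes "x \<in> carrier (der_plus n)" "y \<in> carrier (der_plus n)" "i \<in> {1..<m}"
  shows "der_bracket n i (m - i) (x i) (y (m - i)) \<in> carrier (der n m)"
    and "Psi m (der_bracket n i (m - i) (x i) (y (m - i))) = mcomm n (Psi i (x i)) (Psi (m - i) (y (m - i)))"
proof -
  have i: "i \<ge> 1" "m - i \<ge> 1" "i + (m - i) = m" using assms(3) by auto
  note c = der_plus_component[OF assms(1) i(1)] der_plus_component[OF assms(2) i(2)]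
  show "der_bracket n i (m - i) (x i) (y (m - i)) \<in> carrier (der n m)"
    using der_bracket_closed(1)[OF i(1,2) c] unfolding i(3) .
  show "Psi m (der_bracket n i (m - i) (x i) (y (m - i))) = mcomm n (Psi i (x i)) (Psi (m - i) (y (m - i)))"
    using der_bracket_closed(2)[OF i(1,2) c] unfolding i(3) .
qed

lemma tr_sum: "tr n (sum f A) = (\<Sum>a\<in>A. tr n (f a))"
  by (induction A rule: infinite_finite_induct) (simp_all only: sum.insert tr_add tr_0 sum.empty sum.infinite if_False simp_thms)

text \<open>Each component of a bracket is a sum of matrix commutators, and those have trace
  zero.\<close>

lemma bracket_trace:
  assumes "x \<in> carrier (der_plus n)" "y \<in> carrier (der_plus n)" "m \<ge> 1"
  shows "tr n (Psi m (bracket (der_plus n) x y m)) = 0"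
proof -
  have c: "(\<lambda>i. der_bracket n i (m - i) (x i) (y (m - i))) \<in> {1..<m} \<rightarrow> carrier (der n m)"
    using der_bracket_term(1)[OF assms(1,2)] by blast
  have "Psi m (bracket (der_plus n) x y m) = (\<Sum>i\<in>{1..<m}. Psi m (der_bracket n i (m - i) (x i) (y (m - i))))"
    using hom_finprod[OF der_comm_group[OF assms(3)] comm_group_add_grp Psi_hom[OF assms(3)] c] assms(3) by (simp add: der_plus_simps)
  also have "\<dots> = (\<Sum>i\<in>{1..<m}. mcomm n (Psi i (x i)) (Psi (m - i) (y (m - i))))"
    by (rule sum.cong[OF refl]) (rule der_bracket_term(2)[OF assms(1,2)])
  finally show ?thesis by (simp only: tr_sum tr_mcomm sum.neutral_const)
qed

text \<open>Two positive degrees never add up to 1, so the defining product is empty.\<close>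

lemma bracket_degree_1:
  assumes "x \<in> carrier (der_plus n)" "y \<in> carrier (der_plus n)"
  shows "bracket (der_plus n) x y 1 = \<one>\<^bsub>der n 1\<^esub>"
proof -
  interpret D: comm_group "der n 1" by (rule der_comm_group) simp
  show ?thesis
    using D.finprod_empty[where f = "\<lambda>i. der_bracket n i (1 - i) (x i) (y (1 - i))"]
    by (simp add: der_plus_simps)
qed

abbreviation "hom_der \<equiv> homog {1..} (der n)"

lemma hom_der_hom: "k \<ge> 1 \<Longrightarrow> hom_der k \<in> hom (der n k) (der_plus n)"
  using DG.homog_hom[of k] by (simp add: hom_def der_plus_simps)

lemma hom_der_closed: "k \<ge> 1 \<Longrightarrow> D \<in> carrier (der n k) \<Longrightarrow> hom_der k D \<in> carrier (der_plus n)"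
  by (rule hom_in_carrier[OF hom_der_hom])

lemma bracket_hom_der:
  assumes "k \<ge> 1" "l \<ge> 1" "D \<in> carrier (der n k)" "E \<in> carrier (der n l)"
  shows "bracket (der_plus n) (hom_der k D) (hom_der l E) = hom_der (k + l) (der_bracket n k l D E)"
proof (rule extensionalityI)
  show "bracket (der_plus n) (hom_der k D) (hom_der l E) \<in> extensional {1..}" by (simp add: der_plus_simps)
  show "hom_der (k + l) (der_bracket n k l D E) \<in> extensional {1..}" by (simp add: homog_def)
  fix m :: nat assume m: "m \<in> {1..}"
  interpret M: comm_group "der n m" by (rule der_comm_group) (use m in simp)
  note c = der_bracket_term(1)[OF hom_der_closed[OF assms(1,3)] hom_der_closed[OF assms(2,4)], of _ m]
  have one: "der_bracket n i (m - i) (hom_der k D i) (hom_der l E (m - i)) = \<one>\<^bsub>der n m\<^esub>"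
    if i: "i \<in> {1..<m}" and ne: "i \<noteq> k \<or> m - i \<noteq> l" for i
  proof -
    have im: "i \<ge> 1" "m - i \<ge> 1" "i + (m - i) = m" using i by auto
    note cc = der_plus_component[OF hom_der_closed[OF assms(1,3)] im(1)] der_plus_component[OF hom_der_closed[OF assms(2,4)] im(2)]
    show ?thesis
    proof (cases "i = k")
      case True
      then have "hom_der l E (m - i) = \<one>\<^bsub>der n (m - i)\<^esub>" using ne im by (simp add: homog_def)
      then show ?thesis using der_bracket_one(1)[OF im(1,2) cc(1)] im(3) by simp
    next
      case False
      then have "hom_der k D i = \<one>\<^bsub>der n i\<^esub>" using im by (simp add: homog_def)
      then show ?thesis using der_bracket_one(2)[OF im(1,2) cc(2)] im(3) by simp
    qed
  qed
  have b: "bracket (der_plus n) (hom_der k D) (hom_der l E) m =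
     finprod (der n m) (\<lambda>i. der_bracket n i (m - i) (hom_der k D i) (hom_der l E (m - i))) {1..<m}"
    using m by (simp add: der_plus_simps)
  show "bracket (der_plus n) (hom_der k D) (hom_der l E) m = hom_der (k + l) (der_bracket n k l D E) m"
  proof (cases "m = k + l")
    case True
    have "finprod (der n m) (\<lambda>i. der_bracket n i (m - i) (hom_der k D i) (hom_der l E (m - i))) {1..<m}
      = finprod (der n m) (\<lambda>i. if k = i then der_bracket n i (m - i) (hom_der k D i) (hom_der l E (m - i)) else \<one>\<^bsub>der n m\<^esub>) {1..<m}"
      by (rule M.finprod_cong') (use one c in auto)
    also have "\<dots> = der_bracket n k (m - k) (hom_der k D k) (hom_der l E (m - k))"
      by (rule M.finprod_singleton) (use True assms c in auto)
    also have "\<dots> = der_bracket n k l D E" using True assms by (simp add: homog_def)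
    finally show ?thesis unfolding b using True m by (simp add: homog_def)
  next
    case False
    then have "der_bracket n i (m - i) (hom_der k D i) (hom_der l E (m - i)) = \<one>\<^bsub>der n m\<^esub>" if "i \<in> {1..<m}" for i
      by (intro one[OF that]) (use that in auto)
    then have "finprod (der n m) (\<lambda>i. der_bracket n i (m - i) (hom_der k D i) (hom_der l E (m - i))) {1..<m} = \<one>\<^bsub>der n m\<^esub>"
      by (intro M.finprod_one_eqI)
    then show ?thesis unfolding b using False m by (simp add: homog_def)
  qed
qed

lemma lie_derived_subgroup: "subgroup (lie_derived (der_plus n)) (der_plus n)"
  unfolding lie_derived_def
  by (rule group.generate_is_subgroup[OF comm_group.axioms(2)[OF der_plus_comm_group]])
    (use der_plus_bracket_closed in blast)

text \<open>Translates \<open>trace_zero_in_commutators\<close> from matrices to derivations. The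
  subgroup \<open>?Z\<close> collects the matrices whose derivation lies in the derived algebra;
  brackets of degree 1 with degree \<open>k - 1\<close> supply the commutators it must
  contain.\<close>

lemma trace_zero_derived:
  assumes n: "n \<ge> 2" and k: "k \<ge> 2" and D: "D \<in> carrier (der n k)" and t: "tr n (Psi k D) = 0"
  shows "hom_der k D \<in> lie_derived (der_plus n)"
proof -
  have k1: "k \<ge> 1" "k - 1 \<ge> 1" "1 + (k - 1) = k" using k by auto
  let ?LD = "lie_derived (der_plus n)"
  let ?Z = "{P. \<exists>D\<in>carrier (der n k). Psi k D = P \<and> hom_der k D \<in> ?LD}"
  interpret dk: comm_group "der n k" by (rule der_comm_group[OF k1(1)])
  interpret dp: comm_group "der_plus n" by (rule der_plus_comm_group)
  interpret P: group_hom "der n k" add_grp "Psi k" by (intro group_homI dk.is_group group_add_grp Psi_hom[OF k1(1)])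
  interpret h: group_hom "der n k" "der_plus n" "hom_der k" by (intro group_homI dk.is_group dp.is_group hom_der_hom[OF k1(1)])
  have Z: "subgroup ?Z add_grp"
  proof (rule add_subgroupI)
    show "0 \<in> ?Z"
      using Psi_one[of k] h.hom_one subgroup.one_closed[OF lie_derived_subgroup] dk.one_closed by force
    fix p q assume "p \<in> ?Z" "q \<in> ?Z"
    then obtain D E where D: "D \<in> carrier (der n k)" "Psi k D = p" "hom_der k D \<in> ?LD"
      and E: "E \<in> carrier (der n k)" "Psi k E = q" "hom_der k E \<in> ?LD" by blast
    have "Psi k (D \<otimes>\<^bsub>der n k\<^esub> inv\<^bsub>der n k\<^esub> E) = p - q"
      unfolding P.hom_mult[OF D(1) dk.inv_closed[OF E(1)]] P.hom_inv[OF E(1)] D(2) E(2) by simp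
    moreover have "hom_der k (D \<otimes>\<^bsub>der n k\<^esub> inv\<^bsub>der n k\<^esub> E) \<in> ?LD"
      unfolding h.hom_mult[OF D(1) dk.inv_closed[OF E(1)]] h.hom_inv[OF E(1)]
      by (rule subgroup.m_closed[OF lie_derived_subgroup D(3) subgroup.m_inv_closed[OF lie_derived_subgroup E(3)]])
    ultimately show "p - q \<in> ?Z" using dk.m_closed[OF D(1) dk.inv_closed[OF E(1)]] by blast
  qed
  have "Psi k D \<in> ?Z"
  proof (rule trace_zero_in_commutators[OF n k Z _ Psi_Mt[OF k1(1) D] t])
    fix P Q assume "P \<in> Mt 1" "Q \<in> Mt (k - 1)"
    then obtain E F where E: "E \<in> carrier (der n 1)" "Psi 1 E = P" and F: "F \<in> carrier (der n (k - 1))" "Psi (k - 1) F = Q"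
      using Psi_surj[OF le_refl] Psi_surj[OF k1(2)] by blast
    note b = der_bracket_closed[OF le_refl k1(2) E(1) F(1), unfolded k1(3) E(2) F(2)]
    have "hom_der k (der_bracket n 1 (k - 1) E F) = bracket (der_plus n) (hom_der 1 E) (hom_der (k - 1) F)"
      using bracket_hom_der[OF le_refl k1(2) E(1) F(1)] unfolding k1(3) by (rule sym)
    also have "\<dots> \<in> ?LD" unfolding lie_derived_def
      by (rule generate.incl) (use hom_der_closed[OF le_refl E(1)] hom_der_closed[OF k1(2) F(1)] in blast)
    finally show "mcomm n P Q \<in> ?Z" using b by blast
  qed
  then obtain E where "E \<in> carrier (der n k)" "Psi k E = Psi k D" "hom_der k E \<in> ?LD" by blast
  then show ?thesis using Psi_inj[OF k1(1) _ D] by metis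
qed

end

section \<open>Tensor products of tensor powers\<close>

text \<open>Noncommutative polynomials are finitely supported functions on the free monoid \<open>wd\<close>.\<close>

datatype wd = Wd "nat list"

instantiation wd :: monoid_add
begin

definition "0 = Wd []"

fun plus_wd :: "wd \<Rightarrow> wd \<Rightarrow> wd" where "Wd u + Wd w = Wd (u @ w)"

instance
proof
  fix a b c :: wd
  show "a + b + c = a + (b + c)" by (cases a; cases b; cases c) simp
  show "0 + a = a" "a + 0 = a" by (cases a; simp add: zero_wd_def)+
qed

end

type_synonym ncpoly = "wd \<Rightarrow>\<^sub>0 int"

lemma frag_hom_add_grp_simps:
  fixes E :: "'s \<Rightarrow> 'a::ab_group_add"
  shows "frag_hom add_grp E 0 = 0"
    "frag_hom add_grp E (r + s) = frag_hom add_grp E r + frag_hom add_grp E s"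
    "frag_hom add_grp E (r - s) = frag_hom add_grp E r - frag_hom add_grp E s"
    "frag_hom add_grp E (frag_of t) = E t"
proof -
  interpret f: group_hom add_grp add_grp "frag_hom add_grp E"
    by (intro group_homI group_add_grp frag_hom_add_grp(1))
  show "frag_hom add_grp E 0 = 0" using f.hom_one by simp
  show 1: "frag_hom add_grp E (r + s) = frag_hom add_grp E r + frag_hom add_grp E s" for r s
    using f.hom_mult[of r s] by simp
  show "frag_hom add_grp E (r - s) = frag_hom add_grp E r - frag_hom add_grp E s"
    using 1[of "r - s" s] by simp
  show "frag_hom add_grp E (frag_of t) = E t" by (rule frag_hom_add_grp(2))
qed

lemma frag_hom_compose:
  assumes G: "comm_group G" and h: "h \<in> hom G (add_grp :: 'b::ab_group_add monoid)"
    and E: "E \<in> S \<rightarrow> carrier G" and r: "Poly_Mapping.keys r \<subseteq> S"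
  shows "h (frag_hom G E r) = frag_hom add_grp (\<lambda>s. h (E s)) r"
proof -
  interpret G: comm_group G by fact
  interpret A: comm_group "add_grp :: 'b monoid" by simp
  have "(\<lambda>r. h (frag_hom G E r)) \<in> hom (free_Abelian_group S) add_grp"
    using Group.hom_compose[OF G.frag_hom_hom[OF E] h] by (simp add: comp_def)
  then show ?thesis by (rule A.hom_eq_frag_hom) (use E r in \<open>simp_all add: G.frag_hom_of Pi_iff\<close>)
qed

section \<open>The relations of the free Lie ring under evaluation\<close>

lemma magma_words_Node:
  "s \<in> magma_words n i \<Longrightarrow> t \<in> magma_words n j \<Longrightarrow> Node s t \<in> magma_words n (i + j)"
  by (auto simp: magma_words_def)

lemma lie_rel_keys: "lie_rel n k r \<Longrightarrow> Poly_Mapping.keys r \<subseteq> magma_words n k"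
proof (induction rule: lie_rel.induct)
  case (square s i) then show ?case by (simp add: magma_words_def)
next
  case (antisym s i t j)
  have "Poly_Mapping.keys (frag_of (Node s t) + frag_of (Node t s)) \<subseteq> {Node s t, Node t s}"
    using keys_add[of "frag_of (Node s t)" "frag_of (Node t s)"] by auto
  also have "\<dots> \<subseteq> magma_words n (i + j)" using antisym by (auto simp: magma_words_def)
  finally show ?case .
next
  case (jacobi s i t j u k)
  have "Poly_Mapping.keys (frag_of (Node s (Node t u)) + frag_of (Node t (Node u s)) + frag_of (Node u (Node s t)))
    \<subseteq> {Node s (Node t u), Node t (Node u s), Node u (Node s t)}"
    using keys_add[of "frag_of (Node s (Node t u)) + frag_of (Node t (Node u s))" "frag_of (Node u (Node s t))"]
      keys_add[of "frag_of (Node s (Node t u))" "frag_of (Node t (Node u s))"] by auto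
  also have "\<dots> \<subseteq> magma_words n (i + j + k)" using jacobi by (auto simp: magma_words_def)
  finally show ?case .
next
  case (mult_right i r t j)
  have "Poly_Mapping.keys (frag_extend (\<lambda>s. frag_of (Node s t)) r) \<subseteq> (\<lambda>s. Node s t) ` Poly_Mapping.keys r"
    using keys_frag_extend[of "\<lambda>s. frag_of (Node s t)" r] by auto
  also have "\<dots> \<subseteq> magma_words n (i + j)"
    using mult_right(2,3) by (intro image_subsetI magma_words_Node) (rule subsetD)
  finally show ?case .
next
  case (mult_left i r t j)
  have "Poly_Mapping.keys (frag_extend (\<lambda>s. frag_of (Node t s)) r) \<subseteq> (\<lambda>s. Node t s) ` Poly_Mapping.keys r"
    using keys_frag_extend[of "\<lambda>s. frag_of (Node t s)" r] by auto
  also have "\<dots> \<subseteq> magma_words n (j + i)"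
    using mult_left(2,3) by (intro image_subsetI magma_words_Node) (assumption, rule subsetD)
  finally show ?case .
qed

text \<open>Multiplying a combination of words by a fixed word corresponds to applying a fixed
  additive map to its value. This handles the ideal rules of \<open>lie_rel\<close>.\<close>

lemma frag_hom_extend:
  fixes E :: "'b \<Rightarrow> 'a::ab_group_add"
  assumes b: "b 0 = 0" "\<And>x y. b (x - y) = b x - b y" and E: "\<And>s. E (N s) = b (E' s)"
  shows "frag_hom add_grp E (frag_extend (\<lambda>s. frag_of (N s)) r) = b (frag_hom add_grp E' r)"
  by (rule free_Abelian_group_induct[of r UNIV])
    (simp_all add: frag_hom_add_grp_simps b E frag_extend_diff)

text \<open>Soundness of the relations for every biadditive alternating bracket that satisfies the
  Jacobi identity. It is used for the commutator of noncommutative polynomials and for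
  \<open>brc\<close>; evaluations in other groups are first composed with an injective map into one
  of these.\<close>

lemma lie_rel_zero:
  fixes b :: "'a::ab_group_add \<Rightarrow> 'a \<Rightarrow> 'a"
  assumes bl: "\<And>x y z. b (x - y) z = b x z - b y z" and br: "\<And>x y z. b z (x - y) = b z x - b z y"
    and sq: "\<And>x. b x x = 0" and asym: "\<And>x y. b x y = - b y x"
    and jac: "\<And>x y z. b x (b y z) + b y (b z x) + b z (b x y) = 0"
    and E: "\<And>s t. E (Node s t) = b (E s) (E t)"
    and r: "lie_rel n k r"
  shows "frag_hom add_grp E r = 0"
proof -
  have b0: "b 0 z = 0" "b z 0 = 0" for z using bl[of 0 0 z] br[of z 0 0] by simp_all
  show ?thesis using r
  proof (induction rule: lie_rel.induct)
    case (square s i) then show ?case by (simp add: frag_hom_add_grp_simps E sq)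
  next
    case (antisym s i t j) then show ?case using asym[of "E s" "E t"] by (simp add: frag_hom_add_grp_simps E)
  next
    case (jacobi s i t j u k) then show ?case by (simp only: frag_hom_add_grp_simps E jac)
  next
    case (mult_right i r t j)
    have "frag_hom add_grp E (frag_extend (\<lambda>s. frag_of (Node s t)) r) = b (frag_hom add_grp E r) (E t)"
      by (rule frag_hom_extend[of "\<lambda>x. b x (E t)"]) (simp_all only: b0 bl E)
    then show ?case using mult_right by (simp only: b0)
  next
    case (mult_left i r t j)
    have "frag_hom add_grp E (frag_extend (\<lambda>s. frag_of (Node t s)) r) = b (E t) (frag_hom add_grp E r)"
      by (rule frag_hom_extend[of "\<lambda>x. b (E t) x"]) (simp_all only: b0 br E)
    then show ?case using mult_left by (simp only: b0)
  qed
qed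

section \<open>Products and brackets of tensors\<close>

context comm_group
begin

lemma multilinear_append_right:
  assumes "set xs \<subseteq> carrier G" "length xs = i"
  shows "multilinear G j (tpow G (i + j)) (\<lambda>ys. tprod G (xs @ ys))"
  unfolding multilinear_def
proof (intro conjI ballI allI impI)
  show "tprod G (xs @ ys) \<in> carrier (tpow G (i + j))" if "ys \<in> lists_of_length j (carrier G)" for ys
    by (rule tprod_closed) (use that assms in \<open>auto simp: lists_of_length_def\<close>)
  fix us vs a b
  assume "set us \<union> set vs \<subseteq> carrier G \<and> a \<in> carrier G \<and> b \<in> carrier G \<and> length us + 1 + length vs = j"
  then have m: "set (xs @ us) \<union> set vs \<subseteq> carrier G" "a \<in> carrier G" "b \<in> carrier G" "length (xs @ us) + 1 + length vs = i + j"
    using assms by auto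
  have "tprod G ((xs @ us) @ [a \<otimes> b] @ vs) = tprod G ((xs @ us) @ [a] @ vs) \<otimes>\<^bsub>tpow G (i + j)\<^esub> tprod G ((xs @ us) @ [b] @ vs)"
    using tprod_multilinear[of "i + j"] m unfolding multilinear_def by blast
  then show "tprod G (xs @ us @ [a \<otimes> b] @ vs) = tprod G (xs @ us @ [a] @ vs) \<otimes>\<^bsub>tpow G (i + j)\<^esub> tprod G (xs @ us @ [b] @ vs)"
    by simp
qed

lemma tmult_inner:
  assumes "set xs \<subseteq> carrier G" "length xs = i"
  shows "lift (tpow G (i + j)) (\<lambda>ys. tprod G (xs @ ys)) \<in> hom (tpow G j) (tpow G (i + j))"
    and "ys \<in> lists_of_length j (carrier G) \<Longrightarrow> lift (tpow G (i + j)) (\<lambda>ys. tprod G (xs @ ys)) (tprod G ys) = tprod G (xs @ ys)"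
  using tpow_lift[OF tpow_comm_group multilinear_append_right[OF assms]] by blast+

lemma tmult_multilinear:
  assumes Y: "Y \<in> carrier (tpow G j)"
  shows "multilinear G i (tpow G (i + j)) (\<lambda>xs. lift (tpow G (i + j)) (\<lambda>ys. tprod G (xs @ ys)) Y)"
  unfolding multilinear_def
proof (intro conjI ballI allI impI)
  let ?L = "\<lambda>xs. lift (tpow G (i + j)) (\<lambda>ys. tprod G (xs @ ys))"
  interpret T: comm_group "tpow G (i + j)" by (rule tpow_comm_group)
  show "?L xs Y \<in> carrier (tpow G (i + j))" if "xs \<in> lists_of_length i (carrier G)" for xs
    by (rule hom_in_carrier[OF tmult_inner(1) Y]) (use that in \<open>auto simp: lists_of_length_def\<close>)
  fix us vs a b
  assume "set us \<union> set vs \<subseteq> carrier G \<and> a \<in> carrier G \<and> b \<in> carrier G \<and> length us + 1 + length vs = i"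
  then have m: "set us \<union> set vs \<subseteq> carrier G" "a \<in> carrier G" "b \<in> carrier G" "length us + 1 + length vs = i" by blast+
  then have s: "set (us @ [c] @ vs) \<subseteq> carrier G" "length (us @ [c] @ vs) = i" if "c \<in> carrier G" for c
    using that by auto
  note h = tmult_inner(1)[OF s] and e = tmult_inner(2)[OF s]
  show "?L (us @ [a \<otimes> b] @ vs) Y = ?L (us @ [a] @ vs) Y \<otimes>\<^bsub>tpow G (i + j)\<^esub> ?L (us @ [b] @ vs) Y"
  proof (rule tpow_hom_eqI[OF T.is_group h[OF m_closed[OF m(2,3)] m_closed[OF m(2,3)]] _ _ Y])
    show "(\<lambda>Y. ?L (us @ [a] @ vs) Y \<otimes>\<^bsub>tpow G (i + j)\<^esub> ?L (us @ [b] @ vs) Y) \<in> hom (tpow G j) (tpow G (i + j))"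
      by (rule hom_mult_pointwise[OF tpow_comm_group h[OF m(2) m(2)] h[OF m(3) m(3)]])
    fix ys assume ys: "ys \<in> lists_of_length j (carrier G)"
    have m': "set us \<union> set (vs @ ys) \<subseteq> carrier G" "length us + 1 + length (vs @ ys) = i + j"
      using m ys by (auto simp: lists_of_length_def)
    have "tprod G (us @ [a \<otimes> b] @ vs @ ys) = tprod G (us @ [a] @ vs @ ys) \<otimes>\<^bsub>tpow G (i + j)\<^esub> tprod G (us @ [b] @ vs @ ys)"
      using tprod_multilinear[of "i + j"] m m' unfolding multilinear_def by blast
    then show "?L (us @ [a \<otimes> b] @ vs) (tprod G ys) = ?L (us @ [a] @ vs) (tprod G ys) \<otimes>\<^bsub>tpow G (i + j)\<^esub> ?L (us @ [b] @ vs) (tprod G ys)"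
      unfolding e[OF m_closed[OF m(2,3)] m_closed[OF m(2,3)] ys] e[OF m(2) m(2) ys] e[OF m(3) m(3) ys] by simp
  qed
qed

lemma tmult:
  assumes Y: "Y \<in> carrier (tpow G j)"
  shows "(\<lambda>A. tmult G i j A Y) \<in> hom (tpow G i) (tpow G (i + j))"
    and "xs \<in> lists_of_length i (carrier G) \<Longrightarrow> tmult G i j (tprod G xs) Y = lift (tpow G (i + j)) (\<lambda>ys. tprod G (xs @ ys)) Y"
  unfolding tmult_def using tpow_lift[OF tpow_comm_group tmult_multilinear[OF Y]] by blast+

lemma tmult_closed:
  "A \<in> carrier (tpow G i) \<Longrightarrow> Y \<in> carrier (tpow G j) \<Longrightarrow> tmult G i j A Y \<in> carrier (tpow G (i + j))"
  by (rule hom_in_carrier[OF tmult(1)])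

text \<open>Both sides are additive in each argument, so two applications of uniqueness on pure
  tensors, one for each argument, reduce the claim to concatenation of lists.\<close>

lemma tmult_eval:
  fixes a b c :: "('a list \<Rightarrow>\<^sub>0 int) set \<Rightarrow> 'r::ring_1"
  assumes a: "a \<in> hom (tpow G i) add_grp" and b: "b \<in> hom (tpow G j) add_grp" and c: "c \<in> hom (tpow G (i + j)) add_grp"
    and abc: "\<And>xs ys. xs \<in> lists_of_length i (carrier G) \<Longrightarrow> ys \<in> lists_of_length j (carrier G) \<Longrightarrow>
       c (tprod G (xs @ ys)) = a (tprod G xs) * b (tprod G ys)"
    and A: "A \<in> carrier (tpow G i)" and Y: "Y \<in> carrier (tpow G j)"
  shows "c (tmult G i j A Y) = a A * b Y"
proof (rule tpow_hom_eqI[OF group_add_grp _ _ _ A])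
  have l: "(\<lambda>r. r * s) \<in> hom (add_grp :: 'r monoid) add_grp" and rr: "(\<lambda>r. s * r) \<in> hom (add_grp :: 'r monoid) add_grp" for s :: 'r
    by (auto intro!: homI simp: algebra_simps)
  show "(\<lambda>A. c (tmult G i j A Y)) \<in> hom (tpow G i) add_grp"
    using Group.hom_compose[OF tmult(1)[OF Y] c] by (simp add: comp_def)
  show "(\<lambda>A. a A * b Y) \<in> hom (tpow G i) add_grp"
    using Group.hom_compose[OF a l] by (simp add: comp_def)
  fix xs assume xs: "xs \<in> lists_of_length i (carrier G)"
  then have xs': "set xs \<subseteq> carrier G" "length xs = i" by (auto simp: lists_of_length_def)
  show "c (tmult G i j (tprod G xs) Y) = a (tprod G xs) * b Y"
    unfolding tmult(2)[OF Y xs]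
  proof (rule tpow_hom_eqI[OF group_add_grp _ _ _ Y])
    show "(\<lambda>Y. c (lift (tpow G (i + j)) (\<lambda>ys. tprod G (xs @ ys)) Y)) \<in> hom (tpow G j) add_grp"
      using Group.hom_compose[OF tmult_inner(1)[OF xs'] c] by (simp add: comp_def)
    show "(\<lambda>Y. a (tprod G xs) * b Y) \<in> hom (tpow G j) add_grp"
      using Group.hom_compose[OF b rr] by (simp add: comp_def)
    show "c (lift (tpow G (i + j)) (\<lambda>ys. tprod G (xs @ ys)) (tprod G ys)) = a (tprod G xs) * b (tprod G ys)"
      if ys: "ys \<in> lists_of_length j (carrier G)" for ys
      unfolding tmult_inner(2)[OF xs' ys] by (rule abc[OF xs ys])
  qed
qed

text \<open>The two orders of concatenation are allowed to factor through different functionals.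
  This asymmetry is made for \<open>kap\<close>, which treats the first letter differently from the
  others and so sees only which factor stands in front.\<close>

lemma tbracket_eval:
  fixes a a' b b' c :: "('a list \<Rightarrow>\<^sub>0 int) set \<Rightarrow> 'r::ring_1"
  assumes "a \<in> hom (tpow G i) add_grp" "b \<in> hom (tpow G j) add_grp"
    "a' \<in> hom (tpow G i) add_grp" "b' \<in> hom (tpow G j) add_grp" "c \<in> hom (tpow G (i + j)) add_grp"
    and 1: "\<And>xs ys. xs \<in> lists_of_length i (carrier G) \<Longrightarrow> ys \<in> lists_of_length j (carrier G) \<Longrightarrow>
       c (tprod G (xs @ ys)) = a (tprod G xs) * b (tprod G ys)"
    and 2: "\<And>xs ys. xs \<in> lists_of_length i (carrier G) \<Longrightarrow> ys \<in> lists_of_length j (carrier G) \<Longrightarrow>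
       c (tprod G (ys @ xs)) = b' (tprod G ys) * a' (tprod G xs)"
    and A: "A \<in> carrier (tpow G i)" and Y: "Y \<in> carrier (tpow G j)"
  shows "c (tbracket G i j A Y) = a A * b Y - b' Y * a' A"
proof -
  have ji: "j + i = i + j" by simp
  have yx: "tmult G j i Y A \<in> carrier (tpow G (i + j))" using tmult_closed[OF Y A] by (simp add: ji)
  interpret T: comm_group "tpow G (i + j)" by (rule tpow_comm_group)
  have c: "c \<in> hom (tpow G (j + i)) add_grp" using assms(5) unfolding ji .
  have "c (tmult G j i Y A) = b' Y * a' A"
    by (rule tmult_eval[OF assms(4,3) c 2 Y A])
  moreover have "c (tmult G i j A Y) = a A * b Y"
    by (rule tmult_eval[OF assms(1,2,5) 1 A Y])
  ultimately show ?thesis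
    unfolding tbracket_def hom_add_grp(2)[OF T.is_group assms(5) tmult_closed[OF A Y] T.inv_closed[OF yx]]
      hom_add_grp(3)[OF T.is_group assms(5) yx] by simp
qed

lemma tbracket_closed:
  assumes A: "A \<in> carrier (tpow G i)" and Y: "Y \<in> carrier (tpow G j)"
  shows "tbracket G i j A Y \<in> carrier (tpow G (i + j))"
proof -
  interpret T: comm_group "tpow G (i + j)" by (rule tpow_comm_group)
  have "tmult G j i Y A \<in> carrier (tpow G (i + j))" using tmult_closed[OF Y A] by (simp add: add.commute)
  then show ?thesis unfolding tbracket_def by (intro T.m_closed tmult_closed A Y T.inv_closed)
qed

end

lemma multilinear_prod_list:
  fixes l :: "'a \<Rightarrow> 'r::ring_1"
  assumes "comm_group G" "l \<in> hom G add_grp"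
  shows "multilinear G k add_grp (\<lambda>xs. prod_list (map l xs))"
  unfolding multilinear_def using hom_mult[OF assms(2)] by (simp add: algebra_simps)

section \<open>The trace maps\<close>

context chen_magnus
begin

section \<open>Coordinates on the abelianised free group\<close>

abbreviation "FG \<equiv> free_group n"
abbreviation "FD \<equiv> derived FG (carrier FG)"
abbreviation "SD \<equiv> second_derived FG"

lemma FG_group: "group FG" by (rule free_group_group)

lemma FD_normal: "FD \<lhd> FG"
  by (rule group.derived_is_normal[OF FG_group group.normal_self[OF FG_group]])

lemma Hab_comm_group: "comm_group (Hab n)"
  unfolding Hab_def by (rule group.derived_quot_is_comm_group[OF FG_group])

sublocale HH: comm_group "Hab n" by (rule Hab_comm_group)

definition qm :: "word \<Rightarrow> word set" where "qm w = SD #>\<^bsub>FG\<^esub> w"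

lemma qm_hom: "qm \<in> hom FG (free_metab n)"
  unfolding qm_def[abs_def] free_metab_def by (rule normal.r_coset_hom_Mod[OF second_derived_normal])

lemma qm_derived: assumes "c \<in> FD" shows "qm c \<in> lcs (free_metab n) 2"
proof -
  interpret q: group_hom FG "free_metab n" qm by (intro group_homI FG_group is_group qm_hom)
  have "qm c \<in> qm ` FD" using assms by blast
  also have "qm ` FD = derived (free_metab n) (qm ` carrier FG)" by (rule q.derived_img[symmetric]) simp
  also have "qm ` carrier FG = carrier (free_metab n)"
    by (simp add: free_metab_def carrier_FactGroup qm_def[abs_def])
  finally show ?thesis using derived_lcs by (auto simp: numeral_2_eq_2)
qed

lemma Hab_to_chen_coset:
  assumes "w \<in> carrier FG" shows "Hab_to_chen n (FD #>\<^bsub>FG\<^esub> w) = cl 1 (qm w)"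
proof -
  have "the_elem ((\<lambda>w. cl 1 (qm w)) ` (FD #>\<^bsub>FG\<^esub> w)) = cl 1 (qm w)"
  proof (rule the_elem_image_coset[OF FG_group normal_imp_subgroup[OF FD_normal] assms])
    fix m assume m: "m \<in> FD"
    have mc: "m \<in> carrier FG" using subgroup.subset[OF normal_imp_subgroup[OF FD_normal]] m by blast
    show "cl 1 (qm (m \<otimes>\<^bsub>FG\<^esub> w)) = cl 1 (qm w)"
      unfolding hom_mult[OF qm_hom mc assms]
      by (rule cl_absorb) (use qm_derived[OF m] hom_in_carrier[OF qm_hom assms] in \<open>simp_all add: lcs_1 numeral_2_eq_2\<close>)
  qed
  then show ?thesis by (simp add: Hab_to_chen_def cl_def qm_def numeral_2_eq_2)
qed

lemma carrier_Hab: "carrier (Hab n) = (\<lambda>w. FD #>\<^bsub>FG\<^esub> w) ` carrier FG"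
  by (simp add: Hab_def carrier_FactGroup)

lemma Hab_proj_hom: "(\<lambda>w. FD #>\<^bsub>FG\<^esub> w) \<in> hom FG (Hab n)"
  unfolding Hab_def by (rule normal.r_coset_hom_Mod[OF FD_normal])

lemma Hab_to_chen_hom: "Hab_to_chen n \<in> hom (Hab n) (chen_gr n 1)"
proof (rule homI)
  have q1: "qm w \<in> lcs (free_metab n) 1" if "w \<in> carrier FG" for w
    using hom_in_carrier[OF qm_hom that] by (simp add: lcs_1)
  fix h assume "h \<in> carrier (Hab n)"
  then obtain u where u: "u \<in> carrier FG" "h = FD #>\<^bsub>FG\<^esub> u" unfolding carrier_Hab by blast
  show "Hab_to_chen n h \<in> carrier (chen_gr n 1)"
    unfolding u(2) Hab_to_chen_coset[OF u(1)] by (rule cl_closed[OF q1[OF u(1)]])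
  fix h' assume "h' \<in> carrier (Hab n)"
  then obtain w where w: "w \<in> carrier FG" "h' = FD #>\<^bsub>FG\<^esub> w" unfolding carrier_Hab by blast
  have uw: "u \<otimes>\<^bsub>FG\<^esub> w \<in> carrier FG" by (rule monoid.m_closed[OF group.is_monoid[OF FG_group] u(1) w(1)])
  show "Hab_to_chen n (h \<otimes>\<^bsub>Hab n\<^esub> h') = Hab_to_chen n h \<otimes>\<^bsub>chen_gr n 1\<^esub> Hab_to_chen n h'"
    unfolding u(2) w(2) hom_mult[OF Hab_proj_hom u(1) w(1), symmetric] Hab_to_chen_coset[OF u(1)]
      Hab_to_chen_coset[OF w(1)] Hab_to_chen_coset[OF uw] hom_mult[OF qm_hom u(1) w(1)]
    by (rule cl_mult[OF q1[OF u(1)] q1[OF w(1)]])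
qed

lemma Hab_gen_closed: "i < n \<Longrightarrow> Hab_gen n i \<in> carrier (Hab n)"
  unfolding Hab_gen_def carrier_Hab by (rule imageI) (rule free_group_letter)

lemma Hab_to_chen_gen: "i < n \<Longrightarrow> Hab_to_chen n (Hab_gen n i) = g i"
  unfolding Hab_gen_def by (simp add: Hab_to_chen_coset free_group_letter g_def qm_def)

lemma Hab_generate: "generate (Hab n) (Hab_gen n ` {..<n}) = carrier (Hab n)"
proof -
  have "carrier (Hab n) = (\<lambda>w. FD #>\<^bsub>FG\<^esub> w) ` generate FG ((\<lambda>i. [(i, True)]) ` {..<n})"
    by (simp only: carrier_Hab free_group_generate)
  also have "\<dots> = generate (Hab n) ((\<lambda>w. FD #>\<^bsub>FG\<^esub> w) ` (\<lambda>i. [(i, True)]) ` {..<n})"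
    by (rule hom_generate_image[OF FG_group HH.is_group Hab_proj_hom]) (auto simp: free_group_letter)
  finally show ?thesis by (simp add: image_image Hab_gen_def)
qed

definition JH :: "word set \<Rightarrow> nat \<Rightarrow> poly" where "JH h = J 1 (Hab_to_chen n h)"

lemma JH_hom: "JH \<in> hom (Hab n) add_grp"
  using Group.hom_compose[OF Hab_to_chen_hom J_hom'[OF le_refl]] by (simp add: JH_def[abs_def] comp_def)

lemma JH_gen: "i < n \<Longrightarrow> JH (Hab_gen n i) = e i"
  unfolding JH_def by (simp only: Hab_to_chen_gen J_g)

text \<open>In degree one the leading tuple consists of constants, and the coefficient at the empty
  multiset turns them into integers. These are the coordinates with respect to the
  generators.\<close>

sublocale HB: based_group "Hab n" n "Hab_gen n" "\<lambda>i h. Poly_Mapping.lookup (JH h i) {#}"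
proof unfold_locales
  fix i j assume i: "i < n"
  show "Hab_gen n i \<in> carrier (Hab n)" by (rule Hab_gen_closed[OF i])
  show "(\<lambda>h. Poly_Mapping.lookup (JH h i) {#}) \<in> hom (Hab n) add_grp"
    by (rule homI) (simp_all add: hom_mult[OF JH_hom] Poly_Mapping.lookup_add)
  assume j: "j < n"
  show "Poly_Mapping.lookup (JH (Hab_gen n j) i) {#} = (if j = i then 1 else 0)"
    unfolding JH_gen[OF j] by (simp add: e_def lookup_one)
qed (rule Hab_generate)

lemma dual_gen: "i < n \<Longrightarrow> Hab_gen_dual n i = HB.d i"
  unfolding Hab_gen_dual_def by (rule HB.d_unique)

text \<open>The linear form that has the coordinates of \<open>h\<close> as coefficients;
  \<open>theta\<close> assembles it from the tuple.\<close>

definition lin :: "word set \<Rightarrow> poly" where "lin h = theta n (JH h)"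

lemma lin_hom: "lin \<in> hom (Hab n) add_grp"
proof (rule homI)
  fix h h' assume "h \<in> carrier (Hab n)" "h' \<in> carrier (Hab n)"
  then have "JH (h \<otimes>\<^bsub>Hab n\<^esub> h') = JH h + JH h'" using hom_mult[OF JH_hom] by simp
  then show "lin (h \<otimes>\<^bsub>Hab n\<^esub> h') = lin h \<otimes>\<^bsub>add_grp\<^esub> lin h'"
    unfolding lin_def by (simp add: plus_fun_def theta_linear)
qed simp

lemma lin_gen: "i < n \<Longrightarrow> lin (Hab_gen n i) = X i"
  unfolding lin_def by (simp only: JH_gen theta_e)

lemma gens_image: "lists_of_length k (Hab_gen n ` {..<n}) = map (Hab_gen n) ` lists_of_length k {..<n}"
proof (intro equalityI subsetI)
  fix xs assume "xs \<in> lists_of_length k (Hab_gen n ` {..<n})"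
  then have x: "set xs \<subseteq> Hab_gen n ` {..<n}" "length xs = k" by (auto simp: lists_of_length_def)
  then have "\<forall>x\<in>set xs. \<exists>i<n. x = Hab_gen n i" by blast
  then obtain f where f: "\<And>x. x \<in> set xs \<Longrightarrow> f x < n \<and> x = Hab_gen n (f x)" by metis
  have "xs = map (Hab_gen n) (map f xs)" using f by (simp add: comp_def) (metis map_idI)
  moreover have "map f xs \<in> lists_of_length k {..<n}" using f x by (auto simp: lists_of_length_def)
  ultimately show "xs \<in> map (Hab_gen n) ` lists_of_length k {..<n}" by blast
next
  fix xs assume "xs \<in> map (Hab_gen n) ` lists_of_length k {..<n}"
  then obtain us where "xs = map (Hab_gen n) us" "set us \<subseteq> {..<n}" "length us = k"
    by (auto simp: lists_of_length_def)
  then show "xs \<in> lists_of_length k (Hab_gen n ` {..<n})" by (simp add: lists_of_length_def image_mono)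
qed

lemma lists_of_length_append:
  "xs \<in> lists_of_length i A \<Longrightarrow> ys \<in> lists_of_length j A \<Longrightarrow> xs @ ys \<in> lists_of_length (i + j) A"
  unfolding lists_of_length_def by simp

lemma map_gens_closed: "is \<in> lists_of_length k {..<n} \<Longrightarrow> map (Hab_gen n) is \<in> lists_of_length k (carrier (Hab n))"
  using Hab_gen_closed by (auto simp: lists_of_length_def)

lemma prod_list_X: "prod_list (map X is) = frag_of (mset is)"
  by (induction "is") (simp_all add: single_one X_def mult_single)

lemma prod_list_lin: "is \<in> lists_of_length k {..<n} \<Longrightarrow> prod_list (map lin (map (Hab_gen n) is)) = frag_of (mset is)"
proof -
  assume i: "is \<in> lists_of_length k {..<n}"
  have "map lin (map (Hab_gen n) is) = map X is" using i lin_gen by (auto simp: lists_of_length_def)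
  then show ?thesis by (simp only: prod_list_X)
qed

subsection \<open>Symmetric powers as polynomials\<close>

text \<open>Multiplication of linear forms, the usual identification of the symmetric power with
  homogeneous polynomials. All comparisons of traces take place after applying it.\<close>

definition Lam :: "nat \<Rightarrow> (word set list \<Rightarrow>\<^sub>0 int) set \<Rightarrow> poly" where
  "Lam k = lift add_grp (\<lambda>xs. prod_list (map lin xs))"

lemma Lam:
  shows Lam_hom: "Lam k \<in> hom (spow (Hab n) k) add_grp"
    and Lam_sprod: "xs \<in> lists_of_length k (carrier (Hab n)) \<Longrightarrow> Lam k (sprod (Hab n) xs) = prod_list (map lin xs)"
proof -
  have "prod_list (map lin xs) = prod_list (map lin ys)" if "mset xs = mset ys" for xs ys
    using that by (metis mset_map prod_mset_prod_list)
  then show "Lam k \<in> hom (spow (Hab n) k) add_grp"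
    "xs \<in> lists_of_length k (carrier (Hab n)) \<Longrightarrow> Lam k (sprod (Hab n) xs) = prod_list (map lin xs)"
    unfolding Lam_def
    using HH.spow_lift[OF comm_group_add_grp multilinear_prod_list[OF Hab_comm_group lin_hom]] by blast+
qed

text \<open>The left inverse sends a monomial to the symmetric product of its generators in
  increasing order, and monomials of the wrong kind to the neutral element. It is checked on
  products of generators, where \<open>sprod_perm\<close> undoes the sorting.\<close>

lemma Lam_inj:
  assumes s: "s \<in> carrier (spow (Hab n) k)" and s': "s' \<in> carrier (spow (Hab n) k)" and e: "Lam k s = Lam k s'"
  shows "s = s'"
proof -
  interpret S: comm_group "spow (Hab n) k" by (rule HH.spow_comm_group)
  define t where "t M = (if set_mset M \<subseteq> {..<n} \<and> size M = k then sprod (Hab n) (map (Hab_gen n) (sorted_list_of_multiset M)) else \<one>\<^bsub>spow (Hab n) k\<^esub>)" for M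
  have tc: "t M \<in> carrier (spow (Hab n) k)" for M
  proof (cases "set_mset M \<subseteq> {..<n} \<and> size M = k")
    case True
    then have "sorted_list_of_multiset M \<in> lists_of_length k {..<n}"
      by (simp add: lists_of_length_def) (metis mset_sorted_list_of_multiset size_mset)
    then show ?thesis unfolding t_def if_P[OF True] by (intro HH.sprod_closed map_gens_closed)
  next
    case False show ?thesis unfolding t_def if_not_P[OF False] by (rule S.one_closed)
  qed
  have T: "frag_hom (spow (Hab n) k) t \<in> hom add_grp (spow (Hab n) k)"
    using S.frag_hom_hom[of t UNIV] tc by (simp add: free_Abelian_group_UNIV)
  have "frag_hom (spow (Hab n) k) t (Lam k y) = y" if y: "y \<in> carrier (spow (Hab n) k)" for y
  proof (rule hom_eq_on_generate[where f = "\<lambda>y. frag_hom (spow (Hab n) k) t (Lam k y)" and g = "\<lambda>y. y"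
        and K = "sprod (Hab n) ` lists_of_length k (Hab_gen n ` {..<n})" and x = y and G = "spow (Hab n) k" and H = "spow (Hab n) k"])
    show "(\<lambda>y. frag_hom (spow (Hab n) k) t (Lam k y)) \<in> hom (spow (Hab n) k) (spow (Hab n) k)"
      using Group.hom_compose[OF Lam_hom T] by (simp add: comp_def)
    show "y \<in> generate (spow (Hab n) k) (sprod (Hab n) ` lists_of_length k (Hab_gen n ` {..<n}))"
      unfolding HH.spow_generate[OF HB.e_subset Hab_generate] by (rule y)
    show "sprod (Hab n) ` lists_of_length k (Hab_gen n ` {..<n}) \<subseteq> carrier (spow (Hab n) k)"
      unfolding gens_image by (intro image_subsetI) (auto intro!: HH.sprod_closed map_gens_closed)
    fix z assume "z \<in> sprod (Hab n) ` lists_of_length k (Hab_gen n ` {..<n})"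
    then obtain js where i: "js \<in> lists_of_length k {..<n}" "z = sprod (Hab n) (map (Hab_gen n) js)"
      unfolding gens_image by blast
    have "Lam k z = frag_of (mset js)"
      unfolding i(2) Lam_sprod[OF map_gens_closed[OF i(1)]] by (rule prod_list_lin[OF i(1)])
    then have "frag_hom (spow (Hab n) k) t (Lam k z) = t (mset js)"
      by (simp only: S.frag_hom_of[of t, OF tc])
    also have "\<dots> = sprod (Hab n) (map (Hab_gen n) (sorted_list_of_multiset (mset js)))"
      unfolding t_def by (rule if_P) (use i(1) in \<open>auto simp: lists_of_length_def\<close>)
    also have "\<dots> = z" unfolding i(2)
      by (rule HH.sprod_perm) (use i(1) Hab_gen_closed in \<open>auto simp: lists_of_length_def\<close>)
    finally show "frag_hom (spow (Hab n) k) t (Lam k z) = z" .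
  qed (auto simp: hom_def S.is_group)
  then show ?thesis using s s' e by metis
qed

subsection \<open>Tensor powers as noncommutative polynomials\<close>

definition nlin :: "word set \<Rightarrow> ncpoly" where
  "nlin h = (\<Sum>i<n. of_int (Poly_Mapping.lookup (JH h i) {#}) * frag_of (Wd [i]))"

lemma nlin_hom: "nlin \<in> hom (Hab n) add_grp"
proof (rule homI)
  fix h h' assume h: "h \<in> carrier (Hab n)" "h' \<in> carrier (Hab n)"
  have "JH (h \<otimes>\<^bsub>Hab n\<^esub> h') i = JH h i + JH h' i" for i
    using hom_mult[OF JH_hom h] by (simp add: plus_fun_def)
  then show "nlin (h \<otimes>\<^bsub>Hab n\<^esub> h') = nlin h \<otimes>\<^bsub>add_grp\<^esub> nlin h'"
    unfolding nlin_def by (simp add: Poly_Mapping.lookup_add sum.distrib distrib_right)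
qed simp

lemma nlin_gen: "i < n \<Longrightarrow> nlin (Hab_gen n i) = frag_of (Wd [i])"
proof -
  assume i: "i < n"
  have "nlin (Hab_gen n i) = (\<Sum>j<n. if j = i then frag_of (Wd [i]) else 0)"
    unfolding nlin_def JH_gen[OF i] by (rule sum.cong[OF refl]) (simp add: e_def lookup_one)
  then show ?thesis using i by simp
qed

text \<open>The analogue of \<open>Lam\<close> with noncommuting variables. It turns the tensor
  bracket into a ring commutator and, being injective, decides when an element of a tensor power is
  trivial.\<close>

definition Om :: "nat \<Rightarrow> (word set list \<Rightarrow>\<^sub>0 int) set \<Rightarrow> ncpoly" where
  "Om k = lift add_grp (\<lambda>xs. prod_list (map nlin xs))"

definition pi :: "nat \<Rightarrow> (word set list \<Rightarrow>\<^sub>0 int) set \<Rightarrow> poly" where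
  "pi k = lift add_grp (\<lambda>xs. prod_list (map lin xs))"

text \<open>The first letter is contracted with \<open>f\<close> and the others are allowed to
  commute. By \<open>Lam_contr\<close> this is contraction followed by symmetrisation, written as a
  polynomial; defined directly on the tensor power, it can be computed along brackets.\<close>

definition kap :: "(word set \<Rightarrow> int) \<Rightarrow> nat \<Rightarrow> (word set list \<Rightarrow>\<^sub>0 int) set \<Rightarrow> poly" where
  "kap f k = lift add_grp (\<lambda>xs. of_int (f (hd xs)) * prod_list (map lin (tl xs)))"

lemma Om: "Om k \<in> hom (tpow (Hab n) k) add_grp"
    "xs \<in> lists_of_length k (carrier (Hab n)) \<Longrightarrow> Om k (tprod (Hab n) xs) = prod_list (map nlin xs)"
  unfolding Om_def using HH.tpow_lift[OF comm_group_add_grp multilinear_prod_list[OF Hab_comm_group nlin_hom]] by blast+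

lemma pi: "pi k \<in> hom (tpow (Hab n) k) add_grp"
    "xs \<in> lists_of_length k (carrier (Hab n)) \<Longrightarrow> pi k (tprod (Hab n) xs) = prod_list (map lin xs)"
  unfolding pi_def using HH.tpow_lift[OF comm_group_add_grp multilinear_prod_list[OF Hab_comm_group lin_hom]] by blast+

lemma kap:
  assumes "f \<in> carrier (dual (Hab n))"
  shows "kap f (Suc k) \<in> hom (tpow (Hab n) (Suc k)) add_grp"
    "xs \<in> lists_of_length (Suc k) (carrier (Hab n)) \<Longrightarrow> kap f (Suc k) (tprod (Hab n) xs) = of_int (f (hd xs)) * prod_list (map lin (tl xs))"
proof -
  have f: "f \<in> hom (Hab n) add_grp" using assms by (simp add: HH.carrier_dual)
  have "multilinear (Hab n) (Suc k) add_grp (\<lambda>xs. of_int (f (hd xs)) * prod_list (map lin (tl xs)))"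
    unfolding multilinear_def
  proof (intro conjI ballI allI impI)
    fix us vs a b
    assume m: "set us \<union> set vs \<subseteq> carrier (Hab n) \<and> a \<in> carrier (Hab n) \<and> b \<in> carrier (Hab n) \<and> length us + 1 + length vs = Suc k"
    have fa: "f (a \<otimes>\<^bsub>Hab n\<^esub> b) = f a + f b" using hom_mult[OF f] m by simp
    have la: "lin (a \<otimes>\<^bsub>Hab n\<^esub> b) = lin a + lin b" using hom_mult[OF lin_hom] m by simp
    show "of_int (f (hd (us @ [a \<otimes>\<^bsub>Hab n\<^esub> b] @ vs))) * prod_list (map lin (tl (us @ [a \<otimes>\<^bsub>Hab n\<^esub> b] @ vs))) =
        (of_int (f (hd (us @ [a] @ vs))) * prod_list (map lin (tl (us @ [a] @ vs)))) \<otimes>\<^bsub>add_grp\<^esub>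
        (of_int (f (hd (us @ [b] @ vs))) * prod_list (map lin (tl (us @ [b] @ vs))))"
      by (cases us) (simp_all add: fa la algebra_simps)
  qed simp
  from HH.tpow_lift[OF comm_group_add_grp this]
  show "kap f (Suc k) \<in> hom (tpow (Hab n) (Suc k)) add_grp"
    "xs \<in> lists_of_length (Suc k) (carrier (Hab n)) \<Longrightarrow> kap f (Suc k) (tprod (Hab n) xs) = of_int (f (hd xs)) * prod_list (map lin (tl xs))"
    unfolding kap_def by blast+
qed

lemma prod_list_nlin: "set js \<subseteq> {..<n} \<Longrightarrow> prod_list (map nlin (map (Hab_gen n) js)) = frag_of (Wd js)"
  by (induction js) (simp_all add: nlin_gen mult_single single_one[symmetric] zero_wd_def del: single_one)

lemma Om_inj:
  assumes s: "s \<in> carrier (tpow (Hab n) k)" and e: "Om k s = 0"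
  shows "s = \<one>\<^bsub>tpow (Hab n) k\<^esub>"
proof -
  interpret S: comm_group "tpow (Hab n) k" by (rule HH.tpow_comm_group)
  define t where "t w = (case w of Wd js \<Rightarrow> if js \<in> lists_of_length k {..<n} then tprod (Hab n) (map (Hab_gen n) js) else \<one>\<^bsub>tpow (Hab n) k\<^esub>)" for w
  have tc: "t w \<in> carrier (tpow (Hab n) k)" for w
    unfolding t_def using HH.tprod_closed[OF map_gens_closed] S.one_closed by (cases w) auto
  have T: "frag_hom (tpow (Hab n) k) t \<in> hom add_grp (tpow (Hab n) k)"
    using S.frag_hom_hom[of t UNIV] tc by (simp add: free_Abelian_group_UNIV)
  have "frag_hom (tpow (Hab n) k) t (Om k s) = s"
  proof (rule hom_eq_on_generate[where f = "\<lambda>y. frag_hom (tpow (Hab n) k) t (Om k y)" and g = "\<lambda>y. y"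
        and K = "tprod (Hab n) ` lists_of_length k (Hab_gen n ` {..<n})" and x = s and G = "tpow (Hab n) k" and H = "tpow (Hab n) k"])
    show "(\<lambda>y. frag_hom (tpow (Hab n) k) t (Om k y)) \<in> hom (tpow (Hab n) k) (tpow (Hab n) k)"
      using Group.hom_compose[OF Om(1) T] by (simp add: comp_def)
    show "s \<in> generate (tpow (Hab n) k) (tprod (Hab n) ` lists_of_length k (Hab_gen n ` {..<n}))"
      unfolding HH.tpow_generate[OF HB.e_subset Hab_generate] by (rule s)
    show "tprod (Hab n) ` lists_of_length k (Hab_gen n ` {..<n}) \<subseteq> carrier (tpow (Hab n) k)"
      unfolding gens_image by (intro image_subsetI) (auto intro!: HH.tprod_closed map_gens_closed)
    fix z assume "z \<in> tprod (Hab n) ` lists_of_length k (Hab_gen n ` {..<n})"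
    then obtain js where i: "js \<in> lists_of_length k {..<n}" "z = tprod (Hab n) (map (Hab_gen n) js)"
      unfolding gens_image by blast
    have "Om k z = frag_of (Wd js)"
      unfolding i(2) Om(2)[OF map_gens_closed[OF i(1)]] by (rule prod_list_nlin) (use i(1) in \<open>simp add: lists_of_length_def\<close>)
    then have "frag_hom (tpow (Hab n) k) t (Om k z) = t (Wd js)"
      by (simp only: S.frag_hom_of[of t, OF tc])
    also have "\<dots> = z" using i unfolding t_def by simp
    finally show "frag_hom (tpow (Hab n) k) t (Om k z) = z" .
  qed (auto simp: hom_def S.is_group)
  moreover have "frag_hom (tpow (Hab n) k) t 0 = \<one>\<^bsub>tpow (Hab n) k\<^esub>"
    using hom_one[OF T group_add_grp S.is_group] by simp
  ultimately show ?thesis using e by simp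
qed

subsection \<open>Evaluation of magma words\<close>

text \<open>The value of a word computed in tuples of polynomials alone. Evaluation in the Chen
  algebra and the contracted evaluation in the tensor power are both compared with it, and so with
  each other.\<close>

primrec Jev :: "nat magma \<Rightarrow> nat \<Rightarrow> poly" where
  "Jev (Leaf i) = e i"
| "Jev (Node s t) = brc n (Jev s) (Jev t)"

primrec Qev :: "nat magma \<Rightarrow> ncpoly" where
  "Qev (Leaf i) = frag_of (Wd [i])"
| "Qev (Node s t) = Qev s * Qev t - Qev t * Qev s"

abbreviation "tev \<equiv> magma_eval (tbracket (Hab n)) (\<lambda>i. tprod (Hab n) [Hab_gen n i])"
abbreviation "cev \<equiv> magma_eval (chen_bracket n) (\<lambda>i. Hab_to_chen n (Hab_gen n i))"

lemma leaves_pos: "leaves t \<ge> 1"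
  by (induction t) auto

lemma word_tev: "t \<in> magma_words n k \<Longrightarrow> tev t \<in> carrier (tpow (Hab n) k) \<and> Om k (tev t) = Qev t"
proof (induction t arbitrary: k)
  case (Leaf i)
  then have i: "i < n" "k = 1" by (auto simp: magma_words_def)
  have "[Hab_gen n i] \<in> lists_of_length 1 (carrier (Hab n))" using Hab_gen_closed[OF i(1)] by (simp add: lists_of_length_def)
  then show ?case unfolding i(2) using HH.tprod_closed Om(2) nlin_gen[OF i(1)] by simp
next
  case (Node s t)
  define i j where "i = leaves s" and "j = leaves t"
  have s: "s \<in> magma_words n i" and t: "t \<in> magma_words n j" and k: "k = i + j"
    using Node.prems by (auto simp: magma_words_def i_def j_def)
  note S = Node.IH(1)[OF s] and T = Node.IH(2)[OF t]
  have "Om (i + j) (tbracket (Hab n) i j (tev s) (tev t)) = Om i (tev s) * Om j (tev t) - Om j (tev t) * Om i (tev s)"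
  proof (rule HH.tbracket_eval[OF Om(1) Om(1) Om(1) Om(1) Om(1)])
    fix xs ys assume x: "xs \<in> lists_of_length i (carrier (Hab n))" and y: "ys \<in> lists_of_length j (carrier (Hab n))"
    have "xs @ ys \<in> lists_of_length (i + j) (carrier (Hab n))" "ys @ xs \<in> lists_of_length (i + j) (carrier (Hab n))"
      using lists_of_length_append[OF x y] lists_of_length_append[OF y x] by (simp_all add: add.commute)
    then show "Om (i + j) (tprod (Hab n) (xs @ ys)) = Om i (tprod (Hab n) xs) * Om j (tprod (Hab n) ys)"
      "Om (i + j) (tprod (Hab n) (ys @ xs)) = Om j (tprod (Hab n) ys) * Om i (tprod (Hab n) xs)"
      using x y by (simp_all add: Om(2))
  qed (use S T in blast)+
  moreover have "tbracket (Hab n) i j (tev s) (tev t) \<in> carrier (tpow (Hab n) (i + j))"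
    by (rule HH.tbracket_closed) (use S T in blast)+
  ultimately show ?case using S T unfolding k by (simp add: i_def[symmetric] j_def[symmetric])
qed

text \<open>The reason why Morita's trace is a matrix trace. The first letter of a product of
  tensors belongs to the left factor, so on a commutator \<open>kap\<close> gives \<open>kap\<close>
  of one factor times the commutative image \<open>pi\<close> of the other, minus the same with the
  factors exchanged. As \<open>pi\<close> is \<open>theta\<close> of the tuple, this is the
  recursion defining \<open>brc\<close>; the two claims have to be proved together.\<close>

lemma word_pi_kap:
  assumes f: "f \<in> carrier (dual (Hab n))"
  shows "t \<in> magma_words n k \<Longrightarrow> pi k (tev t) = theta n (Jev t) \<and> kap f k (tev t) = (\<Sum>i<n. of_int (f (Hab_gen n i)) * Jev t i)"
proof (induction t arbitrary: k)
  case (Leaf i)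
  then have i: "i < n" "k = Suc 0" by (auto simp: magma_words_def)
  have l: "[Hab_gen n i] \<in> lists_of_length (Suc 0) (carrier (Hab n))" using Hab_gen_closed[OF i(1)] by (simp add: lists_of_length_def)
  have "(\<Sum>j<n. of_int (f (Hab_gen n j)) * e i j) = (\<Sum>j<n. if j = i then of_int (f (Hab_gen n i)) else 0)"
    by (rule sum.cong[OF refl]) (simp add: e_def)
  then show ?case unfolding i(2) using pi(2)[OF l] kap(2)[OF f l] lin_gen[OF i(1)] theta_e[OF i(1)] i(1) by simp
next
  case (Node s t)
  define i j where "i = leaves s" and "j = leaves t"
  \<comment> \<open>Words have at least one leaf, so neither factor is the empty tensor and the
    first letter of a product is that of its left factor.\<close>
  obtain i' j' where ij: "i = Suc i'" "j = Suc j'"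
    using leaves_pos[of s] leaves_pos[of t] unfolding i_def j_def by (metis Suc_le_D One_nat_def)
  have s: "s \<in> magma_words n i" and t: "t \<in> magma_words n j" and k: "k = i + j"
    using Node.prems by (auto simp: magma_words_def i_def j_def)
  note S = Node.IH(1)[OF s] word_tev[OF s] and T = Node.IH(2)[OF t] word_tev[OF t]
  have "pi (i + j) (tbracket (Hab n) i j (tev s) (tev t)) = pi i (tev s) * pi j (tev t) - pi j (tev t) * pi i (tev s)"
  proof (rule HH.tbracket_eval[OF pi(1) pi(1) pi(1) pi(1) pi(1)])
    fix xs ys assume x: "xs \<in> lists_of_length i (carrier (Hab n))" and y: "ys \<in> lists_of_length j (carrier (Hab n))"
    have "xs @ ys \<in> lists_of_length (i + j) (carrier (Hab n))" "ys @ xs \<in> lists_of_length (i + j) (carrier (Hab n))"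
      using lists_of_length_append[OF x y] lists_of_length_append[OF y x] by (simp_all add: add.commute)
    then show "pi (i + j) (tprod (Hab n) (xs @ ys)) = pi i (tprod (Hab n) xs) * pi j (tprod (Hab n) ys)"
      "pi (i + j) (tprod (Hab n) (ys @ xs)) = pi j (tprod (Hab n) ys) * pi i (tprod (Hab n) xs)"
      using x y by (simp_all add: pi(2))
  qed (use S T in blast)+
  then have 1: "pi k (tev (Node s t)) = theta n (Jev (Node s t))"
    using S T unfolding k by (simp add: i_def[symmetric] j_def[symmetric] theta_brc mult.commute)
  have "kap f (i + j) (tbracket (Hab n) i j (tev s) (tev t)) = kap f i (tev s) * pi j (tev t) - kap f j (tev t) * pi i (tev s)"
  proof (rule HH.tbracket_eval[OF _ pi(1) pi(1)])
    show "kap f i \<in> hom (tpow (Hab n) i) add_grp" "kap f j \<in> hom (tpow (Hab n) j) add_grp" unfolding ij by (rule kap(1)[OF f])+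
    show "kap f (i + j) \<in> hom (tpow (Hab n) (i + j)) add_grp" unfolding ij add_Suc by (rule kap(1)[OF f])
    fix xs ys assume x: "xs \<in> lists_of_length i (carrier (Hab n))" and y: "ys \<in> lists_of_length j (carrier (Hab n))"
    have a: "xs @ ys \<in> lists_of_length (Suc (i' + j)) (carrier (Hab n))" "ys @ xs \<in> lists_of_length (Suc (i' + j)) (carrier (Hab n))"
      using lists_of_length_append[OF x y] lists_of_length_append[OF y x] unfolding ij by (simp_all add: add.commute)
    have ne: "xs \<noteq> []" "ys \<noteq> []" using x y unfolding ij lists_of_length_def by auto
    show "kap f (i + j) (tprod (Hab n) (xs @ ys)) = kap f i (tprod (Hab n) xs) * pi j (tprod (Hab n) ys)"
      using kap(2)[OF f a(1)] kap(2)[OF f, of xs i'] pi(2)[OF y] x ne unfolding ij(1) by (simp add: mult.assoc)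
    show "kap f (i + j) (tprod (Hab n) (ys @ xs)) = kap f j (tprod (Hab n) ys) * pi i (tprod (Hab n) xs)"
      using kap(2)[OF f a(2)] kap(2)[OF f, of ys j'] pi(2)[OF x] y ne unfolding ij by (simp add: mult.assoc)
  qed (use S T in blast)+
  then have "kap f k (tev (Node s t)) = kap f i (tev s) * pi j (tev t) - kap f j (tev t) * pi i (tev s)"
    unfolding k by (simp add: i_def[symmetric] j_def[symmetric])
  also have "\<dots> = (\<Sum>i<n. of_int (f (Hab_gen n i)) * Jev s i) * theta n (Jev t) - (\<Sum>i<n. of_int (f (Hab_gen n i)) * Jev t i) * theta n (Jev s)"
    using S T by simp
  also have "\<dots> = (\<Sum>i<n. of_int (f (Hab_gen n i)) * Jev (Node s t) i)"
    unfolding sum_distrib_right sum_subtractf[symmetric] Jev.simps brc_def by (rule sum.cong[OF refl]) (simp add: algebra_simps)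
  finally show ?case using 1 by blast
qed

lemma word_cev: "t \<in> magma_words n k \<Longrightarrow> cev t \<in> carrier (chen_gr n k) \<and> J k (cev t) = Jev t"
proof (induction t arbitrary: k)
  case (Leaf i)
  then have i: "i < n" "k = 1" by (auto simp: magma_words_def)
  then show ?case using g_closed[OF i(1)] J_g[OF i(1)] Hab_to_chen_gen[OF i(1)] by simp
next
  case (Node s t)
  define i j where "i = leaves s" and "j = leaves t"
  have ij: "i \<ge> 1" "j \<ge> 1" unfolding i_def j_def by (rule leaves_pos)+
  have s: "s \<in> magma_words n i" and t: "t \<in> magma_words n j" and k: "k = i + j"
    using Node.prems by (auto simp: magma_words_def i_def j_def)
  note S = Node.IH(1)[OF s] and T = Node.IH(2)[OF t]
  have c: "chen_bracket n i j (cev s) (cev t) \<in> carrier (chen_gr n (i + j))"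
    by (rule chen_bracket_component[OF ij]) (use S T in blast)+
  moreover have "J (i + j) (chen_bracket n i j (cev s) (cev t)) = brc n (Jev s) (Jev t)"
    by (subst J_bracket[OF ij]) (use S T in simp_all)
  ultimately show ?case unfolding k by (simp add: i_def[symmetric] j_def[symmetric])
qed

sublocale FL: presentation "magma_words n k" "Collect (lie_rel n k)" for k
  by unfold_locales (use lie_rel_keys in blast)

lemma free_lie_comm_group: "comm_group (free_lie n k)"
  unfolding free_lie_def by (rule FL.comm_group)

abbreviation "lgen k \<equiv> pgen (magma_words n k) (Collect (lie_rel n k))"

text \<open>The Lie relations hold for ring commutators of noncommutative polynomials, and the
  injective \<open>Om\<close> reflects them back to the tensor power.\<close>

lemma embed:
  shows "free_lie_embed n k \<in> hom (free_lie n k) (tpow (Hab n) k)"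
    and "t \<in> magma_words n k \<Longrightarrow> free_lie_embed n k (lgen k t) = tev t"
proof -
  have g: "tev \<in> magma_words n k \<rightarrow> carrier (tpow (Hab n) k)" using word_tev by blast
  have r: "frag_hom (tpow (Hab n) k) tev r = \<one>\<^bsub>tpow (Hab n) k\<^esub>" if "r \<in> Collect (lie_rel n k)" for r
  proof (rule Om_inj)
    have rk: "lie_rel n k r" "Poly_Mapping.keys r \<subseteq> magma_words n k" using that lie_rel_keys by blast+
    show "frag_hom (tpow (Hab n) k) tev r \<in> carrier (tpow (Hab n) k)"
      using hom_in_carrier[OF comm_group.frag_hom_hom[OF HH.tpow_comm_group g]] rk by simp
    have "Om k (frag_hom (tpow (Hab n) k) tev r) = frag_hom add_grp (\<lambda>s. Om k (tev s)) r"
      by (rule frag_hom_compose[OF HH.tpow_comm_group Om(1) g rk(2)])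
    also have "\<dots> = frag_hom add_grp Qev r"
      unfolding frag_hom_def finprod_add_grp by (rule sum.cong[OF refl]) (use word_tev rk(2) in \<open>simp add: subset_iff\<close>)
    also have "\<dots> = 0"
      by (rule lie_rel_zero[of "\<lambda>p q. p * q - q * p"]) (use rk(1) in \<open>simp_all add: algebra_simps\<close>)
    finally show "Om k (frag_hom (tpow (Hab n) k) tev r) = 0" .
  qed
  show "free_lie_embed n k \<in> hom (free_lie n k) (tpow (Hab n) k)"
    "t \<in> magma_words n k \<Longrightarrow> free_lie_embed n k (lgen k t) = tev t"
    unfolding free_lie_embed_def free_lie_def using FL.lift_hom[OF HH.tpow_comm_group g r] by blast+
qed

lemma brc_jacobi: "brc n p (brc n q r) + brc n q (brc n r p) + brc n r (brc n p q) = 0"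
proof
  fix i
  have t: "theta n (brc n a b) = 0" for a b by (rule theta_brc)
  have b: "brc n a (brc n c d) i = - theta n a * (theta n d * c i - theta n c * d i)" for a c d
    by (subst brc_def) (simp add: t, simp add: brc_def)
  show "(brc n p (brc n q r) + brc n q (brc n r p) + brc n r (brc n p q)) i = 0 i"
    by (simp add: b algebra_simps)
qed

text \<open>The argument of \<open>embed\<close> with \<open>J k\<close> as the injective map and
  \<open>brc\<close> as the bracket.\<close>

lemma to_chen:
  assumes k: "k \<ge> 1"
  shows "free_lie_to_chen n k \<in> hom (free_lie n k) (chen_gr n k)"
    and "t \<in> magma_words n k \<Longrightarrow> free_lie_to_chen n k (lgen k t) = cev t"
proof -
  have g: "cev \<in> magma_words n k \<rightarrow> carrier (chen_gr n k)" using word_cev by blast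
  have r: "frag_hom (chen_gr n k) cev r = \<one>\<^bsub>chen_gr n k\<^esub>" if "r \<in> Collect (lie_rel n k)" for r
  proof -
    have rk: "lie_rel n k r" "Poly_Mapping.keys r \<subseteq> magma_words n k" using that lie_rel_keys by blast+
    have c: "frag_hom (chen_gr n k) cev r \<in> carrier (chen_gr n k)"
      using hom_in_carrier[OF comm_group.frag_hom_hom[OF gr_comm_group[OF k] g]] rk by simp
    have "J k (frag_hom (chen_gr n k) cev r) = frag_hom add_grp (\<lambda>s. J k (cev s)) r"
      by (rule frag_hom_compose[OF gr_comm_group[OF k] J_hom'[OF k] g rk(2)])
    also have "\<dots> = frag_hom add_grp Jev r"
      unfolding frag_hom_def finprod_add_grp by (rule sum.cong[OF refl]) (use word_cev rk(2) in \<open>simp add: subset_iff\<close>)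
    also have "\<dots> = 0"
    proof (rule lie_rel_zero[of "brc n"])
      have th: "theta n (x - y) = theta n x - theta n y" for x y :: "nat \<Rightarrow> poly"
        using theta_linear(2)[of n x y] by (simp add: fun_diff_def)
      show "brc n (x - y) z = brc n x z - brc n y z" "brc n z (x - y) = brc n z x - brc n z y" for x y z
        by (auto simp: brc_def th fun_eq_iff algebra_simps)
      show "brc n x x = 0" "brc n x y = - brc n y x" for x y by (auto simp: brc_def fun_eq_iff)
    qed (use rk(1) brc_jacobi in simp_all)
    finally show ?thesis using J_eq_0[OF k c] by simp
  qed
  show "free_lie_to_chen n k \<in> hom (free_lie n k) (chen_gr n k)"
    "t \<in> magma_words n k \<Longrightarrow> free_lie_to_chen n k (lgen k t) = cev t"
    unfolding free_lie_to_chen_def free_lie_def using FL.lift_hom[OF gr_comm_group[OF k] g r] by blast+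
qed

abbreviation "DH \<equiv> dual (Hab n)"

lemma DH_two_groups: "comm_group M \<Longrightarrow> two_groups DH M"
  by (rule two_groups.intro[OF HH.dual_comm_group])

subsection \<open>Contraction and symmetrization\<close>

text \<open>The inner function of \<open>contract\<close> for a fixed functional, named so that
  linearity in the tensor and linearity in the functional can be treated separately.\<close>

definition contr :: "(word set \<Rightarrow> int) \<Rightarrow> nat \<Rightarrow> (word set list \<Rightarrow>\<^sub>0 int) set \<Rightarrow> (word set list \<Rightarrow>\<^sub>0 int) set" where
  "contr f k = lift (tpow (Hab n) k) (\<lambda>xs. tprod (Hab n) (tl xs) [^]\<^bsub>tpow (Hab n) k\<^esub> f (hd xs))"

lemma contr_multilinear:
  assumes f: "f \<in> carrier DH"
  shows "multilinear (Hab n) (Suc k) (tpow (Hab n) k) (\<lambda>xs. tprod (Hab n) (tl xs) [^]\<^bsub>tpow (Hab n) k\<^esub> f (hd xs))"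
  unfolding multilinear_def
proof (intro conjI ballI allI impI)
  interpret T: comm_group "tpow (Hab n) k" by (rule HH.tpow_comm_group)
  have fh: "f \<in> hom (Hab n) add_grp" using f unfolding HH.carrier_dual by blast
  fix xs assume xs: "xs \<in> lists_of_length (Suc k) (carrier (Hab n))"
  then have "tl xs \<in> lists_of_length k (carrier (Hab n))"
    unfolding lists_of_length_def using list.set_sel(2) by (cases xs) auto
  then show "tprod (Hab n) (tl xs) [^]\<^bsub>tpow (Hab n) k\<^esub> f (hd xs) \<in> carrier (tpow (Hab n) k)"
    by (intro T.int_pow_closed HH.tprod_closed)
next
  interpret T: comm_group "tpow (Hab n) k" by (rule HH.tpow_comm_group)
  have fh: "f \<in> hom (Hab n) add_grp" using f unfolding HH.carrier_dual by blast
  fix us vs a b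
  assume "set us \<union> set vs \<subseteq> carrier (Hab n) \<and> a \<in> carrier (Hab n) \<and> b \<in> carrier (Hab n) \<and> length us + 1 + length vs = Suc k"
  then have m: "set us \<subseteq> carrier (Hab n)" "set vs \<subseteq> carrier (Hab n)" "a \<in> carrier (Hab n)" "b \<in> carrier (Hab n)"
    "length us + 1 + length vs = Suc k" by blast+
  show "tprod (Hab n) (tl (us @ [a \<otimes>\<^bsub>Hab n\<^esub> b] @ vs)) [^]\<^bsub>tpow (Hab n) k\<^esub> f (hd (us @ [a \<otimes>\<^bsub>Hab n\<^esub> b] @ vs)) =
      tprod (Hab n) (tl (us @ [a] @ vs)) [^]\<^bsub>tpow (Hab n) k\<^esub> f (hd (us @ [a] @ vs)) \<otimes>\<^bsub>tpow (Hab n) k\<^esub>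
      tprod (Hab n) (tl (us @ [b] @ vs)) [^]\<^bsub>tpow (Hab n) k\<^esub> f (hd (us @ [b] @ vs))"
  proof (cases us)
    case Nil
    have v: "tprod (Hab n) vs \<in> carrier (tpow (Hab n) k)"
      by (rule HH.tprod_closed) (use m(2,5) Nil in \<open>simp add: lists_of_length_def\<close>)
    have "f (a \<otimes>\<^bsub>Hab n\<^esub> b) = f a + f b" using hom_mult[OF fh m(3,4)] by simp
    then show ?thesis using T.int_pow_mult[OF v] Nil by simp
  next
    case (Cons u us')
    have l: "set us' \<union> set vs \<subseteq> carrier (Hab n)" "length us' + 1 + length vs = k" using m Cons by auto
    have c: "tprod (Hab n) (us' @ [y] @ vs) \<in> carrier (tpow (Hab n) k)" if "y \<in> carrier (Hab n)" for y
      by (rule HH.tprod_closed) (use l that in \<open>auto simp: lists_of_length_def\<close>)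
    have "tprod (Hab n) (us' @ [a \<otimes>\<^bsub>Hab n\<^esub> b] @ vs) =
        tprod (Hab n) (us' @ [a] @ vs) \<otimes>\<^bsub>tpow (Hab n) k\<^esub> tprod (Hab n) (us' @ [b] @ vs)"
      using HH.tprod_multilinear[of k] l m(3,4) unfolding multilinear_def by blast
    then show ?thesis using T.int_pow_distrib[OF c[OF m(3)] c[OF m(4)]] Cons by simp
  qed
qed

lemma contr:
  assumes "f \<in> carrier DH"
  shows "contr f k \<in> hom (tpow (Hab n) (Suc k)) (tpow (Hab n) k)"
    and "xs \<in> lists_of_length (Suc k) (carrier (Hab n)) \<Longrightarrow>
      contr f k (tprod (Hab n) xs) = tprod (Hab n) (tl xs) [^]\<^bsub>tpow (Hab n) k\<^esub> f (hd xs)"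
  unfolding contr_def using HH.tpow_lift[OF HH.tpow_comm_group contr_multilinear[OF assms]] by blast+

lemma tl_closed: "xs \<in> lists_of_length (Suc k) A \<Longrightarrow> tl xs \<in> lists_of_length k A \<and> hd xs \<in> A"
  by (cases xs) (auto simp: lists_of_length_def)

lemma contract:
  shows contract_hom: "contract (Hab n) k \<in> hom (tensor DH (tpow (Hab n) (Suc k))) (tpow (Hab n) k)"
    and contract_pure: "f \<in> carrier DH \<Longrightarrow> Y \<in> carrier (tpow (Hab n) (Suc k)) \<Longrightarrow>
      contract (Hab n) k (pure DH (tpow (Hab n) (Suc k)) f Y) = contr f k Y"
proof -
  interpret T: comm_group "tpow (Hab n) k" by (rule HH.tpow_comm_group)
  interpret D: two_groups DH "tpow (Hab n) (Suc k)" by (rule DH_two_groups[OF HH.tpow_comm_group])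
  have "(\<lambda>f. contr f k Y) \<in> hom DH (tpow (Hab n) k)" if Y: "Y \<in> carrier (tpow (Hab n) (Suc k))" for Y
  proof (rule homI)
    fix f assume f: "f \<in> carrier DH"
    show "contr f k Y \<in> carrier (tpow (Hab n) k)" by (rule hom_in_carrier[OF contr(1)[OF f] Y])
    fix h assume h: "h \<in> carrier DH"
    have fh: "f \<otimes>\<^bsub>DH\<^esub> h \<in> carrier DH" by (rule D.M.m_closed[OF f h])
    show "contr (f \<otimes>\<^bsub>DH\<^esub> h) k Y = contr f k Y \<otimes>\<^bsub>tpow (Hab n) k\<^esub> contr h k Y"
    proof (rule HH.tpow_hom_eqI[OF T.is_group contr(1)[OF fh] hom_mult_pointwise[OF T.comm_group_axioms contr(1)[OF f] contr(1)[OF h]] _ Y])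
      fix xs assume xs: "xs \<in> lists_of_length (Suc k) (carrier (Hab n))"
      then have t: "tprod (Hab n) (tl xs) \<in> carrier (tpow (Hab n) k)" "hd xs \<in> carrier (Hab n)"
        using tl_closed[OF xs] HH.tprod_closed by blast+
      have e: "(f \<otimes>\<^bsub>DH\<^esub> h) (hd xs) = f (hd xs) + h (hd xs)"
        unfolding HH.dual_mult restrict_apply'[OF t(2)] ..
      show "contr (f \<otimes>\<^bsub>DH\<^esub> h) k (tprod (Hab n) xs) = contr f k (tprod (Hab n) xs) \<otimes>\<^bsub>tpow (Hab n) k\<^esub> contr h k (tprod (Hab n) xs)"
        unfolding contr(2)[OF f xs] contr(2)[OF h xs] contr(2)[OF fh xs] e
        by (rule T.int_pow_mult[OF t(1)])
    qed
  qed
  then have b: "D.bilinear (tpow (Hab n) k) (\<lambda>(f, Y). contr f k Y)"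
    unfolding D.bilinear_def using contr(1) by simp
  show "contract (Hab n) k \<in> hom (tensor DH (tpow (Hab n) (Suc k))) (tpow (Hab n) k)"
    unfolding contract_def contr_def[symmetric] by (rule D.tensor_lift(1)[OF T.comm_group_axioms b])
  show "contract (Hab n) k (pure DH (tpow (Hab n) (Suc k)) f Y) = contr f k Y"
    if "f \<in> carrier DH" "Y \<in> carrier (tpow (Hab n) (Suc k))"
    unfolding contract_def contr_def[symmetric] D.tensor_lift(2)[OF T.comm_group_axioms b that] by simp
qed

lemma sym_proj:
  shows "sym_proj (Hab n) k \<in> hom (tpow (Hab n) k) (spow (Hab n) k)"
    and "xs \<in> lists_of_length k (carrier (Hab n)) \<Longrightarrow> sym_proj (Hab n) k (tprod (Hab n) xs) = sprod (Hab n) xs"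
  unfolding sym_proj_def using HH.tpow_lift[OF HH.spow_comm_group HH.sprod_multilinear] by blast+

lemma Lam_contr:
  assumes f: "f \<in> carrier DH" and Y: "Y \<in> carrier (tpow (Hab n) (Suc k))"
  shows "Lam k (sym_proj (Hab n) k (contr f k Y)) = kap f (Suc k) Y"
proof (rule HH.tpow_hom_eqI[OF group_add_grp _ kap(1)[OF f] _ Y])
  have h: "(\<lambda>Z. Lam k (sym_proj (Hab n) k Z)) \<in> hom (tpow (Hab n) k) add_grp"
    using Group.hom_compose[OF sym_proj(1) Lam_hom] by (simp add: comp_def)
  show "(\<lambda>Y. Lam k (sym_proj (Hab n) k (contr f k Y))) \<in> hom (tpow (Hab n) (Suc k)) add_grp"
    using Group.hom_compose[OF contr(1)[OF f] h] by (simp add: comp_def)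
  fix xs assume xs: "xs \<in> lists_of_length (Suc k) (carrier (Hab n))"
  have t: "tl xs \<in> lists_of_length k (carrier (Hab n))" using tl_closed[OF xs] by blast
  have "Lam k (sym_proj (Hab n) k (contr f k (tprod (Hab n) xs))) =
      Lam k (sym_proj (Hab n) k (tprod (Hab n) (tl xs))) [^]\<^bsub>add_grp\<^esub> f (hd xs)"
    unfolding contr(2)[OF f xs]
    by (rule hom_int_pow'[OF comm_group.axioms(2)[OF HH.tpow_comm_group] group_add_grp h HH.tprod_closed[OF t]])
  also have "\<dots> = of_int (f (hd xs)) * prod_list (map lin (tl xs))"
    unfolding sym_proj(2)[OF t] Lam_sprod[OF t] int_pow_add_grp ..
  finally show "Lam k (sym_proj (Hab n) k (contr f k (tprod (Hab n) xs))) = kap f (Suc k) (tprod (Hab n) xs)"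
    unfolding kap(2)[OF f xs] .
qed

subsection \<open>The trace map on the Chen Lie algebra\<close>

text \<open>The trace written on the metabelian side in the coordinates \<open>J\<close>. That
  Morita's trace agrees with it after the passage to the quotient is what makes the factorisation
  visible.\<close>

definition tau :: "nat \<Rightarrow> ((word set \<Rightarrow> int) \<times> word set set \<Rightarrow>\<^sub>0 int) set \<Rightarrow> poly" where
  "tau k = lift add_grp (\<lambda>(f, w). \<Sum>i<n. of_int (f (Hab_gen n i)) * J (Suc k) w i)"

lemma J_sum_hom: "(\<lambda>w. \<Sum>i<n. of_int (f (Hab_gen n i)) * J (Suc k) w i) \<in> hom (chen_gr n (Suc k)) add_grp"
proof (rule homI)
  fix w w' assume w: "w \<in> carrier (chen_gr n (Suc k))" "w' \<in> carrier (chen_gr n (Suc k))"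
  have "J (Suc k) (w \<otimes>\<^bsub>chen_gr n (Suc k)\<^esub> w') i = J (Suc k) w i + J (Suc k) w' i" for i
    using hom_mult[OF J_hom w] by (simp add: plus_fun_def)
  then show "(\<Sum>i<n. of_int (f (Hab_gen n i)) * J (Suc k) (w \<otimes>\<^bsub>chen_gr n (Suc k)\<^esub> w') i) =
      (\<Sum>i<n. of_int (f (Hab_gen n i)) * J (Suc k) w i) \<otimes>\<^bsub>add_grp\<^esub> (\<Sum>i<n. of_int (f (Hab_gen n i)) * J (Suc k) w' i)"
    by (simp add: distrib_left sum.distrib)
qed simp

lemma chen_gr_Suc: "comm_group (chen_gr n (Suc k))"
  by (rule gr_comm_group) simp

lemma tau:
  shows "tau k \<in> hom (tensor DH (chen_gr n (Suc k))) add_grp"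
    and "f \<in> carrier DH \<Longrightarrow> w \<in> carrier (chen_gr n (Suc k)) \<Longrightarrow>
      tau k (pure DH (chen_gr n (Suc k)) f w) = (\<Sum>i<n. of_int (f (Hab_gen n i)) * J (Suc k) w i)"
proof -
  interpret D: two_groups DH "chen_gr n (Suc k)" by (rule DH_two_groups[OF chen_gr_Suc])
  have "(\<lambda>f. \<Sum>i<n. of_int (f (Hab_gen n i)) * J (Suc k) w i) \<in> hom DH add_grp" for w
  proof (rule homI)
    fix f h
    have "(f \<otimes>\<^bsub>DH\<^esub> h) (Hab_gen n i) = f (Hab_gen n i) + h (Hab_gen n i)" if "i < n" for i
      unfolding HH.dual_mult restrict_apply'[OF Hab_gen_closed[OF that]] ..
    then show "(\<Sum>i<n. of_int ((f \<otimes>\<^bsub>DH\<^esub> h) (Hab_gen n i)) * J (Suc k) w i) =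
        (\<Sum>i<n. of_int (f (Hab_gen n i)) * J (Suc k) w i) \<otimes>\<^bsub>add_grp\<^esub> (\<Sum>i<n. of_int (h (Hab_gen n i)) * J (Suc k) w i)"
      by (simp add: distrib_right sum.distrib)
  qed simp
  then have b: "D.bilinear add_grp (\<lambda>(f, w). \<Sum>i<n. of_int (f (Hab_gen n i)) * J (Suc k) w i)"
    unfolding D.bilinear_def using J_sum_hom by simp
  show "tau k \<in> hom (tensor DH (chen_gr n (Suc k))) add_grp"
    unfolding tau_def by (rule D.tensor_lift(1)[OF comm_group_add_grp b])
  show "tau k (pure DH (chen_gr n (Suc k)) f w) = (\<Sum>i<n. of_int (f (Hab_gen n i)) * J (Suc k) w i)"
    if "f \<in> carrier DH" "w \<in> carrier (chen_gr n (Suc k))"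
    unfolding tau_def D.tensor_lift(2)[OF comm_group_add_grp b that] by simp
qed

abbreviation "chen_quot k \<equiv> id_tensor DH (chen_gr n (Suc k)) (free_lie_to_chen n (Suc k))"

lemma to_chen_Suc: "free_lie_to_chen n (Suc k) \<in> hom (free_lie n (Suc k)) (chen_gr n (Suc k))"
  by (rule to_chen(1)) simp

lemmas chen_quot = id_tensor[OF HH.dual_comm_group free_lie_comm_group chen_gr_Suc to_chen_Suc]
lemmas embed_tensor = id_tensor[OF HH.dual_comm_group free_lie_comm_group HH.tpow_comm_group embed(1)]

lemma trace_map_hom: "trace_map n k \<in> hom (tensor DH (free_lie n (Suc k))) (spow (Hab n) k)"
proof -
  have "sym_proj (Hab n) k \<circ> (contract (Hab n) k \<circ> id_tensor DH (tpow (Hab n) (Suc k)) (free_lie_embed n (Suc k)))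
      \<in> hom (tensor DH (free_lie n (Suc k))) (spow (Hab n) k)"
    by (rule Group.hom_compose[OF Group.hom_compose[OF embed_tensor(1) contract_hom] sym_proj(1)])
  then show ?thesis by (simp add: trace_map_def[abs_def] comp_def)
qed

text \<open>Both sides are additive, so a pure tensor of a functional with a magma word suffices;
  there \<open>word_pi_kap\<close> and \<open>word_cev\<close> produce the same sum.\<close>

lemma Lam_trace_map:
  assumes u: "u \<in> carrier (tensor DH (free_lie n (Suc k)))"
  shows "Lam k (trace_map n k u) = tau k (chen_quot k u)"
proof -
  interpret D: two_groups DH "free_lie n (Suc k)" by (rule DH_two_groups[OF free_lie_comm_group])
  show ?thesis
  proof (rule D.tensor_hom_eqI[OF group_add_grp _ _ _ u])
    show "(\<lambda>u. Lam k (trace_map n k u)) \<in> hom (tensor DH (free_lie n (Suc k))) add_grp"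
      using Group.hom_compose[OF trace_map_hom Lam_hom] by (simp add: comp_def)
    show "(\<lambda>u. tau k (chen_quot k u)) \<in> hom (tensor DH (free_lie n (Suc k))) add_grp"
      using Group.hom_compose[OF chen_quot(1) tau(1)] by (simp add: comp_def)
    fix f l assume f: "f \<in> carrier DH" and l: "l \<in> carrier (free_lie n (Suc k))"
    have "Lam k (trace_map n k (pure DH (free_lie n (Suc k)) f l)) = kap f (Suc k) (free_lie_embed n (Suc k) l)"
      unfolding trace_map_def Suc_eq_plus1[symmetric] embed_tensor(2)[OF f l] contract_pure[OF f hom_in_carrier[OF embed(1) l]]
      by (rule Lam_contr[OF f hom_in_carrier[OF embed(1) l]])
    also have "\<dots> = (\<Sum>i<n. of_int (f (Hab_gen n i)) * J (Suc k) (free_lie_to_chen n (Suc k) l) i)"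
    proof (rule FL.hom_eqI[OF group_add_grp _ _ _ l[unfolded free_lie_def]])
      show "(\<lambda>l. kap f (Suc k) (free_lie_embed n (Suc k) l)) \<in> hom (presented (magma_words n (Suc k)) (Collect (lie_rel n (Suc k)))) add_grp"
        using Group.hom_compose[OF embed(1) kap(1)[OF f]] by (simp add: comp_def free_lie_def)
      show "(\<lambda>l. \<Sum>i<n. of_int (f (Hab_gen n i)) * J (Suc k) (free_lie_to_chen n (Suc k) l) i)
          \<in> hom (presented (magma_words n (Suc k)) (Collect (lie_rel n (Suc k)))) add_grp"
        using Group.hom_compose[OF to_chen_Suc J_sum_hom] by (simp add: comp_def free_lie_def)
      fix t assume t: "t \<in> magma_words n (Suc k)"
      have "free_lie_to_chen n (Suc k) (lgen (Suc k) t) = cev t" by (rule to_chen(2)[OF _ t]) simp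
      then show "kap f (Suc k) (free_lie_embed n (Suc k) (lgen (Suc k) t)) =
          (\<Sum>i<n. of_int (f (Hab_gen n i)) * J (Suc k) (free_lie_to_chen n (Suc k) (lgen (Suc k) t)) i)"
        using word_pi_kap[OF f t] word_cev[OF t] embed(2)[OF t] by simp
    qed
    also have "\<dots> = tau k (chen_quot k (pure DH (free_lie n (Suc k)) f l))"
      unfolding chen_quot(2)[OF f l] tau(2)[OF f hom_in_carrier[OF to_chen_Suc l]] ..
    finally show "Lam k (trace_map n k (pure DH (free_lie n (Suc k)) f l)) = tau k (chen_quot k (pure DH (free_lie n (Suc k)) f l))" .
  qed
qed

lemma cev_generate: "generate (chen_gr n (Suc k)) (cev ` magma_words n (Suc k)) = carrier (chen_gr n (Suc k))"
proof (induction k)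
  case 0
  have "cev ` magma_words n (Suc 0) \<supseteq> g ` {..<n}"
  proof
    fix y assume "y \<in> g ` {..<n}"
    then obtain i where i: "i < n" "y = g i" by blast
    then have "Leaf i \<in> magma_words n (Suc 0)" "y = cev (Leaf i)"
      using Hab_to_chen_gen by (simp_all add: magma_words_def)
    then show "y \<in> cev ` magma_words n (Suc 0)" by blast
  qed
  then have "generate (chen_gr n (Suc 0)) (g ` {..<n}) \<subseteq> generate (chen_gr n (Suc 0)) (cev ` magma_words n (Suc 0))"
    by (rule group.mono_generate[OF gr_group])
  moreover have "generate (chen_gr n (Suc 0)) (cev ` magma_words n (Suc 0)) \<subseteq> carrier (chen_gr n (Suc 0))"
    by (rule group.generate_incl[OF gr_group]) (use word_cev in blast)
  ultimately show ?case using gr_1_generate by simp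
next
  case (Suc k)
  let ?K = "cev ` magma_words n (Suc k)"
  have K: "?K \<subseteq> carrier (chen_gr n (Suc k))" using word_cev by blast
  have "{chen_bracket n (Suc k) 1 A (g i) | A i. A \<in> ?K \<and> i < n} \<subseteq> cev ` magma_words n (Suc (Suc k))"
  proof
    fix y assume "y \<in> {chen_bracket n (Suc k) 1 A (g i) | A i. A \<in> ?K \<and> i < n}"
    then obtain t i where t: "t \<in> magma_words n (Suc k)" "i < n" "y = chen_bracket n (Suc k) 1 (cev t) (g i)" by blast
    then have "Node t (Leaf i) \<in> magma_words n (Suc (Suc k))" "y = cev (Node t (Leaf i))"
      using Hab_to_chen_gen by (simp_all add: magma_words_def)
    then show "y \<in> cev ` magma_words n (Suc (Suc k))" by blast
  qed
  then have "carrier (chen_gr n (Suc (Suc k))) \<subseteq> generate (chen_gr n (Suc (Suc k))) (cev ` magma_words n (Suc (Suc k)))"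
    unfolding gr_Suc_generate[OF Suc_leI[OF zero_less_Suc, folded One_nat_def] K Suc.IH, unfolded Suc_eq_plus1[symmetric], symmetric]
    by (rule group.mono_generate[OF gr_group])
  moreover have "generate (chen_gr n (Suc (Suc k))) (cev ` magma_words n (Suc (Suc k))) \<subseteq> carrier (chen_gr n (Suc (Suc k)))"
    by (rule group.generate_incl[OF gr_group]) (use word_cev in blast)
  ultimately show ?case by blast
qed

lemma to_chen_surj: "free_lie_to_chen n (Suc k) ` carrier (free_lie n (Suc k)) = carrier (chen_gr n (Suc k))"
proof -
  have k: "Suc k \<ge> 1" by simp
  have c: "lgen (Suc k) ` magma_words n (Suc k) \<subseteq> carrier (free_lie n (Suc k))"
    unfolding free_lie_def using FL.pgen_closed by blast
  have "carrier (free_lie n (Suc k)) = generate (free_lie n (Suc k)) (lgen (Suc k) ` magma_words n (Suc k))"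
    unfolding free_lie_def by (rule FL.pgen_generate[symmetric])
  then have "free_lie_to_chen n (Suc k) ` carrier (free_lie n (Suc k)) =
      generate (chen_gr n (Suc k)) (free_lie_to_chen n (Suc k) ` lgen (Suc k) ` magma_words n (Suc k))"
    by (simp only: hom_generate_image[OF comm_group.axioms(2)[OF free_lie_comm_group] gr_group to_chen_Suc c])
  also have "free_lie_to_chen n (Suc k) ` lgen (Suc k) ` magma_words n (Suc k) = cev ` magma_words n (Suc k)"
    unfolding image_image by (rule image_cong[OF refl to_chen(2)[OF k]])
  finally show ?thesis unfolding cev_generate .
qed

lemma choice_on: "(\<And>i. P i \<Longrightarrow> \<exists>l. Q i l) \<Longrightarrow> \<exists>l. \<forall>i. P i \<longrightarrow> Q i (l i)"
  by metis

text \<open>The coordinates of \<open>t\<close> in the Chen algebra are lifted one by one along the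
  surjection from the free Lie ring and reassembled with the dual basis.\<close>

lemma chen_quot_surj:
  assumes t: "t \<in> carrier (tensor DH (chen_gr n (Suc k)))"
  obtains u where "u \<in> carrier (tensor DH (free_lie n (Suc k)))" "chen_quot k u = t"
proof -
  interpret D: two_groups DH "free_lie n (Suc k)" by (rule DH_two_groups[OF free_lie_comm_group])
  interpret D': two_groups DH "chen_gr n (Suc k)" by (rule DH_two_groups[OF chen_gr_Suc])
  interpret T: comm_group "tensor DH (free_lie n (Suc k))" by (rule D.tensor_comm_group)
  define w' where "w' i = HB.tcoord (chen_gr n (Suc k)) i t" for i
  have w: "w' i \<in> carrier (chen_gr n (Suc k))" if "i < n" for i
    unfolding w'_def by (rule hom_in_carrier[OF HB.tcoord(1)[OF chen_gr_Suc that] t])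
  have "\<exists>l. l \<in> carrier (free_lie n (Suc k)) \<and> free_lie_to_chen n (Suc k) l = w' i" if "i < n" for i
    using w[OF that] unfolding to_chen_surj[of k, symmetric] by blast
  then obtain l where l: "\<And>i. i < n \<Longrightarrow> l i \<in> carrier (free_lie n (Suc k)) \<and> free_lie_to_chen n (Suc k) (l i) = w' i"
    using choice_on[of "\<lambda>i. i < n" "\<lambda>i l. l \<in> carrier (free_lie n (Suc k)) \<and> free_lie_to_chen n (Suc k) l = w' i"] by blast
  have p: "(\<lambda>i. pure DH (free_lie n (Suc k)) (HB.d i) (l i)) \<in> {..<n} \<rightarrow> carrier (tensor DH (free_lie n (Suc k)))"
  proof (rule Pi_I)
    fix i assume "i \<in> {..<n}"
    then have i: "i < n" by simp
    show "pure DH (free_lie n (Suc k)) (HB.d i) (l i) \<in> carrier (tensor DH (free_lie n (Suc k)))"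
      by (rule D.pure_closed[OF HB.d_closed[OF i]]) (use l[OF i] in blast)
  qed
  have "chen_quot k (finprod (tensor DH (free_lie n (Suc k))) (\<lambda>i. pure DH (free_lie n (Suc k)) (HB.d i) (l i)) {..<n}) =
      finprod (tensor DH (chen_gr n (Suc k))) (\<lambda>i. chen_quot k (pure DH (free_lie n (Suc k)) (HB.d i) (l i))) {..<n}"
    by (rule hom_finprod[OF T.comm_group_axioms D'.tensor_comm_group chen_quot(1) p])
  also have "\<dots> = finprod (tensor DH (chen_gr n (Suc k))) (\<lambda>i. pure DH (chen_gr n (Suc k)) (HB.d i) (w' i)) {..<n}"
  proof (rule comm_monoid.finprod_cong'[OF comm_group.axioms(1)[OF D'.tensor_comm_group] refl])
    show "(\<lambda>i. pure DH (chen_gr n (Suc k)) (HB.d i) (w' i)) \<in> {..<n} \<rightarrow> carrier (tensor DH (chen_gr n (Suc k)))"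
      by (intro Pi_I D'.pure_closed HB.d_closed w) simp_all
    fix i assume "i \<in> {..<n}"
    then have i: "i < n" by simp
    show "chen_quot k (pure DH (free_lie n (Suc k)) (HB.d i) (l i)) = pure DH (chen_gr n (Suc k)) (HB.d i) (w' i)"
      using chen_quot(2)[OF HB.d_closed[OF i], of "l i"] l[OF i] by simp
  qed
  also have "\<dots> = t" unfolding w'_def by (rule HB.tensor_expand[OF chen_gr_Suc t])
  finally show thesis by (rule that[OF T.finprod_closed[OF p]])
qed

text \<open>The fibre over \<open>t\<close> is nonempty by \<open>chen_quot_surj\<close>. The trace
  is constant on it, because after the injective \<open>Lam\<close> it depends only on the image in
  the quotient. So the \<open>the_elem\<close> in the definition returns this common value.\<close>

lemma trace_map_metab:
  assumes t: "t \<in> carrier (tensor DH (chen_gr n (Suc k)))"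
  shows "trace_map_metab n k t \<in> carrier (spow (Hab n) k)" and "Lam k (trace_map_metab n k t) = tau k t"
proof -
  let ?S = "{u \<in> carrier (tensor DH (free_lie n (Suc k))). chen_quot k u = t}"
  obtain u where u: "u \<in> carrier (tensor DH (free_lie n (Suc k)))" "chen_quot k u = t"
    using chen_quot_surj[OF t] .
  have c: "trace_map n k x \<in> carrier (spow (Hab n) k)" if "x \<in> carrier (tensor DH (free_lie n (Suc k)))" for x
    by (rule hom_in_carrier[OF trace_map_hom that])
  have "trace_map n k x = trace_map n k u" if "x \<in> ?S" for x
    by (rule Lam_inj[OF c c]) (use that u Lam_trace_map in auto)
  then have "trace_map n k ` ?S = {trace_map n k u}" using u by blast
  then have e: "trace_map_metab n k t = trace_map n k u"
    unfolding trace_map_metab_def Suc_eq_plus1[symmetric] by simp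
  show "trace_map_metab n k t \<in> carrier (spow (Hab n) k)" unfolding e by (rule c[OF u(1)])
  show "Lam k (trace_map_metab n k t) = tau k t" unfolding e Lam_trace_map[OF u(1)] u(2) ..
qed

subsection \<open>Derivations as tensors\<close>

lemma der_value: "k \<ge> 1 \<Longrightarrow> D \<in> carrier (der n k) \<Longrightarrow> j < n \<Longrightarrow> D (x_el j) (Suc k) \<in> carrier (chen_gr n (Suc k))"
  by (rule chen_component[OF repD(3)[OF der_rep x_el_closed]]) simp_all

lemma der_tensor_eq:
  assumes "k \<ge> 1" "D \<in> carrier (der n k)"
  shows "der_tensor n k D = finprod (tensor DH (chen_gr n (Suc k))) (\<lambda>i. pure DH (chen_gr n (Suc k)) (HB.d i) (D (x_el i) (Suc k))) {..<n}"
    and "(\<lambda>i. pure DH (chen_gr n (Suc k)) (HB.d i) (D (x_el i) (Suc k))) \<in> {..<n} \<rightarrow> carrier (tensor DH (chen_gr n (Suc k)))"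
proof -
  interpret D: two_groups DH "chen_gr n (Suc k)" by (rule DH_two_groups[OF chen_gr_Suc])
  show p: "(\<lambda>i. pure DH (chen_gr n (Suc k)) (HB.d i) (D (x_el i) (Suc k))) \<in> {..<n} \<rightarrow> carrier (tensor DH (chen_gr n (Suc k)))"
    by (intro Pi_I D.pure_closed HB.d_closed der_value assms) simp_all
  show "der_tensor n k D = finprod (tensor DH (chen_gr n (Suc k))) (\<lambda>i. pure DH (chen_gr n (Suc k)) (HB.d i) (D (x_el i) (Suc k))) {..<n}"
    unfolding der_tensor_def Suc_eq_plus1[symmetric]
  proof (rule comm_monoid.finprod_cong'[OF comm_group.axioms(1)[OF D.tensor_comm_group] refl p])
    fix i assume "i \<in> {..<n}"
    then have "Hab_gen_dual n i = HB.d i" "Hab_to_chen n (Hab_gen n i) = g i" using dual_gen Hab_to_chen_gen by simp_all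
    then show "pure DH (chen_gr n (Suc k)) (Hab_gen_dual n i) (D (hom_el 1 (Hab_to_chen n (Hab_gen n i))) (Suc k)) =
        pure DH (chen_gr n (Suc k)) (HB.d i) (D (x_el i) (Suc k))" by (simp only:)
  qed
qed

lemma der_tensor_closed: "k \<ge> 1 \<Longrightarrow> D \<in> carrier (der n k) \<Longrightarrow> der_tensor n k D \<in> carrier (tensor DH (chen_gr n (Suc k)))"
  unfolding der_tensor_eq(1)
  by (rule comm_monoid.finprod_closed[OF comm_group.axioms(1)[OF two_groups.tensor_comm_group[OF DH_two_groups[OF chen_gr_Suc]]] der_tensor_eq(2)])

text \<open>Pairing the dual basis vector \<open>i\<close> with row \<open>i\<close> leaves exactly
  the diagonal entry.\<close>

lemma tau_der_tensor:
  assumes k: "k \<ge> 1" and D: "D \<in> carrier (der n k)"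
  shows "tau k (der_tensor n k D) = tr n (Psi k D)"
proof -
  interpret D: two_groups DH "chen_gr n (Suc k)" by (rule DH_two_groups[OF chen_gr_Suc])
  have "tau k (der_tensor n k D) = (\<Sum>i<n. tau k (pure DH (chen_gr n (Suc k)) (HB.d i) (D (x_el i) (Suc k))))"
    unfolding der_tensor_eq(1)[OF k D]
    using hom_finprod[OF D.tensor_comm_group comm_group_add_grp tau(1) der_tensor_eq(2)[OF k D]] by simp
  also have "\<dots> = (\<Sum>i<n. Psi k D i i)"
  proof (rule sum.cong[OF refl])
    fix i assume "i \<in> {..<n}"
    then have i: "i < n" by simp
    have "tau k (pure DH (chen_gr n (Suc k)) (HB.d i) (D (x_el i) (Suc k))) =
        (\<Sum>j<n. if j = i then J (Suc k) (D (x_el i) (Suc k)) i else 0)"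
      unfolding tau(2)[OF HB.d_closed[OF i] der_value[OF k D i]]
      by (rule sum.cong[OF refl]) (simp add: HB.d_e[OF i])
    then show "tau k (pure DH (chen_gr n (Suc k)) (HB.d i) (D (x_el i) (Suc k))) = Psi k D i i"
      using i by (simp add: Psi_def)
  qed
  finally show ?thesis unfolding tr_def .
qed

lemma trace_der:
  assumes "k \<ge> 1" "D \<in> carrier (der n k)"
  shows "trace_map_metab n k (der_tensor n k D) \<in> carrier (spow (Hab n) k)"
    and "Lam k (trace_map_metab n k (der_tensor n k D)) = tr n (Psi k D)"
  using trace_map_metab[OF der_tensor_closed[OF assms]] tau_der_tensor[OF assms] by simp_all

subsection \<open>The exterior square in degree two\<close>

sublocale EX: ext_square "Hab n" ..

lemma ext2_to_chen:
  shows ext2_to_chen_hom: "ext2_to_chen n \<in> hom (ext2 (Hab n)) (chen_gr n 2)"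
    and ext2_to_chen_wedge: "x \<in> carrier (Hab n) \<Longrightarrow> y \<in> carrier (Hab n) \<Longrightarrow>
      ext2_to_chen n (EX.wedge x y) = chen_bracket n 1 1 (Hab_to_chen n x) (Hab_to_chen n y)"
proof -
  let ?b = "\<lambda>x y. chen_bracket n 1 1 (Hab_to_chen n x) (Hab_to_chen n y)"
  have two: "(1::nat) + 1 = 2" by simp
  have H2: "comm_group (chen_gr n 2)" by (rule gr_comm_group) simp
  have hc: "Hab_to_chen n x \<in> carrier (chen_gr n 1)" if "x \<in> carrier (Hab n)" for x
    by (rule hom_in_carrier[OF Hab_to_chen_hom that])
  have r: "(\<lambda>y. ?b x y) \<in> hom (Hab n) (chen_gr n 2)" if x: "x \<in> carrier (Hab n)" for x
    using Group.hom_compose[OF Hab_to_chen_hom cl_bracket_hom(1)[OF le_refl le_refl hc[OF x]]]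
    unfolding two by (simp add: comp_def)
  have l: "(\<lambda>x. ?b x y) \<in> hom (Hab n) (chen_gr n 2)" if y: "y \<in> carrier (Hab n)" for y
    using Group.hom_compose[OF Hab_to_chen_hom cl_bracket_hom(2)[OF le_refl le_refl hc[OF y]]]
    unfolding two by (simp add: comp_def)
  have b: "EX.MM.bilinear (chen_gr n 2) (\<lambda>(x, y). ?b x y)"
    unfolding EX.MM.bilinear_def using l r by simp
  have s: "(case (x, x) of (x, y) \<Rightarrow> ?b x y) = \<one>\<^bsub>chen_gr n 2\<^esub>" if x: "x \<in> carrier (Hab n)" for x
  proof -
    have c: "?b x x \<in> carrier (chen_gr n 2)" by (rule hom_in_carrier[OF r[OF x] x])
    have "J (1 + 1) (?b x x) = brc n (J 1 (Hab_to_chen n x)) (J 1 (Hab_to_chen n x))"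
      by (rule J_bracket[OF le_refl le_refl hc[OF x] hc[OF x]])
    also have "\<dots> = 0" by (simp add: brc_def fun_eq_iff)
    finally show ?thesis using J_eq_0[of 2, OF _ c] unfolding two by simp
  qed
  show "ext2_to_chen n \<in> hom (ext2 (Hab n)) (chen_gr n 2)"
    unfolding ext2_to_chen_def by (rule EX.ext2_lift(1)[OF H2 b s])
  show "ext2_to_chen n (EX.wedge x y) = ?b x y" if "x \<in> carrier (Hab n)" "y \<in> carrier (Hab n)"
    using EX.ext2_lift(2)[OF H2 b s that] unfolding ext2_to_chen_def by (simp only: prod.case)
qed

abbreviation "wg a b \<equiv> EX.wedge (Hab_gen n a) (Hab_gen n b)"

lemma wg_closed: "a < n \<Longrightarrow> b < n \<Longrightarrow> wg a b \<in> carrier (ext2 (Hab n))"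
  by (rule EX.wedge_closed[OF Hab_gen_closed Hab_gen_closed])

lemma ext2_to_chen_wg:
  assumes "a < n" "b < n"
  shows "ext2_to_chen n (wg a b) = lc a b []" and "J 2 (ext2_to_chen n (wg a b)) = v a b"
proof -
  show e: "ext2_to_chen n (wg a b) = lc a b []"
    unfolding ext2_to_chen_wedge[OF assms[THEN Hab_gen_closed]] lc_Nil[OF assms] assms[THEN Hab_to_chen_gen] ..
  show "J 2 (ext2_to_chen n (wg a b)) = v a b"
    unfolding e using J_lc[OF assms, of "[]"] by (simp add: single_one numeral_2_eq_2)
qed

lemma wg_generate: "generate (ext2 (Hab n)) {wg a b | a b. a < n \<and> b < n} = carrier (ext2 (Hab n))"
proof -
  have "{wg a b | a b. a < n \<and> b < n} = {EX.wedge a b | a b. a \<in> Hab_gen n ` {..<n} \<and> b \<in> Hab_gen n ` {..<n}}" by blast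
  then show ?thesis using EX.ext2_generate[OF HB.e_subset Hab_generate] by simp
qed

lemma ext2_to_chen_surj: "ext2_to_chen n ` carrier (ext2 (Hab n)) = carrier (chen_gr n 2)"
proof -
  have s: "{wg a b | a b. a < n \<and> b < n} \<subseteq> carrier (ext2 (Hab n))" using wg_closed by blast
  have "ext2_to_chen n ` {wg a b | a b. a < n \<and> b < n} = {lc a b fs | a b fs. a < n \<and> b < n \<and> set fs \<subseteq> {..<n} \<and> length fs + 2 = 2}"
    (is "?L = ?R")
  proof (intro equalityI subsetI)
    fix y assume "y \<in> ?L"
    then obtain a b where "a < n" "b < n" "y = ext2_to_chen n (wg a b)" by blast
    then have "y = lc a b [] \<and> a < n \<and> b < n \<and> set [] \<subseteq> {..<n} \<and> length [] + 2 = (2::nat)"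
      using ext2_to_chen_wg(1) by simp
    then show "y \<in> ?R" by blast
  next
    fix y assume "y \<in> ?R"
    then obtain a b fs where "a < n" "b < n" "length fs + 2 = 2" "y = lc a b fs" by blast
    then have "a < n" "b < n" "y = ext2_to_chen n (wg a b)" using ext2_to_chen_wg(1) by simp_all
    then show "y \<in> ?L" by blast
  qed
  then show ?thesis
    using hom_generate_image[OF comm_group.axioms(2)[OF EX.ext2_comm_group] gr_group ext2_to_chen_hom s] gr_generate[of 2]
    unfolding wg_generate by simp
qed

text \<open>The left inverse reads from a tuple the coefficients of \<open>X d\<close> in component
  \<open>c\<close> for \<open>d < c\<close> and uses them as exponents of the wedges of generators.
  It recovers the wedges of generators from \<open>v a b\<close>, hence everything.\<close>

lemma ext2_to_chen_inj: "inj_on (ext2_to_chen n) (carrier (ext2 (Hab n)))"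
proof -
  interpret E: comm_group "ext2 (Hab n)" by (rule EX.ext2_comm_group)
  let ?A = "{(a, b). b < a \<and> a < n}"
  have fin: "finite ?A" by (rule finite_subset[of _ "{..<n} \<times> {..<n}"]) auto
  define q where "q p = (\<lambda>(c, d). wg c d [^]\<^bsub>ext2 (Hab n)\<^esub> Poly_Mapping.lookup (p c :: poly) {#d#})" for p
  define Q where "Q p = finprod (ext2 (Hab n)) (q p) ?A" for p
  have qh: "(\<lambda>p. q p z) \<in> hom add_grp (ext2 (Hab n))" if "z \<in> ?A" for z
  proof -
    obtain c d where z1: "z = (c, d)" by (cases z) blast
    then have z: "z = (c, d)" "c < n" "d < n" using that by auto
    have "(\<lambda>p. Poly_Mapping.lookup (p c :: poly) {#d#}) \<in> hom add_grp add_grp"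
      by (rule homI) (simp_all add: plus_fun_def Poly_Mapping.lookup_add)
    from Group.hom_compose[OF this E.int_pow_hom_right[OF wg_closed[OF z(2,3)]]]
    show ?thesis unfolding q_def z(1) by (simp add: comp_def)
  qed
  have Qh: "Q \<in> hom add_grp (ext2 (Hab n))"
    unfolding Q_def[abs_def] by (rule finprod_hom[OF EX.ext2_comm_group group_add_grp qh])
  have Q1: "Q (v a b) = wg a b" if ab: "b < a" "a < n" for a b
  proof -
    have an: "a < n" "b < n" using ab by simp_all
    have "q (v a b) z = (if (a, b) = z then wg a b else \<one>\<^bsub>ext2 (Hab n)\<^esub>)" if z: "z \<in> ?A" for z
    proof -
      obtain c d where z: "z = (c, d)" "d < c" "c < n" using z by (cases z) auto
      \<comment> \<open>The other entry of \<open>v a b\<close>, the variable \<open>X a\<close> in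
        component \<open>b\<close>, belongs to the pair \<open>(b, a)\<close>, which is not in
        \<open>?A\<close> because \<open>b < a\<close>.\<close>
      have "Poly_Mapping.lookup (v a b c) {#d#} = (if a = c \<and> b = d then 1 else 0)"
        unfolding v_eq[OF an] using ab z(2,3)
        by (auto simp: e_def X_def lookup_single when_def lookup_minus)
      then show ?thesis unfolding q_def z(1) using E.int_pow_1[OF wg_closed[OF an]] by auto
    qed
    then have "Q (v a b) = finprod (ext2 (Hab n)) (\<lambda>z. if (a, b) = z then (\<lambda>_. wg a b) z else \<one>\<^bsub>ext2 (Hab n)\<^esub>) ?A"
      unfolding Q_def by (intro E.finprod_cong' refl) (use wg_closed[OF an] E.one_closed in auto)
    also have "\<dots> = wg a b"
      by (rule E.finprod_singleton[of "(a, b)" ?A "\<lambda>_. wg a b"]) (use fin ab wg_closed[OF an] in auto)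
    finally show ?thesis .
  qed
  have inv: "Q (- p) = inv\<^bsub>ext2 (Hab n)\<^esub> (Q p)" for p
  proof -
    interpret q: group_hom add_grp "ext2 (Hab n)" Q by (rule group_homI[OF group_add_grp E.is_group Qh])
    show ?thesis using q.hom_inv[of p] by simp
  qed
  have Q2: "Q (v a b) = wg a b" if ab: "a < n" "b < n" for a b
  proof (cases "b < a")
    case True then show ?thesis using Q1 ab by blast
  next
    case False
    show ?thesis
    proof (cases "a = b")
      case True
      have "Q 0 = \<one>\<^bsub>ext2 (Hab n)\<^esub>" using hom_one[OF Qh group_add_grp E.is_group] by simp
      then show ?thesis using EX.wedge_self[OF Hab_gen_closed[OF ab(1)]] v_self[of a] unfolding True[symmetric]
        by (simp add: zero_fun_def)
    next
      case ne: False
      have "v a b = - v b a" using v_swap[of b a] by (simp add: fun_Compl_def)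
      then have "Q (v a b) = inv\<^bsub>ext2 (Hab n)\<^esub> (wg b a)" using inv Q1[of a b] False ne ab by simp
      then show ?thesis using EX.wedge_swap[OF Hab_gen_closed[OF ab(2)] Hab_gen_closed[OF ab(1)]] by simp
    qed
  qed
  have two: "(1::nat) \<le> 2" by simp
  have QJ: "(\<lambda>y. Q (J 2 (ext2_to_chen n y))) \<in> hom (ext2 (Hab n)) (ext2 (Hab n))"
    using Group.hom_compose[OF Group.hom_compose[OF ext2_to_chen_hom J_hom'[OF two]] Qh] by (simp add: comp_def)
  have id: "(\<lambda>y. y) \<in> hom (ext2 (Hab n)) (ext2 (Hab n))" by (rule homI) simp_all
  have s: "{wg a b | a b. a < n \<and> b < n} \<subseteq> carrier (ext2 (Hab n))" using wg_closed by blast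
  have "Q (J 2 (ext2_to_chen n y)) = y" if "y \<in> carrier (ext2 (Hab n))" for y
  proof (rule hom_eq_on_generate[OF E.is_group E.is_group QJ id s])
    show "y \<in> generate (ext2 (Hab n)) {wg a b | a b. a < n \<and> b < n}" unfolding wg_generate by (rule that)
    fix z assume "z \<in> {wg a b | a b. a < n \<and> b < n}"
    then obtain a b where z: "z = wg a b" "a < n" "b < n" by blast
    show "Q (J 2 (ext2_to_chen n z)) = z" unfolding z(1) ext2_to_chen_wg(2)[OF z(2,3)] by (rule Q2[OF z(2,3)])
  qed
  then show ?thesis by (rule inj_on_inverseI)
qed

definition sig :: "word set set \<Rightarrow> (word set \<times> word set \<Rightarrow>\<^sub>0 int) set" where
  "sig = inv_into (carrier (ext2 (Hab n))) (ext2_to_chen n)"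

lemma sig_iso: "sig \<in> iso (chen_gr n 2) (ext2 (Hab n))"
proof -
  have "ext2_to_chen n \<in> iso (ext2 (Hab n)) (chen_gr n 2)"
    using ext2_to_chen_hom ext2_to_chen_inj ext2_to_chen_surj by (simp add: iso_def bij_betw_def)
  then show ?thesis unfolding sig_def
    by (rule group.iso_set_sym[OF comm_group.axioms(2)[OF EX.ext2_comm_group]])
qed

lemma sig_hom: "sig \<in> hom (chen_gr n 2) (ext2 (Hab n))"
  using sig_iso by (simp add: iso_def)

lemma sig_inj: "inj_on sig (carrier (chen_gr n 2))"
  using sig_iso by (simp add: iso_def bij_betw_def)

lemma sig_ext2_to_chen: "y \<in> carrier (ext2 (Hab n)) \<Longrightarrow> sig (ext2_to_chen n y) = y"
  unfolding sig_def by (rule inv_into_f_f[OF ext2_to_chen_inj])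

subsection \<open>Degree one\<close>

abbreviation "E2 \<equiv> ext2 (Hab n)"
abbreviation "TE \<equiv> tensor DH E2"

lemma TE_comm_group: "comm_group TE"
  by (rule two_groups.tensor_comm_group[OF DH_two_groups[OF EX.ext2_comm_group]])

lemma TE_eqI:
  assumes "s \<in> carrier TE" "t \<in> carrier TE" "\<And>j. j < n \<Longrightarrow> HB.tcoord E2 j s = HB.tcoord E2 j t"
  shows "s = t"
proof -
  interpret T: comm_group TE by (rule TE_comm_group)
  interpret D: two_groups DH E2 by (rule DH_two_groups[OF EX.ext2_comm_group])
  have "s = finprod TE (\<lambda>i. pure DH E2 (HB.d i) (HB.tcoord E2 i s)) {..<n}"
    by (rule HB.tensor_expand[OF EX.ext2_comm_group assms(1), symmetric])
  also have "\<dots> = finprod TE (\<lambda>i. pure DH E2 (HB.d i) (HB.tcoord E2 i t)) {..<n}"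
  proof (rule T.finprod_cong'[OF refl])
    show "(\<lambda>i. pure DH E2 (HB.d i) (HB.tcoord E2 i t)) \<in> {..<n} \<rightarrow> carrier TE"
      by (intro Pi_I D.pure_closed HB.d_closed hom_in_carrier[OF HB.tcoord(1)[OF EX.ext2_comm_group] assms(2)]) simp_all
    show "pure DH E2 (HB.d i) (HB.tcoord E2 i s) = pure DH E2 (HB.d i) (HB.tcoord E2 i t)" if "i \<in> {..<n}" for i
      using assms(3)[of i] that by simp
  qed
  also have "\<dots> = t" by (rule HB.tensor_expand[OF EX.ext2_comm_group assms(2)])
  finally show ?thesis .
qed

lemma Suc_1: "Suc 1 = (2::nat)" by simp

lemmas der_value_1 = der_value[OF le_refl, unfolded Suc_1]

lemma der1_ident:
  assumes D: "D \<in> carrier (der n 1)"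
  shows der1_ident_closed: "der1_ident n D \<in> carrier TE"
    and der1_ident_coord: "j < n \<Longrightarrow> HB.tcoord E2 j (der1_ident n D) = sig (D (x_el j) 2)"
proof -
  interpret T: comm_group TE by (rule TE_comm_group)
  interpret D: two_groups DH E2 by (rule DH_two_groups[OF EX.ext2_comm_group])
  have H2: "comm_group (chen_gr n 2)" by (rule gr_comm_group) simp
  note it = id_tensor[OF HH.dual_comm_group H2 EX.ext2_comm_group sig_hom]
  have w: "(\<lambda>i. sig (D (x_el i) 2)) \<in> {..<n} \<rightarrow> carrier E2"
    by (intro Pi_I hom_in_carrier[OF sig_hom] der_value_1[OF D]) simp
  have p: "(\<lambda>i. pure DH E2 (HB.d i) (sig (D (x_el i) 2))) \<in> {..<n} \<rightarrow> carrier TE"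
    by (intro Pi_I D.pure_closed HB.d_closed funcset_mem[OF w]) simp_all
  have e: "der1_ident n D = finprod TE (\<lambda>i. pure DH E2 (HB.d i) (sig (D (x_el i) 2))) {..<n}"
  proof -
    have "der1_ident n D = id_tensor DH E2 sig (finprod (tensor DH (chen_gr n 2)) (\<lambda>i. pure DH (chen_gr n 2) (HB.d i) (D (x_el i) 2)) {..<n})"
      unfolding der1_ident_def sig_def using der_tensor_eq(1)[OF le_refl D] unfolding Suc_1 by (simp only:)
    also have "\<dots> = finprod TE (\<lambda>i. id_tensor DH E2 sig (pure DH (chen_gr n 2) (HB.d i) (D (x_el i) 2))) {..<n}"
      by (rule hom_finprod[OF two_groups.tensor_comm_group[OF DH_two_groups[OF H2]] TE_comm_group it(1) der_tensor_eq(2)[OF le_refl D, unfolded Suc_1]])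
    also have "\<dots> = finprod TE (\<lambda>i. pure DH E2 (HB.d i) (sig (D (x_el i) 2))) {..<n}"
    proof (rule T.finprod_cong'[OF refl p])
      fix i assume "i \<in> {..<n}"
      then have i: "i < n" by simp
      show "id_tensor DH E2 sig (pure DH (chen_gr n 2) (HB.d i) (D (x_el i) 2)) = pure DH E2 (HB.d i) (sig (D (x_el i) 2))"
        by (rule it(2)[OF HB.d_closed[OF i] der_value_1[OF D i]])
    qed
    finally show ?thesis .
  qed
  show "der1_ident n D \<in> carrier TE" unfolding e by (rule T.finprod_closed[OF p])
  show "HB.tcoord E2 j (der1_ident n D) = sig (D (x_el j) 2)" if "j < n"
    unfolding e by (rule HB.tcoord_sum[OF EX.ext2_comm_group w that])
qed

lemma der1_ident_hom: "der1_ident n \<in> hom (der n 1) TE"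
proof (rule homI)
  interpret T: comm_group TE by (rule TE_comm_group)
  interpret d: comm_group "der n 1" by (rule der_comm_group[OF le_refl])
  fix D assume D: "D \<in> carrier (der n 1)"
  show "der1_ident n D \<in> carrier TE" by (rule der1_ident_closed[OF D])
  fix E assume E: "E \<in> carrier (der n 1)"
  have DE: "D \<otimes>\<^bsub>der n 1\<^esub> E \<in> carrier (der n 1)" by (rule d.m_closed[OF D E])
  show "der1_ident n (D \<otimes>\<^bsub>der n 1\<^esub> E) = der1_ident n D \<otimes>\<^bsub>TE\<^esub> der1_ident n E"
  proof (rule TE_eqI[OF der1_ident_closed[OF DE] T.m_closed[OF der1_ident_closed[OF D] der1_ident_closed[OF E]]])
    fix j assume j: "j < n"
    have "(D \<otimes>\<^bsub>der n 1\<^esub> E) (x_el j) 2 = (D (x_el j) \<otimes>\<^bsub>chen n\<^esub> E (x_el j)) 2"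
      unfolding der_simps restrict_apply'[OF x_el_closed[OF j]] ..
    also have "\<dots> = D (x_el j) 2 \<otimes>\<^bsub>chen_gr n 2\<^esub> E (x_el j) 2" unfolding chen_simps by simp
    finally show "HB.tcoord E2 j (der1_ident n (D \<otimes>\<^bsub>der n 1\<^esub> E)) = HB.tcoord E2 j (der1_ident n D \<otimes>\<^bsub>TE\<^esub> der1_ident n E)"
      unfolding hom_mult[OF HB.tcoord(1)[OF EX.ext2_comm_group j] der1_ident_closed[OF D] der1_ident_closed[OF E]]
        der1_ident_coord[OF D j] der1_ident_coord[OF E j] der1_ident_coord[OF DE j]
      using hom_mult[OF sig_hom der_value_1[OF D j] der_value_1[OF E j]] by simp
  qed
qed

lemma der1_ident_inj: "inj_on (der1_ident n) (carrier (der n 1))"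
proof (rule inj_onI)
  fix D E assume D: "D \<in> carrier (der n 1)" and E: "E \<in> carrier (der n 1)" and e: "der1_ident n D = der1_ident n E"
  have "D (x_el j) 2 = E (x_el j) 2" if j: "j < n" for j
    by (rule inj_onD[OF sig_inj _ der_value_1[OF D j] der_value_1[OF E j]])
      (metis e der1_ident_coord[OF D j] der1_ident_coord[OF E j])
  then have "Psi 1 D j = Psi 1 E j" for j
    unfolding Psi_def one_add_one by (cases "j < n") (simp_all only: if_True if_False)
  then have "Psi 1 D = Psi 1 E" by blast
  then show "D = E" by (rule Psi_inj[OF le_refl D E])
qed

text \<open>The coordinates of a tensor, carried to the Chen algebra, prescribe the rows of a
  matrix, and every matrix in \<open>Mt 1\<close> comes from a derivation.\<close>

lemma der1_ident_surj: "der1_ident n ` carrier (der n 1) = carrier TE"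
proof (intro equalityI subsetI)
  fix t assume "t \<in> der1_ident n ` carrier (der n 1)"
  then show "t \<in> carrier TE" using der1_ident_closed by blast
next
  fix t assume t: "t \<in> carrier TE"
  define w where "w j = HB.tcoord E2 j t" for j
  have w: "w j \<in> carrier E2" if "j < n" for j
    unfolding w_def by (rule hom_in_carrier[OF HB.tcoord(1)[OF EX.ext2_comm_group that] t])
  have w2: "ext2_to_chen n (w j) \<in> carrier (chen_gr n 2)" if "j < n" for j
    by (rule hom_in_carrier[OF ext2_to_chen_hom w[OF that]])
  define P where "P j = (if j < n then J 2 (ext2_to_chen n (w j)) else 0)" for j
  have "P \<in> Mt 1"
    unfolding Mt_def B_def P_def one_add_one using w2 by auto
  then obtain D where D: "D \<in> carrier (der n 1)" "Psi 1 D = P" using Psi_surj[OF le_refl] by blast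
  have "der1_ident n D = t"
  proof (rule TE_eqI[OF der1_ident_closed[OF D(1)] t])
    fix j assume j: "j < n"
    have "J 2 (D (x_el j) 2) = J 2 (ext2_to_chen n (w j))"
      using fun_cong[OF D(2), of j] j unfolding Psi_def P_def one_add_one by simp
    then have "D (x_el j) 2 = ext2_to_chen n (w j)"
      using inj_onD[OF J_inj[of 2] _ der_value_1[OF D(1) j] w2[OF j]] by simp
    then show "HB.tcoord E2 j (der1_ident n D) = HB.tcoord E2 j t"
      unfolding der1_ident_coord[OF D(1) j] w_def[symmetric] using sig_ext2_to_chen[OF w[OF j]] by simp
  qed
  then show "t \<in> der1_ident n ` carrier (der n 1)" using D(1) by blast
qed

end

section \<open>The comparison homomorphism, its image and its kernel\<close>

lemma homog_other: "i \<in> I \<Longrightarrow> i \<noteq> k \<Longrightarrow> homog I G k a i = \<one>\<^bsub>G i\<^esub>"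
  and homog_same: "k \<in> I \<Longrightarrow> homog I G k a k = a"
  by (simp_all add: homog_def)

lemma degree_part_homog:
  assumes "group_family I G" "k \<in> I"
  shows "degree_part I G k = homog I G k ` carrier (G k)"
proof (intro equalityI subsetI)
  fix x assume "x \<in> degree_part I G k"
  then have x: "x \<in> carrier (sum_group I G)" "\<And>i. i \<in> I \<Longrightarrow> i \<noteq> k \<Longrightarrow> x i = \<one>\<^bsub>G i\<^esub>"
    unfolding degree_part_def by blast+
  have xe: "x \<in> extensional I" "x k \<in> carrier (G k)" using x(1) assms(2) unfolding group_family.carrier_iff[OF assms(1)] by blast+
  have "x = homog I G k (x k)"
  proof (rule extensionalityI[OF xe(1)])
    show "homog I G k (x k) \<in> extensional I" by (simp add: homog_def)
    show "x i = homog I G k (x k) i" if "i \<in> I" for i using that x(2) by (simp add: homog_def)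
  qed
  then show "x \<in> homog I G k ` carrier (G k)" using xe(2) by blast
next
  fix x assume "x \<in> homog I G k ` carrier (G k)"
  then obtain a where a: "a \<in> carrier (G k)" "x = homog I G k a" by blast
  show "x \<in> degree_part I G k"
    unfolding degree_part_def a(2) using group_family.homog_closed[OF assms a(1)] by (simp add: homog_other)
qed

context chen_magnus
begin

abbreviation "Tk k D \<equiv> trace_map_metab n k (der_tensor n k D)"
abbreviation "SP \<equiv> sum_group {2..} (spow (Hab n))"

text \<open>\<open>trace_map_metab\<close> is given by a choice of preimage, so additivity is
  verified after \<open>Lam\<close>, where the trace is a matrix trace.\<close>

lemma Tk_hom: assumes k: "k \<ge> 1" shows "(\<lambda>D. Tk k D) \<in> hom (der n k) (spow (Hab n) k)"
proof (rule homI)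
  interpret S: comm_group "spow (Hab n) k" by (rule HH.spow_comm_group)
  interpret d: comm_group "der n k" by (rule der_comm_group[OF k])
  fix D assume D: "D \<in> carrier (der n k)"
  show "Tk k D \<in> carrier (spow (Hab n) k)" by (rule trace_der(1)[OF k D])
  fix E assume E: "E \<in> carrier (der n k)"
  have DE: "D \<otimes>\<^bsub>der n k\<^esub> E \<in> carrier (der n k)" by (rule d.m_closed[OF D E])
  show "Tk k (D \<otimes>\<^bsub>der n k\<^esub> E) = Tk k D \<otimes>\<^bsub>spow (Hab n) k\<^esub> Tk k E"
  proof (rule Lam_inj[OF trace_der(1)[OF k DE] S.m_closed[OF trace_der(1)[OF k D] trace_der(1)[OF k E]]])
    show "Lam k (Tk k (D \<otimes>\<^bsub>der n k\<^esub> E)) = Lam k (Tk k D \<otimes>\<^bsub>spow (Hab n) k\<^esub> Tk k E)"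
      unfolding hom_mult[OF Lam_hom trace_der(1)[OF k D] trace_der(1)[OF k E]] trace_der(2)[OF k D] trace_der(2)[OF k E]
        trace_der(2)[OF k DE] hom_mult[OF Psi_hom[OF k] D E] add_grp_simps tr_add ..
  qed
qed

lemma Tk_one: assumes k: "k \<ge> 1" shows "Tk k \<one>\<^bsub>der n k\<^esub> = \<one>\<^bsub>spow (Hab n) k\<^esub>"
  by (rule hom_one[OF Tk_hom[OF k] comm_group.axioms(2)[OF der_comm_group[OF k]] comm_group.axioms(2)[OF HH.spow_comm_group]])

lemma Lam_one: "Lam k \<one>\<^bsub>spow (Hab n) k\<^esub> = 0"
  using hom_one[OF Lam_hom comm_group.axioms(2)[OF HH.spow_comm_group] group_add_grp] by simp

lemma Tk_eq_one:
  assumes k: "k \<ge> 1" and D: "D \<in> carrier (der n k)"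
  shows "Tk k D = \<one>\<^bsub>spow (Hab n) k\<^esub> \<longleftrightarrow> tr n (Psi k D) = 0"
proof
  assume "Tk k D = \<one>\<^bsub>spow (Hab n) k\<^esub>"
  then show "tr n (Psi k D) = 0" using trace_der(2)[OF k D] Lam_one by metis
next
  interpret S: comm_group "spow (Hab n) k" by (rule HH.spow_comm_group)
  assume "tr n (Psi k D) = 0"
  then show "Tk k D = \<one>\<^bsub>spow (Hab n) k\<^esub>"
    by (intro Lam_inj[OF trace_der(1)[OF k D] S.one_closed]) (simp only: trace_der(2)[OF k D] Lam_one)
qed

text \<open>A symmetric product of generators corresponds to a monomial under \<open>Lam\<close>,
  and each monomial of positive degree is the trace of a matrix by
  \<open>trace_monomial\<close>.\<close>

lemma Tk_surj:
  assumes n: "n \<ge> 2" and k: "k \<ge> 2"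
  shows "(\<lambda>D. Tk k D) ` carrier (der n k) = carrier (spow (Hab n) k)"
proof
  have k1: "k \<ge> 1" using k by simp
  interpret S: comm_group "spow (Hab n) k" by (rule HH.spow_comm_group)
  show "(\<lambda>D. Tk k D) ` carrier (der n k) \<subseteq> carrier (spow (Hab n) k)"
    using trace_der(1)[OF k1] by blast
  interpret T: group_hom "der n k" "spow (Hab n) k" "\<lambda>D. Tk k D"
    by (rule group_homI[OF comm_group.axioms(2)[OF der_comm_group[OF k1]] S.is_group Tk_hom[OF k1]])
  have "sprod (Hab n) ` lists_of_length k (Hab_gen n ` {..<n}) \<subseteq> (\<lambda>D. Tk k D) ` carrier (der n k)"
  proof
    fix z assume "z \<in> sprod (Hab n) ` lists_of_length k (Hab_gen n ` {..<n})"
    then obtain js where z: "js \<in> lists_of_length k {..<n}" "z = sprod (Hab n) (map (Hab_gen n) js)"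
      unfolding gens_image by blast
    have "mset js \<in> Mon (k - 1 + 1)" using z(1) k unfolding Mon_def lists_of_length_def by simp
    from trace_monomial[OF n this] obtain P where P: "P \<in> Mt k" "tr n P = frag_of (mset js)" using k by auto
    obtain D where D: "D \<in> carrier (der n k)" "Psi k D = P" using Psi_surj[OF k1 P(1)] by blast
    have "Tk k D = z"
    proof (rule Lam_inj[OF trace_der(1)[OF k1 D(1)]])
      show "z \<in> carrier (spow (Hab n) k)" unfolding z(2) by (rule HH.sprod_closed[OF map_gens_closed[OF z(1)]])
      show "Lam k (Tk k D) = Lam k z"
        unfolding trace_der(2)[OF k1 D(1)] D(2) P(2) z(2) Lam_sprod[OF map_gens_closed[OF z(1)]] prod_list_lin[OF z(1)] ..
    qed
    then show "z \<in> (\<lambda>D. Tk k D) ` carrier (der n k)" using D(1) by blast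
  qed
  from EX.generate_subset[OF S.is_group this T.img_is_subgroup]
  show "carrier (spow (Hab n) k) \<subseteq> (\<lambda>D. Tk k D) ` carrier (der n k)"
    unfolding HH.spow_generate[OF HB.e_subset Hab_generate] .
qed

sublocale SPF: group_family "{2..}" "spow (Hab n)"
  by (rule group_family.intro) (rule HH.spow_comm_group)

lemma SP_comm_group: "comm_group SP"
  by (rule sum_group_comm) (rule HH.spow_comm_group)

lemma target_simps:
  "carrier (target n) = carrier TE \<times> carrier SP"
  "\<one>\<^bsub>target n\<^esub> = (\<one>\<^bsub>TE\<^esub>, \<one>\<^bsub>SP\<^esub>)"
  "(a, b) \<otimes>\<^bsub>target n\<^esub> (a', b') = (a \<otimes>\<^bsub>TE\<^esub> a', b \<otimes>\<^bsub>SP\<^esub> b')"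
  "bracket (target n) x y = \<one>\<^bsub>target n\<^esub>"
  unfolding target_def abelian_lie_def lie_of_simps DirProd_def by simp_all

lemma target_group: "group (target n)"
proof -
  interpret T: comm_group TE by (rule TE_comm_group)
  interpret S: comm_group SP by (rule SP_comm_group)
  have g: "group (TE \<times>\<times> SP)" by (rule DirProd_group[OF T.is_group S.is_group])
  have "comm_group (TE \<times>\<times> SP)"
  proof (rule group.group_comm_groupI[OF g])
    fix x y assume "x \<in> carrier (TE \<times>\<times> SP)" "y \<in> carrier (TE \<times>\<times> SP)"
    then obtain a b c d where "x = (a, b)" "y = (c, d)" "a \<in> carrier TE" "b \<in> carrier SP" "c \<in> carrier TE" "d \<in> carrier SP"
      unfolding DirProd_def partial_object.simps by blast
    then show "x \<otimes>\<^bsub>TE \<times>\<times> SP\<^esub> y = y \<otimes>\<^bsub>TE \<times>\<times> SP\<^esub> x"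
      using T.m_comm[of a c] S.m_comm[of b d] unfolding DirProd_def by (simp only: monoid.simps prod.case)
  qed
  then show ?thesis
    unfolding target_def abelian_lie_def by (rule comm_group.axioms(2)[OF comm_group_lie_of])
qed

text \<open>The isomorphism of the theorem before division by the derived algebra.\<close>

definition phi :: "(nat \<Rightarrow> (nat \<Rightarrow> word set set) \<Rightarrow> nat \<Rightarrow> word set set) \<Rightarrow> target" where
  "phi x = (der1_ident n (x 1), \<lambda>k\<in>{2..}. Tk k (x k))"

lemma der_plus_finite: "x \<in> carrier (der_plus n) \<Longrightarrow> finite {i \<in> {1..}. x i \<noteq> \<one>\<^bsub>der n i\<^esub>}"
  unfolding der_plus_simps DG.carrier_iff by blast

lemma phi_hom: "phi \<in> hom (der_plus n) (target n)"
proof (rule homI)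
  fix x assume x: "x \<in> carrier (der_plus n)"
  have "{k \<in> {2..}. (\<lambda>k\<in>{2..}. Tk k (x k)) k \<noteq> \<one>\<^bsub>spow (Hab n) k\<^esub>} \<subseteq> {i \<in> {1..}. x i \<noteq> \<one>\<^bsub>der n i\<^esub>}"
  proof
    fix k assume "k \<in> {k \<in> {2..}. (\<lambda>k\<in>{2..}. Tk k (x k)) k \<noteq> \<one>\<^bsub>spow (Hab n) k\<^esub>}"
    then have k: "2 \<le> k" "Tk k (x k) \<noteq> \<one>\<^bsub>spow (Hab n) k\<^esub>" by (simp_all cong: conj_cong)
    have k1: "k \<ge> 1" using k(1) by simp
    have "x k \<noteq> \<one>\<^bsub>der n k\<^esub>" using k(2) Tk_one[OF k1] by metis
    then show "k \<in> {i \<in> {1..}. x i \<noteq> \<one>\<^bsub>der n i\<^esub>}" using k(1) by simp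
  qed
  from finite_subset[OF this der_plus_finite[OF x]]
  have "(\<lambda>k\<in>{2..}. Tk k (x k)) \<in> carrier SP"
    unfolding SPF.carrier_iff
  proof (intro conjI ballI)
    fix k :: nat assume k: "k \<in> {2..}"
    then have k1: "k \<ge> 1" by simp
    show "(\<lambda>k\<in>{2..}. Tk k (x k)) k \<in> carrier (spow (Hab n) k)"
      unfolding restrict_apply'[OF k] by (rule trace_der(1)[OF k1 der_plus_component[OF x k1]])
  qed simp_all
  then show "phi x \<in> carrier (target n)"
    unfolding phi_def target_simps using der1_ident_closed[OF der_plus_component[OF x le_refl]] by blast
next
  fix x y assume x: "x \<in> carrier (der_plus n)" and y: "y \<in> carrier (der_plus n)"
  have c: "(x \<otimes>\<^bsub>der_plus n\<^esub> y) k = x k \<otimes>\<^bsub>der n k\<^esub> y k" if "k \<ge> 1" for k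
    using that unfolding der_plus_simps mult_sum_group by simp
  have "(\<lambda>k\<in>{2..}. Tk k ((x \<otimes>\<^bsub>der_plus n\<^esub> y) k)) = (\<lambda>k\<in>{2..}. Tk k (x k)) \<otimes>\<^bsub>SP\<^esub> (\<lambda>k\<in>{2..}. Tk k (y k))"
    unfolding mult_sum_group
  proof (rule restrict_ext)
    fix k :: nat assume "k \<in> {2..}"
    then have k: "k \<ge> 1" "k \<ge> 2" by simp_all
    show "Tk k ((x \<otimes>\<^bsub>der_plus n\<^esub> y) k) = (\<lambda>k\<in>{2..}. Tk k (x k)) k \<otimes>\<^bsub>spow (Hab n) k\<^esub> (\<lambda>k\<in>{2..}. Tk k (y k)) k"
      unfolding c[OF k(1)] hom_mult[OF Tk_hom[OF k(1)] der_plus_component[OF x k(1)] der_plus_component[OF y k(1)]] using k(2) by simp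
  qed
  then show "phi (x \<otimes>\<^bsub>der_plus n\<^esub> y) = phi x \<otimes>\<^bsub>target n\<^esub> phi y"
    unfolding phi_def target_simps c[OF le_refl]
      hom_mult[OF der1_ident_hom der_plus_component[OF x le_refl] der_plus_component[OF y le_refl]] by (simp only:)
qed

lemma der_plus_group: "group (der_plus n)"
  by (rule comm_group.axioms(2)[OF der_plus_comm_group])

lemma phi_group_hom: "group_hom (der_plus n) (target n) phi"
  by (rule group_homI[OF der_plus_group target_group phi_hom])

lemma phi_surj:
  assumes n: "n \<ge> 2"
  shows "phi ` carrier (der_plus n) = carrier (target n)"
proof (intro equalityI subsetI)
  fix z assume "z \<in> phi ` carrier (der_plus n)"
  then show "z \<in> carrier (target n)" using hom_in_carrier[OF phi_hom] by blast
next
  fix z assume "z \<in> carrier (target n)"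
  then obtain t s where z: "z = (t, s)" "t \<in> carrier TE" "s \<in> carrier SP" unfolding target_simps by blast
  have "t \<in> der1_ident n ` carrier (der n 1)" unfolding der1_ident_surj by (rule z(2))
  then obtain D1 where D1': "t = der1_ident n D1" "D1 \<in> carrier (der n 1)" by (rule imageE)
  note D1 = D1'(2) D1'(1)[symmetric]
  \<comment> \<open>The last clause selects the neutral derivation wherever \<open>s\<close> is
    trivial; without it the assembled family could have infinite support.\<close>
  have "\<exists>D. D \<in> carrier (der n k) \<and> Tk k D = s k \<and> (s k = \<one>\<^bsub>spow (Hab n) k\<^esub> \<longrightarrow> D = \<one>\<^bsub>der n k\<^esub>)" if k: "k \<ge> 2" for k
  proof (cases "s k = \<one>\<^bsub>spow (Hab n) k\<^esub>")
    case True
    have k1: "k \<ge> 1" using k by simp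
    show ?thesis
    proof (intro exI[of _ "\<one>\<^bsub>der n k\<^esub>"] conjI impI refl)
      show "\<one>\<^bsub>der n k\<^esub> \<in> carrier (der n k)"
        by (rule monoid.one_closed[OF group.is_monoid[OF comm_group.axioms(2)[OF der_comm_group[OF k1]]]])
      show "Tk k \<one>\<^bsub>der n k\<^esub> = s k" unfolding True by (rule Tk_one[OF k1])
    qed
  next
    case False
    have "s k \<in> carrier (spow (Hab n) k)" using z(3) k unfolding SPF.carrier_iff by simp
    then have "s k \<in> (\<lambda>D. Tk k D) ` carrier (der n k)" unfolding Tk_surj[OF n k] .
    then obtain D where "s k = Tk k D" "D \<in> carrier (der n k)" by (rule imageE)
    then show ?thesis using False by metis
  qed
  from choice_on[of "\<lambda>k. k \<ge> 2" "\<lambda>k D. D \<in> carrier (der n k) \<and> Tk k D = s k \<and> (s k = \<one>\<^bsub>spow (Hab n) k\<^esub> \<longrightarrow> D = \<one>\<^bsub>der n k\<^esub>)", OF this]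
  obtain D where D: "\<And>k. k \<ge> 2 \<Longrightarrow> D k \<in> carrier (der n k) \<and> Tk k (D k) = s k \<and> (s k = \<one>\<^bsub>spow (Hab n) k\<^esub> \<longrightarrow> D k = \<one>\<^bsub>der n k\<^esub>)"
    by blast
  define x where "x = (\<lambda>k\<in>{1..}. if k = 1 then D1 else D k)"
  have x1: "x 1 = D1" and xk: "\<And>k. k \<ge> 2 \<Longrightarrow> x k = D k" by (simp_all add: x_def)
  have "{i \<in> {1..}. x i \<noteq> \<one>\<^bsub>der n i\<^esub>} \<subseteq> insert 1 {k \<in> {2..}. s k \<noteq> \<one>\<^bsub>spow (Hab n) k\<^esub>}"
  proof
    fix i assume "i \<in> {i \<in> {1..}. x i \<noteq> \<one>\<^bsub>der n i\<^esub>}"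
    then have i: "1 \<le> i" "x i \<noteq> \<one>\<^bsub>der n i\<^esub>" by simp_all
    show "i \<in> insert 1 {k \<in> {2..}. s k \<noteq> \<one>\<^bsub>spow (Hab n) k\<^esub>}"
    proof (cases "i = 1")
      case False
      then have i2: "i \<ge> 2" using i(1) by simp
      have "s i \<noteq> \<one>\<^bsub>spow (Hab n) i\<^esub>" using i(2) D[OF i2] xk[OF i2] by metis
      then show ?thesis using i2 by simp
    qed simp
  qed
  moreover have "finite {k \<in> {2..}. s k \<noteq> \<one>\<^bsub>spow (Hab n) k\<^esub>}" using z(3) unfolding SPF.carrier_iff by blast
  ultimately have f: "finite {i \<in> {1..}. x i \<noteq> \<one>\<^bsub>der n i\<^esub>}" by (meson finite_insert finite_subset)
  have xc: "x \<in> carrier (der_plus n)"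
    unfolding der_plus_simps DG.carrier_iff
  proof (intro conjI ballI f)
    show "x \<in> extensional {1..}" by (simp add: x_def)
    fix i :: nat assume "i \<in> {1..}"
    then consider "i = 1" | "i \<ge> 2" by fastforce
    then show "x i \<in> carrier (der n i)"
    proof cases
      case 1 then show ?thesis using x1 D1(1) by metis
    next
      case 2 show ?thesis unfolding xk[OF 2] using D[OF 2] by blast
    qed
  qed
  have "s = (\<lambda>k\<in>{2..}. Tk k (x k))"
  proof (rule extensionalityI)
    show "s \<in> extensional {2..}" using z(3) unfolding SPF.carrier_iff by blast
    show "s k = (\<lambda>k\<in>{2..}. Tk k (x k)) k" if "k \<in> {2..}" for k using that D[of k] xk[of k] by simp
  qed simp
  then have "phi x = z" unfolding phi_def x1 D1(2) z(1) by simp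
  then show "z \<in> phi ` carrier (der_plus n)" using xc by blast
qed

lemma phi_bracket:
  assumes x: "x \<in> carrier (der_plus n)" and y: "y \<in> carrier (der_plus n)"
  shows "phi (bracket (der_plus n) x y) = \<one>\<^bsub>target n\<^esub>"
proof -
  let ?b = "bracket (der_plus n) x y"
  have b: "?b \<in> carrier (der_plus n)" by (rule der_plus_bracket_closed[OF x y])
  have "der1_ident n (?b 1) = \<one>\<^bsub>TE\<^esub>"
    unfolding bracket_degree_1[OF x y]
    by (rule hom_one[OF der1_ident_hom comm_group.axioms(2)[OF der_comm_group[OF le_refl]] comm_group.axioms(2)[OF TE_comm_group]])
  moreover have "(\<lambda>k\<in>{2..}. Tk k (?b k)) = \<one>\<^bsub>SP\<^esub>"
    unfolding one_sum_group
  proof (rule restrict_ext)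
    fix k :: nat assume "k \<in> {2..}"
    then have k: "k \<ge> 1" by simp
    show "Tk k (?b k) = \<one>\<^bsub>spow (Hab n) k\<^esub>"
      unfolding Tk_eq_one[OF k der_plus_component[OF b k]] by (rule bracket_trace[OF x y k])
  qed
  ultimately show ?thesis unfolding phi_def target_simps by simp
qed

text \<open>An element of the kernel has trivial degree one part, and all its other components have
  trace zero; such components lie in the derived algebra one by one. Conversely brackets have no
  degree one part and trace zero in every degree.\<close>

lemma phi_kernel:
  assumes n: "n \<ge> 2"
  shows "kernel (der_plus n) (target n) phi = lie_derived (der_plus n)"
proof (intro equalityI subsetI)
  fix x assume "x \<in> kernel (der_plus n) (target n) phi"
  then have x: "x \<in> carrier (der_plus n)" "phi x = \<one>\<^bsub>target n\<^esub>" unfolding kernel_def by blast+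
  then have e: "der1_ident n (x 1) = \<one>\<^bsub>TE\<^esub>" "(\<lambda>k\<in>{2..}. Tk k (x k)) = \<one>\<^bsub>SP\<^esub>"
    unfolding phi_def target_simps by simp_all
  have o: "\<one>\<^bsub>der n 1\<^esub> \<in> carrier (der n 1)"
    by (rule monoid.one_closed[OF group.is_monoid[OF comm_group.axioms(2)[OF der_comm_group[OF le_refl]]]])
  have "der1_ident n \<one>\<^bsub>der n 1\<^esub> = \<one>\<^bsub>TE\<^esub>"
    by (rule hom_one[OF der1_ident_hom comm_group.axioms(2)[OF der_comm_group[OF le_refl]] comm_group.axioms(2)[OF TE_comm_group]])
  then have x1: "x 1 = \<one>\<^bsub>der n 1\<^esub>"
    by (intro inj_onD[OF der1_ident_inj _ der_plus_component[OF x(1) le_refl] o]) (simp only: e(1))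
  have xk: "tr n (Psi k (x k)) = 0" if k: "k \<ge> 2" for k
  proof -
    have k1: "k \<ge> 1" using k by simp
    have "Tk k (x k) = \<one>\<^bsub>spow (Hab n) k\<^esub>" using fun_cong[OF e(2), of k] k by simp
    then show ?thesis unfolding Tk_eq_one[OF k1 der_plus_component[OF x(1) k1]] .
  qed
  have S: "subgroup (lie_derived (der_plus n)) (sum_group {1..} (der n))"
    using lie_derived_subgroup unfolding subgroup_def m_inv_def der_plus_simps .
  show "x \<in> lie_derived (der_plus n)"
  proof (rule DG.sum_group_subset[OF S, where P = "\<lambda>k D. (k = 1 \<longrightarrow> D = \<one>\<^bsub>der n k\<^esub>) \<and> (k \<ge> 2 \<longrightarrow> tr n (Psi k D) = 0)"])
    show "x \<in> carrier (sum_group {1..} (der n))" using x(1) unfolding der_plus_simps .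
    show "(k = 1 \<longrightarrow> x k = \<one>\<^bsub>der n k\<^esub>) \<and> (k \<ge> 2 \<longrightarrow> tr n (Psi k (x k)) = 0)" for k
      using x1 xk by metis
    fix k :: nat and D
    assume k: "k \<in> {1..}" and D: "D \<in> carrier (der n k)" "D \<noteq> \<one>\<^bsub>der n k\<^esub>"
      "(k = 1 \<longrightarrow> D = \<one>\<^bsub>der n k\<^esub>) \<and> (k \<ge> 2 \<longrightarrow> tr n (Psi k D) = 0)"
    then have "k \<noteq> 1" by blast
    then have k2: "k \<ge> 2" using k by simp
    show "hom_der k D \<in> lie_derived (der_plus n)"
      by (rule trace_zero_derived[OF n k2 D(1)]) (use D(3) k2 in blast)
  qed
next
  fix x assume x: "x \<in> lie_derived (der_plus n)"
  have "{bracket (der_plus n) x y | x y. x \<in> carrier (der_plus n) \<and> y \<in> carrier (der_plus n)} \<subseteq> kernel (der_plus n) (target n) phi"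
    unfolding kernel_def using phi_bracket der_plus_bracket_closed by blast
  from EX.generate_subset[OF der_plus_group this group_hom.subgroup_kernel[OF phi_group_hom]]
  show "x \<in> kernel (der_plus n) (target n) phi" using x unfolding lie_derived_def by blast
qed

lemma phi_hom_der_1:
  assumes "D \<in> carrier (der n 1)"
  shows "phi (hom_der 1 D) = (der1_ident n D, \<one>\<^bsub>SP\<^esub>)"
proof -
  have "(\<lambda>k\<in>{2..}. Tk k (hom_der 1 D k)) = \<one>\<^bsub>SP\<^esub>"
    unfolding one_sum_group
  proof (rule restrict_ext)
    fix k :: nat assume "k \<in> {2..}"
    then have k: "k \<in> {1..}" "k \<noteq> 1" "k \<ge> 1" by simp_all
    show "Tk k (hom_der 1 D k) = \<one>\<^bsub>spow (Hab n) k\<^esub>"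
      unfolding homog_other[OF k(1,2)] by (rule Tk_one[OF k(3)])
  qed
  moreover have "hom_der 1 D 1 = D" by (rule homog_same) simp
  ultimately show ?thesis unfolding phi_def by (simp only:)
qed

lemma phi_hom_der:
  assumes k: "k \<ge> 2" and D: "D \<in> carrier (der n k)"
  shows "phi (hom_der k D) = (\<one>\<^bsub>TE\<^esub>, homog {2..} (spow (Hab n)) k (Tk k D))"
proof -
  have "(\<lambda>j\<in>{2..}. Tk j (hom_der k D j)) = homog {2..} (spow (Hab n)) k (Tk k D)"
    unfolding homog_def[of "{2..}"]
  proof (rule restrict_ext)
    fix j :: nat assume "j \<in> {2..}"
    then have j: "j \<in> {1..}" "j \<ge> 1" by simp_all
    show "Tk j (hom_der k D j) = (if j = k then Tk k D else \<one>\<^bsub>spow (Hab n) j\<^esub>)"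
    proof (cases "j = k")
      case True
      then have "hom_der k D j = D" using homog_same[of k "{1..}" "der n" D] j by metis
      then show ?thesis using True by simp
    next
      case False
      show ?thesis unfolding homog_other[OF j(1) False] if_not_P[OF False] by (rule Tk_one[OF j(2)])
    qed
  qed
  moreover have "hom_der k D 1 = \<one>\<^bsub>der n 1\<^esub>" by (rule homog_other) (use k in simp_all)
  moreover have "der1_ident n \<one>\<^bsub>der n 1\<^esub> = \<one>\<^bsub>TE\<^esub>"
    by (rule hom_one[OF der1_ident_hom comm_group.axioms(2)[OF der_comm_group[OF le_refl]] comm_group.axioms(2)[OF TE_comm_group]])
  ultimately show ?thesis unfolding phi_def by (simp only:)
qed

section \<open>Descent to the abelianisation\<close>

abbreviation "LD \<equiv> lie_derived (der_plus n)"

text \<open>This is the form of the map supplied by the homomorphism theorem for quotient groups,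
  \<open>FactGroup_iso_set\<close>.\<close>

definition Phi where "Phi Y = the_elem (phi ` Y)"

lemma Phi_coset:
  assumes n: "n \<ge> 2" and x: "x \<in> carrier (der_plus n)"
  shows "Phi (LD #>\<^bsub>der_plus n\<^esub> x) = phi x"
  unfolding Phi_def
proof (rule the_elem_image_coset[OF der_plus_group lie_derived_subgroup x])
  fix m assume "m \<in> LD"
  then have m: "m \<in> carrier (der_plus n)" "phi m = \<one>\<^bsub>target n\<^esub>"
    unfolding phi_kernel[OF n, symmetric] kernel_def by blast+
  have "phi (m \<otimes>\<^bsub>der_plus n\<^esub> x) = \<one>\<^bsub>target n\<^esub> \<otimes>\<^bsub>target n\<^esub> phi x"
    unfolding hom_mult[OF phi_hom m(1) x] m(2) ..
  also have "\<dots> = phi x" by (rule monoid.l_one[OF group.is_monoid[OF target_group] hom_in_carrier[OF phi_hom x]])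
  finally show "phi (m \<otimes>\<^bsub>der_plus n\<^esub> x) = phi x" .
qed

lemma Phi_der_class:
  assumes "n \<ge> 2" "k \<ge> 1" "D \<in> carrier (der n k)"
  shows "Phi (der_class n k D) = phi (hom_der k D)"
  unfolding der_class_def by (rule Phi_coset[OF assms(1) hom_der_closed[OF assms(2,3)]])

lemma carrier_der_ab: "carrier (der_ab n) = (\<lambda>x. LD #>\<^bsub>der_plus n\<^esub> x) ` carrier (der_plus n)"
  unfolding der_ab_def lie_ab_def lie_of_simps carrier_FactGroup ..

lemma Phi_iso: assumes n: "n \<ge> 2" shows "Phi \<in> iso (der_ab n) (target n)"
proof -
  have "Phi \<in> iso (der_plus n Mod LD) (target n)"
    using group_hom.FactGroup_iso_set[OF phi_group_hom phi_surj[OF n]] unfolding phi_kernel[OF n] Phi_def[abs_def] .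
  then show ?thesis unfolding der_ab_def lie_ab_def iso_def hom_def lie_of_simps .
qed

text \<open>The defining image runs over all pairs of representatives; each bracket lies in the
  derived algebra, so the image is a single coset.\<close>

lemma bracket_der_ab:
  assumes "A \<in> carrier (der_ab n)" "B' \<in> carrier (der_ab n)"
  shows "bracket (der_ab n) A B' = LD #>\<^bsub>der_plus n\<^esub> \<one>\<^bsub>der_plus n\<^esub>"
proof -
  have ne: "Y \<noteq> {} \<and> Y \<subseteq> carrier (der_plus n)" if Y: "Y \<in> carrier (der_ab n)" for Y
  proof -
    obtain x where x: "x \<in> carrier (der_plus n)" "Y = LD #>\<^bsub>der_plus n\<^esub> x" using Y unfolding carrier_der_ab by blast
    have "x \<in> Y" unfolding x(2) by (rule group.rcos_self[OF der_plus_group x(1) lie_derived_subgroup])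
    moreover have "Y \<subseteq> carrier (der_plus n)" unfolding x(2)
      by (rule monoid.r_coset_subset_G[OF group.is_monoid[OF der_plus_group] subgroup.subset[OF lie_derived_subgroup] x(1)])
    ultimately show ?thesis by blast
  qed
  have o: "LD #>\<^bsub>der_plus n\<^esub> \<one>\<^bsub>der_plus n\<^esub> = LD"
    by (rule group.coset_mult_one[OF der_plus_group subgroup.subset[OF lie_derived_subgroup]])
  have c: "LD #>\<^bsub>der_plus n\<^esub> bracket (der_plus n) x y = LD" if "x \<in> A" "y \<in> B'" for x y
  proof -
    have xy: "x \<in> carrier (der_plus n)" "y \<in> carrier (der_plus n)" using that ne assms by blast+
    have b: "bracket (der_plus n) x y \<in> LD"
      unfolding lie_derived_def by (rule generate.incl) (use xy in blast)
    show ?thesis by (rule group.coset_join2[OF der_plus_group subgroup.mem_carrier[OF lie_derived_subgroup b] lie_derived_subgroup b])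
  qed
  have "(\<lambda>(x, y). LD #>\<^bsub>der_plus n\<^esub> bracket (der_plus n) x y) ` (A \<times> B') = {LD}"
    using ne[OF assms(1)] ne[OF assms(2)] c by (auto simp: image_iff)
  then show ?thesis unfolding o der_ab_def lie_ab_def lie_of_simps by simp
qed

lemma Phi_part:
  assumes n: "n \<ge> 2" and k: "k \<ge> 1"
  shows "Phi ` der_ab_part n k = target_part n k"
proof (cases "k = 1")
  case True
  have "Phi ` der_ab_part n k = (\<lambda>D. (der1_ident n D, \<one>\<^bsub>SP\<^esub>)) ` carrier (der n 1)"
    unfolding der_ab_part_def image_image True
    by (rule image_cong[OF refl]) (simp only: Phi_der_class[OF n le_refl] phi_hom_der_1)
  also have "\<dots> = carrier TE \<times> {\<one>\<^bsub>SP\<^esub>}" unfolding der1_ident_surj[symmetric] by blast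
  finally show ?thesis unfolding target_part_def if_P[OF True] .
next
  case False
  then have k2: "k \<ge> 2" "k \<in> {2..}" using k by simp_all
  have "Phi ` der_ab_part n k = (\<lambda>D. (\<one>\<^bsub>TE\<^esub>, homog {2..} (spow (Hab n)) k (Tk k D))) ` carrier (der n k)"
    unfolding der_ab_part_def image_image
    by (rule image_cong[OF refl]) (simp only: Phi_der_class[OF n k] phi_hom_der[OF k2(1)])
  also have "\<dots> = {\<one>\<^bsub>TE\<^esub>} \<times> degree_part {2..} (spow (Hab n)) k"
    unfolding degree_part_homog[OF SPF.group_family_axioms k2(2)] Tk_surj[OF n k2(1), symmetric] by blast
  finally show ?thesis unfolding target_part_def if_not_P[OF False] .
qed

lemma Phi_graded_lie_iso:
  assumes n: "n \<ge> 2"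
  shows "Phi \<in> graded_lie_iso (der_ab n) (der_ab_part n) (target n) (target_part n)"
  unfolding graded_lie_iso_def mem_Collect_eq
proof (intro conjI ballI allI impI Phi_iso[OF n] Phi_part[OF n])
  fix A B' assume "A \<in> carrier (der_ab n)" "B' \<in> carrier (der_ab n)"
  have "Phi (LD #>\<^bsub>der_plus n\<^esub> \<one>\<^bsub>der_plus n\<^esub>) = \<one>\<^bsub>target n\<^esub>"
    unfolding Phi_coset[OF n monoid.one_closed[OF group.is_monoid[OF der_plus_group]]]
    by (rule hom_one[OF phi_hom der_plus_group target_group])
  then show "Phi (bracket (der_ab n) A B') = bracket (target n) (Phi A) (Phi B')"
    unfolding bracket_der_ab[OF \<open>A \<in> carrier (der_ab n)\<close> \<open>B' \<in> carrier (der_ab n)\<close>] target_simps .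
qed

lemma trace_isomorphism:
  assumes n: "n \<ge> 2"
  shows "\<exists>\<Phi>. \<Phi> \<in> graded_lie_iso (der_ab n) (der_ab_part n) (target n) (target_part n) \<and>
    (\<forall>D\<in>carrier (der n 1).
       \<Phi> (der_class n 1 D) = (der1_ident n D, \<one>\<^bsub>sum_group {2..} (spow (Hab n))\<^esub>)) \<and>
    (\<forall>k\<ge>2. \<forall>D\<in>carrier (der n k).
       \<Phi> (der_class n k D) =
         (\<one>\<^bsub>tensor (dual (Hab n)) (ext2 (Hab n))\<^esub>,
          homog {2..} (spow (Hab n)) k (trace_map_metab n k (der_tensor n k D))))"
proof (intro exI[of _ Phi] conjI ballI allI impI Phi_graded_lie_iso[OF n])
  show "Phi (der_class n 1 D) = (der1_ident n D, \<one>\<^bsub>SP\<^esub>)" if "D \<in> carrier (der n 1)" for D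
    unfolding Phi_der_class[OF n le_refl that] by (rule phi_hom_der_1[OF that])
  fix k D assume k: "2 \<le> k" and D: "D \<in> carrier (der n k)"
  have k1: "k \<ge> 1" using k by simp
  show "Phi (der_class n k D) = (\<one>\<^bsub>TE\<^esub>, homog {2..} (spow (Hab n)) k (Tk k D))"
    unfolding Phi_der_class[OF n k1 D] by (rule phi_hom_der[OF k D])
qed

end

section \<open>Existence of the Magnus representation\<close>

text \<open>On this subgroup the Magnus product is addition of tuples. It will receive the derived
  subgroup of the free group.\<close>

lemma Theta_kernel_subgroup: "subgroup {p \<in> carrier (magnus_group n). Theta n p = 0} (magnus_group n)"
proof -
  interpret M: group "magnus_group n" by (rule magnus_group_group)
  show ?thesis
  proof (rule M.subgroupI)
    show "{p \<in> carrier (magnus_group n). Theta n p = 0} \<noteq> {}"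
      using M.one_closed by (auto simp: magnus_simps Theta_linear intro!: exI[of _ "\<lambda>i. 0"])
    fix p assume "p \<in> {p \<in> carrier (magnus_group n). Theta n p = 0}"
    then have p: "p \<in> carrier (magnus_group n)" "Theta n p = 0" by blast+
    obtain r where "inv\<^bsub>magnus_group n\<^esub> p = (\<lambda>i. - r * p i)" using magnus_inv[OF p(1)] by blast
    then have "Theta n (inv\<^bsub>magnus_group n\<^esub> p) = 0" by (simp only: Theta_linear p(2) mult_zero_right)
    then show "inv\<^bsub>magnus_group n\<^esub> p \<in> {p \<in> carrier (magnus_group n). Theta n p = 0}" using M.inv_closed[OF p(1)] by blast
    fix q assume "q \<in> {p \<in> carrier (magnus_group n). Theta n p = 0}"
    then have q: "q \<in> carrier (magnus_group n)" "Theta n q = 0" by blast+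
    have "Theta n (p \<otimes>\<^bsub>magnus_group n\<^esub> q) = 0" by (simp add: magnus_simps p(2) q(2) Theta_linear)
    then show "p \<otimes>\<^bsub>magnus_group n\<^esub> q \<in> {p \<in> carrier (magnus_group n). Theta n p = 0}" using M.m_closed[OF p(1) q(1)] by blast
  qed auto
qed

lemma derived_hom_in_subgroup:
  assumes "group G" "group H" "h \<in> hom G H" "subgroup L H" "K \<subseteq> carrier G"
    and c: "\<And>a b. a \<in> K \<Longrightarrow> b \<in> K \<Longrightarrow> commutator H (h a) (h b) \<in> L" and x: "x \<in> derived G K"
  shows "h x \<in> L"
proof (rule hom_image_in_subgroup[OF assms(1-3) _ assms(4) _ x[unfolded derived_def]])
  interpret h: group_hom G H h by (rule group_homI[OF assms(1-3)])
  show "(\<Union>a\<in>K. \<Union>b\<in>K. {a \<otimes>\<^bsub>G\<^esub> b \<otimes>\<^bsub>G\<^esub> inv\<^bsub>G\<^esub> a \<otimes>\<^bsub>G\<^esub> inv\<^bsub>G\<^esub> b}) \<subseteq> carrier G"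
    using assms(5) by (auto intro!: h.G.m_closed h.G.inv_closed)
  fix y assume "y \<in> (\<Union>a\<in>K. \<Union>b\<in>K. {a \<otimes>\<^bsub>G\<^esub> b \<otimes>\<^bsub>G\<^esub> inv\<^bsub>G\<^esub> a \<otimes>\<^bsub>G\<^esub> inv\<^bsub>G\<^esub> b})"
  then obtain a b where ab: "a \<in> K" "b \<in> K" and y: "y = a \<otimes>\<^bsub>G\<^esub> b \<otimes>\<^bsub>G\<^esub> inv\<^bsub>G\<^esub> a \<otimes>\<^bsub>G\<^esub> inv\<^bsub>G\<^esub> b" by blast
  have abc: "a \<in> carrier G" "b \<in> carrier G" using ab assms(5) by blast+
  have "h y = commutator H (h a) (h b)"
    unfolding y commutator_def using abc by (simp add: h.hom_mult h.hom_inv)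
  then show "h y \<in> L" using c[OF ab] by simp
qed

text \<open>By the exact commutator formula, commutators are killed by \<open>Theta\<close>; by the
  same formula, two elements killed by \<open>Theta\<close> have trivial commutator.\<close>

lemma magnus_hom_second_derived:
  assumes h: "h \<in> hom (free_group n) (magnus_group n)" and w: "w \<in> second_derived (free_group n)"
  shows "h w = \<one>\<^bsub>magnus_group n\<^esub>"
proof -
  let ?F = "free_group n" and ?Z = "{p \<in> carrier (magnus_group n). Theta n p = 0}"
  have FG: "group ?F" by (rule free_group_group)
  have hc: "h a \<in> carrier (magnus_group n)" if "a \<in> carrier ?F" for a by (rule hom_in_carrier[OF h that])
  have D: "derived ?F (carrier ?F) \<subseteq> carrier ?F" by (rule group.derived_in_carrier[OF FG]) simp
  have Z: "h a \<in> ?Z" if "a \<in> derived ?F (carrier ?F)" for a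
  proof (rule derived_hom_in_subgroup[OF FG magnus_group_group h Theta_kernel_subgroup subset_refl _ that])
    fix a b assume "a \<in> carrier ?F" "b \<in> carrier ?F"
    then show "commutator (magnus_group n) (h a) (h b) \<in> ?Z"
      using magnus_commutator[OF hc hc] Brc_closed[OF hc hc] Theta_Brc by simp
  qed
  have "h w \<in> {\<one>\<^bsub>magnus_group n\<^esub>}"
  proof (rule derived_hom_in_subgroup[OF FG magnus_group_group h group.triv_subgroup[OF magnus_group_group] D _ w[unfolded second_derived_def]])
    fix a b assume "a \<in> derived ?F (carrier ?F)" "b \<in> derived ?F (carrier ?F)"
    then have z: "h a \<in> ?Z" "h b \<in> ?Z" using Z by blast+
    then have "commutator (magnus_group n) (h a) (h b) = Brc n (h a) (h b)" by (intro magnus_commutator) blast+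
    also have "\<dots> = \<one>\<^bsub>magnus_group n\<^esub>" using z by (simp add: Brc_def magnus_simps)
    finally show "commutator (magnus_group n) (h a) (h b) \<in> {\<one>\<^bsub>magnus_group n\<^esub>}" by simp
  qed
  then show ?thesis by simp
qed

lemma chen_magnus_exists: obtains \<mu> where "chen_magnus n \<mu>"
proof -
  let ?F = "free_group n" and ?M = "magnus_group n"
  let ?N = "second_derived ?F"
  let ?q = "\<lambda>w. ?N #>\<^bsub>?F\<^esub> w"
  have FG: "group ?F" by (rule free_group_group)
  have N: "?N \<lhd> ?F" by (rule second_derived_normal)
  have f: "(\<lambda>j. if j = i then 1 else 0) \<in> carrier ?M" if "i < n" for i using that by (simp add: magnus_simps)
  have "\<exists>h. h \<in> hom ?F ?M \<and> (\<forall>i<n. h [(i, True)] = (\<lambda>j. if j = i then 1 else 0))"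
    by (rule free_group_universal[where f = "\<lambda>i j. if j = i then 1 else 0", OF magnus_group_group f]) blast+
  then obtain h where h: "h \<in> hom ?F ?M" "\<And>i. i < n \<Longrightarrow> h [(i, True)] = (\<lambda>j. if j = i then 1 else 0)" by blast
  define \<mu> where "\<mu> Y = the_elem (h ` Y)" for Y
  have q: "?q \<in> hom ?F (free_metab n)" unfolding free_metab_def by (rule normal.r_coset_hom_Mod[OF N])
  have c: "carrier (free_metab n) = ?q ` carrier ?F" by (simp add: free_metab_def carrier_FactGroup)
  have \<mu>: "\<mu> (?q w) = h w" if w: "w \<in> carrier ?F" for w
    unfolding \<mu>_def
  proof (rule the_elem_image_coset[OF FG normal_imp_subgroup[OF N] w])
    fix m assume m: "m \<in> ?N"
    have mc: "m \<in> carrier ?F" by (rule subgroup.mem_carrier[OF normal_imp_subgroup[OF N] m])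
    show "h (m \<otimes>\<^bsub>?F\<^esub> w) = h w"
      unfolding hom_mult[OF h(1) mc w] magnus_hom_second_derived[OF h(1) m]
      by (rule monoid.l_one[OF group.is_monoid[OF magnus_group_group] hom_in_carrier[OF h(1) w]])
  qed
  interpret metabelian_group "free_metab n" by (rule free_metab_metabelian)
  have "magnus (free_metab n) n (\<lambda>i. ?q [(i, True)]) \<mu>"
  proof unfold_locales
    show "?q [(i, True)] \<in> carrier (free_metab n)" if "i < n" for i
      unfolding c by (rule imageI[OF free_group_letter[OF that]])
    have "?q ` generate ?F ((\<lambda>i. [(i, True)]) ` {..<n}) = generate (free_metab n) (?q ` (\<lambda>i. [(i, True)]) ` {..<n})"
      by (rule hom_generate_image[OF FG is_group q]) (auto simp: free_group_letter)
    then show "generate (free_metab n) ((\<lambda>i. ?q [(i, True)]) ` {..<n}) = carrier (free_metab n)"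
      unfolding c free_group_generate image_image by (rule sym)
    show "\<mu> \<in> hom (free_metab n) ?M"
    proof (rule homI)
      fix Y assume "Y \<in> carrier (free_metab n)"
      then obtain u where u: "Y = ?q u" "u \<in> carrier ?F" unfolding c by (rule imageE)
      show "\<mu> Y \<in> carrier ?M" unfolding u(1) \<mu>[OF u(2)] by (rule hom_in_carrier[OF h(1) u(2)])
      fix Y' assume "Y' \<in> carrier (free_metab n)"
      then obtain w where w: "Y' = ?q w" "w \<in> carrier ?F" unfolding c by (rule imageE)
      have uw: "u \<otimes>\<^bsub>?F\<^esub> w \<in> carrier ?F" by (rule monoid.m_closed[OF group.is_monoid[OF FG] u(2) w(2)])
      show "\<mu> (Y \<otimes>\<^bsub>free_metab n\<^esub> Y') = \<mu> Y \<otimes>\<^bsub>?M\<^esub> \<mu> Y'"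
        unfolding u(1) w(1) hom_mult[OF q u(2) w(2), symmetric] \<mu>[OF u(2)] \<mu>[OF w(2)] \<mu>[OF uw]
        by (rule hom_mult[OF h(1) u(2) w(2)])
    qed
    show "\<mu> (?q [(i, True)]) = (\<lambda>j. if j = i then 1 else 0)" if "i < n" for i
      unfolding \<mu>[OF free_group_letter[OF that]] by (rule h(2)[OF that])
  qed
  then show thesis by (intro that chen_magnus.intro)
qed

theorem theorem3:
  fixes n :: nat
  assumes "n \<ge> 4"
  shows "\<exists>\<Phi>. \<Phi> \<in> graded_lie_iso (der_ab n) (der_ab_part n) (target n) (target_part n) \<and>
    (\<forall>D\<in>carrier (der n 1).
       \<Phi> (der_class n 1 D) = (der1_ident n D, \<one>\<^bsub>sum_group {2..} (spow (Hab n))\<^esub>)) \<and>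
    (\<forall>k\<ge>2. \<forall>D\<in>carrier (der n k).
       \<Phi> (der_class n k D) =
         (\<one>\<^bsub>tensor (dual (Hab n)) (ext2 (Hab n))\<^esub>,
          homog {2..} (spow (Hab n)) k (trace_map_metab n k (der_tensor n k D))))"
proof -
  obtain \<mu> where "chen_magnus n \<mu>" by (rule chen_magnus_exists)
  then show ?thesis by (rule chen_magnus.trace_isomorphism) (use assms in simp)
qed

end
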